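(* Let $c_1\le Np_m\le c_2$ for some positive constants $c_1,c_2$ and all $m=1,\dots,N$. Let $X_N^2=\sum_{m=1}^N\eta_m^2$. Then there exist positive constants $c,C$ such that uniformly in $b\in\{n+2k:\ k=0,1,\dots,n(n-1)/2\}$ (the set of possible values of $X_N^2$) $$\left|\frac{\sigma_N}{2}P\{X_N^2=b\}-\frac{d}{du_b}\mathbb W_N^{(5)}(u_b,0)\right|\le C\left(\frac1{N^{3/2}}+\frac1{n\lambda^{3/2}}+n\lambda\exp\Big\{-\frac{cN}{\lambda\max(1,\lambda)}\Big\}\right),$$ where $u_b=(b-\Lambda_N)/\sigma_N$, $\Lambda_N=n(1+n\mathrm P_{2N})$ and $\sigma_N^2=2n^2\mathrm P_{2N}+4n^3(\mathrm P_{3N}-\mathrm P_{2N}^2)$.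
   Context: Sampling with replacement. $n\to\infty$, $N=N(n)\to\infty$; $p_m>0$, $p_1+\dots+p_N=1$ (the $p_m$ may depend on $n$), $\max_mp_m\to0$. $\eta=(\eta_1,\dots,\eta_N)$ is multinomial $M(n,p_1,\dots,p_N)$. $\lambda=n/N$, $\lambda_m=np_m$, $\mathrm P_{iN}=p_1^i+\dots+p_N^i$. Let $\xi_1,\dots,\xi_N$ be independent, $\xi_m$ Poisson with mean $\lambda_m$, and $g_m(\xi_m)=\xi_m^2-\lambda_m(\lambda_m+1)-(2n\mathrm P_{2N}+1)(\xi_m-\lambda_m)$; then $\sigma_N^2=\sum_m\mathrm{Var}\,g_m(\xi_m)$. Put $\hat\sigma_N^2=\sigma_N^2/N$, $\hat g_m=g_m(\xi_m)/\hat\sigma_N$, $\hat\xi_m=(\xi_m-\lambda_m)/\sqrt\lambda$. Expansion: $P_{1,N}(t,\tau)=\frac{i^3}{6N}\sum_mE(t\hat g_m+\tau\hat\xi_m)^3$, $P_{2,N}(t,\tau)=\frac{i^4}{24N}\sum_m\big(E(t\hat g_m+\tau\hat\xi_m)^4-3(E(t\hat g_m+\tau\hat\xi_m)^2)^2\big)+\frac12P_{1,N}^2(t,\tau)$, $G_k(t)=\frac1{\sqrt{2\pi}}\int_{-\infty}^\infty P_{k,N}(t,\tau)e^{-\tau^2/2}d\tau$, $$W_N^{(5)}(t,0)=1+\frac{G_1(t)-G_1(0)}{\sqrt N}+\frac{G_2(t)-G_2(0)-G_1(0)(G_1(t)-G_1(0))}{N},$$ and $\mathbb W_N^{(5)}(u,0)$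 is the function of $u$, of bounded variation and tending to $0$ as $u\to-\infty$, with $\int e^{itu}d_u\mathbb W_N^{(5)}(u,0)=W_N^{(5)}(t,0)e^{-t^2/2}$; $\frac d{du_b}\mathbb W_N^{(5)}(u_b,0)$ is its $u$-derivative at $u_b$. The constants $c,C$ may depend on $c_1,c_2$ but not on $n$, $N$, or the $p_m$. *)

theory Defs
  imports "HOL-Probability.Probability" "HOL-Combinatorics.Multiset_Permutations"
begin

text \<open>
  Cells are numbered \<open>1, \<dots>, N\<close>; the cell probabilities are \<open>p 1, \<dots>, p N\<close>, and values of
  \<open>p\<close> outside \<open>{1..N}\<close> are never used.
\<close>

definition cell_pmf :: "nat \<Rightarrow> (nat \<Rightarrow> real) \<Rightarrow> nat pmf" where
  "cell_pmf N p = embed_pmf (\<lambda>m. if m \<in> {1..N} then p m else 0)"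

text \<open>
  The multinomial law \<open>M(n, p 1, \<dots>, p N)\<close>: the cell counts of \<open>n\<close> independent draws
  (sampling with replacement).  See \<open>pmf_multinomial\<close> below for its mass function.
\<close>

definition multinomial_pmf :: "nat \<Rightarrow> nat \<Rightarrow> (nat \<Rightarrow> real) \<Rightarrow> (nat \<Rightarrow> nat) pmf" where
  "multinomial_pmf n N p = map_pmf count_list (replicate_pmf n (cell_pmf N p))"

definition power_sum :: "nat \<Rightarrow> (nat \<Rightarrow> real) \<Rightarrow> nat \<Rightarrow> real" where
  "power_sum N p i = (\<Sum>m=1..N. p m ^ i)"

definition lam :: "nat \<Rightarrow> nat \<Rightarrow> real" where
  "lam n N = real n / real N"

definition lam_cell :: "nat \<Rightarrow> (nat \<Rightarrow> real) \<Rightarrow> nat \<Rightarrow> real" where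
  "lam_cell n p m = real n * p m"

definition poisson_vec :: "nat \<Rightarrow> nat \<Rightarrow> (nat \<Rightarrow> real) \<Rightarrow> (nat \<Rightarrow> nat) pmf" where
  "poisson_vec n N p = Pi_pmf {1..N} 0 (\<lambda>m. poisson_pmf (lam_cell n p m))"

definition g_stat :: "nat \<Rightarrow> nat \<Rightarrow> (nat \<Rightarrow> real) \<Rightarrow> nat \<Rightarrow> real \<Rightarrow> real" where
  "g_stat n N p m x = x\<^sup>2 - lam_cell n p m * (lam_cell n p m + 1)
     - (2 * real n * power_sum N p 2 + 1) * (x - lam_cell n p m)"

text \<open>The closed form of \<open>sigma_sq\<close> in terms of power sums is \<open>sigma_sq_eq\<close> below.\<close>

definition sigma_sq :: "nat \<Rightarrow> nat \<Rightarrow> (nat \<Rightarrow> real) \<Rightarrow> real" where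
  "sigma_sq n N p = (\<Sum>m=1..N.
     measure_pmf.variance (poisson_vec n N p) (\<lambda>\<xi>. g_stat n N p m (real (\<xi> m))))"

definition sigma_N :: "nat \<Rightarrow> nat \<Rightarrow> (nat \<Rightarrow> real) \<Rightarrow> real" where
  "sigma_N n N p = sqrt (sigma_sq n N p)"

definition g_hat :: "nat \<Rightarrow> nat \<Rightarrow> (nat \<Rightarrow> real) \<Rightarrow> nat \<Rightarrow> real \<Rightarrow> real" where
  "g_hat n N p m x = g_stat n N p m x / sqrt (sigma_sq n N p / real N)"

definition xi_hat :: "nat \<Rightarrow> nat \<Rightarrow> (nat \<Rightarrow> real) \<Rightarrow> nat \<Rightarrow> real \<Rightarrow> real" where
  "xi_hat n N p m x = (x - lam_cell n p m) / sqrt (lam n N)"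

definition lin_moment ::
    "nat \<Rightarrow> nat \<Rightarrow> (nat \<Rightarrow> real) \<Rightarrow> nat \<Rightarrow> nat \<Rightarrow> real \<Rightarrow> real \<Rightarrow> real" where
  "lin_moment n N p k m t \<tau> = measure_pmf.expectation (poisson_vec n N p)
     (\<lambda>\<xi>. (t * g_hat n N p m (real (\<xi> m)) + \<tau> * xi_hat n N p m (real (\<xi> m))) ^ k)"

definition P1 :: "nat \<Rightarrow> nat \<Rightarrow> (nat \<Rightarrow> real) \<Rightarrow> real \<Rightarrow> real \<Rightarrow> complex" where
  "P1 n N p t \<tau> = \<i> ^ 3 / (6 * of_nat N) * of_real (\<Sum>m=1..N. lin_moment n N p 3 m t \<tau>)"

definition P2 :: "nat \<Rightarrow> nat \<Rightarrow> (nat \<Rightarrow> real) \<Rightarrow> real \<Rightarrow> real \<Rightarrow> complex" where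
  "P2 n N p t \<tau> = \<i> ^ 4 / (24 * of_nat N) * of_real (\<Sum>m=1..N.
       lin_moment n N p 4 m t \<tau> - 3 * (lin_moment n N p 2 m t \<tau>)\<^sup>2)
     + 1 / 2 * (P1 n N p t \<tau>)\<^sup>2"

definition gauss_avg :: "(real \<Rightarrow> real \<Rightarrow> complex) \<Rightarrow> real \<Rightarrow> complex" where
  "gauss_avg P t = of_real (1 / sqrt (2 * pi)) *
     (CLBINT \<tau>. P t \<tau> * of_real (exp (- \<tau>\<^sup>2 / 2)))"

definition W5 :: "nat \<Rightarrow> nat \<Rightarrow> (nat \<Rightarrow> real) \<Rightarrow> real \<Rightarrow> complex" where
  "W5 n N p t = (let G1 = gauss_avg (P1 n N p); G2 = gauss_avg (P2 n N p) in
     1 + (G1 t - G1 0) / of_real (sqrt (real N))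
       + (G2 t - G2 0 - G1 0 * (G1 t - G1 0)) / of_nat N)"

text \<open>
  \<open>F\<close> is of bounded variation on the line, and \<open>\<phi> t\<close> is the Lebesgue--Stieltjes integral of
  \<open>exp (i t u)\<close> with respect to \<open>F\<close>.  Bounded variation is expressed through a Jordan
  decomposition \<open>F = A - B\<close> into bounded nondecreasing functions, which also yields the integral.
  The usual normalization of \<open>F\<close> by right-continuity is imposed: without it, \<open>F\<close> would be
  determined by \<open>\<phi>\<close> only up to its values at countably many points.
\<close>

definition has_fourier_stieltjes_transform ::
    "(real \<Rightarrow> real) \<Rightarrow> (real \<Rightarrow> complex) \<Rightarrow> bool" where
  "has_fourier_stieltjes_transform F \<phi> \<longleftrightarrow>
     (\<exists>A B. mono A \<and> bounded (range A) \<and> (\<forall>u. continuous (at_right u) A) \<and>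
            mono B \<and> bounded (range B) \<and> (\<forall>u. continuous (at_right u) B) \<and>
            (\<forall>u. F u = A u - B u) \<and>
            (\<forall>t. \<phi> t = (CLINT u | interval_measure A. iexp (t * u))
                     - (CLINT u | interval_measure B. iexp (t * u))))"

text \<open>
  The transform below is a polynomial in \<open>t\<close> times \<open>exp (- t\<^sup>2 / 2)\<close>, with Hermitian symmetry, so
  \<open>WW5\<close> is a real function, a primitive of a polynomial multiple of the Gaussian density.
\<close>

definition WW5 :: "nat \<Rightarrow> nat \<Rightarrow> (nat \<Rightarrow> real) \<Rightarrow> real \<Rightarrow> real" where
  "WW5 n N p = (THE F.
     has_fourier_stieltjes_transform F (\<lambda>t. W5 n N p t * of_real (exp (- t\<^sup>2 / 2))) \<and>
     (F \<longlongrightarrow> 0) at_bot)"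

definition Lambda :: "nat \<Rightarrow> nat \<Rightarrow> (nat \<Rightarrow> real) \<Rightarrow> real" where
  "Lambda n N p = real n * (1 + real n * power_sum N p 2)"


subsection \<open>Closed form of the variance, and the multinomial mass function\<close>

lemma has_bochner_integral_poisson_shift:
  fixes f :: "nat \<Rightarrow> real"
  assumes r: "r > 0" and f: "has_bochner_integral (poisson_pmf r) (\<lambda>k. f (Suc k)) I"
  shows "has_bochner_integral (poisson_pmf r) (\<lambda>k. real k * f k) (r * I)"
proof -
  let ?P = "\<lambda>k. pmf (poisson_pmf r) k"
  have step: "?P (Suc k) * (real (Suc k) * f (Suc k)) = r * (?P k * f (Suc k))" for k
    using r by (simp add: field_simps del: of_nat_Suc)
  have int: "integrable (count_space UNIV) (\<lambda>k. ?P k * f (Suc k))"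
    and I: "integral\<^sup>L (count_space UNIV) (\<lambda>k. ?P k * f (Suc k)) = I"
    using f by (simp_all add: has_bochner_integral_iff measure_pmf_eq_density
        integrable_density integral_density pmf_nonneg del: pmf_poisson)
  have "summable (\<lambda>k. norm (?P k * f (Suc k)))"
    using int by (simp only: integrable_count_space_nat_iff)
  hence "summable (\<lambda>k. r * norm (?P k * f (Suc k)))" by (rule summable_mult)
  moreover have "norm (?P (Suc k) * (real (Suc k) * f (Suc k))) = r * norm (?P k * f (Suc k))" for k
    unfolding step using r by (simp add: abs_mult)
  ultimately have "summable (\<lambda>k. norm (?P (Suc k) * (real (Suc k) * f (Suc k))))"
    by (simp only:)
  hence "summable (\<lambda>k. norm (?P k * (real k * f k)))"
    by (subst (asm) summable_Suc_iff)
  hence int2: "integrable (count_space UNIV) (\<lambda>k. ?P k * (real k * f k))"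
    by (simp only: integrable_count_space_nat_iff)
  have "(\<lambda>k. ?P k * f (Suc k)) sums I"
    using sums_integral_count_space_nat[OF int] I by simp
  hence "(\<lambda>k. r * (?P k * f (Suc k))) sums (r * I)" by (rule sums_mult)
  hence "(\<lambda>k. ?P (Suc k) * (real (Suc k) * f (Suc k))) sums (r * I)"
    by (simp only: step)
  hence "(\<lambda>k. ?P k * (real k * f k)) sums (r * I)"
    using sums_Suc[of "\<lambda>k. ?P k * (real k * f k)" "r * I"] by simp
  hence "integral\<^sup>L (count_space UNIV) (\<lambda>k. ?P k * (real k * f k)) = r * I"
    using sums_integral_count_space_nat[OF int2] sums_unique2 by blast
  with int2 show ?thesis
    by (simp add: has_bochner_integral_iff measure_pmf_eq_density
        integrable_density integral_density pmf_nonneg del: pmf_poisson)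
qed

lemma poisson_moments:
  assumes "r > 0"
  defines "M \<equiv> measure_pmf (poisson_pmf r)"
  shows "has_bochner_integral M (\<lambda>k. 1 :: real) 1"
    and "has_bochner_integral M (\<lambda>k. real k) r"
    and "has_bochner_integral M (\<lambda>k. real k ^ 2) (r\<^sup>2 + r)"
    and "has_bochner_integral M (\<lambda>k. real k ^ 3) (r ^ 3 + 3 * r\<^sup>2 + r)"
    and "has_bochner_integral M (\<lambda>k. real k ^ 4) (r ^ 4 + 6 * r ^ 3 + 7 * r\<^sup>2 + r)"
proof -
  note shift = has_bochner_integral_poisson_shift[OF assms(1), folded M_def]
  show 0: "has_bochner_integral M (\<lambda>k. 1 :: real) 1"
    by (simp add: has_bochner_integral_iff M_def)
  show 1: "has_bochner_integral M (\<lambda>k. real k) r"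
    using shift[of "\<lambda>_. 1", OF 0] by simp
  have "has_bochner_integral M (\<lambda>k. real k + 1) (r + 1)"
    using has_bochner_integral_add[OF 1 0] .
  hence "has_bochner_integral M (\<lambda>k. real (Suc k)) (r + 1)" by (simp add: add.commute)
  from shift[of real, OF this] show 2: "has_bochner_integral M (\<lambda>k. real k ^ 2) (r\<^sup>2 + r)"
    by (simp add: power2_eq_square algebra_simps)
  have "has_bochner_integral M (\<lambda>k. real k ^ 2 + 2 * real k + 1) ((r\<^sup>2 + r) + 2 * r + 1)"
    by (intro has_bochner_integral_add has_bochner_integral_mult_right 0 1 2)
  hence "has_bochner_integral M (\<lambda>k. real (Suc k) ^ 2) ((r\<^sup>2 + r) + 2 * r + 1)"
    by (simp add: power2_eq_square algebra_simps)
  from shift[of "\<lambda>k. real k ^ 2", OF this]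
  show 3: "has_bochner_integral M (\<lambda>k. real k ^ 3) (r ^ 3 + 3 * r\<^sup>2 + r)"
    by (simp add: power2_eq_square power3_eq_cube algebra_simps)
  have "has_bochner_integral M (\<lambda>k. real k ^ 3 + 3 * real k ^ 2 + 3 * real k + 1)
      ((r ^ 3 + 3 * r\<^sup>2 + r) + 3 * (r\<^sup>2 + r) + 3 * r + 1)"
    by (intro has_bochner_integral_add has_bochner_integral_mult_right 0 1 2 3)
  hence "has_bochner_integral M (\<lambda>k. real (Suc k) ^ 3)
      ((r ^ 3 + 3 * r\<^sup>2 + r) + 3 * (r\<^sup>2 + r) + 3 * r + 1)"
    by (simp add: power2_eq_square power3_eq_cube algebra_simps)
  from shift[of "\<lambda>k. real k ^ 3", OF this]
  show "has_bochner_integral M (\<lambda>k. real k ^ 4) (r ^ 4 + 6 * r ^ 3 + 7 * r\<^sup>2 + r)"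
    by (simp add: power2_eq_square power3_eq_cube power4_eq_xxxx algebra_simps)
qed

lemma poisson_variance_quadratic:
  assumes r: "r > 0"
  shows "measure_pmf.variance (poisson_pmf r)
      (\<lambda>k. (real k)\<^sup>2 - r * (r + 1) - a * (real k - r))
    = 4 * r ^ 3 + 6 * r\<^sup>2 + r - 2 * a * (2 * r\<^sup>2 + r) + a\<^sup>2 * r"
proof -
  let ?M = "measure_pmf (poisson_pmf r)"
  note m = poisson_moments[OF r]
  have "has_bochner_integral ?M (\<lambda>k. (real k)\<^sup>2 - a * real k + (a * r - r * (r + 1)) * 1)
      ((r\<^sup>2 + r) - a * r + (a * r - r * (r + 1)) * 1)"
    by (intro has_bochner_integral_add has_bochner_integral_diff
        has_bochner_integral_mult_right m)
  hence 1: "integral\<^sup>L ?M (\<lambda>k. (real k)\<^sup>2 - r * (r + 1) - a * (real k - r)) = 0"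
    by (simp add: has_bochner_integral_iff power2_eq_square algebra_simps)
  define b where "b = a * r - r * (r + 1)"
  have "has_bochner_integral ?M (\<lambda>k. (real k) ^ 4 - 2 * a * real k ^ 3 +
        (a\<^sup>2 + 2 * b) * (real k)\<^sup>2 - 2 * a * b * real k + b\<^sup>2 * 1)
      ((r ^ 4 + 6 * r ^ 3 + 7 * r\<^sup>2 + r) - 2 * a * (r ^ 3 + 3 * r\<^sup>2 + r) +
        (a\<^sup>2 + 2 * b) * (r\<^sup>2 + r) - 2 * a * b * r + b\<^sup>2 * 1)"
    by (intro has_bochner_integral_add has_bochner_integral_diff
        has_bochner_integral_mult_right m)
  hence 2: "integral\<^sup>L ?M (\<lambda>k. (real k) ^ 4 - 2 * a * real k ^ 3 +
        (a\<^sup>2 + 2 * b) * (real k)\<^sup>2 - 2 * a * b * real k + b\<^sup>2 * 1)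
     = ((r ^ 4 + 6 * r ^ 3 + 7 * r\<^sup>2 + r) - 2 * a * (r ^ 3 + 3 * r\<^sup>2 + r) +
        (a\<^sup>2 + 2 * b) * (r\<^sup>2 + r) - 2 * a * b * r + b\<^sup>2 * 1)"
    by (simp only: has_bochner_integral_iff)
  have sq: "((real k)\<^sup>2 - r * (r + 1) - a * (real k - r))\<^sup>2 = (real k) ^ 4 - 2 * a * real k ^ 3 +
        (a\<^sup>2 + 2 * b) * (real k)\<^sup>2 - 2 * a * b * real k + b\<^sup>2 * 1" for k
    unfolding b_def by algebra
  have "measure_pmf.variance (poisson_pmf r)
      (\<lambda>k. (real k)\<^sup>2 - r * (r + 1) - a * (real k - r)) =
     ((r ^ 4 + 6 * r ^ 3 + 7 * r\<^sup>2 + r) - 2 * a * (r ^ 3 + 3 * r\<^sup>2 + r) +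
        (a\<^sup>2 + 2 * b) * (r\<^sup>2 + r) - 2 * a * b * r + b\<^sup>2 * 1)"
    unfolding 1 using 2 by (simp only: diff_0_right sq)
  also have "\<dots> = 4 * r ^ 3 + 6 * r\<^sup>2 + r - 2 * a * (2 * r\<^sup>2 + r) + a\<^sup>2 * r"
    unfolding b_def by algebra
  finally show ?thesis .
qed

lemma expectation_poisson_vec:
  fixes f :: "nat \<Rightarrow> real"
  assumes "m \<in> {1..N}"
  shows "measure_pmf.expectation (poisson_vec n N p) (\<lambda>\<xi>. f (\<xi> m))
       = measure_pmf.expectation (poisson_pmf (lam_cell n p m)) f"
proof -
  have "poisson_pmf (lam_cell n p m) = map_pmf (\<lambda>\<xi>. \<xi> m) (poisson_vec n N p)"
    using assms by (simp add: poisson_vec_def Pi_pmf_component)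
  thus ?thesis by simp
qed

lemma sigma_sq_eq:
  assumes "n \<ge> 1" and "\<And>m. m \<in> {1..N} \<Longrightarrow> p m > 0" and "(\<Sum>m=1..N. p m) = 1"
  shows "sigma_sq n N p = 2 * real n ^ 2 * power_sum N p 2
           + 4 * real n ^ 3 * (power_sum N p 3 - (power_sum N p 2)\<^sup>2)"
proof -
  define a where "a = 2 * real n * power_sum N p 2 + 1"
  have "sigma_sq n N p = (\<Sum>m=1..N. 4 * (n * p m) ^ 3 + 6 * (n * p m)\<^sup>2 + n * p m
      - 2 * a * (2 * (n * p m)\<^sup>2 + n * p m) + a\<^sup>2 * (n * p m))"
    unfolding sigma_sq_def
  proof (rule sum.cong[OF refl])
    fix m assume m: "m \<in> {1..N}"
    have pos: "lam_cell n p m > 0" using assms(1) assms(2)[OF m] by (simp add: lam_cell_def)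
    show "measure_pmf.variance (poisson_vec n N p) (\<lambda>\<xi>. g_stat n N p m (real (\<xi> m)))
       = 4 * (n * p m) ^ 3 + 6 * (n * p m)\<^sup>2 + n * p m
      - 2 * a * (2 * (n * p m)\<^sup>2 + n * p m) + a\<^sup>2 * (n * p m)"
      using poisson_variance_quadratic[OF pos, of a]
        expectation_poisson_vec[OF m, of n p "\<lambda>k. g_stat n N p m (real k)"]
        expectation_poisson_vec[OF m, of n p "\<lambda>k. (g_stat n N p m (real k) - z)\<^sup>2" for z]
      by (simp add: g_stat_def a_def lam_cell_def)
  qed
  also have "\<dots> = 4 * n ^ 3 * power_sum N p 3 + 6 * n ^ 2 * power_sum N p 2
      + n * (\<Sum>m=1..N. p m)
      - 2 * a * (2 * (n ^ 2 * power_sum N p 2) + n * (\<Sum>m=1..N. p m))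
      + a\<^sup>2 * (n * (\<Sum>m=1..N. p m))"
    by (simp add: power_sum_def power_mult_distrib sum.distrib sum_subtractf sum_distrib_left
        algebra_simps)
  also have "\<dots> = 2 * real n ^ 2 * power_sum N p 2
           + 4 * real n ^ 3 * (power_sum N p 3 - (power_sum N p 2)\<^sup>2)"
    unfolding assms(3) a_def by (simp add: power2_eq_square power3_eq_cube algebra_simps)
  finally show ?thesis .
qed

lemma pmf_cell:
  assumes "\<And>m. m \<in> {1..N} \<Longrightarrow> p m > 0" and "(\<Sum>m=1..N. p m) = 1"
  shows "pmf (cell_pmf N p) m = (if m \<in> {1..N} then p m else 0)"
  unfolding cell_pmf_def
proof (rule pmf_embed_pmf)
  show "0 \<le> (if m \<in> {1..N} then p m else 0)" for m
    using assms(1) by (auto intro: less_imp_le)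
  have "(\<integral>\<^sup>+m. ennreal (if m \<in> {1..N} then p m else 0) \<partial>count_space UNIV)
      = (\<Sum>m=1..N. ennreal (p m))"
    by (subst nn_integral_count_space'[where A = "{1..N}"]) (auto simp: assms(1) less_imp_le)
  also have "\<dots> = ennreal (\<Sum>m=1..N. p m)"
    using assms(1) by (subst sum_ennreal) (auto intro: less_imp_le)
  finally show "(\<integral>\<^sup>+m. ennreal (if m \<in> {1..N} then p m else 0) \<partial>count_space UNIV) = 1"
    using assms(2) by simp
qed

lemma pmf_replicate:
  "length xs = n \<Longrightarrow> pmf (replicate_pmf n q) xs = prod_list (map (pmf q) xs)"
proof (induction xs arbitrary: n)
  case Nil
  thus ?case by simp
next
  case (Cons x xs)
  obtain k where k: "n = Suc k" "length xs = k" using Cons.prems by auto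
  have eq: "replicate_pmf (Suc k) q = map_pmf (\<lambda>(x, xs). x # xs) (pair_pmf q (replicate_pmf k q))"
    by (simp add: pair_pmf_def map_bind_pmf map_return_pmf)
  have "pmf (replicate_pmf (Suc k) q) ((\<lambda>(x, xs). x # xs) (x, xs))
      = pmf (pair_pmf q (replicate_pmf k q)) (x, xs)"
    unfolding eq by (rule pmf_map_inj') (auto simp: inj_def)
  thus ?case using Cons.IH k by (simp add: pmf_pair)
qed

lemma pmf_multinomial:
  assumes p: "\<And>m. m \<in> {1..N} \<Longrightarrow> p m > 0" "(\<Sum>m=1..N. p m) = 1"
    and supp: "\<And>m. m \<notin> {1..N} \<Longrightarrow> \<eta> m = 0" and tot: "(\<Sum>m=1..N. \<eta> m) = n"
  shows "pmf (multinomial_pmf n N p) \<eta> = fact n / (\<Prod>m=1..N. fact (\<eta> m)) * (\<Prod>m=1..N. p m ^ \<eta> m)"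
proof -
  have fin: "finite {m. 0 < \<eta> m}"
    by (rule finite_subset[of _ "{1..N}"]) (use supp in force)+
  define A where "A = Abs_multiset \<eta>"
  have cA: "count A = \<eta>" unfolding A_def using fin by (simp add: Abs_multiset_inverse)
  have setA: "set_mset A \<subseteq> {1..N}"
    using supp cA by (metis count_eq_zero_iff subsetI)
  have sizeA: "size A = n"
    unfolding size_multiset_overloaded_eq cA tot[symmetric]
    by (rule sum.mono_neutral_left) (use setA cA in \<open>auto simp: not_in_iff\<close>)
  let ?S = "permutations_of_multiset A"
  have S: "xs \<in> ?S \<longleftrightarrow> count_list xs = \<eta>" for xs
    unfolding permutations_of_multiset_def mem_Collect_eq multiset_eq_iff cA fun_eq_iff
    by (simp add: count_mset)
  have pm: "pmf (replicate_pmf n (cell_pmf N p)) xs = (\<Prod>m=1..N. p m ^ \<eta> m)" if "xs \<in> ?S" for xs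
  proof -
    have mx: "mset xs = A" using that by (simp add: permutations_of_multiset_def)
    hence "length xs = n" using sizeA size_mset by metis
    hence "pmf (replicate_pmf n (cell_pmf N p)) xs = prod_list (map (pmf (cell_pmf N p)) xs)"
      by (rule pmf_replicate)
    also have "\<dots> = prod_mset (image_mset (pmf (cell_pmf N p)) A)"
      unfolding mx[symmetric] mset_map[symmetric] by (simp only: prod_mset_prod_list)
    also have "\<dots> = (\<Prod>m\<in>set_mset A. pmf (cell_pmf N p) m ^ \<eta> m)"
      by (simp only: image_prod_mset_multiplicity cA)
    also have "\<dots> = (\<Prod>m=1..N. pmf (cell_pmf N p) m ^ \<eta> m)"
      by (rule prod.mono_neutral_left) (use setA cA in \<open>auto simp: not_in_iff\<close>)
    also have "\<dots> = (\<Prod>m=1..N. p m ^ \<eta> m)"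
      using pmf_cell[of N p] p by (intro prod.cong) auto
    finally show ?thesis .
  qed
  have "pmf (multinomial_pmf n N p) \<eta> = measure_pmf.prob (replicate_pmf n (cell_pmf N p)) ?S"
    unfolding multinomial_pmf_def pmf_map using S by (intro arg_cong[where f = "measure_pmf.prob _"]) auto
  also have "\<dots> = (\<Sum>xs\<in>?S. pmf (replicate_pmf n (cell_pmf N p)) xs)"
    by (rule measure_measure_pmf_finite) simp
  also have "\<dots> = real (card ?S) * (\<Prod>m=1..N. p m ^ \<eta> m)"
    by (simp add: pm)
  also have "real (card ?S) = fact n / (\<Prod>m=1..N. fact (\<eta> m))"
  proof -
    have "(\<Prod>m\<in>set_mset A. fact (count A m) :: nat) = (\<Prod>m=1..N. fact (\<eta> m))"
      unfolding cA by (rule prod.mono_neutral_left) (use setA cA in \<open>auto simp: not_in_iff\<close>)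
    thus ?thesis
      using card_permutations_of_multiset[of A] sizeA by (simp add: real_of_nat_div)
  qed
  finally show ?thesis .
qed
end

theory Submission
  imports Defs
begin

text \<open>
  Given \<open>\<Sum>m. \<xi> m = n\<close>, the Poisson vector \<open>\<xi>\<close> is multinomial, and on that event \<open>\<Sum>m. (\<xi> m)\<^sup>2 - \<Lambda>\<close>
  equals \<open>\<Sum>m. g\<^sub>m (\<xi> m)\<close>.  Two-dimensional Fourier inversion therefore writes
  \<open>(\<sigma> / 2) P {X\<^sup>2 = b}\<close> as the integral of the joint characteristic function of
  \<open>\<Sum>m. g\<^sub>m (\<xi> m) / \<sigma>\<close> and \<open>(\<Sum>m. \<xi> m - n) / sqrt n\<close> over a box, divided by the correspondingly scaled
  probability that \<open>\<Sum>m. \<xi> m = n\<close>; the box is only \<open>pi * \<sigma>\<close> wide in the first variable because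
  \<open>X\<^sup>2\<close> and \<open>n\<close> have the same parity.
  The characteristic function is a product over the cells.  Near the origin each factor is expanded
  up to its fourth cumulant; away from it a factor is bounded either through its Poisson part or, for
  large first variable, by a Cauchy--Schwarz bound on the quadratic phase.  The resulting
  two-dimensional Edgeworth integrand, integrated over the second variable, gives \<open>W\<^sup>(\<^sup>5\<^sup>)\<close> up to the
  constant \<open>1 + g\<close>, which the denominator cancels to the required order.
\<close>

section \<open>Poisson moments\<close>

text \<open>The obstacle is uniformity in \<lambda>, which may tend to 0 or to infinity. For a large
  cell mean r, a joint Taylor expansion in both frequencies leaves a remainder of order (r
  \<omega>^2)^(5/2), too large by a power of r. So the Poisson exponent stays exact in \<omega>,
  only \<theta> is expanded, and the truncated Taylor sum is turned back into an exponential through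
  the cumulants of \<open>charlier2\<close> under the weight exp(i \<omega> \<xi>). Every cell error
  is then the cell variance times the cube of a size max(1, r) |\<theta>| + |\<omega>|.
  Orthogonality makes these errors summable: \<open>g_stat\<close> is \<open>charlier2\<close> plus
  2 \<delta> (\<xi> - r), the two parts are uncorrelated, and the \<delta> are centred under the
  weights r. Hence the cell variances add up to exactly t^2 + s^2, and one size estimate per cell
  gives a global error of order K^(-3/2). The denominator is the same integrand on the line t = 0.
  It is 1 + g with g of order 1 / K only, because the third-cumulant term is purely imaginary while
  the integral is real.\<close>

lemma has_bochner_integral_poisson_shift_complex:
  fixes f :: "nat \<Rightarrow> complex"
  assumes r: "r > 0" and f: "has_bochner_integral (poisson_pmf r) (\<lambda>k. f (Suc k)) I"
  shows "has_bochner_integral (poisson_pmf r) (\<lambda>k. of_nat k * f k) (of_real r * I)"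
proof -
  have "has_bochner_integral (poisson_pmf r) (\<lambda>k. Re (f (Suc k))) (Re I)"
    by (rule has_bochner_integral_bounded_linear[OF bounded_linear_Re f])
  from has_bochner_integral_poisson_shift[OF r this]
  have 1: "has_bochner_integral (poisson_pmf r) (\<lambda>k. complex_of_real (real k * Re (f k))) (of_real (r * Re I))"
    by (rule has_bochner_integral_of_real)
  have "has_bochner_integral (poisson_pmf r) (\<lambda>k. Im (f (Suc k))) (Im I)"
    by (rule has_bochner_integral_bounded_linear[OF bounded_linear_Im f])
  from has_bochner_integral_poisson_shift[OF r this]
  have 2: "has_bochner_integral (poisson_pmf r) (\<lambda>k. complex_of_real (real k * Im (f k))) (of_real (r * Im I))"
    by (rule has_bochner_integral_of_real)
  have "has_bochner_integral (poisson_pmf r)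
      (\<lambda>k. complex_of_real (real k * Re (f k)) + \<i> * complex_of_real (real k * Im (f k)))
      (of_real (r * Re I) + \<i> * of_real (r * Im I))"
    by (intro has_bochner_integral_add has_bochner_integral_mult_right 1 2)
  moreover have "complex_of_real (real k * Re (f k)) + \<i> * complex_of_real (real k * Im (f k)) = of_nat k * f k" for k
    by (simp add: complex_eq_iff)
  moreover have "complex_of_real (r * Re I) + \<i> * of_real (r * Im I) = of_real r * I"
    by (simp add: complex_eq_iff)
  ultimately show ?thesis by simp
qed

definition centered_poisson_cf :: "real \<Rightarrow> real \<Rightarrow> complex" where
  "centered_poisson_cf r \<omega> = exp (of_real r * (iexp \<omega> - 1 - \<i> * of_real \<omega>))"

lemma poisson_generating_function:
  fixes w :: complex
  assumes "r > 0" "norm w \<le> 1"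
  shows "has_bochner_integral (poisson_pmf r) (\<lambda>k. w ^ k) (exp (of_real r * (w - 1)))"
proof -
  have int: "integrable (poisson_pmf r) (\<lambda>k. w ^ k)"
    by (rule measure_pmf.integrable_const_bound[where B = 1])
      (use assms in \<open>auto simp: norm_power intro!: AE_I2 power_le_one\<close>)
  have int': "integrable (count_space UNIV) (\<lambda>k. pmf (poisson_pmf r) k *\<^sub>R w ^ k)"
    using int by (simp add: measure_pmf_eq_density integrable_density pmf_nonneg del: pmf_poisson)
  have eq: "integral\<^sup>L (poisson_pmf r) (\<lambda>k. w ^ k)
      = integral\<^sup>L (count_space UNIV) (\<lambda>k. pmf (poisson_pmf r) k *\<^sub>R w ^ k)"
    by (simp add: measure_pmf_eq_density integral_density pmf_nonneg del: pmf_poisson)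
  have "(\<lambda>k. (of_real r * w) ^ k /\<^sub>R fact k) sums exp (of_real r * w)"
    by (rule exp_converges)
  hence "(\<lambda>k. of_real (exp (- r)) * ((of_real r * w) ^ k /\<^sub>R fact k)) sums
      (of_real (exp (- r)) * exp (of_real r * w))"
    by (rule sums_mult)
  moreover have "of_real (exp (- r)) * ((of_real r * w) ^ k /\<^sub>R fact k)
      = pmf (poisson_pmf r) k *\<^sub>R w ^ k" for k
    using assms(1) by (simp add: scaleR_conv_of_real power_mult_distrib field_simps)
  moreover have "of_real (exp (- r)) * exp (of_real r * w) = exp (of_real r * (w - 1))"
    by (simp add: exp_of_real[symmetric] exp_add[symmetric] algebra_simps)
  ultimately have "(\<lambda>k. pmf (poisson_pmf r) k *\<^sub>R w ^ k) sums exp (of_real r * (w - 1))"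
    by (simp del: pmf_poisson)
  with sums_integral_count_space_nat[OF int'] eq have "integral\<^sup>L (poisson_pmf r) (\<lambda>k. w ^ k) = exp (of_real r * (w - 1))"
    using sums_unique2 by metis
  with int show ?thesis by (simp add: has_bochner_integral_iff)
qed

lemma centered_poisson_cf:
  assumes "r > 0"
  shows "has_bochner_integral (poisson_pmf r) (\<lambda>k. iexp (\<omega> * (real k - r))) (centered_poisson_cf r \<omega>)"
proof -
  have "has_bochner_integral (poisson_pmf r) (\<lambda>k. iexp (- (\<omega> * r)) * iexp \<omega> ^ k)
      (iexp (- (\<omega> * r)) * exp (of_real r * (iexp \<omega> - 1)))"
    by (intro has_bochner_integral_mult_right poisson_generating_function assms) simp
  moreover have "iexp (- (\<omega> * r)) * iexp \<omega> ^ k = iexp (\<omega> * (real k - r))" for k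
    by (simp add: exp_of_nat_mult[symmetric] exp_add[symmetric] algebra_simps)
  moreover have "iexp (- (\<omega> * r)) * exp (of_real r * (iexp \<omega> - 1)) = centered_poisson_cf r \<omega>"
    unfolding centered_poisson_cf_def by (simp add: exp_add[symmetric] algebra_simps)
  ultimately show ?thesis by simp
qed

text \<open>Moments of \<open>\<xi> - r\<close> under the complex weight \<open>w\<^sup>\<xi>\<close>, for \<open>\<xi>\<close> Poisson with mean \<open>r\<close>.\<close>

function tilted_moment :: "'a::idom \<Rightarrow> 'a \<Rightarrow> nat \<Rightarrow> 'a" where
  "tilted_moment r w 0 = 1"
| "tilted_moment r w (Suc j) =
     r * w * (\<Sum>i\<le>j. of_nat (j choose i) * tilted_moment r w i) - r * tilted_moment r w j"
  by pat_completeness auto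
termination by (relation "Wellfounded.measure (\<lambda>(r, w, j). j)") auto

text \<open>The recursion is the shift identity E \<xi> f(\<xi>) = r E f(\<xi> + 1) for f(k) = (k -
  r)^j w^k, with (k + 1 - r)^j expanded by the binomial theorem; the shift multiplies the weight by
  w = exp(i \<omega>) only, so \<open>centered_poisson_cf\<close> separates as a common
  factor.\<close>

lemma tilted_moment:
  assumes r: "r > 0"
  shows "has_bochner_integral (poisson_pmf r)
      (\<lambda>k. of_real (real k - r) ^ j * iexp (\<omega> * (real k - r)))
      (centered_poisson_cf r \<omega> * tilted_moment (of_real r) (iexp \<omega>) j)"
proof (induction j rule: less_induct)
  case (less j)
  show ?case
  proof (cases j)
    case 0
    thus ?thesis using centered_poisson_cf[OF r] by simp
  next
    case (Suc i)
    let ?e = "\<lambda>k. iexp (\<omega> * (real k - r))"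
    let ?\<Phi> = "centered_poisson_cf r \<omega>" and ?T = "tilted_moment (of_real r) (iexp \<omega>)"
    have "has_bochner_integral (poisson_pmf r)
        (\<lambda>k. iexp \<omega> * (\<Sum>l\<le>i. of_nat (i choose l) * (of_real (real k - r) ^ l * ?e k)))
        (iexp \<omega> * (\<Sum>l\<le>i. of_nat (i choose l) * (?\<Phi> * ?T l)))"
      by (intro has_bochner_integral_mult_right has_bochner_integral_sum less.IH) (use Suc in auto)
    moreover have "iexp \<omega> * (\<Sum>l\<le>i. of_nat (i choose l) * (of_real (real k - r) ^ l * ?e k))
       = of_real (real (Suc k) - r) ^ i * ?e (Suc k)" for k
    proof -
      have e: "?e (Suc k) = iexp \<omega> * ?e k"
        by (simp add: exp_add[symmetric] algebra_simps)
      have "of_real (real (Suc k) - r) ^ i = (complex_of_real (real k - r) + 1) ^ i"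
        by (simp add: algebra_simps)
      also have "\<dots> = (\<Sum>l\<le>i. of_nat (i choose l) * of_real (real k - r) ^ l)"
        by (subst binomial_ring) simp
      finally show ?thesis unfolding e by (simp add: sum_distrib_right sum_distrib_left mult_ac)
    qed
    ultimately have "has_bochner_integral (poisson_pmf r) (\<lambda>k. of_real (real (Suc k) - r) ^ i * ?e (Suc k))
        (iexp \<omega> * (\<Sum>l\<le>i. of_nat (i choose l) * (?\<Phi> * ?T l)))" by (simp only:)
    note 1 = has_bochner_integral_poisson_shift_complex[OF r this]
    have "has_bochner_integral (poisson_pmf r) (\<lambda>k. of_nat k * (of_real (real k - r) ^ i * ?e k)
          - of_real r * (of_real (real k - r) ^ i * ?e k))
        (of_real r * (iexp \<omega> * (\<Sum>l\<le>i. of_nat (i choose l) * (?\<Phi> * ?T l))) - of_real r * (?\<Phi> * ?T i))"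
      by (intro has_bochner_integral_diff 1 has_bochner_integral_mult_right less.IH) (use Suc in auto)
    moreover have "of_real r * (iexp \<omega> * (\<Sum>l\<le>i. of_nat (i choose l) * (?\<Phi> * ?T l))) - of_real r * (?\<Phi> * ?T i)
      = ?\<Phi> * ?T j"
      unfolding Suc by (simp add: algebra_simps sum_distrib_left)
    moreover have "of_nat k * (of_real (real k - r) ^ i * ?e k) - of_real r * (of_real (real k - r) ^ i * ?e k)
        = of_real (real k - r) ^ j * ?e k" for k
      unfolding Suc by (simp add: algebra_simps)
    ultimately show ?thesis by (simp only:)
  qed
qed

text \<open>The second Charlier polynomial is \<open>g_stat\<close> with its component along \<open>\<xi> - r\<close> removed.\<close>

definition charlier2 :: "real \<Rightarrow> nat \<Rightarrow> real" where
  "charlier2 r k = (real k - r)\<^sup>2 - (real k - r) - r"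

text \<open>Mixed moments of C = \<open>charlier2\<close> and x = \<xi> - r under the weight
  w^\<xi>: one factor C = x^2 - x - r is expanded at a time until only powers of x remain.\<close>

fun charlier2_moment :: "'a::idom \<Rightarrow> 'a \<Rightarrow> nat \<Rightarrow> nat \<Rightarrow> 'a" where
  "charlier2_moment r w 0 l = tilted_moment r w l"
| "charlier2_moment r w (Suc j) l =
     charlier2_moment r w j (l + 2) - charlier2_moment r w j (l + 1) - r * charlier2_moment r w j l"

lemma charlier2_moment:
  assumes r: "r > 0"
  shows "has_bochner_integral (poisson_pmf r)
      (\<lambda>k. of_real (charlier2 r k ^ j * (real k - r) ^ l) * iexp (\<omega> * (real k - r)))
      (centered_poisson_cf r \<omega> * charlier2_moment (of_real r) (iexp \<omega>) j l)"
proof (induction j arbitrary: l)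
  case 0
  show ?case using tilted_moment[OF r, of l \<omega>] by simp
next
  case (Suc j)
  let ?e = "\<lambda>k. iexp (\<omega> * (real k - r))"
  let ?f = "\<lambda>l k. of_real (charlier2 r k ^ j * (real k - r) ^ l) * ?e k"
  have "has_bochner_integral (poisson_pmf r) (\<lambda>k. ?f (l + 2) k - ?f (l + 1) k - of_real r * ?f l k)
      (centered_poisson_cf r \<omega> * charlier2_moment (of_real r) (iexp \<omega>) j (l + 2)
        - centered_poisson_cf r \<omega> * charlier2_moment (of_real r) (iexp \<omega>) j (l + 1)
        - of_real r * (centered_poisson_cf r \<omega> * charlier2_moment (of_real r) (iexp \<omega>) j l))"
    by (intro has_bochner_integral_diff has_bochner_integral_mult_right Suc)
  moreover have "?f (l + 2) k - ?f (l + 1) k - of_real r * ?f l k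
      = of_real (charlier2 r k ^ Suc j * (real k - r) ^ l) * ?e k" for k
  proof -
    have "charlier2 r k ^ Suc j * (real k - r) ^ l = charlier2 r k ^ j * (real k - r) ^ (l + 2)
        - charlier2 r k ^ j * (real k - r) ^ (l + 1) - r * (charlier2 r k ^ j * (real k - r) ^ l)"
      by (simp add: charlier2_def power2_eq_square algebra_simps)
    thus ?thesis by (simp only: of_real_diff of_real_mult ring_distribs left_diff_distrib mult.assoc)
  qed
  ultimately show ?case by (simp only:) (simp add: algebra_simps)
qed

lemma charlier2_real_moment:
  assumes "r > 0"
  shows "has_bochner_integral (poisson_pmf r) (\<lambda>k. charlier2 r k ^ j * (real k - r) ^ l)
      (Re (charlier2_moment (of_real r) 1 j l))"
  using has_bochner_integral_bounded_linear[OF bounded_linear_Re charlier2_moment[OF assms, of j l 0]]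
  by (simp add: centered_poisson_cf_def)

text \<open>Written in d = w - 1, which is of order \<omega> for w = exp(i \<omega>), so that the
  order of each monomial in \<omega> can be read off.\<close>

lemma tilted_moment_eqs:
  fixes r d :: "'a::idom"
  defines "T \<equiv> tilted_moment r (1 + d)"
  shows "T 0 = 1"
    and "T 1 = r * d"
    and "T 2 = r + r * d + r ^ 2 * d ^ 2"
    and "T 3 = r + 3 * r ^ 2 * d + r * d + 3 * r ^ 2 * d ^ 2 + r ^ 3 * d ^ 3"
    and "T 4 = 3 * r ^ 2 + r + 10 * r ^ 2 * d + r * d + 6 * r ^ 3 * d ^ 2 + 7 * r ^ 2 * d ^ 2
       + 6 * r ^ 3 * d ^ 3 + r ^ 4 * d ^ 4"
    and "T 5 = 10 * r ^ 2 + r + 15 * r ^ 3 * d + 25 * r ^ 2 * d + r * d + 40 * r ^ 3 * d ^ 2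
       + 15 * r ^ 2 * d ^ 2 + 10 * r ^ 4 * d ^ 3 + 25 * r ^ 3 * d ^ 3 + 10 * r ^ 4 * d ^ 4
       + r ^ 5 * d ^ 5"
    and "T 6 = 15 * r ^ 3 + 25 * r ^ 2 + r + 105 * r ^ 3 * d + 56 * r ^ 2 * d + r * d
       + 45 * r ^ 4 * d ^ 2 + 180 * r ^ 3 * d ^ 2 + 31 * r ^ 2 * d ^ 2 + 110 * r ^ 4 * d ^ 3
       + 90 * r ^ 3 * d ^ 3 + 15 * r ^ 5 * d ^ 4 + 65 * r ^ 4 * d ^ 4 + 15 * r ^ 5 * d ^ 5
       + r ^ 6 * d ^ 6"
    and "T 7 = 105 * r ^ 3 + 56 * r ^ 2 + r + 105 * r ^ 4 * d + 490 * r ^ 3 * d + 119 * r ^ 2 * d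
       + r * d + 525 * r ^ 4 * d ^ 2 + 686 * r ^ 3 * d ^ 2 + 63 * r ^ 2 * d ^ 2
       + 105 * r ^ 5 * d ^ 3 + 770 * r ^ 4 * d ^ 3 + 301 * r ^ 3 * d ^ 3 + 245 * r ^ 5 * d ^ 4
       + 350 * r ^ 4 * d ^ 4 + 21 * r ^ 6 * d ^ 5 + 140 * r ^ 5 * d ^ 5 + 21 * r ^ 6 * d ^ 6
       + r ^ 7 * d ^ 7"
    and "T 8 = 105 * r ^ 4 + 490 * r ^ 3 + 119 * r ^ 2 + r + 1260 * r ^ 4 * d + 1918 * r ^ 3 * d
       + 246 * r ^ 2 * d + r * d + 420 * r ^ 5 * d ^ 2 + 3850 * r ^ 4 * d ^ 2
       + 2394 * r ^ 3 * d ^ 2 + 127 * r ^ 2 * d ^ 2 + 1820 * r ^ 5 * d ^ 3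
       + 4396 * r ^ 4 * d ^ 3 + 966 * r ^ 3 * d ^ 3 + 210 * r ^ 6 * d ^ 4 + 2450 * r ^ 5 * d ^ 4
       + 1701 * r ^ 4 * d ^ 4 + 476 * r ^ 6 * d ^ 5 + 1050 * r ^ 5 * d ^ 5 + 28 * r ^ 7 * d ^ 6
       + 266 * r ^ 6 * d ^ 6 + 28 * r ^ 7 * d ^ 7 + r ^ 8 * d ^ 8"
proof -
  have rec: "T (Suc j) = r * (1 + d) * (\<Sum>i\<le>j. of_nat (j choose i) * T i) - r * T j" for j
    by (simp add: T_def)
  show 0: "T 0 = 1" by (simp add: T_def)
  have "T 1 = r * (1 + d) * (T 0) - r * T 0"
    using rec[of 0] by (simp add: eval_nat_numeral)
  thus 1: "T 1 = r * d"
    unfolding 0 by algebra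
  have "T 2 = r * (1 + d) * (T 0 + T 1) - r * T 1"
    using rec[of 1] by (simp add: eval_nat_numeral)
  thus 2: "T 2 = r + r * d + r ^ 2 * d ^ 2"
    unfolding 0 1 by algebra
  have "T 3 = r * (1 + d) * (T 0 + 2 * T 1 + T 2) - r * T 2"
    using rec[of 2] by (simp add: eval_nat_numeral)
  thus 3: "T 3 = r + 3 * r ^ 2 * d + r * d + 3 * r ^ 2 * d ^ 2 + r ^ 3 * d ^ 3"
    unfolding 0 1 2 by algebra
  have "T 4 = r * (1 + d) * (T 0 + 3 * T 1 + 3 * T 2 + T 3) - r * T 3"
    using rec[of 3] by (simp add: eval_nat_numeral)
  thus 4: "T 4 = 3 * r ^ 2 + r + 10 * r ^ 2 * d + r * d + 6 * r ^ 3 * d ^ 2 + 7 * r ^ 2 * d ^ 2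
       + 6 * r ^ 3 * d ^ 3 + r ^ 4 * d ^ 4"
    unfolding 0 1 2 3 by algebra
  have "T 5 = r * (1 + d) * (T 0 + 4 * T 1 + 6 * T 2 + 4 * T 3 + T 4) - r * T 4"
    using rec[of 4] by (simp add: eval_nat_numeral)
  thus 5: "T 5 = 10 * r ^ 2 + r + 15 * r ^ 3 * d + 25 * r ^ 2 * d + r * d + 40 * r ^ 3 * d ^ 2
       + 15 * r ^ 2 * d ^ 2 + 10 * r ^ 4 * d ^ 3 + 25 * r ^ 3 * d ^ 3 + 10 * r ^ 4 * d ^ 4
       + r ^ 5 * d ^ 5"
    unfolding 0 1 2 3 4 by algebra
  have "T 6 = r * (1 + d) * (T 0 + 5 * T 1 + 10 * T 2 + 10 * T 3 + 5 * T 4 + T 5) - r * T 5"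
    using rec[of 5] by (simp add: eval_nat_numeral)
  thus 6: "T 6 = 15 * r ^ 3 + 25 * r ^ 2 + r + 105 * r ^ 3 * d + 56 * r ^ 2 * d + r * d
       + 45 * r ^ 4 * d ^ 2 + 180 * r ^ 3 * d ^ 2 + 31 * r ^ 2 * d ^ 2 + 110 * r ^ 4 * d ^ 3
       + 90 * r ^ 3 * d ^ 3 + 15 * r ^ 5 * d ^ 4 + 65 * r ^ 4 * d ^ 4 + 15 * r ^ 5 * d ^ 5
       + r ^ 6 * d ^ 6"
    unfolding 0 1 2 3 4 5 by algebra
  have "T 7 = r * (1 + d) * (T 0 + 6 * T 1 + 15 * T 2 + 20 * T 3 + 15 * T 4 + 6 * T 5 + T 6) - r * T 6"
    using rec[of 6] by (simp add: eval_nat_numeral)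
  thus 7: "T 7 = 105 * r ^ 3 + 56 * r ^ 2 + r + 105 * r ^ 4 * d + 490 * r ^ 3 * d + 119 * r ^ 2 * d
       + r * d + 525 * r ^ 4 * d ^ 2 + 686 * r ^ 3 * d ^ 2 + 63 * r ^ 2 * d ^ 2
       + 105 * r ^ 5 * d ^ 3 + 770 * r ^ 4 * d ^ 3 + 301 * r ^ 3 * d ^ 3 + 245 * r ^ 5 * d ^ 4
       + 350 * r ^ 4 * d ^ 4 + 21 * r ^ 6 * d ^ 5 + 140 * r ^ 5 * d ^ 5 + 21 * r ^ 6 * d ^ 6
       + r ^ 7 * d ^ 7"
    unfolding 0 1 2 3 4 5 6 by algebra
  have "T 8 = r * (1 + d) * (T 0 + 7 * T 1 + 21 * T 2 + 35 * T 3 + 35 * T 4 + 21 * T 5 + 7 * T 6 + T 7) - r * T 7"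
    using rec[of 7] by (simp add: eval_nat_numeral)
  thus 8: "T 8 = 105 * r ^ 4 + 490 * r ^ 3 + 119 * r ^ 2 + r + 1260 * r ^ 4 * d + 1918 * r ^ 3 * d
       + 246 * r ^ 2 * d + r * d + 420 * r ^ 5 * d ^ 2 + 3850 * r ^ 4 * d ^ 2
       + 2394 * r ^ 3 * d ^ 2 + 127 * r ^ 2 * d ^ 2 + 1820 * r ^ 5 * d ^ 3
       + 4396 * r ^ 4 * d ^ 3 + 966 * r ^ 3 * d ^ 3 + 210 * r ^ 6 * d ^ 4 + 2450 * r ^ 5 * d ^ 4
       + 1701 * r ^ 4 * d ^ 4 + 476 * r ^ 6 * d ^ 5 + 1050 * r ^ 5 * d ^ 5 + 28 * r ^ 7 * d ^ 6
       + 266 * r ^ 6 * d ^ 6 + 28 * r ^ 7 * d ^ 7 + r ^ 8 * d ^ 8"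
    unfolding 0 1 2 3 4 5 6 7 by algebra
qed

text \<open>For j \<ge> 1 every monomial has degree at least 2 in r; for small cell means this keeps
  the moments comparable with the variance 2 r^2.\<close>

lemma charlier2_moment_eqs:
  fixes r d :: "'a::idom"
  defines "M \<equiv> charlier2_moment r (1 + d)"
  shows "M 0 0 = 1"
    and "M 1 0 = r ^ 2 * d ^ 2"
    and "M 2 0 = 2 * r ^ 2 + 4 * r ^ 2 * d + 4 * r ^ 3 * d ^ 2 + 2 * r ^ 2 * d ^ 2 + 4 * r ^ 3 * d ^ 3
       + r ^ 4 * d ^ 4"
    and "M 3 0 = 8 * r ^ 3 + 4 * r ^ 2 + 48 * r ^ 3 * d + 8 * r ^ 2 * d + 30 * r ^ 4 * d ^ 2
       + 72 * r ^ 3 * d ^ 2 + 4 * r ^ 2 * d ^ 2 + 68 * r ^ 4 * d ^ 3 + 32 * r ^ 3 * d ^ 3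
       + 12 * r ^ 5 * d ^ 4 + 38 * r ^ 4 * d ^ 4 + 12 * r ^ 5 * d ^ 5 + r ^ 6 * d ^ 6"
    and "M 4 0 = 60 * r ^ 4 + 144 * r ^ 3 + 8 * r ^ 2 + 624 * r ^ 4 * d + 496 * r ^ 3 * d + 16 * r ^ 2 * d
       + 272 * r ^ 5 * d ^ 2 + 1720 * r ^ 4 * d ^ 2 + 560 * r ^ 3 * d ^ 2 + 8 * r ^ 2 * d ^ 2
       + 1104 * r ^ 5 * d ^ 3 + 1808 * r ^ 4 * d ^ 3 + 208 * r ^ 3 * d ^ 3 + 156 * r ^ 6 * d ^ 4
       + 1408 * r ^ 5 * d ^ 4 + 652 * r ^ 4 * d ^ 4 + 344 * r ^ 6 * d ^ 5 + 576 * r ^ 5 * d ^ 5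
       + 24 * r ^ 7 * d ^ 6 + 188 * r ^ 6 * d ^ 6 + 24 * r ^ 7 * d ^ 7 + r ^ 8 * d ^ 8"
proof -
  define T where "T = tilted_moment r (1 + d)"
  note T = tilted_moment_eqs[of r d, folded T_def]
  have M0: "M 0 l = T l" for l by (simp add: M_def T_def)
  have MS: "M (j + 1) l = M j (l + 2) - M j (l + 1) - r * M j l" for j l by (simp add: M_def)
  have M1: "M 1 l = T (l + 2) - T (l + 1) - r * T l" for l using MS[of 0] by (simp add: M0 del: One_nat_def add_2_eq_Suc add_2_eq_Suc')
  have M2: "M 2 l = (1) * T (l + 4) + (-2) * T (l + 3) + (-2 * r + 1) * T (l + 2) + (2 * r) * T (l + 1)
       + (r ^ 2) * T l" for l
    unfolding MS[of 1 l, simplified one_add_one numeral_plus_one add_num_simps] M1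
    by (simp only: add.assoc arith_simps one_add_one one_plus_numeral numeral_plus_one) algebra
  have M3: "M 3 l = (1) * T (l + 6) + (-3) * T (l + 5) + (-3 * r + 3) * T (l + 4) + (6 * r + -1) * T (l + 3)
       + (3 * r ^ 2 + -3 * r) * T (l + 2) + (-3 * r ^ 2) * T (l + 1) + (-1 * r ^ 3) * T l" for l
    unfolding MS[of 2 l, simplified one_add_one numeral_plus_one add_num_simps] M2
    by (simp only: add.assoc arith_simps one_add_one one_plus_numeral numeral_plus_one) algebra
  have M4: "M 4 l = (1) * T (l + 8) + (-4) * T (l + 7) + (-4 * r + 6) * T (l + 6) + (12 * r + -4) * T (l + 5)
       + (6 * r ^ 2 + -12 * r + 1) * T (l + 4) + (-12 * r ^ 2 + 4 * r) * T (l + 3) + (-4 * r ^ 3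
       + 6 * r ^ 2) * T (l + 2) + (4 * r ^ 3) * T (l + 1) + (r ^ 4) * T l" for l
    unfolding MS[of 3 l, simplified one_add_one numeral_plus_one add_num_simps] M3
    by (simp only: add.assoc arith_simps one_add_one one_plus_numeral numeral_plus_one) algebra
  have "M 0 0 = (1) * T 0"
    by (simp add: M0)
  thus "M 0 0 = 1"
    using T(1,2) by simp
  have "M 1 0 = (1) * T 2 + (-1) * T 1 + (-1 * r) * T 0"
    using M1[of 0] by (simp add: algebra_simps del: One_nat_def add_2_eq_Suc add_2_eq_Suc')
  thus "M 1 0 = r ^ 2 * d ^ 2"
    unfolding T by algebra
  have "M 2 0 = (1) * T 4 + (-2) * T 3 + (-2 * r + 1) * T 2 + (2 * r) * T 1 + (r ^ 2) * T 0"
    using M2[of 0] by (simp add: algebra_simps del: One_nat_def add_2_eq_Suc add_2_eq_Suc')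
  thus "M 2 0 = 2 * r ^ 2 + 4 * r ^ 2 * d + 4 * r ^ 3 * d ^ 2 + 2 * r ^ 2 * d ^ 2 + 4 * r ^ 3 * d ^ 3
       + r ^ 4 * d ^ 4"
    unfolding T by algebra
  have "M 3 0 = (1) * T 6 + (-3) * T 5 + (-3 * r + 3) * T 4 + (6 * r + -1) * T 3 + (3 * r ^ 2
       + -3 * r) * T 2 + (-3 * r ^ 2) * T 1 + (-1 * r ^ 3) * T 0"
    using M3[of 0] by (simp add: algebra_simps del: One_nat_def add_2_eq_Suc add_2_eq_Suc')
  thus "M 3 0 = 8 * r ^ 3 + 4 * r ^ 2 + 48 * r ^ 3 * d + 8 * r ^ 2 * d + 30 * r ^ 4 * d ^ 2
       + 72 * r ^ 3 * d ^ 2 + 4 * r ^ 2 * d ^ 2 + 68 * r ^ 4 * d ^ 3 + 32 * r ^ 3 * d ^ 3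
       + 12 * r ^ 5 * d ^ 4 + 38 * r ^ 4 * d ^ 4 + 12 * r ^ 5 * d ^ 5 + r ^ 6 * d ^ 6"
    unfolding T by algebra
  have "M 4 0 = (1) * T 8 + (-4) * T 7 + (-4 * r + 6) * T 6 + (12 * r + -4) * T 5 + (6 * r ^ 2 + -12 * r
       + 1) * T 4 + (-12 * r ^ 2 + 4 * r) * T 3 + (-4 * r ^ 3 + 6 * r ^ 2) * T 2
       + (4 * r ^ 3) * T 1 + (r ^ 4) * T 0"
    using M4[of 0] by (simp add: algebra_simps del: One_nat_def add_2_eq_Suc add_2_eq_Suc')
  thus "M 4 0 = 60 * r ^ 4 + 144 * r ^ 3 + 8 * r ^ 2 + 624 * r ^ 4 * d + 496 * r ^ 3 * d + 16 * r ^ 2 * d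
       + 272 * r ^ 5 * d ^ 2 + 1720 * r ^ 4 * d ^ 2 + 560 * r ^ 3 * d ^ 2 + 8 * r ^ 2 * d ^ 2
       + 1104 * r ^ 5 * d ^ 3 + 1808 * r ^ 4 * d ^ 3 + 208 * r ^ 3 * d ^ 3 + 156 * r ^ 6 * d ^ 4
       + 1408 * r ^ 5 * d ^ 4 + 652 * r ^ 4 * d ^ 4 + 344 * r ^ 6 * d ^ 5 + 576 * r ^ 5 * d ^ 5
       + 24 * r ^ 7 * d ^ 6 + 188 * r ^ 6 * d ^ 6 + 24 * r ^ 7 * d ^ 7 + r ^ 8 * d ^ 8"
    unfolding T by algebra
qed

text \<open>The untilted case. Order 12 is reached because the sixth moment of the quadratic
  \<open>charlier2\<close> is wanted.\<close>

lemma tilted_moment_at_1: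
  fixes r :: "'a::idom"
  defines "T \<equiv> tilted_moment r 1"
  shows "T 0 = 1"
    and "T 1 = 0"
    and "T 2 = r"
    and "T 3 = r"
    and "T 4 = 3 * r ^ 2 + r"
    and "T 5 = 10 * r ^ 2 + r"
    and "T 6 = 15 * r ^ 3 + 25 * r ^ 2 + r"
    and "T 7 = 105 * r ^ 3 + 56 * r ^ 2 + r"
    and "T 8 = 105 * r ^ 4 + 490 * r ^ 3 + 119 * r ^ 2 + r"
    and "T 9 = 1260 * r ^ 4 + 1918 * r ^ 3 + 246 * r ^ 2 + r"
    and "T 10 = 945 * r ^ 5 + 9450 * r ^ 4 + 6825 * r ^ 3 + 501 * r ^ 2 + r"
    and "T 11 = 17325 * r ^ 5 + 56980 * r ^ 4 + 22935 * r ^ 3 + 1012 * r ^ 2 + r"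
    and "T 12 = 10395 * r ^ 6 + 190575 * r ^ 5 + 302995 * r ^ 4 + 74316 * r ^ 3 + 2035 * r ^ 2 + r"
proof -
  have rec: "T (Suc j) = r * (\<Sum>i\<le>j. of_nat (j choose i) * T i) - r * T j" for j
    by (simp add: T_def)
  note eqs = tilted_moment_eqs[of r 0, unfolded add_0_right, folded T_def]
  show 0: "T 0 = 1" using eqs(1) by simp
  show 1: "T 1 = 0" using eqs(2) by simp
  show 2: "T 2 = r" using eqs(3) by simp
  show 3: "T 3 = r" using eqs(4) by simp
  show 4: "T 4 = 3 * r ^ 2 + r" using eqs(5) by simp
  show 5: "T 5 = 10 * r ^ 2 + r" using eqs(6) by simp
  show 6: "T 6 = 15 * r ^ 3 + 25 * r ^ 2 + r" using eqs(7) by simp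
  show 7: "T 7 = 105 * r ^ 3 + 56 * r ^ 2 + r" using eqs(8) by simp
  show 8: "T 8 = 105 * r ^ 4 + 490 * r ^ 3 + 119 * r ^ 2 + r" using eqs(9) by simp
  have "T 9 = r * (T 0 + 8 * T 1 + 28 * T 2 + 56 * T 3 + 70 * T 4 + 56 * T 5 + 28 * T 6 + 8 * T 7 + T 8) - r * T 8"
    using rec[of 8] by (simp add: eval_nat_numeral)
  thus 9: "T 9 = 1260 * r ^ 4 + 1918 * r ^ 3 + 246 * r ^ 2 + r"
    unfolding 0 1 2 3 4 5 6 7 8 by algebra
  have "T 10 = r * (T 0 + 9 * T 1 + 36 * T 2 + 84 * T 3 + 126 * T 4 + 126 * T 5 + 84 * T 6 + 36 * T 7 + 9 * T 8 + T 9) - r * T 9"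
    using rec[of 9] by (simp add: eval_nat_numeral)
  thus 10: "T 10 = 945 * r ^ 5 + 9450 * r ^ 4 + 6825 * r ^ 3 + 501 * r ^ 2 + r"
    unfolding 0 1 2 3 4 5 6 7 8 9 by algebra
  have "T 11 = r * (T 0 + 10 * T 1 + 45 * T 2 + 120 * T 3 + 210 * T 4 + 252 * T 5 + 210 * T 6 + 120 * T 7 + 45 * T 8 + 10 * T 9 + T 10) - r * T 10"
    using rec[of 10] by (simp add: eval_nat_numeral)
  thus 11: "T 11 = 17325 * r ^ 5 + 56980 * r ^ 4 + 22935 * r ^ 3 + 1012 * r ^ 2 + r"
    unfolding 0 1 2 3 4 5 6 7 8 9 10 by algebra
  have "T 12 = r * (T 0 + 11 * T 1 + 55 * T 2 + 165 * T 3 + 330 * T 4 + 462 * T 5 + 462 * T 6 + 330 * T 7 + 165 * T 8 + 55 * T 9 + 11 * T 10 + T 11) - r * T 11"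
    using rec[of 11] by (simp add: eval_nat_numeral)
  thus 12: "T 12 = 10395 * r ^ 6 + 190575 * r ^ 5 + 302995 * r ^ 4 + 74316 * r ^ 3 + 2035 * r ^ 2 + r"
    unfolding 0 1 2 3 4 5 6 7 8 9 10 11 by algebra
qed

text \<open>Total orders up to 4 give the cumulants of a cell; the sixth moment controls the Taylor
  remainder in \<theta>. That \<open>M 1 1\<close> vanishes is the orthogonality of the first two
  Charlier polynomials.\<close>

lemma charlier2_moment_at_1:
  fixes r :: "'a::idom"
  defines "M \<equiv> charlier2_moment r 1"
  shows "M 0 1 = 0"
    and "M 1 0 = 0"
    and "M 0 2 = r"
    and "M 1 1 = 0"
    and "M 2 0 = 2 * r ^ 2"
    and "M 0 3 = r"
    and "M 1 2 = 2 * r ^ 2"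
    and "M 2 1 = 4 * r ^ 2"
    and "M 3 0 = 8 * r ^ 3 + 4 * r ^ 2"
    and "M 0 4 = 3 * r ^ 2 + r"
    and "M 1 3 = 6 * r ^ 2"
    and "M 2 2 = 10 * r ^ 3 + 8 * r ^ 2"
    and "M 3 1 = 48 * r ^ 3 + 8 * r ^ 2"
    and "M 4 0 = 60 * r ^ 4 + 144 * r ^ 3 + 8 * r ^ 2"
    and "M 6 0 = 6040 * r ^ 6 + 77920 * r ^ 5 + 72400 * r ^ 4 + 7360 * r ^ 3 + 32 * r ^ 2"
proof -
  define T where "T = tilted_moment r 1"
  note T = tilted_moment_at_1[of r, folded T_def]
  have M0: "M 0 l = T l" for l by (simp add: M_def T_def)
  have MS: "M (j + 1) l = M j (l + 2) - M j (l + 1) - r * M j l" for j l by (simp add: M_def)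
  have M1: "M 1 l = T (l + 2) - T (l + 1) - r * T l" for l using MS[of 0] by (simp add: M0 del: One_nat_def add_2_eq_Suc add_2_eq_Suc')
  have M2: "M 2 l = (1) * T (l + 4) + (-2) * T (l + 3) + (-2 * r + 1) * T (l + 2) + (2 * r) * T (l + 1)
       + (r ^ 2) * T l" for l
    unfolding MS[of 1 l, simplified one_add_one numeral_plus_one add_num_simps] M1
    by (simp only: add.assoc arith_simps one_add_one one_plus_numeral numeral_plus_one) algebra
  have M3: "M 3 l = (1) * T (l + 6) + (-3) * T (l + 5) + (-3 * r + 3) * T (l + 4) + (6 * r + -1) * T (l + 3)
       + (3 * r ^ 2 + -3 * r) * T (l + 2) + (-3 * r ^ 2) * T (l + 1) + (-1 * r ^ 3) * T l" for l
    unfolding MS[of 2 l, simplified one_add_one numeral_plus_one add_num_simps] M2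
    by (simp only: add.assoc arith_simps one_add_one one_plus_numeral numeral_plus_one) algebra
  have M4: "M 4 l = (1) * T (l + 8) + (-4) * T (l + 7) + (-4 * r + 6) * T (l + 6) + (12 * r + -4) * T (l + 5)
       + (6 * r ^ 2 + -12 * r + 1) * T (l + 4) + (-12 * r ^ 2 + 4 * r) * T (l + 3) + (-4 * r ^ 3
       + 6 * r ^ 2) * T (l + 2) + (4 * r ^ 3) * T (l + 1) + (r ^ 4) * T l" for l
    unfolding MS[of 3 l, simplified one_add_one numeral_plus_one add_num_simps] M3
    by (simp only: add.assoc arith_simps one_add_one one_plus_numeral numeral_plus_one) algebra
  have M5: "M 5 l = (1) * T (l + 10) + (-5) * T (l + 9) + (-5 * r + 10) * T (l + 8) + (20 * r + -10) * T (l
       + 7) + (10 * r ^ 2 + -30 * r + 5) * T (l + 6) + (-30 * r ^ 2 + 20 * r + -1) * T (l + 5)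
       + (-10 * r ^ 3 + 30 * r ^ 2 + -5 * r) * T (l + 4) + (20 * r ^ 3 + -10 * r ^ 2) * T (l
       + 3) + (5 * r ^ 4 + -10 * r ^ 3) * T (l + 2) + (-5 * r ^ 4) * T (l + 1)
       + (-1 * r ^ 5) * T l" for l
    unfolding MS[of 4 l, simplified one_add_one numeral_plus_one add_num_simps] M4
    by (simp only: add.assoc arith_simps one_add_one one_plus_numeral numeral_plus_one) algebra
  have M6: "M 6 l = (1) * T (l + 12) + (-6) * T (l + 11) + (-6 * r + 15) * T (l + 10) + (30 * r + -20) * T (l
       + 9) + (15 * r ^ 2 + -60 * r + 15) * T (l + 8) + (-60 * r ^ 2 + 60 * r + -6) * T (l + 7)
       + (-20 * r ^ 3 + 90 * r ^ 2 + -30 * r + 1) * T (l + 6) + (60 * r ^ 3 + -60 * r ^ 2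
       + 6 * r) * T (l + 5) + (15 * r ^ 4 + -60 * r ^ 3 + 15 * r ^ 2) * T (l + 4) + (-30 * r ^ 4
       + 20 * r ^ 3) * T (l + 3) + (-6 * r ^ 5 + 15 * r ^ 4) * T (l + 2) + (6 * r ^ 5) * T (l
       + 1) + (r ^ 6) * T l" for l
    unfolding MS[of 5 l, simplified one_add_one numeral_plus_one add_num_simps] M5
    by (simp only: add.assoc arith_simps one_add_one one_plus_numeral numeral_plus_one) algebra
  have "M 0 1 = (1) * T 1"
    by (simp add: M0)
  thus "M 0 1 = 0"
    using T(1,2) by simp
  have "M 1 0 = (1) * T 2 + (-1) * T 1 + (-1 * r) * T 0"
    using M1[of 0] by (simp add: algebra_simps del: One_nat_def add_2_eq_Suc add_2_eq_Suc')
  thus "M 1 0 = 0"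
    unfolding T by algebra
  have "M 0 2 = (1) * T 2"
    by (simp add: M0)
  thus "M 0 2 = r"
    unfolding T by algebra
  have "M 1 1 = (1) * T 3 + (-1) * T 2 + (-1 * r) * T 1"
    using M1[of 1] by (simp add: algebra_simps del: One_nat_def add_2_eq_Suc add_2_eq_Suc')
  thus "M 1 1 = 0"
    unfolding T by algebra
  have "M 2 0 = (1) * T 4 + (-2) * T 3 + (-2 * r + 1) * T 2 + (2 * r) * T 1 + (r ^ 2) * T 0"
    using M2[of 0] by (simp add: algebra_simps del: One_nat_def add_2_eq_Suc add_2_eq_Suc')
  thus "M 2 0 = 2 * r ^ 2"
    unfolding T by algebra
  have "M 0 3 = (1) * T 3"
    by (simp add: M0)
  thus "M 0 3 = r"
    unfolding T by algebra
  have "M 1 2 = (1) * T 4 + (-1) * T 3 + (-1 * r) * T 2"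
    using M1[of 2] by (simp add: algebra_simps del: One_nat_def add_2_eq_Suc add_2_eq_Suc')
  thus "M 1 2 = 2 * r ^ 2"
    unfolding T by algebra
  have "M 2 1 = (1) * T 5 + (-2) * T 4 + (-2 * r + 1) * T 3 + (2 * r) * T 2 + (r ^ 2) * T 1"
    using M2[of 1] by (simp add: algebra_simps del: One_nat_def add_2_eq_Suc add_2_eq_Suc')
  thus "M 2 1 = 4 * r ^ 2"
    unfolding T by algebra
  have "M 3 0 = (1) * T 6 + (-3) * T 5 + (-3 * r + 3) * T 4 + (6 * r + -1) * T 3 + (3 * r ^ 2
       + -3 * r) * T 2 + (-3 * r ^ 2) * T 1 + (-1 * r ^ 3) * T 0"
    using M3[of 0] by (simp add: algebra_simps del: One_nat_def add_2_eq_Suc add_2_eq_Suc')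
  thus "M 3 0 = 8 * r ^ 3 + 4 * r ^ 2"
    unfolding T by algebra
  have "M 0 4 = (1) * T 4"
    by (simp add: M0)
  thus "M 0 4 = 3 * r ^ 2 + r"
    unfolding T by algebra
  have "M 1 3 = (1) * T 5 + (-1) * T 4 + (-1 * r) * T 3"
    using M1[of 3] by (simp add: algebra_simps del: One_nat_def add_2_eq_Suc add_2_eq_Suc')
  thus "M 1 3 = 6 * r ^ 2"
    unfolding T by algebra
  have "M 2 2 = (1) * T 6 + (-2) * T 5 + (-2 * r + 1) * T 4 + (2 * r) * T 3 + (r ^ 2) * T 2"
    using M2[of 2] by (simp add: algebra_simps del: One_nat_def add_2_eq_Suc add_2_eq_Suc')
  thus "M 2 2 = 10 * r ^ 3 + 8 * r ^ 2"
    unfolding T by algebra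
  have "M 3 1 = (1) * T 7 + (-3) * T 6 + (-3 * r + 3) * T 5 + (6 * r + -1) * T 4 + (3 * r ^ 2
       + -3 * r) * T 3 + (-3 * r ^ 2) * T 2 + (-1 * r ^ 3) * T 1"
    using M3[of 1] by (simp add: algebra_simps del: One_nat_def add_2_eq_Suc add_2_eq_Suc')
  thus "M 3 1 = 48 * r ^ 3 + 8 * r ^ 2"
    unfolding T by algebra
  have "M 4 0 = (1) * T 8 + (-4) * T 7 + (-4 * r + 6) * T 6 + (12 * r + -4) * T 5 + (6 * r ^ 2 + -12 * r
       + 1) * T 4 + (-12 * r ^ 2 + 4 * r) * T 3 + (-4 * r ^ 3 + 6 * r ^ 2) * T 2
       + (4 * r ^ 3) * T 1 + (r ^ 4) * T 0"
    using M4[of 0] by (simp add: algebra_simps del: One_nat_def add_2_eq_Suc add_2_eq_Suc')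
  thus "M 4 0 = 60 * r ^ 4 + 144 * r ^ 3 + 8 * r ^ 2"
    unfolding T by algebra
  have "M 6 0 = (1) * T 12 + (-6) * T 11 + (-6 * r + 15) * T 10 + (30 * r + -20) * T 9 + (15 * r ^ 2
       + -60 * r + 15) * T 8 + (-60 * r ^ 2 + 60 * r + -6) * T 7 + (-20 * r ^ 3 + 90 * r ^ 2
       + -30 * r + 1) * T 6 + (60 * r ^ 3 + -60 * r ^ 2 + 6 * r) * T 5 + (15 * r ^ 4
       + -60 * r ^ 3 + 15 * r ^ 2) * T 4 + (-30 * r ^ 4 + 20 * r ^ 3) * T 3 + (-6 * r ^ 5
       + 15 * r ^ 4) * T 2 + (6 * r ^ 5) * T 1 + (r ^ 6) * T 0"
    using M6[of 0] by (simp add: algebra_simps del: One_nat_def add_2_eq_Suc add_2_eq_Suc')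
  thus "M 6 0 = 6040 * r ^ 6 + 77920 * r ^ 5 + 72400 * r ^ 4 + 7360 * r ^ 3 + 32 * r ^ 2"
    unfolding T by algebra
qed

section \<open>The characteristic function of a cell\<close>

lemma norm_has_bochner_integral_le:
  fixes f :: "'a \<Rightarrow> 'b::{banach, second_countable_topology}"
  assumes "has_bochner_integral M f I" "has_bochner_integral M g J" "\<And>x. norm (f x) \<le> g x"
  shows "norm I \<le> (J :: real)"
proof -
  have "norm I \<le> (\<integral>x. norm (f x) \<partial>M)"
    using integral_norm_bound[of M f] has_bochner_integral_integral_eq[OF assms(1)] by blast
  also have "\<dots> \<le> integral\<^sup>L M g"
    using assms by (intro integral_mono) (auto simp: has_bochner_integral_iff)
  finally show ?thesis using assms(2) by (simp add: has_bochner_integral_iff)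
qed

text \<open>As introduction rules, together with the triangle inequality, this and the next two
  lemmas bound a polynomial expression by the same expression in bounds of its atoms.\<close>

lemma norm_mult_le:
  fixes a b :: "'a::real_normed_algebra"
  shows "norm a \<le> A \<Longrightarrow> norm b \<le> B \<Longrightarrow> norm (a * b) \<le> A * B"
  by (meson mult_mono norm_ge_zero norm_mult_ineq order_trans)

lemma norm_power_le:
  fixes a :: "'a::real_normed_div_algebra"
  shows "norm a \<le> A \<Longrightarrow> norm (a ^ n) \<le> A ^ n"
  by (simp add: norm_power power_mono)

lemma norm_divide_numeral_le:
  fixes a :: complex
  shows "norm a \<le> A \<Longrightarrow> norm (a / numeral w) \<le> A / numeral w"
  by (simp add: norm_divide divide_right_mono)

text \<open>Factor out exp y; the exponent 3 B is B from exp y plus 2 B from exp (x - y) -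
  1.\<close>

lemma norm_exp_diff_le:
  fixes x y :: complex
  assumes "norm x \<le> B" "norm y \<le> B"
  shows "norm (exp x - exp y) \<le> exp (3 * B) * norm (x - y)"
proof -
  have "norm (exp (x - y) - 1) \<le> exp \<bar>Re (x - y)\<bar> * norm (x - y)"
    using Taylor_exp[of "x - y" 0] by simp
  moreover have "\<bar>Re (x - y)\<bar> \<le> 2 * B"
    using abs_Re_le_cmod[of "x - y"] norm_triangle_ineq4[of x y] assms by linarith
  ultimately have 1: "norm (exp (x - y) - 1) \<le> exp (2 * B) * norm (x - y)"
    by (smt (verit) exp_le_cancel_iff mult_right_mono norm_ge_zero)
  have 2: "norm (exp y) \<le> exp B"
    using assms(2) complex_Re_le_cmod[of y] by simp
  have "exp x - exp y = exp y * (exp (x - y) - 1)"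
    by (simp add: exp_diff algebra_simps)
  hence "norm (exp x - exp y) \<le> exp B * (exp (2 * B) * norm (x - y))"
    using norm_mult_le[OF 2 1] by simp
  also have "\<dots> = exp (3 * B) * norm (x - y)"
    by (simp add: mult_exp_exp[symmetric] mult.assoc[symmetric] exp_add[symmetric])
  finally show ?thesis .
qed

text \<open>The arguments are graded by their degrees 1, ..., 4 in h, and the exponential is
  truncated at total degree 4. The bound retains one factor E besides h^5: E will measure how small
  the cell is, and a bare h^5 would lose powers of \<lambda> when summed over the cells.\<close>

lemma exp_graded_truncation:
  fixes z1 z2 z3 z4 :: complex
  assumes z: "norm z1 \<le> E * h" "norm z2 \<le> E * h\<^sup>2" "norm z3 \<le> E * h ^ 3" "norm z4 \<le> E * h ^ 4"
    and h: "0 \<le> h" "h \<le> 1" and E: "0 \<le> E" "E \<le> A"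
  shows "norm (exp (z1 + z2 + z3 + z4) - (1 + z1 + (z2 + z1\<^sup>2 / 2) + (z3 + z1 * z2 + z1 ^ 3 / 6)
          + (z4 + z1 * z3 + z2\<^sup>2 / 2 + z1\<^sup>2 * z2 / 2 + z1 ^ 4 / 24)))
       \<le> (5 * A + 10 * A\<^sup>2 + 11 * A ^ 3 + 43 * A ^ 4 * exp (4 * A)) * (E * h ^ 5)"
proof -
  define u where "u = z2 + z3 + z4"
  define z where "z = z1 + u"
  have hp: "h ^ (i + j) \<le> h ^ i" for i j
    using h by (simp add: power_add mult_left_le power_le_one)
  have Eh: "E * h ^ 3 \<le> E * h\<^sup>2" "E * h ^ 4 \<le> E * h\<^sup>2" "E * h\<^sup>2 \<le> E * h" "E * h ^ 4 \<le> E * h ^ 3"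
    using hp[of 2 1] hp[of 2 2] hp[of 1 1] hp[of 3 1] E
    by (auto intro!: mult_left_mono simp: power2_eq_square[symmetric])
  have u: "norm u \<le> 3 * (E * h\<^sup>2)"
    unfolding u_def using norm_triangle_ineq[of "z2 + z3" z4] norm_triangle_ineq[of z2 z3] z Eh by linarith
  have z3z4: "norm (z3 + z4) \<le> 2 * (E * h ^ 3)"
    using norm_triangle_ineq[of z3 z4] z Eh by linarith
  have nz: "norm z \<le> 4 * (E * h)"
    unfolding z_def using norm_triangle_ineq[of z1 u] z u Eh by linarith
  have zz1: "norm (z + z1) \<le> 5 * (E * h)"
    using norm_triangle_ineq[of z z1] z nz by linarith
  have "norm (exp z - (\<Sum>k\<le>4. z ^ k / fact k)) \<le> exp \<bar>Re z\<bar> * norm z ^ Suc 4 / fact 4"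
    by (rule Taylor_exp)
  also have "\<dots> \<le> exp (4 * A) * (4 * (E * h)) ^ Suc 4 / fact 4"
  proof -
    have "E * h \<le> A * 1" using E h by (intro mult_mono) auto
    hence "\<bar>Re z\<bar> \<le> 4 * A" using abs_Re_le_cmod[of z] nz by linarith
    thus ?thesis using nz by (intro divide_right_mono mult_mono power_mono) auto
  qed
  finally have T: "norm (exp z - (\<Sum>k\<le>4. z ^ k / fact k)) \<le> exp (4 * A) * (4 * (E * h)) ^ Suc 4 / fact 4" .
  have a2: "norm (2 * z1 * z4 + 2 * (z2 * (z3 + z4)) + (z3 + z4)\<^sup>2)
     \<le> 2 * (E * h) * (E * h ^ 4) + 2 * (E * h\<^sup>2 * (2 * (E * h ^ 3))) + (2 * (E * h ^ 3))\<^sup>2"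
    by (intro order_trans[OF norm_triangle_ineq] add_mono norm_mult_le norm_power_le z z3z4) auto
  have a3: "norm (3 * z1\<^sup>2 * (z3 + z4) + 3 * z1 * u\<^sup>2 + u ^ 3)
     \<le> 3 * (E * h)\<^sup>2 * (2 * (E * h ^ 3)) + 3 * (E * h) * (3 * (E * h\<^sup>2))\<^sup>2 + (3 * (E * h\<^sup>2)) ^ 3"
    by (intro order_trans[OF norm_triangle_ineq] add_mono norm_mult_le norm_power_le z z3z4 u) auto
  have a4: "norm (u * (z + z1) * (z\<^sup>2 + z1\<^sup>2))
     \<le> 3 * (E * h\<^sup>2) * (5 * (E * h)) * ((4 * (E * h))\<^sup>2 + (E * h)\<^sup>2)"
    by (intro norm_mult_le order_trans[OF norm_triangle_ineq] add_mono norm_power_le z u nz zz1)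
  have S: "(\<Sum>k\<le>4. z ^ k / fact k) = 1 + z + z\<^sup>2 / 2 + z ^ 3 / 6 + z ^ 4 / 24"
    by (simp add: eval_nat_numeral)
  \<comment> \<open>In each of the three identities the last summand collects the products of degree
    at least 5; the others are exactly the terms kept in the truncation.\<close>
  have e2: "z\<^sup>2 = z1\<^sup>2 + 2 * z1 * z2 + 2 * z1 * z3 + z2\<^sup>2 + (2 * z1 * z4 + 2 * (z2 * (z3 + z4)) + (z3 + z4)\<^sup>2)"
    unfolding z_def u_def by algebra
  have e3: "z ^ 3 = z1 ^ 3 + 3 * z1\<^sup>2 * z2 + (3 * z1\<^sup>2 * (z3 + z4) + 3 * z1 * u\<^sup>2 + u ^ 3)"
    unfolding z_def u_def by algebra
  have e4: "z ^ 4 = z1 ^ 4 + u * (z + z1) * (z\<^sup>2 + z1\<^sup>2)"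
    unfolding z_def by algebra
  define R where "R = (2 * z1 * z4 + 2 * (z2 * (z3 + z4)) + (z3 + z4)\<^sup>2) / 2
      + (3 * z1\<^sup>2 * (z3 + z4) + 3 * z1 * u\<^sup>2 + u ^ 3) / 6 + u * (z + z1) * (z\<^sup>2 + z1\<^sup>2) / 24"
  have "exp (z1 + z2 + z3 + z4) - (1 + z1 + (z2 + z1\<^sup>2 / 2) + (z3 + z1 * z2 + z1 ^ 3 / 6)
          + (z4 + z1 * z3 + z2\<^sup>2 / 2 + z1\<^sup>2 * z2 / 2 + z1 ^ 4 / 24))
      = (exp z - (\<Sum>k\<le>4. z ^ k / fact k)) + R"
    unfolding S e2 e3 e4 R_def by (simp add: z_def u_def add_divide_distrib algebra_simps)
  hence "norm (exp (z1 + z2 + z3 + z4) - (1 + z1 + (z2 + z1\<^sup>2 / 2) + (z3 + z1 * z2 + z1 ^ 3 / 6)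
          + (z4 + z1 * z3 + z2\<^sup>2 / 2 + z1\<^sup>2 * z2 / 2 + z1 ^ 4 / 24)))
      \<le> norm (exp z - (\<Sum>k\<le>4. z ^ k / fact k)) + norm R"
    by (metis norm_triangle_ineq)
  also have "norm R \<le> (2 * (E * h) * (E * h ^ 4) + 2 * (E * h\<^sup>2 * (2 * (E * h ^ 3))) + (2 * (E * h ^ 3))\<^sup>2) / 2
     + (3 * (E * h)\<^sup>2 * (2 * (E * h ^ 3)) + 3 * (E * h) * (3 * (E * h\<^sup>2))\<^sup>2 + (3 * (E * h\<^sup>2)) ^ 3) / 6
     + 3 * (E * h\<^sup>2) * (5 * (E * h)) * ((4 * (E * h))\<^sup>2 + (E * h)\<^sup>2) / 24"
    unfolding R_def
    by (intro order_trans[OF norm_triangle_ineq] add_mono norm_divide_numeral_le a2 a3 a4)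
  also have "\<dots> = 5 * (E * E * h ^ 5) - h ^ 5 * (1 - h) * (2 * E * E)
     + (E ^ 3 * h ^ 5) + (9 / 2) * (E ^ 3 * h ^ 5) + (9 / 2) * (E ^ 3 * h ^ 6) + (255 / 24) * (E ^ 4 * h ^ 5)"
    by (simp add: field_simps eval_nat_numeral)
  also have "\<dots> \<le> 5 * (E * E * h ^ 5) + 10 * (E ^ 3 * h ^ 5) + 11 * (E ^ 4 * h ^ 5)"
  proof -
    have "h ^ 5 * (1 - h) * (2 * E * E) \<ge> 0" using h E by simp
    moreover have "E ^ 3 * h ^ 6 \<le> E ^ 3 * h ^ 5" using hp[of 5 1] E by (simp add: mult_left_mono)
    moreover have "E ^ 4 * h ^ 5 \<ge> 0" using h E by simp
    ultimately show ?thesis by linarith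
  qed
  also have "norm (exp z - (\<Sum>k\<le>4. z ^ k / fact k)) \<le> 43 * exp (4 * A) * (E ^ 5 * h ^ 5)"
  proof -
    have "exp (4 * A) * (4 * (E * h)) ^ Suc 4 / fact 4 = (1024 / 24) * exp (4 * A) * (E ^ 5 * h ^ 5)"
      by (simp add: power_mult_distrib fact_numeral)
    also have "\<dots> \<le> 43 * exp (4 * A) * (E ^ 5 * h ^ 5)"
      using h E by (intro mult_right_mono) auto
    finally show ?thesis using T by linarith
  qed
  finally have "norm (exp (z1 + z2 + z3 + z4) - (1 + z1 + (z2 + z1\<^sup>2 / 2) + (z3 + z1 * z2 + z1 ^ 3 / 6)
          + (z4 + z1 * z3 + z2\<^sup>2 / 2 + z1\<^sup>2 * z2 / 2 + z1 ^ 4 / 24)))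
     \<le> (5 * E + 10 * E\<^sup>2 + 11 * E ^ 3 + 43 * E ^ 4 * exp (4 * A)) * (E * h ^ 5)"
    by (simp add: algebra_simps eval_nat_numeral)
  also have "\<dots> \<le> (5 * A + 10 * A\<^sup>2 + 11 * A ^ 3 + 43 * A ^ 4 * exp (4 * A)) * (E * h ^ 5)"
    using E h by (intro mult_right_mono add_mono mult_left_mono power_mono) auto
  finally show ?thesis .
qed

section \<open>Taylor expansion of a cell in the first frequency\<close>

definition cell_cf :: "real \<Rightarrow> real \<Rightarrow> real \<Rightarrow> complex" where
  "cell_cf r \<theta> \<omega> = (CLINT k | poisson_pmf r. iexp (\<theta> * charlier2 r k + \<omega> * (real k - r)))"

lemma integrable_iexp_pmf: "complex_integrable (measure_pmf M) (\<lambda>k. iexp (f k))"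
  by (rule measure_pmf.integrable_const_bound[where B = 1]) auto

lemma charlier2_even_moments:
  assumes "r > 0"
  shows "has_bochner_integral (poisson_pmf r) (\<lambda>k. charlier2 r k ^ 2) (2 * r\<^sup>2)"
    and "has_bochner_integral (poisson_pmf r) (\<lambda>k. charlier2 r k ^ 4) (60 * r ^ 4 + 144 * r ^ 3 + 8 * r\<^sup>2)"
    and "has_bochner_integral (poisson_pmf r) (\<lambda>k. charlier2 r k ^ 6)
      (6040 * r ^ 6 + 77920 * r ^ 5 + 72400 * r ^ 4 + 7360 * r ^ 3 + 32 * r ^ 2)"
proof -
  note m = charlier2_real_moment[OF assms, of _ 0]
  have *: "6040 * complex_of_real r ^ 6 + 77920 * of_real r ^ 5 + 72400 * of_real r ^ 4 + 7360 * of_real r ^ 3 + 32 * of_real r ^ 2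
     = of_real (6040 * r ^ 6 + 77920 * r ^ 5 + 72400 * r ^ 4 + 7360 * r ^ 3 + 32 * r ^ 2)"
     "60 * complex_of_real r ^ 4 + 144 * of_real r ^ 3 + 8 * of_real r ^ 2
     = of_real (60 * r ^ 4 + 144 * r ^ 3 + 8 * r ^ 2)"
     "2 * complex_of_real r ^ 2 = of_real (2 * r ^ 2)"
    by simp_all
  show "has_bochner_integral (poisson_pmf r) (\<lambda>k. charlier2 r k ^ 2) (2 * r\<^sup>2)"
    using m[of 2] unfolding charlier2_moment_at_1 * by simp
  show "has_bochner_integral (poisson_pmf r) (\<lambda>k. charlier2 r k ^ 4) (60 * r ^ 4 + 144 * r ^ 3 + 8 * r\<^sup>2)"
    using m[of 4] unfolding charlier2_moment_at_1 * by simp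
  show "has_bochner_integral (poisson_pmf r) (\<lambda>k. charlier2 r k ^ 6)
      (6040 * r ^ 6 + 77920 * r ^ 5 + 72400 * r ^ 4 + 7360 * r ^ 3 + 32 * r ^ 2)"
    using m[of 6] unfolding charlier2_moment_at_1 * by simp
qed

text \<open>Bounds a polynomial in r of lowest degree 2 uniformly: for small r the lowest power
  governs, for large r the highest, and r^2 max(1, r)^(j - 2) covers both.\<close>

lemma power_le_max_one:
  fixes r :: real
  assumes "r > 0" "2 \<le> i" "i \<le> j"
  shows "r ^ i \<le> r\<^sup>2 * max 1 r ^ (j - 2)"
proof -
  have "r ^ i = r\<^sup>2 * r ^ (i - 2)" using assms(2) by (metis le_add_diff_inverse power_add)
  also have "\<dots> \<le> r\<^sup>2 * max 1 r ^ (j - 2)"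
  proof (rule mult_left_mono)
    have "r ^ (i - 2) \<le> max 1 r ^ (i - 2)" using assms by (intro power_mono) auto
    also have "\<dots> \<le> max 1 r ^ (j - 2)" using assms by (intro power_increasing) auto
    finally show "r ^ (i - 2) \<le> max 1 r ^ (j - 2)" .
  qed simp
  finally show ?thesis .
qed

text \<open>Taylor's formula in \<theta> alone, the factor exp(i \<omega> (\<xi> - r)) being carried
  along exactly. It produces the tilted moments in the main terms; in the remainder it has modulus
  1, so ordinary absolute moments suffice there.\<close>

lemma cell_cf_theta_expansion:
  assumes r: "r > 0" and h: "max 1 r * \<bar>\<theta>\<bar> \<le> 1"
  shows "norm (cell_cf r \<theta> \<omega> - centered_poisson_cf r \<omega> *
           (\<Sum>j\<le>4. (\<i> * of_real \<theta>) ^ j / fact j * charlier2_moment (of_real r) (iexp \<omega>) j 0))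
      \<le> 700 * (r\<^sup>2 * \<theta>\<^sup>2 * (max 1 r * \<bar>\<theta>\<bar>) ^ 3)"
proof -
  define M where "M = max 1 r"
  have M: "M \<ge> 1" "r \<le> M" by (auto simp: M_def)
  let ?C = "charlier2 r" and ?e = "\<lambda>k. iexp (\<omega> * (real k - r))"
  let ?P = "measure_pmf (poisson_pmf r)"
  have S: "has_bochner_integral ?P
      (\<lambda>k. \<Sum>j\<le>4. (\<i> * of_real \<theta>) ^ j / fact j * (of_real (?C k ^ j * (real k - r) ^ 0) * ?e k))
      (\<Sum>j\<le>4. (\<i> * of_real \<theta>) ^ j / fact j * (centered_poisson_cf r \<omega> * charlier2_moment (of_real r) (iexp \<omega>) j 0))"
    by (intro has_bochner_integral_sum has_bochner_integral_mult_right charlier2_moment r)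
  have X: "has_bochner_integral ?P (\<lambda>k. iexp (\<theta> * ?C k + \<omega> * (real k - r))) (cell_cf r \<theta> \<omega>)"
    unfolding cell_cf_def by (intro has_bochner_integral_integrable integrable_iexp_pmf)
  let ?g = "\<lambda>k. iexp (\<theta> * ?C k + \<omega> * (real k - r))
     - (\<Sum>j\<le>4. (\<i> * of_real \<theta>) ^ j / fact j * (of_real (?C k ^ j * (real k - r) ^ 0) * ?e k))"
  note D = has_bochner_integral_diff[OF X S]
  have g: "norm (?g k) \<le> \<bar>\<theta>\<bar> ^ 5 / 240 * (M * ?C k ^ 4 + ?C k ^ 6 / M)" for k
  proof -
    have "?g k = ?e k * (iexp (\<theta> * ?C k) - (\<Sum>j\<le>4. (\<i> * of_real (\<theta> * ?C k)) ^ j / fact j))"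
      by (simp add: right_diff_distrib sum_distrib_left exp_add distrib_left power_mult_distrib mult_ac)
    hence "norm (?g k) = norm (iexp (\<theta> * ?C k) - (\<Sum>j\<le>4. (\<i> * of_real (\<theta> * ?C k)) ^ j / fact j))"
      by (simp add: norm_mult del: of_real_mult)
    also have "\<dots> \<le> \<bar>\<theta> * ?C k\<bar> ^ Suc 4 / fact (Suc 4)"
      by (rule iexp_approx1)
    also have "\<dots> = \<bar>\<theta>\<bar> ^ 5 / 120 * \<bar>?C k\<bar> ^ 5"
      by (simp add: abs_mult power_mult_distrib fact_numeral)
    finally have 1: "norm (?g k) \<le> \<bar>\<theta>\<bar> ^ 5 / 120 * \<bar>?C k\<bar> ^ 5" .
    \<comment> \<open>The fifth absolute power is traded for the fourth and the sixth by the
      arithmetic-geometric mean inequality; the weight M balances their orders in r.\<close>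
    have "\<bar>?C k\<bar> ^ 5 \<le> (M * ?C k ^ 4 + ?C k ^ 6 / M) / 2"
    proof -
      have "0 \<le> \<bar>?C k\<bar> ^ 4 * (M - \<bar>?C k\<bar>)\<^sup>2" by simp
      also have "\<dots> = M\<^sup>2 * ?C k ^ 4 + ?C k ^ 6 - 2 * M * \<bar>?C k\<bar> ^ 5"
        by (simp add: power2_eq_square algebra_simps eval_nat_numeral abs_mult_self_eq)
      finally show ?thesis using M by (simp add: field_simps power2_eq_square)
    qed
    hence "\<bar>\<theta>\<bar> ^ 5 / 120 * \<bar>?C k\<bar> ^ 5 \<le> \<bar>\<theta>\<bar> ^ 5 / 120 * ((M * ?C k ^ 4 + ?C k ^ 6 / M) / 2)"
      by (rule mult_left_mono) simp
    with 1 show ?thesis by (simp only: times_divide_eq_left times_divide_eq_right divide_divide_eq_left mult.assoc)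
  qed
  have B: "has_bochner_integral ?P (\<lambda>k. \<bar>\<theta>\<bar> ^ 5 / 240 * (M * ?C k ^ 4 + ?C k ^ 6 / M))
     (\<bar>\<theta>\<bar> ^ 5 / 240 * (M * (60 * r ^ 4 + 144 * r ^ 3 + 8 * r\<^sup>2) +
        (6040 * r ^ 6 + 77920 * r ^ 5 + 72400 * r ^ 4 + 7360 * r ^ 3 + 32 * r ^ 2) / M))"
    by (intro has_bochner_integral_mult_right has_bochner_integral_add has_bochner_integral_divide
        charlier2_even_moments r)
  have "norm (cell_cf r \<theta> \<omega> - (\<Sum>j\<le>4. (\<i> * of_real \<theta>) ^ j / fact j * (centered_poisson_cf r \<omega> * charlier2_moment (of_real r) (iexp \<omega>) j 0)))
     \<le> \<bar>\<theta>\<bar> ^ 5 / 240 * (M * (60 * r ^ 4 + 144 * r ^ 3 + 8 * r\<^sup>2) +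
        (6040 * r ^ 6 + 77920 * r ^ 5 + 72400 * r ^ 4 + 7360 * r ^ 3 + 32 * r ^ 2) / M)"
    by (rule norm_has_bochner_integral_le[OF D B g])
  \<comment> \<open>212 and 163752 are the coefficient sums of the two moment polynomials.\<close>
  also have "\<dots> \<le> \<bar>\<theta>\<bar> ^ 5 / 240 * (M * (212 * (r\<^sup>2 * M\<^sup>2)) + (163752 * (r\<^sup>2 * M ^ 4)) / M)"
  proof -
    note p = power_le_max_one[OF r, folded M_def]
    have "60 * r ^ 4 + 144 * r ^ 3 + 8 * r\<^sup>2 \<le> 212 * (r\<^sup>2 * M\<^sup>2)"
      using p[of 4 4] p[of 3 4] p[of 2 4] by simp
    moreover have "6040 * r ^ 6 + 77920 * r ^ 5 + 72400 * r ^ 4 + 7360 * r ^ 3 + 32 * r ^ 2 \<le> 163752 * (r\<^sup>2 * M ^ 4)"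
      using p[of 6 6] p[of 5 6] p[of 4 6] p[of 3 6] p[of 2 6] by simp
    ultimately show ?thesis using M
      by (intro mult_left_mono add_mono divide_right_mono) auto
  qed
  also have "\<dots> = 163964 / 240 * (r\<^sup>2 * \<theta>\<^sup>2 * (M * \<bar>\<theta>\<bar>) ^ 3)"
    using M by (simp add: field_simps eval_nat_numeral abs_mult_self_eq)
  also have "\<dots> \<le> 700 * (r\<^sup>2 * \<theta>\<^sup>2 * (M * \<bar>\<theta>\<bar>) ^ 3)"
    using M by (intro mult_right_mono) auto
  finally show ?thesis
    by (simp add: M_def sum_distrib_left mult_ac)
qed

text \<open>There is no mixed term because \<open>charlier2\<close> and \<xi> - r are uncorrelated;
  their variances are 2 r^2 and r.\<close>

definition cell_var :: "real \<Rightarrow> real \<Rightarrow> real \<Rightarrow> real" where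
  "cell_var r \<theta> \<omega> = 2 * r\<^sup>2 * \<theta>\<^sup>2 + r * \<omega>\<^sup>2"

definition cell_cumulant3 :: "real \<Rightarrow> real \<Rightarrow> real \<Rightarrow> real" where
  "cell_cumulant3 r \<theta> \<omega> = (8 * r ^ 3 + 4 * r\<^sup>2) * \<theta> ^ 3 + 12 * r\<^sup>2 * \<theta>\<^sup>2 * \<omega> + 6 * r\<^sup>2 * \<theta> * \<omega>\<^sup>2 + r * \<omega> ^ 3"

definition cell_cumulant4 :: "real \<Rightarrow> real \<Rightarrow> real \<Rightarrow> real" where
  "cell_cumulant4 r \<theta> \<omega> = (48 * r ^ 4 + 144 * r ^ 3 + 8 * r\<^sup>2) * \<theta> ^ 4
     + (192 * r ^ 3 + 32 * r\<^sup>2) * \<theta> ^ 3 * \<omega> + (48 * r ^ 3 + 48 * r\<^sup>2) * \<theta>\<^sup>2 * \<omega>\<^sup>2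
     + 24 * r\<^sup>2 * \<theta> * \<omega> ^ 3 + r * \<omega> ^ 4"

text \<open>The logarithm of \<open>cell_cf\<close> truncated after the fourth cumulant; the signs
  are the powers of the imaginary unit.\<close>

definition cell_exponent :: "real \<Rightarrow> real \<Rightarrow> real \<Rightarrow> complex" where
  "cell_exponent r \<theta> \<omega> = - of_real (cell_var r \<theta> \<omega>) / 2 - \<i> * of_real (cell_cumulant3 r \<theta> \<omega>) / 6
     + of_real (cell_cumulant4 r \<theta> \<omega>) / 24"

text \<open>Binomial expansion into mixed moments. As the mean is 0, the fourth moment is the fourth
  cumulant plus three times the squared variance.\<close>

lemma cell_moments:
  assumes r: "r > 0"
  defines "Y \<equiv> \<lambda>\<theta> \<omega> k. \<theta> * charlier2 r k + \<omega> * (real k - r)"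
  shows "has_bochner_integral (poisson_pmf r) (Y \<theta> \<omega>) 0"
    and "has_bochner_integral (poisson_pmf r) (\<lambda>k. Y \<theta> \<omega> k ^ 2) (cell_var r \<theta> \<omega>)"
    and "has_bochner_integral (poisson_pmf r) (\<lambda>k. Y \<theta> \<omega> k ^ 3) (cell_cumulant3 r \<theta> \<omega>)"
    and "has_bochner_integral (poisson_pmf r) (\<lambda>k. Y \<theta> \<omega> k ^ 4)
           (cell_cumulant4 r \<theta> \<omega> + 3 * (cell_var r \<theta> \<omega>)\<^sup>2)"
proof -
  define q where "q = (\<lambda>j l. Re (charlier2_moment (of_real r) 1 j l))"
  have q: "q 1 0 = 0" "q 0 1 = 0" "q 0 2 = r" "q 1 1 = 0" "q 2 0 = 2 * r ^ 2" "q 0 3 = r"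
    "q 1 2 = 2 * r ^ 2" "q 2 1 = 4 * r ^ 2" "q 3 0 = 8 * r ^ 3 + 4 * r ^ 2" "q 0 4 = 3 * r ^ 2 + r"
    "q 1 3 = 6 * r ^ 2" "q 2 2 = 10 * r ^ 3 + 8 * r ^ 2" "q 3 1 = 48 * r ^ 3 + 8 * r ^ 2"
    "q 4 0 = 60 * r ^ 4 + 144 * r ^ 3 + 8 * r ^ 2"
    unfolding q_def charlier2_moment_at_1 by (simp_all flip: of_real_power)
  have m: "has_bochner_integral (poisson_pmf r) (\<lambda>k. charlier2 r k ^ j * (real k - r) ^ l) (q j l)" for j l
    unfolding q_def by (rule charlier2_real_moment[OF r])
  have "has_bochner_integral (poisson_pmf r)
      (\<lambda>k. \<Sum>j\<le>n. (of_nat (n choose j) * \<theta> ^ j * \<omega> ^ (n - j)) * (charlier2 r k ^ j * (real k - r) ^ (n - j)))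
      (\<Sum>j\<le>n. (of_nat (n choose j) * \<theta> ^ j * \<omega> ^ (n - j)) * q j (n - j))" for n
    by (intro has_bochner_integral_sum has_bochner_integral_mult_right m)
  moreover have "(\<Sum>j\<le>n. (of_nat (n choose j) * \<theta> ^ j * \<omega> ^ (n - j)) * (charlier2 r k ^ j * (real k - r) ^ (n - j)))
      = Y \<theta> \<omega> k ^ n" for n k
    unfolding Y_def binomial_ring by (intro sum.cong refl) (simp add: power_mult_distrib mult_ac)
  ultimately have Y: "has_bochner_integral (poisson_pmf r) (\<lambda>k. Y \<theta> \<omega> k ^ n)
      (\<Sum>j\<le>n. (of_nat (n choose j) * \<theta> ^ j * \<omega> ^ (n - j)) * q j (n - j))" for n
    by simp
  show "has_bochner_integral (poisson_pmf r) (Y \<theta> \<omega>) 0"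
    using Y[of 1] q by simp
  have "(\<Sum>j\<le>2. (of_nat (2 choose j) * \<theta> ^ j * \<omega> ^ (2 - j)) * q j (2 - j))
     = \<omega> ^ 2 * q 0 2 + 2 * \<theta> * \<omega> * q 1 1 + \<theta> ^ 2 * q 2 0" by (simp add: eval_nat_numeral)
  also have "\<dots> = cell_var r \<theta> \<omega>" unfolding q cell_var_def by algebra
  finally show "has_bochner_integral (poisson_pmf r) (\<lambda>k. Y \<theta> \<omega> k ^ 2) (cell_var r \<theta> \<omega>)"
    using Y[of 2] by simp
  have "(\<Sum>j\<le>3. (of_nat (3 choose j) * \<theta> ^ j * \<omega> ^ (3 - j)) * q j (3 - j))
     = \<omega> ^ 3 * q 0 3 + 3 * \<theta> * \<omega> ^ 2 * q 1 2 + 3 * \<theta> ^ 2 * \<omega> * q 2 1 + \<theta> ^ 3 * q 3 0"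
    by (simp add: eval_nat_numeral)
  also have "\<dots> = cell_cumulant3 r \<theta> \<omega>" unfolding q cell_cumulant3_def by algebra
  finally show "has_bochner_integral (poisson_pmf r) (\<lambda>k. Y \<theta> \<omega> k ^ 3) (cell_cumulant3 r \<theta> \<omega>)"
    using Y[of 3] by simp
  have "(\<Sum>j\<le>4. (of_nat (4 choose j) * \<theta> ^ j * \<omega> ^ (4 - j)) * q j (4 - j))
     = \<omega> ^ 4 * q 0 4 + 4 * \<theta> * \<omega> ^ 3 * q 1 3 + 6 * \<theta> ^ 2 * \<omega> ^ 2 * q 2 2 + 4 * \<theta> ^ 3 * \<omega> * q 3 1 + \<theta> ^ 4 * q 4 0"
    by (simp add: eval_nat_numeral)
  also have "\<dots> = cell_cumulant4 r \<theta> \<omega> + 3 * (cell_var r \<theta> \<omega>)\<^sup>2"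
    unfolding q cell_cumulant4_def cell_var_def by algebra
  finally show "has_bochner_integral (poisson_pmf r) (\<lambda>k. Y \<theta> \<omega> k ^ 4)
           (cell_cumulant4 r \<theta> \<omega> + 3 * (cell_var r \<theta> \<omega>)\<^sup>2)"
    using Y[of 4] by simp
qed

text \<open>Each monomial contains r^2 \<theta>^2 or r \<omega>^2, which the variance dominates, and
  its remaining factors are \<theta>, r \<theta> or \<omega>, all at most s in absolute value. This
  is the reason for measuring a cell by max(1, r) |\<theta>| + |\<omega>|.\<close>

lemma cell_cumulant_bounds:
  fixes r \<theta> \<omega> :: real
  assumes r: "r > 0"
  defines "s \<equiv> max 1 r * \<bar>\<theta>\<bar> + \<bar>\<omega>\<bar>"
  shows "\<bar>cell_cumulant3 r \<theta> \<omega>\<bar> \<le> 100 * (cell_var r \<theta> \<omega> * s)"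
    and "\<bar>cell_cumulant4 r \<theta> \<omega>\<bar> \<le> 1000 * (cell_var r \<theta> \<omega> * s\<^sup>2)"
proof -
  define x y h where "x = \<bar>\<theta>\<bar>" and "y = \<bar>\<omega>\<bar>" and "h = max 1 r * x"
  have xy: "x \<ge> 0" "y \<ge> 0" and xh: "x \<le> h" "r * x \<le> h"
    using r by (auto simp: x_def y_def h_def intro!: mult_right_mono simp: mult_le_cancel_right1)
  define v where "v = 2 * r\<^sup>2 * x\<^sup>2 + r * y\<^sup>2"
  have v: "cell_var r \<theta> \<omega> = v" by (simp add: v_def cell_var_def x_def y_def)
  have s: "s = h + y" by (simp add: s_def h_def x_def y_def)
  have h: "h \<ge> 0" using xh xy by linarith
  have a: "r\<^sup>2 * x\<^sup>2 \<le> v" "r * y\<^sup>2 \<le> v" and v0: "v \<ge> 0" using r by (auto simp: v_def)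
  have hs: "h \<le> s" "y \<le> s" "x \<le> s" "r * x \<le> s" and s0: "s \<ge> 0" using xh xy h by (auto simp: s)
  have b: "A * B \<le> v * s" if "A \<le> v" "B \<le> s" "B \<ge> 0" for A B
    using that v0 by (intro mult_mono) auto
  have c: "A * (B * B') \<le> v * s\<^sup>2" if "A \<le> v" "B \<le> s" "B \<ge> 0" "B' \<le> s" "B' \<ge> 0" for A B B'
    using that v0 s0 unfolding power2_eq_square by (intro mult_mono) auto
  have rx: "r * x \<ge> 0" using r xy by simp
  have "\<bar>cell_cumulant3 r \<theta> \<omega>\<bar> \<le> (8 * r ^ 3 + 4 * r\<^sup>2) * x ^ 3 + 12 * r\<^sup>2 * x\<^sup>2 * y + 6 * r\<^sup>2 * x * y\<^sup>2 + r * y ^ 3"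
    unfolding cell_cumulant3_def x_def y_def using r
    by (intro order_trans[OF abs_triangle_ineq] add_mono) (auto simp: abs_mult power_abs)
  also have "\<dots> = 8 * ((r\<^sup>2 * x\<^sup>2) * (r * x)) + 4 * ((r\<^sup>2 * x\<^sup>2) * x) + 12 * ((r\<^sup>2 * x\<^sup>2) * y)
      + 6 * ((r * y\<^sup>2) * (r * x)) + (r * y\<^sup>2) * y"
    by (simp add: power2_eq_square power3_eq_cube algebra_simps)
  also have "\<dots> \<le> 100 * (v * s)"
    using b[OF a(1) hs(4) rx] b[OF a(1) hs(3) xy(1)] b[OF a(1) hs(2) xy(2)] b[OF a(2) hs(4) rx]
      b[OF a(2) hs(2) xy(2)] mult_nonneg_nonneg[OF v0 s0] by linarith
  finally show "\<bar>cell_cumulant3 r \<theta> \<omega>\<bar> \<le> 100 * (cell_var r \<theta> \<omega> * s)" unfolding v .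
  have "\<bar>cell_cumulant4 r \<theta> \<omega>\<bar> \<le> (48 * r ^ 4 + 144 * r ^ 3 + 8 * r\<^sup>2) * x ^ 4
     + (192 * r ^ 3 + 32 * r\<^sup>2) * x ^ 3 * y + (48 * r ^ 3 + 48 * r\<^sup>2) * x\<^sup>2 * y\<^sup>2
     + 24 * r\<^sup>2 * x * y ^ 3 + r * y ^ 4"
    unfolding cell_cumulant4_def x_def y_def using r
    by (intro order_trans[OF abs_triangle_ineq] add_mono) (auto simp: abs_mult power_abs)
  also have "\<dots> = 48 * ((r\<^sup>2 * x\<^sup>2) * ((r * x) * (r * x))) + 144 * ((r\<^sup>2 * x\<^sup>2) * ((r * x) * x)) + 8 * ((r\<^sup>2 * x\<^sup>2) * (x * x))
      + 192 * ((r\<^sup>2 * x\<^sup>2) * ((r * x) * y)) + 32 * ((r\<^sup>2 * x\<^sup>2) * (x * y))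
      + 48 * ((r * y\<^sup>2) * ((r * x) * (r * x))) + 48 * ((r\<^sup>2 * x\<^sup>2) * (y * y)) + 24 * ((r * y\<^sup>2) * ((r * x) * y)) + (r * y\<^sup>2) * (y * y)"
    by (simp add: power2_eq_square power3_eq_cube power4_eq_xxxx algebra_simps)
  also have "\<dots> \<le> 1000 * (v * s\<^sup>2)"
    using c[OF a(1) hs(4) rx hs(4) rx] c[OF a(1) hs(4) rx hs(3) xy(1)] c[OF a(1) hs(3) xy(1) hs(3) xy(1)]
      c[OF a(1) hs(4) rx hs(2) xy(2)] c[OF a(1) hs(3) xy(1) hs(2) xy(2)] c[OF a(2) hs(4) rx hs(4) rx]
      c[OF a(1) hs(2) xy(2) hs(2) xy(2)] c[OF a(2) hs(4) rx hs(2) xy(2)] c[OF a(2) hs(2) xy(2) hs(2) xy(2)]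
      mult_nonneg_nonneg[OF v0 zero_le_power2[of s]] by linarith
  finally show "\<bar>cell_cumulant4 r \<theta> \<omega>\<bar> \<le> 1000 * (cell_var r \<theta> \<omega> * s\<^sup>2)" unfolding v .
qed

text \<open>The cubic Taylor remainder is replaced by a square and a fourth power, whose
  expectations are known exactly.\<close>

lemma iexp_quadratic_remainder:
  "norm (iexp y - (1 + \<i> * of_real y - of_real (y ^ 2) / 2)) \<le> (y ^ 2 / 2 + y ^ 4 / 2) / 6"
proof -
  have "norm (iexp y - (1 + \<i> * of_real y - of_real (y ^ 2) / 2)) = norm (iexp y - (\<Sum>j\<le>2. (\<i> * of_real y) ^ j / fact j))"
    by (simp add: eval_nat_numeral algebra_simps)
  also have "\<dots> \<le> \<bar>y\<bar> ^ Suc 2 / fact (Suc 2)" by (rule iexp_approx1)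
  also have "\<dots> = \<bar>y\<bar> ^ 3 / 6" by (simp add: fact_numeral numeral_3_eq_3 numeral_2_eq_2)
  finally have "norm (iexp y - (1 + \<i> * of_real y - of_real (y ^ 2) / 2)) \<le> \<bar>y\<bar> ^ 3 / 6" .
  moreover have "0 \<le> \<bar>y\<bar> ^ 2 * (1 - \<bar>y\<bar>)\<^sup>2" by simp
  hence "0 \<le> \<bar>y\<bar> ^ 2 + \<bar>y\<bar> ^ 4 - 2 * \<bar>y\<bar> ^ 3" by (simp only: power2_diff) (simp add: algebra_simps eval_nat_numeral)
  ultimately show ?thesis by (simp add: power_even_abs)
qed

text \<open>Second-order expansion of a variable with mean 0 and variance v. The fourth moment is at
  most v / 2, so the remainder costs at most v / 4 and half of the Gaussian decay v / 2
  survives.\<close>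

lemma cell_cf_decay:
  assumes r: "r > 0" and s: "max 1 r * \<bar>\<theta>\<bar> + \<bar>\<omega>\<bar> \<le> 1 / 100" and rw: "r * \<omega>\<^sup>2 \<le> 1 / 100"
  shows "norm (cell_cf r \<theta> \<omega>) \<le> exp (- cell_var r \<theta> \<omega> / 4)"
proof -
  define s where "s = max 1 r * \<bar>\<theta>\<bar> + \<bar>\<omega>\<bar>"
  define v where "v = cell_var r \<theta> \<omega>"
  let ?Y = "\<lambda>k. \<theta> * charlier2 r k + \<omega> * (real k - r)"
  let ?P = "measure_pmf (poisson_pmf r)"
  note m = cell_moments[OF r, of \<theta> \<omega>, folded v_def]
  have s0: "s \<ge> 0" "s \<le> 1 / 100" using s by (auto simp: s_def)
  have v0: "v \<ge> 0" using r by (simp add: v_def cell_var_def)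
  have v1: "v \<le> 1 / 50"
  proof -
    have "r * \<bar>\<theta>\<bar> \<le> max 1 r * \<bar>\<theta>\<bar>" by (intro mult_right_mono) auto
    also have "\<dots> \<le> 1 / 100" using s by simp
    finally have "(r * \<bar>\<theta>\<bar>)\<^sup>2 \<le> (1 / 100)\<^sup>2" using r by (intro power_mono) auto
    thus ?thesis using rw by (simp add: v_def cell_var_def power_mult_distrib power_divide)
  qed
  have m4: "cell_cumulant4 r \<theta> \<omega> + 3 * v\<^sup>2 \<le> v / 2"
  proof -
    have "\<bar>cell_cumulant4 r \<theta> \<omega>\<bar> \<le> 1000 * (v * s\<^sup>2)"
      using cell_cumulant_bounds(2)[OF r, of \<theta> \<omega>] by (simp add: v_def s_def)
    also have "\<dots> \<le> 1000 * (v * (1 / 100)\<^sup>2)"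
      using s0 v0 by (intro mult_left_mono power_mono) auto
    finally have "\<bar>cell_cumulant4 r \<theta> \<omega>\<bar> \<le> v / 10" by (simp add: power2_eq_square)
    moreover have "v\<^sup>2 \<le> v / 50" using v1 v0 by (simp add: power2_eq_square mult_left_mono[of v "1/50" v, simplified])
    ultimately show ?thesis using v0 by linarith
  qed
  let ?g = "\<lambda>k. iexp (?Y k) - (1 + \<i> * of_real (?Y k) - of_real (?Y k ^ 2) / 2)"
  have X: "has_bochner_integral ?P (\<lambda>k. iexp (?Y k)) (cell_cf r \<theta> \<omega>)"
    unfolding cell_cf_def by (intro has_bochner_integral_integrable integrable_iexp_pmf)
  have "has_bochner_integral ?P (\<lambda>k. 1 + \<i> * of_real (?Y k) - of_real (?Y k ^ 2) / 2)
     (1 + \<i> * of_real 0 - of_real v / 2)"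
    by (intro has_bochner_integral_add has_bochner_integral_diff has_bochner_integral_mult_right
        has_bochner_integral_divide has_bochner_integral_of_real m) (simp add: has_bochner_integral_iff)
  note D = has_bochner_integral_diff[OF X this]
  have g: "norm (?g k) \<le> (?Y k ^ 2 / 2 + ?Y k ^ 4 / 2) / 6" for k
    by (rule iexp_quadratic_remainder)
  have B: "has_bochner_integral ?P (\<lambda>k. (?Y k ^ 2 / 2 + ?Y k ^ 4 / 2) / 6)
     ((v / 2 + (cell_cumulant4 r \<theta> \<omega> + 3 * v\<^sup>2) / 2) / 6)"
    by (intro has_bochner_integral_divide has_bochner_integral_add m)
  have "norm (cell_cf r \<theta> \<omega> - (1 + \<i> * of_real 0 - of_real v / 2)) \<le> (v / 2 + (cell_cumulant4 r \<theta> \<omega> + 3 * v\<^sup>2) / 2) / 6"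
    by (rule norm_has_bochner_integral_le[OF D B g])
  also have "\<dots> \<le> v / 4" using m4 v0 by simp
  finally have "norm (cell_cf r \<theta> \<omega> - of_real (1 - v / 2)) \<le> v / 4" by simp
  moreover have "norm (complex_of_real (1 - v / 2)) = 1 - v / 2"
    using v1 v0 unfolding norm_of_real by simp
  ultimately have "norm (cell_cf r \<theta> \<omega>) \<le> 1 - v / 4"
    using norm_triangle_ineq2[of "cell_cf r \<theta> \<omega>" "of_real (1 - v / 2)"] by linarith
  also have "\<dots> \<le> exp (- v / 4)" using exp_ge_add_one_self[of "- v / 4"] by simp
  finally show ?thesis by (simp add: v_def)
qed

text \<open>The cubic term does not affect the modulus, and the quartic term is at most v / 240 at
  such small frequencies.\<close>

lemma norm_cell_exponent_le:
  assumes r: "r > 0" and s: "max 1 r * \<bar>\<theta>\<bar> + \<bar>\<omega>\<bar> \<le> 1 / 100"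
  shows "norm (exp (cell_exponent r \<theta> \<omega>)) \<le> exp (- cell_var r \<theta> \<omega> / 4)"
proof -
  define s where "s = max 1 r * \<bar>\<theta>\<bar> + \<bar>\<omega>\<bar>"
  define v where "v = cell_var r \<theta> \<omega>"
  have s0: "s \<ge> 0" "s \<le> 1 / 100" using s by (auto simp: s_def)
  have v0: "v \<ge> 0" using r by (simp add: v_def cell_var_def)
  have "\<bar>cell_cumulant4 r \<theta> \<omega>\<bar> \<le> 1000 * (v * s\<^sup>2)"
    using cell_cumulant_bounds(2)[OF r, of \<theta> \<omega>] by (simp add: v_def s_def)
  also have "\<dots> \<le> 1000 * (v * (1 / 100)\<^sup>2)"
    using s0 v0 by (intro mult_left_mono power_mono) auto
  finally have "\<bar>cell_cumulant4 r \<theta> \<omega>\<bar> \<le> v / 10" by (simp add: power2_eq_square)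
  thus ?thesis using v0 by (simp add: cell_exponent_def v_def[symmetric])
qed

text \<open>The moment-cumulant relations up to order 4, regrouped by degree into the shape that
  \<open>exp_graded_truncation\<close> produces for the arguments q^j k_j / j!.\<close>

lemma moments_from_cumulants:
  fixes q k1 k2 k3 k4 :: complex
  shows "1 + q * k1 + q ^ 2 / 2 * (k2 + k1 ^ 2) + q ^ 3 / 6 * (k3 + 3 * k1 * k2 + k1 ^ 3)
      + q ^ 4 / 24 * (k4 + 4 * k3 * k1 + 3 * k2 ^ 2 + 6 * k2 * k1 ^ 2 + k1 ^ 4)
    = 1 + q * k1 + (q\<^sup>2 * k2 / 2 + (q * k1)\<^sup>2 / 2) + (q ^ 3 * k3 / 6 + q * k1 * (q\<^sup>2 * k2 / 2) + (q * k1) ^ 3 / 6)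
      + (q ^ 4 * k4 / 24 + q * k1 * (q ^ 3 * k3 / 6) + (q\<^sup>2 * k2 / 2)\<^sup>2 / 2 + (q * k1)\<^sup>2 * (q\<^sup>2 * k2 / 2) / 2 + (q * k1) ^ 4 / 24)"
  by (simp add: power_mult_distrib power_divide add_divide_distrib distrib_left eval_nat_numeral mult_ac)

lemma moments_sum_upto_4: "(\<Sum>j\<le>4. q ^ j / fact j * f j) = f 0 + q * f 1 + q ^ 2 / 2 * f 2 + q ^ 3 / 6 * f 3 + q ^ 4 / 24 * (f 4 :: complex)"
  by (simp add: atMost_nat_numeral fact_numeral)

text \<open>Sorted by powers of q = i \<theta>, the exponent can be compared coefficient by
  coefficient with the cumulants of the tilted law.\<close>

lemma cell_exponent_in_powers_of_i:
  fixes r \<theta> \<omega> :: real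
  defines "R \<equiv> complex_of_real r" and "q \<equiv> \<i> * complex_of_real \<theta>" and "t \<equiv> \<i> * complex_of_real \<omega>"
  shows "cell_exponent r \<theta> \<omega> = R * (t\<^sup>2 / 2 + t ^ 3 / 6 + t ^ 4 / 24) + q * (R\<^sup>2 * (t\<^sup>2 + t ^ 3))
       + q\<^sup>2 / 2 * (2 * R\<^sup>2 + 4 * R\<^sup>2 * t + (4 * R ^ 3 + 4 * R\<^sup>2) * t\<^sup>2)
       + q ^ 3 / 6 * (8 * R ^ 3 + 4 * R\<^sup>2 + (48 * R ^ 3 + 8 * R\<^sup>2) * t) + q ^ 4 / 24 * (48 * R ^ 4 + 144 * R ^ 3 + 8 * R\<^sup>2)"
proof -
  define T W where "T = complex_of_real \<theta>" and "W = complex_of_real \<omega>"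
  have i_powers: "\<i> ^ 3 = - \<i>" "\<i> ^ 4 = 1" by (simp_all add: power3_eq_cube power4_eq_xxxx)
  have p: "q\<^sup>2 = - (T\<^sup>2)" "q ^ 3 = - \<i> * T ^ 3" "q ^ 4 = T ^ 4" "t\<^sup>2 = - (W\<^sup>2)" "t ^ 3 = - \<i> * W ^ 3" "t ^ 4 = W ^ 4"
    by (simp_all add: q_def t_def T_def W_def power_mult_distrib i_powers)
  have a: "q * (R\<^sup>2 * (- (W\<^sup>2) + - \<i> * W ^ 3)) = - \<i> * (R\<^sup>2 * T * W\<^sup>2) + R\<^sup>2 * T * W ^ 3"
    by (simp add: q_def T_def algebra_simps)
  have b: "- \<i> * T ^ 3 / 6 * (8 * R ^ 3 + 4 * R\<^sup>2 + (48 * R ^ 3 + 8 * R\<^sup>2) * t)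
     = - \<i> * ((8 * R ^ 3 + 4 * R\<^sup>2) * T ^ 3) / 6 + (48 * R ^ 3 + 8 * R\<^sup>2) * T ^ 3 * W / 6"
    by (simp add: t_def W_def algebra_simps add_divide_distrib diff_divide_distrib)
  have c: "- (T\<^sup>2) / 2 * (2 * R\<^sup>2 + 4 * R\<^sup>2 * t + (4 * R ^ 3 + 4 * R\<^sup>2) * - (W\<^sup>2))
     = - (2 * R\<^sup>2 * T\<^sup>2) / 2 - \<i> * (12 * R\<^sup>2 * T\<^sup>2 * W) / 6 + (48 * R ^ 3 + 48 * R\<^sup>2) * T\<^sup>2 * W\<^sup>2 / 24"
    by (simp add: t_def W_def algebra_simps add_divide_distrib)
  have "cell_exponent r \<theta> \<omega> = - (2 * R\<^sup>2 * T\<^sup>2 + R * W\<^sup>2) / 2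
         - \<i> * ((8 * R ^ 3 + 4 * R\<^sup>2) * T ^ 3 + 12 * R\<^sup>2 * T\<^sup>2 * W + 6 * R\<^sup>2 * T * W\<^sup>2 + R * W ^ 3) / 6
         + ((48 * R ^ 4 + 144 * R ^ 3 + 8 * R\<^sup>2) * T ^ 4
     + (192 * R ^ 3 + 32 * R\<^sup>2) * T ^ 3 * W + (48 * R ^ 3 + 48 * R\<^sup>2) * T\<^sup>2 * W\<^sup>2
     + 24 * R\<^sup>2 * T * W ^ 3 + R * W ^ 4) / 24"
    by (simp add: cell_exponent_def cell_var_def cell_cumulant3_def cell_cumulant4_def R_def T_def W_def)
  thus ?thesis unfolding p a b c by (simp add: add_divide_distrib diff_divide_distrib algebra_simps)
qed


text \<open>\<open>cell_cf\<close> is close to exp \<psi> times a sum of tilted moments; that sum is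
  the exponential of the tilted cumulant series up to an error of degree 5 in h; and the tilted
  cumulants, polynomials in d = exp(i \<omega>) - 1, agree with \<open>cell_exponent\<close> after
  expansion of d. Each of the three errors is at most a constant times the variance times
  s^3.\<close>

lemma cell_cf_expansion:
  "\<exists>C>0. \<forall>r>0. \<forall>\<theta> \<omega>. max 1 r * \<bar>\<theta>\<bar> \<le> 1 \<longrightarrow> \<bar>\<omega>\<bar> \<le> 1 \<longrightarrow> r * \<omega>\<^sup>2 \<le> 1 \<longrightarrow>
     norm (cell_cf r \<theta> \<omega> - exp (cell_exponent r \<theta> \<omega>))
       \<le> C * (cell_var r \<theta> \<omega> * (max 1 r * \<bar>\<theta>\<bar> + \<bar>\<omega>\<bar>) ^ 3)"
proof -
  \<comment> \<open>A bounds the truncation parameter 400 e, as e is at most 2, and B bounds the two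
    exponents compared in the last step.\<close>
  define A where "A = (800 :: real)"
  define C1 where "C1 = 5 * A + 10 * A\<^sup>2 + 11 * A ^ 3 + 43 * A ^ 4 * exp (4 * A)"
  define B where "B = (4000 :: real)"
  have C1: "C1 \<ge> 0" by (simp add: C1_def A_def)
  have main: "norm (cell_cf r \<theta> \<omega> - exp (cell_exponent r \<theta> \<omega>))
       \<le> (700 + 800 * C1 + exp (3 * B) * 1000) * (cell_var r \<theta> \<omega> * (max 1 r * \<bar>\<theta>\<bar> + \<bar>\<omega>\<bar>) ^ 3)"
    if r: "r > 0" and h1: "max 1 r * \<bar>\<theta>\<bar> \<le> 1" and y1: "\<bar>\<omega>\<bar> \<le> 1" and ry: "r * \<omega>\<^sup>2 \<le> 1" for r \<theta> \<omega>
  proof -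
    define M where "M = max 1 r"
    define x y h where "x = \<bar>\<theta>\<bar>" and "y = \<bar>\<omega>\<bar>" and "h = M * x"
    define s where "s = h + y"
    define v where "v = cell_var r \<theta> \<omega>"
    have M: "M \<ge> 1" "r \<le> M" by (auto simp: M_def)
    have xy: "x \<ge> 0" "y \<ge> 0" "y \<le> 1" and h: "h \<ge> 0" "h \<le> 1" and D: "r * y\<^sup>2 \<le> 1" "r * y\<^sup>2 \<ge> 0"
      using that by (auto simp: x_def y_def h_def M_def)
    have xh: "x \<le> h" "r * x \<le> h" and rx: "r * x \<ge> 0"
      using r M xy by (auto simp: h_def intro!: mult_right_mono simp: mult_le_cancel_right1)
    have v: "v = 2 * (r\<^sup>2 * x\<^sup>2) + r * y\<^sup>2" by (simp add: v_def cell_var_def x_def y_def)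
    have vp: "r\<^sup>2 * x\<^sup>2 \<le> v" "r * y\<^sup>2 \<le> v" "v \<ge> 0" using r by (auto simp: v)
    have hs: "h \<le> s" "y \<le> s" "x \<le> s" "r * x \<le> s" "s \<ge> 0" "s \<le> 2" using xh xy h by (auto simp: s_def)
    have p1: "r ^ i * y ^ j \<le> r\<^sup>2 * M ^ n" if "2 \<le> i" "i \<le> n + 2" for i j n
    proof -
      have "r ^ i * y ^ j \<le> r ^ i * 1" using r xy by (intro mult_left_mono power_le_one) auto
      also have "\<dots> \<le> r\<^sup>2 * M ^ (n + 2 - 2)" using power_le_max_one[OF r that] by (simp add: M_def)
      finally show ?thesis by simp
    qed
    have p2: "r ^ i * y ^ j \<le> r\<^sup>2 * M ^ n" if "3 \<le> i" "i \<le> n + 3" "2 \<le> j" for i j n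
    proof -
      have "r ^ i * y ^ j = (r ^ (i - 1) * y ^ (j - 2)) * (r * y\<^sup>2)"
        using that by (cases i; cases j; cases "j - 1") (auto simp: power2_eq_square mult_ac)
      also have "\<dots> \<le> (r ^ (i - 1) * y ^ (j - 2)) * 1"
        using r xy D by (intro mult_left_mono) auto
      also have "\<dots> \<le> r\<^sup>2 * M ^ n" using p1[of "i - 1" n "j - 2"] that by simp
      finally show ?thesis .
    qed
    define R where "R = complex_of_real r"
    define q where "q = \<i> * complex_of_real \<theta>"
    define t where "t = \<i> * complex_of_real \<omega>"
    define d where "d = iexp \<omega> - 1"
    have nR: "norm R \<le> r" and nq: "norm q \<le> x" and nt: "norm t \<le> y"
      using r by (auto simp: R_def q_def t_def x_def y_def norm_mult)
    have nd: "norm d \<le> y" using iexp_approx1[of \<omega> 0] by (simp add: d_def y_def)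
    have nd1: "norm (d - t) \<le> y\<^sup>2 / 2" using iexp_approx1[of \<omega> 1] by (simp add: d_def y_def t_def algebra_simps power2_eq_square)
    have nd2: "norm (d - t - t\<^sup>2 / 2) \<le> y ^ 3 / 6"
      using iexp_approx1[of \<omega> 2] by (simp add: d_def y_def t_def algebra_simps eval_nat_numeral)
    have nd4: "norm (iexp \<omega> - (1 + t + t\<^sup>2 / 2 + t ^ 3 / 6 + t ^ 4 / 24)) \<le> y ^ 5"
    proof -
      have "norm (iexp \<omega> - (\<Sum>k\<le>4. t ^ k / fact k)) \<le> y ^ 5 / fact 5"
        using iexp_approx1[of \<omega> 4] by (simp add: t_def y_def)
      also have "\<dots> \<le> y ^ 5" using xy by (simp add: fact_numeral)
      also have "(\<Sum>k\<le>4. t ^ k / fact k) = 1 + t + t\<^sup>2 / 2 + t ^ 3 / 6 + t ^ 4 / 24"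
        by (simp add: eval_nat_numeral)
      finally show ?thesis .
    qed
    have norm_c: "norm (numeral w :: complex) \<le> numeral w" for w by simp
    have norm_1: "norm (1 :: complex) \<le> 1" by simp
    note nb = order_trans[OF norm_triangle_ineq] add_mono norm_mult_le norm_power_le norm_divide_numeral_le
      nR nq nt nd nd1 nd2 nd4 norm_c norm_1
    \<comment> \<open>\<open>k1\<close> to \<open>k4\<close> are the first four cumulants of
      \<open>charlier2\<close> under the normalised weight exp(i \<omega> \<xi>).\<close>
    define k1 where "k1 = R ^ 2 * d ^ 2"
    define k2 where "k2 = 2 * R ^ 2 + 4 * R ^ 2 * d ^ 1 + 4 * R ^ 3 * d ^ 2 + 2 * R ^ 2 * d ^ 2 + 4 * R ^ 3 * d ^ 3"
    define k3 where "k3 = 8 * R ^ 3 + 4 * R ^ 2 + 48 * R ^ 3 * d ^ 1 + 8 * R ^ 2 * d ^ 1 + 24 * R ^ 4 * d ^ 2 + 72 * R ^ 3 * d ^ 2 + 4 * R ^ 2 * d ^ 2 + 56 * R ^ 4 * d ^ 3 + 32 * R ^ 3 * d ^ 3 + 32 * R ^ 4 * d ^ 4"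
    define k4 where "k4 = 48 * R ^ 4 + 144 * R ^ 3 + 8 * R ^ 2 + 576 * R ^ 4 * d ^ 1 + 496 * R ^ 3 * d ^ 1 + 16 * R ^ 2 * d ^ 1 + 192 * R ^ 5 * d ^ 2 + 1632 * R ^ 4 * d ^ 2 + 560 * R ^ 3 * d ^ 2 + 8 * R ^ 2 * d ^ 2 + 768 * R ^ 5 * d ^ 3 + 1728 * R ^ 4 * d ^ 3 + 208 * R ^ 3 * d ^ 3 + 976 * R ^ 5 * d ^ 4 + 624 * R ^ 4 * d ^ 4 + 400 * R ^ 5 * d ^ 5"
    have m: "charlier2_moment R (iexp \<omega>) 0 0 = 1" "charlier2_moment R (iexp \<omega>) 1 0 = k1"
      "charlier2_moment R (iexp \<omega>) 2 0 = k2 + k1 ^ 2"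
      "charlier2_moment R (iexp \<omega>) 3 0 = k3 + 3 * k1 * k2 + k1 ^ 3"
      "charlier2_moment R (iexp \<omega>) 4 0 = k4 + 4 * k3 * k1 + 3 * k2 ^ 2 + 6 * k2 * k1 ^ 2 + k1 ^ 4"
    proof -
      have w: "iexp \<omega> = 1 + d" by (simp add: d_def)
      note e = charlier2_moment_eqs[of R d, folded w]
      show "charlier2_moment R (iexp \<omega>) 0 0 = 1" by (rule e)
      show "charlier2_moment R (iexp \<omega>) 1 0 = k1" unfolding e k1_def ..
      show "charlier2_moment R (iexp \<omega>) 2 0 = k2 + k1 ^ 2" unfolding e k1_def k2_def by algebra
      show "charlier2_moment R (iexp \<omega>) 3 0 = k3 + 3 * k1 * k2 + k1 ^ 3" unfolding e k1_def k2_def k3_def by algebra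
      show "charlier2_moment R (iexp \<omega>) 4 0 = k4 + 4 * k3 * k1 + 3 * k2 ^ 2 + 6 * k2 * k1 ^ 2 + k1 ^ 4"
        unfolding e k1_def k2_def k3_def k4_def by algebra
    qed
    define z1 z2 z3 z4 where "z1 = q * k1" and "z2 = q\<^sup>2 * k2 / 2" and "z3 = q ^ 3 * k3 / 6" and "z4 = q ^ 4 * k4 / 24"
    have S: "(\<Sum>j\<le>4. q ^ j / fact j * charlier2_moment R (iexp \<omega>) j 0) =
       1 + z1 + (z2 + z1\<^sup>2 / 2) + (z3 + z1 * z2 + z1 ^ 3 / 6)
          + (z4 + z1 * z3 + z2\<^sup>2 / 2 + z1\<^sup>2 * z2 / 2 + z1 ^ 4 / 24)"
    proof -
      show ?thesis unfolding moments_sum_upto_4 m z1_def z2_def z3_def z4_def by (rule moments_from_cumulants)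
    qed
    have "norm k2 \<le> 2 * r ^ 2 + 4 * r ^ 2 * y ^ 1 + 4 * r ^ 3 * y ^ 2 + 2 * r ^ 2 * y ^ 2 + 4 * r ^ 3 * y ^ 3"
      unfolding k2_def by (intro nb)
    hence nk2: "norm k2 \<le> 16 * (r\<^sup>2 * M ^ 0)"
      using p1[of 2 0 1] p1[of 2 0 0] p2[of 3 0 2] p1[of 2 0 2] p2[of 3 0 3] by (simp add: mult.assoc)
    have "norm k3 \<le> 8 * r ^ 3 + 4 * r ^ 2 + 48 * r ^ 3 * y ^ 1 + 8 * r ^ 2 * y ^ 1 + 24 * r ^ 4 * y ^ 2 + 72 * r ^ 3 * y ^ 2 + 4 * r ^ 2 * y ^ 2 + 56 * r ^ 4 * y ^ 3 + 32 * r ^ 3 * y ^ 3 + 32 * r ^ 4 * y ^ 4"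
      unfolding k3_def by (intro nb)
    hence nk3: "norm k3 \<le> 288 * (r\<^sup>2 * M ^ 1)"
      using p1[of 2 1 1] p1[of 2 1 0] p1[of 3 1 2] p1[of 3 1 1] p2[of 4 1 3] p1[of 3 1 0] p2[of 4 1 2] p1[of 2 1 2] p1[of 3 1 3] p2[of 4 1 4] by (simp add: mult.assoc)
    have "norm k4 \<le> 48 * r ^ 4 + 144 * r ^ 3 + 8 * r ^ 2 + 576 * r ^ 4 * y ^ 1 + 496 * r ^ 3 * y ^ 1 + 16 * r ^ 2 * y ^ 1 + 192 * r ^ 5 * y ^ 2 + 1632 * r ^ 4 * y ^ 2 + 560 * r ^ 3 * y ^ 2 + 8 * r ^ 2 * y ^ 2 + 768 * r ^ 5 * y ^ 3 + 1728 * r ^ 4 * y ^ 3 + 208 * r ^ 3 * y ^ 3 + 976 * r ^ 5 * y ^ 4 + 624 * r ^ 4 * y ^ 4 + 400 * r ^ 5 * y ^ 5"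
      unfolding k4_def by (intro nb)
    hence nk4: "norm k4 \<le> 8384 * (r\<^sup>2 * M ^ 2)"
      using p1[of 2 2 1] p1[of 2 2 0] p1[of 3 2 2] p1[of 3 2 1] p1[of 4 2 3] p1[of 3 2 0] p1[of 4 2 2] p2[of 5 2 4] p1[of 4 2 1] p2[of 5 2 3] p1[of 4 2 0] p2[of 5 2 2] p1[of 2 2 2] p1[of 3 2 3] p1[of 4 2 4] p2[of 5 2 5] by (simp add: mult.assoc)
    have nk1: "norm k1 \<le> r ^ 2 * y ^ 2" unfolding k1_def by (intro nb)
    \<comment> \<open>The parameter E of the truncation, up to the factor 400:
      \<open>(r / M)\<^sup>2 * h\<^sup>2\<close> is the \<theta>-part of the variance, and r y^2
      accounts for the tilted mean in \<open>z1\<close>.\<close>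
    define e where "e = (r / M)\<^sup>2 + r * y\<^sup>2"
    have W: "(r / M)\<^sup>2 * h\<^sup>2 = r\<^sup>2 * x\<^sup>2" using M by (simp add: h_def power_divide power_mult_distrib)
    have e: "e \<ge> 0" "e \<le> 2"
    proof -
      have "(r / M)\<^sup>2 \<le> 1\<^sup>2" using M r by (intro power_mono) auto
      thus "e \<le> 2" using D by (simp add: e_def)
    qed (use D in \<open>simp add: e_def\<close>)
    have eW: "r\<^sup>2 * x\<^sup>2 \<le> e * h\<^sup>2" using D h by (simp add: e_def distrib_right W)
    have nz1: "norm z1 \<le> 400 * e * h"
    proof -
      have "norm z1 \<le> x * (r ^ 2 * y ^ 2)" unfolding z1_def by (intro norm_mult_le nq nk1)
      also have "\<dots> = (r * y\<^sup>2) * (r * x)" by (simp add: power2_eq_square mult_ac)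
      also have "\<dots> \<le> e * h" using D xh rx e by (intro mult_mono) (auto simp: e_def)
      also have "\<dots> \<le> 400 * e * h" using e h by (simp add: mult_nonneg_nonneg)
      finally show ?thesis .
    qed
    have eh: "r\<^sup>2 * x\<^sup>2 * h ^ n \<le> e * h ^ (n + 2)" for n
    proof -
      have "r\<^sup>2 * x\<^sup>2 * h ^ n \<le> e * h\<^sup>2 * h ^ n" using h by (intro mult_right_mono eW) auto
      thus ?thesis by (simp add: power_add power2_eq_square mult_ac)
    qed
    have eh': "r\<^sup>2 * x\<^sup>2 * h ^ 0 \<le> e * h\<^sup>2" "r\<^sup>2 * x\<^sup>2 * h ^ 1 \<le> e * h ^ 3" "r\<^sup>2 * x\<^sup>2 * h ^ 2 \<le> e * h ^ 4"
      using eh[of 0] eh[of 1] eh[of 2] by (simp_all add: eval_nat_numeral)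
    have eh0: "e * h ^ n \<ge> 0" for n using e h by simp
    have nz2: "norm z2 \<le> 400 * e * h\<^sup>2"
    proof -
      have "norm z2 \<le> x\<^sup>2 * (16 * (r\<^sup>2 * M ^ 0)) / 2" unfolding z2_def by (intro nb nk2)
      also have "\<dots> = 8 * (r\<^sup>2 * x\<^sup>2 * h ^ 0)" by simp
      also have "\<dots> \<le> 400 * e * h\<^sup>2" using eh'(1) eh0[of 2] by linarith
      finally show ?thesis .
    qed
    have nz3: "norm z3 \<le> 400 * e * h ^ 3"
    proof -
      have "norm z3 \<le> x ^ 3 * (288 * (r\<^sup>2 * M ^ 1)) / 6" unfolding z3_def by (intro nb nk3)
      also have "\<dots> = 288 / 6 * (r\<^sup>2 * x\<^sup>2 * h ^ 1)" by (simp add: h_def eval_nat_numeral)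
      also have "\<dots> \<le> 400 * e * h ^ 3" using eh'(2) eh0[of 3] by linarith
      finally show ?thesis .
    qed
    have nz4: "norm z4 \<le> 400 * e * h ^ 4"
    proof -
      have "norm z4 \<le> x ^ 4 * (8384 * (r\<^sup>2 * M ^ 2)) / 24" unfolding z4_def by (intro nb nk4)
      also have "\<dots> = 8384 / 24 * (r\<^sup>2 * x\<^sup>2 * h ^ 2)" by (simp add: h_def eval_nat_numeral)
      also have "\<dots> \<le> 400 * e * h ^ 4" using eh'(3) eh0[of 4] by linarith
      finally show ?thesis .
    qed
    define z where "z = z1 + z2 + z3 + z4"
    have "norm (exp z - (\<Sum>j\<le>4. q ^ j / fact j * charlier2_moment R (iexp \<omega>) j 0)) \<le> C1 * (400 * e * h ^ 5)"
      unfolding S z_def C1_def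
      by (rule exp_graded_truncation[OF nz1 nz2 nz3 nz4]) (use h e in \<open>auto simp: A_def\<close>)
    also have "\<dots> \<le> C1 * (800 * (v * s ^ 3))"
    proof (rule mult_left_mono[OF _ C1])
      \<comment> \<open>In the first part of e two factors h restore r^2 x^2; in the second part two
        factors h are dropped. Both leave a part of the variance times h^3.\<close>
      have "h ^ 5 \<le> h ^ 3" using h by (intro power_decreasing) auto
      hence "r * y\<^sup>2 * h ^ 5 \<le> r * y\<^sup>2 * h ^ 3" using D by (intro mult_left_mono) auto
      hence "e * h ^ 5 \<le> (r\<^sup>2 * x\<^sup>2 + r * y\<^sup>2) * h ^ 3"
        using W by (simp add: e_def distrib_right eval_nat_numeral flip: mult.assoc)
      also have "\<dots> \<le> (2 * v) * s ^ 3"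
        using vp hs h by (intro mult_mono power_mono) auto
      finally show "400 * e * h ^ 5 \<le> 800 * (v * s ^ 3)" by simp
    qed
    finally have T2: "norm (exp z - (\<Sum>j\<le>4. q ^ j / fact j * charlier2_moment R (iexp \<omega>) j 0)) \<le> C1 * (800 * (v * s ^ 3))" .
    define \<psi> where "\<psi> = R * (iexp \<omega> - 1 - t)"
    have \<Phi>: "centered_poisson_cf r \<omega> = exp \<psi>" by (simp add: centered_poisson_cf_def \<psi>_def R_def t_def)
    have n\<Phi>: "norm (exp \<psi>) \<le> 1"
      using r by (simp add: \<psi>_def R_def t_def mult_nonneg_nonpos Re_exp)
    have T1: "norm (cell_cf r \<theta> \<omega> - exp \<psi> * (\<Sum>j\<le>4. q ^ j / fact j * charlier2_moment R (iexp \<omega>) j 0)) \<le> 700 * (v * s ^ 3)"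
    proof -
      have "norm (cell_cf r \<theta> \<omega> - exp \<psi> * (\<Sum>j\<le>4. q ^ j / fact j * charlier2_moment R (iexp \<omega>) j 0)) \<le> 700 * (r\<^sup>2 * \<theta>\<^sup>2 * h ^ 3)"
        using cell_cf_theta_expansion[OF r h1, of \<omega>] unfolding \<Phi> by (simp add: R_def q_def h_def M_def x_def)
      also have "r\<^sup>2 * \<theta>\<^sup>2 * h ^ 3 \<le> v * s ^ 3"
        using vp hs h by (intro mult_mono power_mono) (auto simp: x_def)
      finally show ?thesis by simp
    qed
    have npsi: "norm \<psi> \<le> 1"
    proof -
      have "norm \<psi> \<le> r * (y\<^sup>2 / 2)" unfolding \<psi>_def using nd1 by (intro norm_mult_le nR) (simp add: d_def)
      thus ?thesis using D by simp
    qed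
    define K2 K3 K4 where "K2 = 2 * R\<^sup>2 + 4 * R\<^sup>2 * t + (4 * R ^ 3 + 4 * R\<^sup>2) * t\<^sup>2"
      and "K3 = 8 * R ^ 3 + 4 * R\<^sup>2 + (48 * R ^ 3 + 8 * R\<^sup>2) * t"
      and "K4 = 48 * R ^ 4 + 144 * R ^ 3 + 8 * R\<^sup>2"
    have ce: "cell_exponent r \<theta> \<omega> = R * (t\<^sup>2 / 2 + t ^ 3 / 6 + t ^ 4 / 24) + q * (R\<^sup>2 * (t\<^sup>2 + t ^ 3))
       + q\<^sup>2 / 2 * K2 + q ^ 3 / 6 * K3 + q ^ 4 / 24 * K4"
      unfolding K2_def K3_def K4_def R_def q_def t_def by (rule cell_exponent_in_powers_of_i)
    \<comment> \<open>Subtracting like powers of q leaves Taylor remainders of d and products that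
      carry enough factors of order y.\<close>
    have diff: "\<psi> + z - cell_exponent r \<theta> \<omega>
       = R * (iexp \<omega> - (1 + t + t\<^sup>2 / 2 + t ^ 3 / 6 + t ^ 4 / 24)) + q * (R\<^sup>2 * ((d - t - t\<^sup>2 / 2) * (d + (t + t\<^sup>2 / 2)) + t ^ 4 / 4))
        + q\<^sup>2 / 2 * (4 * R\<^sup>2 * (d - t - t\<^sup>2 / 2) + (4 * R ^ 3 + 2 * R\<^sup>2) * ((d - t) * (d + t)) + 4 * R ^ 3 * d ^ 3)
        + q ^ 3 / 6 * ((48 * R ^ 3 + 8 * R\<^sup>2) * (d - t) + 24 * R ^ 4 * d\<^sup>2 + 72 * R ^ 3 * d\<^sup>2 + 4 * R\<^sup>2 * d\<^sup>2
            + 56 * R ^ 4 * d ^ 3 + 32 * R ^ 3 * d ^ 3 + 32 * R ^ 4 * d ^ 4)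
        + q ^ 4 / 24 * (576 * R ^ 4 * d ^ 1 + 496 * R ^ 3 * d ^ 1 + 16 * R ^ 2 * d ^ 1 + 192 * R ^ 5 * d ^ 2 + 1632 * R ^ 4 * d ^ 2 + 560 * R ^ 3 * d ^ 2 + 8 * R ^ 2 * d ^ 2 + 768 * R ^ 5 * d ^ 3 + 1728 * R ^ 4 * d ^ 3 + 208 * R ^ 3 * d ^ 3 + 976 * R ^ 5 * d ^ 4 + 624 * R ^ 4 * d ^ 4 + 400 * R ^ 5 * d ^ 5)"
    proof -
      have e2: "q\<^sup>2 / 2 * k2 - q\<^sup>2 / 2 * K2 = q\<^sup>2 / 2 * (4 * R\<^sup>2 * (d - t - t\<^sup>2 / 2) + (4 * R ^ 3 + 2 * R\<^sup>2) * ((d - t) * (d + t)) + 4 * R ^ 3 * d ^ 3)"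
      proof -
        have "k2 - K2 = 4 * R\<^sup>2 * (d - t - t\<^sup>2 / 2) + (4 * R ^ 3 + 2 * R\<^sup>2) * ((d - t) * (d + t)) + 4 * R ^ 3 * d ^ 3"
          unfolding k2_def K2_def by (simp add: algebra_simps power2_eq_square)
        thus ?thesis by (simp only: right_diff_distrib[symmetric])
      qed
      have e3: "q ^ 3 / 6 * k3 - q ^ 3 / 6 * K3 = q ^ 3 / 6 * ((48 * R ^ 3 + 8 * R\<^sup>2) * (d - t) + 24 * R ^ 4 * d\<^sup>2 + 72 * R ^ 3 * d\<^sup>2 + 4 * R\<^sup>2 * d\<^sup>2
            + 56 * R ^ 4 * d ^ 3 + 32 * R ^ 3 * d ^ 3 + 32 * R ^ 4 * d ^ 4)"
      proof -
        have "k3 - K3 = (48 * R ^ 3 + 8 * R\<^sup>2) * (d - t) + 24 * R ^ 4 * d\<^sup>2 + 72 * R ^ 3 * d\<^sup>2 + 4 * R\<^sup>2 * d\<^sup>2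
            + 56 * R ^ 4 * d ^ 3 + 32 * R ^ 3 * d ^ 3 + 32 * R ^ 4 * d ^ 4"
          unfolding k3_def K3_def by algebra
        thus ?thesis by (simp only: right_diff_distrib[symmetric])
      qed
      have e4: "q ^ 4 / 24 * k4 - q ^ 4 / 24 * K4 = q ^ 4 / 24 * (576 * R ^ 4 * d ^ 1 + 496 * R ^ 3 * d ^ 1 + 16 * R ^ 2 * d ^ 1 + 192 * R ^ 5 * d ^ 2 + 1632 * R ^ 4 * d ^ 2 + 560 * R ^ 3 * d ^ 2 + 8 * R ^ 2 * d ^ 2 + 768 * R ^ 5 * d ^ 3 + 1728 * R ^ 4 * d ^ 3 + 208 * R ^ 3 * d ^ 3 + 976 * R ^ 5 * d ^ 4 + 624 * R ^ 4 * d ^ 4 + 400 * R ^ 5 * d ^ 5)"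
      proof -
        have "k4 - K4 = 576 * R ^ 4 * d ^ 1 + 496 * R ^ 3 * d ^ 1 + 16 * R ^ 2 * d ^ 1 + 192 * R ^ 5 * d ^ 2 + 1632 * R ^ 4 * d ^ 2 + 560 * R ^ 3 * d ^ 2 + 8 * R ^ 2 * d ^ 2 + 768 * R ^ 5 * d ^ 3 + 1728 * R ^ 4 * d ^ 3 + 208 * R ^ 3 * d ^ 3 + 976 * R ^ 5 * d ^ 4 + 624 * R ^ 4 * d ^ 4 + 400 * R ^ 5 * d ^ 5" unfolding k4_def K4_def by algebra
        thus ?thesis by (simp only: right_diff_distrib[symmetric])
      qed
      have e1: "q * k1 - q * (R\<^sup>2 * (t\<^sup>2 + t ^ 3)) = q * (R\<^sup>2 * ((d - t - t\<^sup>2 / 2) * (d + (t + t\<^sup>2 / 2)) + t ^ 4 / 4))"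
      proof -
        have "d ^ 2 - (t\<^sup>2 + t ^ 3) = (d - t - t\<^sup>2 / 2) * (d + (t + t\<^sup>2 / 2)) + t ^ 4 / 4"
          by (simp add: algebra_simps eval_nat_numeral)
        thus ?thesis unfolding k1_def by (simp only: right_diff_distrib[symmetric])
      qed
      have e0: "\<psi> - R * (t\<^sup>2 / 2 + t ^ 3 / 6 + t ^ 4 / 24) = R * (iexp \<omega> - (1 + t + t\<^sup>2 / 2 + t ^ 3 / 6 + t ^ 4 / 24))"
        unfolding \<psi>_def by (simp add: algebra_simps)
      have z': "z = q * k1 + q\<^sup>2 / 2 * k2 + q ^ 3 / 6 * k3 + q ^ 4 / 24 * k4"
        by (simp add: z_def z1_def z2_def z3_def z4_def)
      have gen: "p + (a1 + a2 + a3 + a4) - (p0 + b1 + b2 + b3 + b4) = (p - p0) + (a1 - b1) + (a2 - b2) + (a3 - b3) + (a4 - b4)"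
        for p p0 a1 a2 a3 a4 b1 b2 b3 b4 :: complex by simp
      show ?thesis unfolding ce z' gen unfolding e0 e1 e2 e3 e4 ..
    qed
    have N: "norm (\<psi> + z - cell_exponent r \<theta> \<omega>) \<le> r * y ^ 5 + x * (r\<^sup>2 * (y ^ 3 / 6 * (y + (y + y\<^sup>2 / 2)) + y ^ 4 / 4))
        + x\<^sup>2 / 2 * (4 * r\<^sup>2 * (y ^ 3 / 6) + (4 * r ^ 3 + 2 * r\<^sup>2) * (y\<^sup>2 / 2 * (y + y)) + 4 * r ^ 3 * y ^ 3)
        + x ^ 3 / 6 * ((48 * r ^ 3 + 8 * r\<^sup>2) * (y\<^sup>2 / 2) + 24 * r ^ 4 * y\<^sup>2 + 72 * r ^ 3 * y\<^sup>2 + 4 * r\<^sup>2 * y\<^sup>2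
            + 56 * r ^ 4 * y ^ 3 + 32 * r ^ 3 * y ^ 3 + 32 * r ^ 4 * y ^ 4)
        + x ^ 4 / 24 * (576 * r ^ 4 * y ^ 1 + 496 * r ^ 3 * y ^ 1 + 16 * r ^ 2 * y ^ 1 + 192 * r ^ 5 * y ^ 2 + 1632 * r ^ 4 * y ^ 2 + 560 * r ^ 3 * y ^ 2 + 8 * r ^ 2 * y ^ 2 + 768 * r ^ 5 * y ^ 3 + 1728 * r ^ 4 * y ^ 3 + 208 * r ^ 3 * y ^ 3 + 976 * r ^ 5 * y ^ 4 + 624 * r ^ 4 * y ^ 4 + 400 * r ^ 5 * y ^ 5)"
      unfolding diff by (intro nb)
    have yp: "y ^ (i + j) \<le> y ^ i" for i j using xy by (simp add: power_add mult_left_le power_le_one)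
    have c3: "Aa * (b * (b' * b'')) \<le> v * s ^ 3"
      if "Aa \<le> v" "b \<le> s" "0 \<le> b" "b' \<le> s" "0 \<le> b'" "b'' \<le> s" "0 \<le> b''" for Aa b b' b''
    proof -
      have "b * (b' * b'') \<le> s * (s * s)" using that hs by (intro mult_mono) auto
      thus ?thesis using that vp hs unfolding power3_eq_cube mult.assoc by (intro mult_mono) auto
    qed
    note cx = c3[OF vp(1)] and cy = c3[OF vp(2)]
    note X = hs(3) xy(1) and Y = hs(2) xy(2) and RX = hs(4) rx
    have f0: "r * y ^ 5 \<le> v * s ^ 3" using cy[OF Y Y Y] by (simp add: eval_nat_numeral mult_ac)
    have f1: "x * (r\<^sup>2 * (y ^ 3 / 6 * (y + (y + y\<^sup>2 / 2)) + y ^ 4 / 4)) \<le> v * s ^ 3"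
    proof -
      have "y ^ 3 / 6 * (y + (y + y\<^sup>2 / 2)) + y ^ 4 / 4 = (7 / 12) * y ^ 4 + (1 / 12) * y ^ 5"
        by (simp add: eval_nat_numeral field_simps)
      also have "\<dots> \<le> y ^ 4"
      proof -
        have "y ^ 5 \<le> y ^ 4" "0 \<le> y ^ 4" using yp[of 4 1] xy by simp_all
        thus ?thesis by linarith
      qed
      finally have "x * (r\<^sup>2 * (y ^ 3 / 6 * (y + (y + y\<^sup>2 / 2)) + y ^ 4 / 4)) \<le> x * (r\<^sup>2 * y ^ 4)"
        using xy by (intro mult_left_mono) auto
      also have "\<dots> = (r * y\<^sup>2) * ((r * x) * (y * y))" by (simp add: eval_nat_numeral mult_ac)
      also have "\<dots> \<le> v * s ^ 3" by (intro cy RX Y)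
      finally show ?thesis .
    qed
    have f2: "x\<^sup>2 / 2 * (4 * r\<^sup>2 * (y ^ 3 / 6) + (4 * r ^ 3 + 2 * r\<^sup>2) * (y\<^sup>2 / 2 * (y + y)) + 4 * r ^ 3 * y ^ 3) \<le> 6 * (v * s ^ 3)"
    proof -
      have "x\<^sup>2 / 2 * (4 * r\<^sup>2 * (y ^ 3 / 6) + (4 * r ^ 3 + 2 * r\<^sup>2) * (y\<^sup>2 / 2 * (y + y)) + 4 * r ^ 3 * y ^ 3)
        = (4 / 3) * ((r\<^sup>2 * x\<^sup>2) * (y * (y * y))) + 4 * ((r * y\<^sup>2) * ((r * x) * ((r * x) * y)))"
        by (simp add: eval_nat_numeral field_simps)
      also have "\<dots> \<le> (4 / 3) * (v * s ^ 3) + 4 * (v * s ^ 3)"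
        by (intro add_mono mult_left_mono cx cy RX Y) auto
      also have "\<dots> \<le> 6 * (v * s ^ 3)" using vp hs by simp
      finally show ?thesis .
    qed
    have f3: "x ^ 3 / 6 * ((48 * r ^ 3 + 8 * r\<^sup>2) * (y\<^sup>2 / 2) + 24 * r ^ 4 * y\<^sup>2 + 72 * r ^ 3 * y\<^sup>2 + 4 * r\<^sup>2 * y\<^sup>2
            + 56 * r ^ 4 * y ^ 3 + 32 * r ^ 3 * y ^ 3 + 32 * r ^ 4 * y ^ 4) \<le> 42 * (v * s ^ 3)"
    proof -
      have "(48 * r ^ 3 + 8 * r\<^sup>2) * (y\<^sup>2 / 2) + 24 * r ^ 4 * y\<^sup>2 + 72 * r ^ 3 * y\<^sup>2 + 4 * r\<^sup>2 * y\<^sup>2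
            + 56 * r ^ 4 * y ^ 3 + 32 * r ^ 3 * y ^ 3 + 32 * r ^ 4 * y ^ 4
          \<le> 112 * (r ^ 4 * y ^ 2) + 128 * (r ^ 3 * y ^ 2) + 8 * (r ^ 2 * y ^ 2)"
      proof -
        have "r ^ 4 * y ^ 3 \<le> r ^ 4 * y ^ 2" "r ^ 4 * y ^ 4 \<le> r ^ 4 * y ^ 2" "r ^ 3 * y ^ 3 \<le> r ^ 3 * y ^ 2"
          using r xy by (auto intro!: mult_left_mono power_decreasing)
        moreover have "(48 * r ^ 3 + 8 * r\<^sup>2) * (y\<^sup>2 / 2) = 24 * (r ^ 3 * y\<^sup>2) + 4 * (r\<^sup>2 * y\<^sup>2)" by (simp add: algebra_simps)
        ultimately show ?thesis by linarith
      qed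
      hence "x ^ 3 / 6 * ((48 * r ^ 3 + 8 * r\<^sup>2) * (y\<^sup>2 / 2) + 24 * r ^ 4 * y\<^sup>2 + 72 * r ^ 3 * y\<^sup>2 + 4 * r\<^sup>2 * y\<^sup>2
            + 56 * r ^ 4 * y ^ 3 + 32 * r ^ 3 * y ^ 3 + 32 * r ^ 4 * y ^ 4)
         \<le> x ^ 3 / 6 * (112 * (r ^ 4 * y ^ 2) + 128 * (r ^ 3 * y ^ 2) + 8 * (r ^ 2 * y ^ 2))"
        using xy by (intro mult_left_mono) auto
      also have "\<dots> = (112 / 6) * ((r * y\<^sup>2) * ((r * x) * ((r * x) * (r * x)))) + (128 / 6) * ((r\<^sup>2 * x\<^sup>2) * ((r * x) * (y * y)))
         + (8 / 6) * ((r\<^sup>2 * x\<^sup>2) * (x * (y * y)))"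
        by (simp add: eval_nat_numeral field_simps)
      also have "\<dots> \<le> (112 / 6) * (v * s ^ 3) + (128 / 6) * (v * s ^ 3) + (8 / 6) * (v * s ^ 3)"
        by (intro add_mono mult_left_mono cx cy RX X Y) auto
      also have "\<dots> \<le> 42 * (v * s ^ 3)" using vp hs by simp
      finally show ?thesis .
    qed
    have f4: "x ^ 4 / 24 * (576 * r ^ 4 * y ^ 1 + 496 * r ^ 3 * y ^ 1 + 16 * r ^ 2 * y ^ 1 + 192 * r ^ 5 * y ^ 2 + 1632 * r ^ 4 * y ^ 2 + 560 * r ^ 3 * y ^ 2 + 8 * r ^ 2 * y ^ 2 + 768 * r ^ 5 * y ^ 3 + 1728 * r ^ 4 * y ^ 3 + 208 * r ^ 3 * y ^ 3 + 976 * r ^ 5 * y ^ 4 + 624 * r ^ 4 * y ^ 4 + 400 * r ^ 5 * y ^ 5) \<le> 400 * (v * s ^ 3)"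
    proof -
      have "576 * r ^ 4 * y ^ 1 + 496 * r ^ 3 * y ^ 1 + 16 * r ^ 2 * y ^ 1 + 192 * r ^ 5 * y ^ 2 + 1632 * r ^ 4 * y ^ 2 + 560 * r ^ 3 * y ^ 2 + 8 * r ^ 2 * y ^ 2 + 768 * r ^ 5 * y ^ 3 + 1728 * r ^ 4 * y ^ 3 + 208 * r ^ 3 * y ^ 3 + 976 * r ^ 5 * y ^ 4 + 624 * r ^ 4 * y ^ 4 + 400 * r ^ 5 * y ^ 5 \<le> 4560 * (r ^ 4 * y ^ 1) + 1264 * (r ^ 3 * y ^ 1) + 24 * (r ^ 2 * y ^ 1) + 2336 * (r ^ 5 * y ^ 2)"
      proof -
        have g0: "r ^ 3 * y ^ 2 \<le> r ^ 3 * y ^ 1" using r xy by (intro mult_left_mono power_decreasing) auto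
        have g1: "r ^ 4 * y ^ 3 \<le> r ^ 4 * y ^ 1" using r xy by (intro mult_left_mono power_decreasing) auto
        have g2: "r ^ 4 * y ^ 2 \<le> r ^ 4 * y ^ 1" using r xy by (intro mult_left_mono power_decreasing) auto
        have g3: "r ^ 5 * y ^ 4 \<le> r ^ 5 * y ^ 2" using r xy by (intro mult_left_mono power_decreasing) auto
        have g4: "r ^ 5 * y ^ 3 \<le> r ^ 5 * y ^ 2" using r xy by (intro mult_left_mono power_decreasing) auto
        have g5: "r ^ 2 * y ^ 2 \<le> r ^ 2 * y ^ 1" using r xy by (intro mult_left_mono power_decreasing) auto
        have g6: "r ^ 3 * y ^ 3 \<le> r ^ 3 * y ^ 1" using r xy by (intro mult_left_mono power_decreasing) auto
        have g7: "r ^ 4 * y ^ 4 \<le> r ^ 4 * y ^ 1" using r xy by (intro mult_left_mono power_decreasing) auto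
        have g8: "r ^ 5 * y ^ 5 \<le> r ^ 5 * y ^ 2" using r xy by (intro mult_left_mono power_decreasing) auto
        show ?thesis using g0 g1 g2 g3 g4 g5 g6 g7 g8 by linarith
      qed
      hence "x ^ 4 / 24 * (576 * r ^ 4 * y ^ 1 + 496 * r ^ 3 * y ^ 1 + 16 * r ^ 2 * y ^ 1 + 192 * r ^ 5 * y ^ 2 + 1632 * r ^ 4 * y ^ 2 + 560 * r ^ 3 * y ^ 2 + 8 * r ^ 2 * y ^ 2 + 768 * r ^ 5 * y ^ 3 + 1728 * r ^ 4 * y ^ 3 + 208 * r ^ 3 * y ^ 3 + 976 * r ^ 5 * y ^ 4 + 624 * r ^ 4 * y ^ 4 + 400 * r ^ 5 * y ^ 5) \<le> x ^ 4 / 24 * (4560 * (r ^ 4 * y ^ 1) + 1264 * (r ^ 3 * y ^ 1) + 24 * (r ^ 2 * y ^ 1) + 2336 * (r ^ 5 * y ^ 2))"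
        using xy by (intro mult_left_mono) auto
      also have "\<dots> = (4560 / 24) * ((r\<^sup>2 * x\<^sup>2) * ((r * x) * ((r * x) * y))) + (1264 / 24) * ((r\<^sup>2 * x\<^sup>2) * ((r * x) * (x * y)))
         + (24 / 24) * ((r\<^sup>2 * x\<^sup>2) * (x * (x * y))) + (2336 / 24) * ((r * y\<^sup>2) * ((r * x) * ((r * x) * (r * x)))) * (r * x)"
        by (simp add: eval_nat_numeral field_simps)
      \<comment> \<open>In the last term a fourth factor r x remains after three of them are spent
        on s^3; it is at most h \<le> 1.\<close>
      also have "\<dots> \<le> (4560 / 24) * (v * s ^ 3) + (1264 / 24) * (v * s ^ 3) + (24 / 24) * (v * s ^ 3) + (2336 / 24) * (v * s ^ 3) * 1"
        using xh h D rx vp hs by (intro add_mono mult_mono mult_left_mono[OF cx] mult_left_mono[OF cy] RX X Y) auto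
      also have "\<dots> \<le> 400 * (v * s ^ 3)" using vp hs by simp
      finally show ?thesis .
    qed
    have F: "norm (\<psi> + z - cell_exponent r \<theta> \<omega>) \<le> 1000 * (v * s ^ 3)"
      using N f0 f1 f2 f3 f4 mult_nonneg_nonneg[OF vp(3) zero_le_power[OF hs(5), of 3]] by linarith
    have nz: "norm (\<psi> + z) \<le> B"
    proof -
      have "400 * e * h ^ n \<le> 400 * 2 * 1" for n
        using e h by (intro mult_mono power_le_one) auto
      from this[of 1] this[of 2] this[of 3] this[of 4]
      have "norm z1 \<le> 800" "norm z2 \<le> 800" "norm z3 \<le> 800" "norm z4 \<le> 800" using nz1 nz2 nz3 nz4 by auto
      hence "norm z \<le> 3200"
        unfolding z_def using norm_triangle_ineq[of "z1 + z2 + z3" z4] norm_triangle_ineq[of "z1 + z2" z3] norm_triangle_ineq[of z1 z2]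
        by linarith
      thus ?thesis using npsi norm_triangle_ineq[of \<psi> z] by (simp add: B_def)
    qed
    have na: "norm (cell_exponent r \<theta> \<omega>) \<le> B"
    proof -
      have "(r * x)\<^sup>2 \<le> 1\<^sup>2" using xh h rx by (intro power_mono) auto
      hence v3: "v \<le> 3" using D by (simp add: v power_mult_distrib)
      have "\<bar>cell_cumulant3 r \<theta> \<omega>\<bar> \<le> 100 * (v * s)"
        using cell_cumulant_bounds(1)[OF r, of \<theta> \<omega>] by (simp add: v_def s_def h_def M_def x_def y_def)
      also have "\<dots> \<le> 100 * (3 * 2)" using v3 hs vp by (intro mult_left_mono mult_mono) auto
      finally have c3': "\<bar>cell_cumulant3 r \<theta> \<omega>\<bar> \<le> 600" by simp
      have "\<bar>cell_cumulant4 r \<theta> \<omega>\<bar> \<le> 1000 * (v * s\<^sup>2)"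
        using cell_cumulant_bounds(2)[OF r, of \<theta> \<omega>] by (simp add: v_def s_def h_def M_def x_def y_def)
      also have "\<dots> \<le> 1000 * (3 * 2\<^sup>2)" using v3 hs vp by (intro mult_left_mono mult_mono power_mono) auto
      finally have c4': "\<bar>cell_cumulant4 r \<theta> \<omega>\<bar> \<le> 12000" by simp
      have "norm (cell_exponent r \<theta> \<omega>) \<le> v / 2 + \<bar>cell_cumulant3 r \<theta> \<omega>\<bar> / 6 + \<bar>cell_cumulant4 r \<theta> \<omega>\<bar> / 24"
        unfolding cell_exponent_def v_def[symmetric] using vp
        by (intro order_trans[OF norm_triangle_ineq] order_trans[OF norm_triangle_ineq4] add_mono) (auto simp: norm_divide norm_mult)
      thus ?thesis using v3 c3' c4' by (simp add: B_def)
    qed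
    have T3: "norm (exp (\<psi> + z) - exp (cell_exponent r \<theta> \<omega>)) \<le> exp (3 * B) * (1000 * (v * s ^ 3))"
      using norm_exp_diff_le[OF nz na] F by (smt (verit) exp_gt_zero mult_left_mono)
    have T2': "norm (exp \<psi> * (\<Sum>j\<le>4. q ^ j / fact j * charlier2_moment R (iexp \<omega>) j 0) - exp (\<psi> + z)) \<le> 1 * (C1 * (800 * (v * s ^ 3)))"
      using norm_mult_le[OF n\<Phi> T2] by (simp add: exp_add right_diff_distrib norm_minus_commute)
    have "norm (cell_cf r \<theta> \<omega> - exp (cell_exponent r \<theta> \<omega>))
      \<le> 700 * (v * s ^ 3) + 1 * (C1 * (800 * (v * s ^ 3))) + exp (3 * B) * (1000 * (v * s ^ 3))"
      by (rule norm_diff_triangle_le[OF norm_diff_triangle_le[OF T1 T2'] T3])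
    thus ?thesis by (simp add: v_def s_def h_def M_def x_def y_def algebra_simps)
  qed
  show ?thesis
    by (rule exI[of _ "700 + 800 * C1 + exp (3 * B) * 1000"]) (use main C1 in \<open>auto intro!: add_pos_nonneg add_nonneg_pos\<close>)
qed

section \<open>Decay of the characteristic function of a cell\<close>

text \<open>Makes Fubini's theorem for product measures applicable to pairs of discrete
  laws.\<close>

lemma pair_pmf_eq_pair_measure:
  fixes A :: "'a::countable pmf" and B :: "'b::countable pmf"
  shows "measure_pmf A \<Otimes>\<^sub>M measure_pmf B = measure_pmf (pair_pmf A B)"
proof (rule pair_measure_eqI)
  have "sets (measure_pmf A \<Otimes>\<^sub>M measure_pmf B) = sets (count_space UNIV \<Otimes>\<^sub>M count_space UNIV)"
    by (intro sets_pair_measure_cong) auto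
  also have "\<dots> = sets (count_space (UNIV \<times> UNIV))"
    by (subst pair_measure_countable) auto
  finally show "sets (measure_pmf A \<Otimes>\<^sub>M measure_pmf B) = sets (measure_pmf (pair_pmf A B))" by simp
  fix X Y
  have "measure_pmf.prob (pair_pmf A B) (X \<times> Y) = measure_pmf.prob A X * measure_pmf.prob B Y"
    by (rule measure_pmf_prob_product) auto
  thus "emeasure A X * emeasure B Y = emeasure (pair_pmf A B) (X \<times> Y)"
    by (simp add: measure_pmf.emeasure_eq_measure ennreal_mult)
qed (rule measure_pmf.sigma_finite_measure_axioms)+

lemma poisson_pmf_add:
  assumes "a > 0" "b > 0"
  shows "map_pmf (\<lambda>(x, y). x + y) (pair_pmf (poisson_pmf a) (poisson_pmf b)) = poisson_pmf (a + b)"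
proof (rule pmf_eqI)
  fix k :: nat
  have eq: "(\<lambda>(x, y). x + y) -` {k} = (\<lambda>i. (i, k - i)) ` {..k::nat}" by (auto simp: image_iff)
  have "pmf (map_pmf (\<lambda>(x, y). x + y) (pair_pmf (poisson_pmf a) (poisson_pmf b))) k
      = (\<Sum>z\<in>(\<lambda>i. (i, k - i)) ` {..k}. pmf (pair_pmf (poisson_pmf a) (poisson_pmf b)) z)"
    unfolding pmf_map eq by (rule measure_measure_pmf_finite) auto
  also have "\<dots> = (\<Sum>i\<le>k. pmf (poisson_pmf a) i * pmf (poisson_pmf b) (k - i))"
    by (subst sum.reindex) (auto simp: inj_on_def pmf_pair)
  also have "\<dots> = (\<Sum>i\<le>k. exp (- (a + b)) / fact k * (of_nat (k choose i) * a ^ i * b ^ (k - i)))"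
    using assms by (intro sum.cong refl) (simp add: binomial_fact exp_minus exp_diff field_simps)
  also have "\<dots> = exp (- (a + b)) / fact k * (a + b) ^ k"
    by (simp add: binomial_ring sum_distrib_left)
  also have "\<dots> = pmf (poisson_pmf (a + b)) k" using assms by simp
  finally show "pmf (map_pmf (\<lambda>(x, y). x + y) (pair_pmf (poisson_pmf a) (poisson_pmf b))) k
     = pmf (poisson_pmf (a + b)) k" .
qed

lemma poisson_cf:
  assumes "r > 0"
  shows "has_bochner_integral (poisson_pmf r) (\<lambda>k. iexp (\<phi> * real k)) (exp (of_real r * (iexp \<phi> - 1)))"
proof -
  have "iexp (\<phi> * real k) = iexp \<phi> ^ k" for k
    by (simp add: exp_of_nat_mult[symmetric] mult_ac)
  thus ?thesis using poisson_generating_function[OF assms, of "iexp \<phi>"] by simp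
qed

lemma norm_poisson_cf:
  "norm (exp (complex_of_real r * (iexp \<phi> - 1))) = exp (- r * (1 - cos \<phi>))"
  by (simp add: Re_exp algebra_simps)

text \<open>
  Splitting \<open>\<xi>\<close> into two independent Poisson halves turns the quadratic phase into a bilinear one,
  so that the Cauchy--Schwarz inequality removes all factors depending on one half only;
  the bound is therefore uniform in the linear coefficient \<open>\<tau>\<close>.
\<close>

lemma poisson_quadratic_phase_bound:
  fixes \<theta> \<tau> r :: real
  assumes r: "r > 0"
  shows "norm (CLINT k | poisson_pmf r. iexp (\<theta> * (real k)\<^sup>2 + \<tau> * real k)) ^ 2
       \<le> 1 - (1 - exp (- r)) * (1 - exp (- r * (1 - cos (2 * \<theta>)))) / 2"
proof -
  define A where "A = poisson_pmf (r / 2)"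
  let ?A = "measure_pmf A"
  interpret P: pair_prob_space ?A ?A ..
  have r2: "r / 2 > 0" using r by simp
  define a where "a = (\<lambda>x::nat. iexp (\<theta> * (real x)\<^sup>2 + \<tau> * real x))"
  have na: "norm (a x) = 1" for x by (simp add: a_def)
  define B where "B = (\<lambda>x::nat. CLINT y | ?A. a y * iexp (2 * \<theta> * real x * real y))"
  have intr: "integrable ?A f" if "\<And>x. \<bar>f x\<bar> \<le> 1" for f :: "nat \<Rightarrow> real"
    by (rule measure_pmf.integrable_const_bound[where B = 1]) (use that in auto)
  have int2: "integrable (?A \<Otimes>\<^sub>M ?A) f" if "\<And>z. norm (f z) \<le> 1" for f :: "nat \<times> nat \<Rightarrow> complex"
    unfolding pair_pmf_eq_pair_measure
    by (rule measure_pmf.integrable_const_bound[where B = 1]) (use that in auto)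
  have nB: "norm (B x) \<le> 1" for x
  proof -
    have "norm (B x) \<le> (\<integral>y. norm (a y * iexp (2 * \<theta> * real x * real y)) \<partial>?A)"
      unfolding B_def by (rule integral_norm_bound)
    also have "\<dots> = 1" by (simp add: norm_mult na)
    finally show ?thesis .
  qed
  have "(CLINT k | poisson_pmf r. iexp (\<theta> * (real k)\<^sup>2 + \<tau> * real k))
      = (CLINT z | pair_pmf A A. iexp (\<theta> * (real (fst z + snd z))\<^sup>2 + \<tau> * real (fst z + snd z)))"
    using poisson_pmf_add[OF r2 r2] unfolding A_def
    by (metis (mono_tags, lifting) field_sum_of_halves integral_map_pmf case_prod_unfold Bochner_Integration.integral_cong)
  also have "\<dots> = (CLINT z | ?A \<Otimes>\<^sub>M ?A. a (fst z) * (a (snd z) * iexp (2 * \<theta> * real (fst z) * real (snd z))))"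
    unfolding pair_pmf_eq_pair_measure a_def
    by (intro Bochner_Integration.integral_cong refl)
      (simp add: exp_add[symmetric] algebra_simps power2_eq_square)
  also have "\<dots> = (CLINT x | ?A. CLINT y | ?A. a x * (a y * iexp (2 * \<theta> * real x * real y)))"
    by (subst P.integral_fst'[symmetric]) (auto intro!: int2 simp: norm_mult na)
  also have "\<dots> = (CLINT x | ?A. a x * B x)"
    by (simp add: B_def)
  finally have eq: "(CLINT k | poisson_pmf r. iexp (\<theta> * (real k)\<^sup>2 + \<tau> * real k)) = (CLINT x | ?A. a x * B x)" .
  have "norm (CLINT x | ?A. a x * B x) \<le> (\<integral>x. norm (a x * B x) \<partial>?A)"
    by (rule integral_norm_bound)
  also have "\<dots> = (\<integral>x. norm (B x) \<partial>?A)" by (simp add: norm_mult na)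
  finally have 1: "norm (CLINT x | ?A. a x * B x) ^ 2 \<le> (\<integral>x. norm (B x) \<partial>?A) ^ 2"
    by (intro power_mono) auto
  \<comment> \<open>The Cauchy-Schwarz inequality, in the form of a nonnegative variance.\<close>
  have "0 \<le> measure_pmf.variance A (\<lambda>x. norm (B x))" by simp
  also have "\<dots> = (\<integral>x. norm (B x) ^ 2 \<partial>?A) - (\<integral>x. norm (B x) \<partial>?A) ^ 2"
    by (intro measure_pmf.variance_eq intr) (auto simp: nB power_le_one)
  finally have 2: "(\<integral>x. norm (B x) \<partial>?A) ^ 2 \<le> (\<integral>x. norm (B x) ^ 2 \<partial>?A)" by simp
  define F where "F = (\<lambda>x z. a (fst z) * cnj (a (snd z)) * iexp (2 * \<theta> * (real (fst z) - real (snd z)) * real x))"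
  have nF: "norm (F x z) = 1" for x z by (simp add: F_def norm_mult na)
  have BF: "of_real (norm (B x) ^ 2) = (CLINT z | pair_pmf A A. F x z)" for x
  proof -
    have "of_real (norm (B x) ^ 2) = B x * cnj (B x)" by (rule complex_norm_square)
    also have "cnj (B x) = (CLINT y | ?A. cnj (a y * iexp (2 * \<theta> * real x * real y)))"
      unfolding B_def by (rule Bochner_Integration.integral_cnj[symmetric])
    also have "B x * \<dots> = (CLINT y | ?A. CLINT y' | ?A. (a y * iexp (2 * \<theta> * real x * real y)) * cnj (a y' * iexp (2 * \<theta> * real x * real y')))"
      by (simp add: B_def)
    also have "\<dots> = (CLINT z | ?A \<Otimes>\<^sub>M ?A. (a (fst z) * iexp (2 * \<theta> * real x * real (fst z))) * cnj (a (snd z) * iexp (2 * \<theta> * real x * real (snd z))))"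
      by (subst P.integral_fst'[symmetric]) (auto intro!: int2 simp: norm_mult na)
    also have "\<dots> = (CLINT z | pair_pmf A A. F x z)"
      unfolding pair_pmf_eq_pair_measure F_def
      by (intro Bochner_Integration.integral_cong refl) (simp add: exp_cnj exp_diff[symmetric] exp_add[symmetric] algebra_simps mult_exp_exp)
    finally show ?thesis .
  qed
  have "complex_of_real (\<integral>x. norm (B x) ^ 2 \<partial>?A) = (CLINT x | ?A. of_real (norm (B x) ^ 2))"
    by (rule integral_complex_of_real[symmetric])
  also have "\<dots> = (CLINT x | ?A. CLINT z | pair_pmf A A. F x z)" by (simp only: BF)
  also have "\<dots> = (CLINT z | pair_pmf A A. CLINT x | ?A. F x z)"
  proof -
    interpret Q: pair_prob_space ?A "measure_pmf (pair_pmf A A)" ..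
    have "integrable (?A \<Otimes>\<^sub>M measure_pmf (pair_pmf A A)) (\<lambda>(x, z). F x z)"
      unfolding pair_pmf_eq_pair_measure
      by (rule measure_pmf.integrable_const_bound[where B = 1]) (auto simp: nF)
    thus ?thesis by (rule Q.Fubini_integral[symmetric])
  qed
  finally have "(\<integral>x. norm (B x) ^ 2 \<partial>?A) \<le> norm (CLINT z | pair_pmf A A. CLINT x | ?A. F x z)"
    by (metis norm_of_real abs_ge_self)
  also have "\<dots> \<le> (\<integral>z. norm (CLINT x | ?A. F x z) \<partial>pair_pmf A A)"
    by (rule integral_norm_bound)
  also have "\<dots> \<le> (\<integral>z. 1 - (1 - exp (- r)) / 2 * (1 - cos (2 * \<theta> * (real (fst z) - real (snd z)))) \<partial>pair_pmf A A)"
  proof (rule integral_mono)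
    show "integrable (pair_pmf A A) (\<lambda>z. norm (CLINT x | ?A. F x z))"
    proof (rule measure_pmf.integrable_const_bound[where B = 1])
      have "norm (CLINT x | ?A. F x z) \<le> 1" for z
        using integral_norm_bound[of ?A "\<lambda>x. F x z"] by (simp add: nF)
      thus "AE z in pair_pmf A A. norm (norm (CLINT x | ?A. F x z)) \<le> 1" by simp
    qed auto
    show "integrable (pair_pmf A A) (\<lambda>z. 1 - (1 - exp (- r)) / 2 * (1 - cos (2 * \<theta> * (real (fst z) - real (snd z)))))"
      by (intro Bochner_Integration.integrable_diff integrable_mult_right measure_pmf.integrable_const_bound[where B = 1]) auto
    fix z :: "nat \<times> nat"
    define \<phi> where "\<phi> = 2 * \<theta> * (real (fst z) - real (snd z))"
    have "(CLINT x | ?A. F x z) = (CLINT x | ?A. (a (fst z) * cnj (a (snd z))) * iexp (\<phi> * real x))"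
      by (simp add: F_def \<phi>_def)
    also have "\<dots> = (a (fst z) * cnj (a (snd z))) * exp (of_real (r / 2) * (iexp \<phi> - 1))"
      using poisson_cf[OF r2, of \<phi>] by (simp add: A_def has_bochner_integral_iff)
    finally have "norm (CLINT x | ?A. F x z) = exp (- (r / 2) * (1 - cos \<phi>))"
      by (simp only: norm_mult na complex_mod_cnj norm_poisson_cf mult_1)
    \<comment> \<open>Convexity of exp on [-r, 0] with the weight (1 - cos \<phi>) / 2 in [0, 1].
      The resulting bound is affine in cos \<phi> and can be averaged exactly.\<close>
    also have "\<dots> = exp ((1 - (1 - cos \<phi>) / 2) * 0 + (1 - cos \<phi>) / 2 * (- r))" by (simp add: field_simps)
    also have "\<dots> \<le> (1 - (1 - cos \<phi>) / 2) * exp 0 + (1 - cos \<phi>) / 2 * exp (- r)"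
      using convex_onD[OF exp_convex, of "(1 - cos \<phi>) / 2" 0 "- r"] cos_ge_minus_one[of \<phi>] by simp
    also have "\<dots> = 1 - (1 - exp (- r)) / 2 * (1 - cos \<phi>)" by (simp add: field_simps)
    finally show "norm (CLINT x | ?A. F x z) \<le> 1 - (1 - exp (- r)) / 2 * (1 - cos (2 * \<theta> * (real (fst z) - real (snd z))))"
      by (simp only: \<phi>_def)
  qed
  also have "\<dots> = 1 - (1 - exp (- r)) / 2 * (1 - (\<integral>z. cos (2 * \<theta> * (real (fst z) - real (snd z))) \<partial>pair_pmf A A))"
  proof -
    have "integrable (pair_pmf A A) (\<lambda>z. cos (2 * \<theta> * (real (fst z) - real (snd z))))"
      by (intro measure_pmf.integrable_const_bound[where B = 1]) auto
    thus ?thesis by simp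
  qed
  \<comment> \<open>By independence this mean is the squared modulus of the characteristic function
    of one half at 2 \<theta>.\<close>
  also have "(\<integral>z. cos (2 * \<theta> * (real (fst z) - real (snd z))) \<partial>pair_pmf A A) = exp (- r * (1 - cos (2 * \<theta>)))"
  proof -
    have "(\<integral>z. cos (2 * \<theta> * (real (fst z) - real (snd z))) \<partial>pair_pmf A A)
        = Re (CLINT z | ?A \<Otimes>\<^sub>M ?A. iexp (2 * \<theta> * real (fst z)) * cnj (iexp (2 * \<theta> * real (snd z))))"
      unfolding pair_pmf_eq_pair_measure
      by (subst integral_Re[symmetric])
        (auto intro!: measure_pmf.integrable_const_bound[where B = 1] Bochner_Integration.integral_cong
           simp: norm_mult Re_exp Im_exp cos_diff right_diff_distrib)
    also have "(CLINT z | ?A \<Otimes>\<^sub>M ?A. iexp (2 * \<theta> * real (fst z)) * cnj (iexp (2 * \<theta> * real (snd z))))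
        = (CLINT x | ?A. CLINT y | ?A. iexp (2 * \<theta> * real x) * cnj (iexp (2 * \<theta> * real y)))"
      by (subst P.integral_fst'[symmetric]) (auto intro!: int2 simp: norm_mult)
    also have "\<dots> = (CLINT x | ?A. iexp (2 * \<theta> * real x)) * cnj (CLINT x | ?A. iexp (2 * \<theta> * real x))"
      by simp
    also have "\<dots> = of_real (norm (CLINT x | ?A. iexp (2 * \<theta> * real x)) ^ 2)"
      by (rule complex_norm_square[symmetric])
    also have "(CLINT x | ?A. iexp (2 * \<theta> * real x)) = exp (of_real (r / 2) * (iexp (2 * \<theta>) - 1))"
      using poisson_cf[OF r2, of "2 * \<theta>"] by (simp add: A_def has_bochner_integral_iff)
    also have "norm (exp (complex_of_real (r / 2) * (iexp (2 * \<theta>) - 1))) ^ 2 = exp (- r * (1 - cos (2 * \<theta>)))"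
      unfolding norm_poisson_cf by (simp add: exp_double[symmetric])
    finally show ?thesis by simp
  qed
  finally have 3: "(\<integral>x. norm (B x) ^ 2 \<partial>?A) \<le> 1 - (1 - exp (- r)) / 2 * (1 - exp (- r * (1 - cos (2 * \<theta>))))" .
  have "(1 - exp (- r)) / 2 * (1 - exp (- r * (1 - cos (2 * \<theta>)))) = (1 - exp (- r)) * (1 - exp (- r * (1 - cos (2 * \<theta>)))) / 2"
    by (rule times_divide_eq_left)
  thus ?thesis using order_trans[OF 1 order_trans[OF 2 3]] unfolding eq by (simp only:)
qed

text \<open>Up to a constant of modulus 1 a cell is a quadratic phase in which \<omega> enters only
  through the linear coefficient, and the bound above is uniform in that coefficient.\<close>

lemma cell_cf_as_quadratic_phase:
  "norm (cell_cf r \<theta> \<omega>) = norm (CLINT k | poisson_pmf r. iexp (\<theta> * (real k)\<^sup>2 + (\<omega> - \<theta> * (2 * r + 1)) * real k))"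
proof -
  have "cell_cf r \<theta> \<omega> = (CLINT k | poisson_pmf r. iexp (\<theta> * r\<^sup>2 - \<omega> * r) *
      iexp (\<theta> * (real k)\<^sup>2 + (\<omega> - \<theta> * (2 * r + 1)) * real k))"
    unfolding cell_cf_def charlier2_def
    by (intro Bochner_Integration.integral_cong refl)
      (simp add: exp_add[symmetric] mult_exp_exp power2_eq_square algebra_simps)
  thus ?thesis by (simp add: norm_mult)
qed

lemma one_minus_exp_ge:
  assumes "0 \<le> (x::real)"
  shows "min 1 x / 2 \<le> 1 - exp (- x)"
proof -
  have "exp (- x) \<le> 1 / (1 + x)"
    using exp_ge_add_one_self[of x] assms by (simp add: exp_minus field_simps)
  moreover have "min 1 x / 2 \<le> 1 - 1 / (1 + x)"
    using assms mult_left_le[of x x] by (auto simp: field_simps min_def)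
  ultimately show ?thesis by linarith
qed

section \<open>Fourier inversion\<close>

lemma char_Pi_pmf_sum:
  fixes f :: "nat \<Rightarrow> nat \<Rightarrow> real" and P :: "nat \<Rightarrow> nat pmf"
  assumes "finite A"
  shows "(CLINT \<xi> | Pi_pmf A d P. iexp (\<Sum>m\<in>A. f m (\<xi> m))) = (\<Prod>m\<in>A. CLINT k | P m. iexp (f m k))"
proof -
  define Q where "Q = Pi_pmf A d P"
  have "prob_space.indep_vars (measure_pmf Q) (\<lambda>_. count_space UNIV) (\<lambda>m \<xi>. \<xi> m :: nat) A"
    unfolding Q_def by (rule indep_vars_Pi_pmf[OF assms])
  hence ind: "prob_space.indep_vars (measure_pmf Q) (\<lambda>_. borel) (\<lambda>m \<xi>. f m (\<xi> m)) A"
    by (rule prob_space.indep_vars_compose2[OF measure_pmf.prob_space_axioms]) auto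
  have c: "char (distr (measure_pmf Q) borel X) 1 = (CLINT \<xi> | Q. iexp (X \<xi>))" for X :: "(nat \<Rightarrow> nat) \<Rightarrow> real"
    unfolding char_def by (subst integral_distr) auto
  have "(CLINT \<xi> | Q. iexp (\<Sum>m\<in>A. f m (\<xi> m))) = (\<Prod>m\<in>A. CLINT \<xi> | Q. iexp (f m (\<xi> m)))"
    using prob_space.char_distr_sum[OF measure_pmf.prob_space_axioms ind, of 1] unfolding c .
  also have "\<dots> = (\<Prod>m\<in>A. CLINT k | P m. iexp (f m k))"
  proof (intro prod.cong refl)
    fix m assume "m \<in> A"
    hence "P m = map_pmf (\<lambda>\<xi>. \<xi> m) Q" using assms by (simp add: Q_def Pi_pmf_component)
    thus "(CLINT \<xi> | Q. iexp (f m (\<xi> m))) = (CLINT k | P m. iexp (f m k))" by simp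
  qed
  finally show ?thesis by (simp add: Q_def)
qed

text \<open>The interval has length 2 a and 2 a c is a multiple of 2 \<pi>, so it consists of whole
  periods.\<close>

lemma integral_iexp_period:
  fixes c a :: real
  assumes a: "a > 0" and j: "c * a = pi * of_int j"
  shows "(CLBINT t. indicator {- a..a} t *\<^sub>R iexp (t * c)) = (if j = 0 then of_real (2 * a) else 0)"
proof (cases "j = 0")
  case True
  hence "c = 0" using a j by simp
  thus ?thesis using True a by (simp add: scaleR_conv_of_real)
next
  case False
  hence c: "c \<noteq> 0" using a j by auto
  define F where "F = (\<lambda>t. iexp (t * c) / (\<i> * of_real c))"
  have "(CLBINT t. indicator {- a..a} t *\<^sub>R iexp (t * c)) = F a - F (- a)"
  proof (rule integral_FTC_atLeastAtMost)
    show "(F has_vector_derivative iexp (t * c)) (at t within {- a..a})" for t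
    proof -
      have "((\<lambda>z. exp (\<i> * (z * of_real c)) / (\<i> * of_real c)) has_field_derivative exp (\<i> * (z * of_real c))) (at z)" for z
        using c by (auto intro!: derivative_eq_intros simp: mult.commute[of _ "\<i>"])
      from has_vector_derivative_real_field[OF this[of "of_real t"]]
      show ?thesis unfolding F_def by simp
    qed
    show "continuous_on {- a..a} (\<lambda>t. iexp (t * c))" by (intro continuous_intros)
  qed (use a in auto)
  also have "\<dots> = 0"
  proof -
    have "sin (a * c) = 0" using j by (simp add: mult.commute)
    hence "iexp (a * c) = iexp (- a * c)"
      by (simp add: complex_eq_iff Re_exp Im_exp)
    thus ?thesis by (simp add: F_def)
  qed
  finally show ?thesis using False by simp
qed

text \<open>Countability of the discrete factor gives joint measurability, and the finite measure of
  B gives integrability.\<close>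

lemma pmf_fubini:
  fixes R :: "'a::countable pmf" and K :: "'a \<Rightarrow> 'b \<Rightarrow> real" and M :: "'b measure"
  assumes [measurable]: "\<And>x. K x \<in> borel_measurable M" and B [measurable]: "B \<in> sets M" and fin: "emeasure M B < \<infinity>"
    and sf: "sigma_finite_measure M"
  shows "(CLINT x | R. CLINT w | M. indicator B w *\<^sub>R iexp (K x w)) = (CLINT w | M. indicator B w *\<^sub>R (CLINT x | R. iexp (K x w)))"
proof -
  interpret M: sigma_finite_measure M by (rule sf)
  interpret pair_sigma_finite "measure_pmf R" M ..
  have meas: "(\<lambda>(x, w). indicator B w *\<^sub>R iexp (K x w)) \<in> borel_measurable (measure_pmf R \<Otimes>\<^sub>M M)"
  proof -
    have "(\<lambda>(x, w). indicator B w *\<^sub>R iexp (K x w)) \<in> borel_measurable (count_space UNIV \<Otimes>\<^sub>M M)"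
      by (rule measurable_pair_measure_countable1) auto
    moreover have "sets (measure_pmf R \<Otimes>\<^sub>M M) = sets (count_space UNIV \<Otimes>\<^sub>M M)"
      by (intro sets_pair_measure_cong) auto
    ultimately show ?thesis by (simp cong: measurable_cong_sets)
  qed
  have "integrable (measure_pmf R \<Otimes>\<^sub>M M) (\<lambda>(x, w). indicator B w *\<^sub>R iexp (K x w))"
  proof (rule Bochner_Integration.integrable_bound)
    have "integrable (measure_pmf R \<Otimes>\<^sub>M M) (indicator (UNIV \<times> B) :: _ \<Rightarrow> real)"
      using fin by (subst integrable_indicator_iff)
        (auto simp: M.emeasure_pair_measure_Times intro!: measurable_sets)
    thus "integrable (measure_pmf R \<Otimes>\<^sub>M M) (\<lambda>z. indicator (UNIV \<times> B) z :: real)" .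
  qed (use meas in \<open>auto intro!: AE_I2 simp: indicator_def split: if_splits\<close>)
  from Fubini_integral[OF this] show ?thesis by simp
qed

lemma pmf_inversion_1:
  fixes R :: "nat pmf"
  assumes \<alpha>: "\<alpha> > 0"
  shows "of_real (2 * pi * \<alpha> * pmf R n) = (CLBINT s. indicator {- (pi * \<alpha>)..pi * \<alpha>} s *\<^sub>R (CLINT k | R. iexp (s * ((real k - real n) / \<alpha>))))"
proof -
  have "(CLBINT s. indicator {- (pi * \<alpha>)..pi * \<alpha>} s *\<^sub>R (CLINT k | R. iexp (s * ((real k - real n) / \<alpha>))))
      = (CLINT k | R. CLBINT s. indicator {- (pi * \<alpha>)..pi * \<alpha>} s *\<^sub>R iexp (s * ((real k - real n) / \<alpha>)))"
    by (rule pmf_fubini[symmetric]) (auto intro: lborel.sigma_finite_measure_axioms simp: emeasure_lborel_Icc_eq)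
  also have "\<dots> = (CLINT k | R. of_real (2 * pi * \<alpha> * indicator {n} k))"
  proof (intro Bochner_Integration.integral_cong refl)
    fix k
    have "(real k - real n) / \<alpha> * (pi * \<alpha>) = pi * of_int (int k - int n)" using \<alpha> by simp
    from integral_iexp_period[OF _ this] \<alpha>
    show "(CLBINT s. indicator {- (pi * \<alpha>)..pi * \<alpha>} s *\<^sub>R iexp (s * ((real k - real n) / \<alpha>))) = of_real (2 * pi * \<alpha> * indicator {n} k)"
      by (auto simp: indicator_def)
  qed
  also have "\<dots> = of_real (2 * pi * \<alpha> * pmf R n)"
    by (subst integral_complex_of_real) (simp add: pmf.rep_eq)
  finally show ?thesis ..
qed

text \<open>Integration over the second variable forces y = n, where the shear with coefficient a
  vanishes. Then x - b is even, so half of the usual interval in the first variable already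
  separates the values of x.\<close>

lemma pmf_inversion_2:
  fixes R :: "(nat \<times> nat) pmf"
  assumes \<alpha>: "\<alpha> > 0" and \<sigma>: "\<sigma> > 0"
    and par: "\<And>x y. (x, y) \<in> set_pmf R \<Longrightarrow> even (int x - int y)" and b: "even (int b - int n)"
  shows "of_real (2 * pi * \<alpha> * (pi * \<sigma>) * pmf R (b, n)) =
    (CLINT w | lborel \<Otimes>\<^sub>M lborel. indicator ({- (pi * \<sigma> / 2)..pi * \<sigma> / 2} \<times> {- (pi * \<alpha>)..pi * \<alpha>}) w *\<^sub>R
      (CLINT z | R. iexp (fst w / \<sigma> * (real (fst z) - real b - a * (real (snd z) - real n)) + snd w / \<alpha> * (real (snd z) - real n))))"
    (is "_ = (CLINT w | _. indicator ?B w *\<^sub>R (CLINT z | R. iexp (?K z w)))")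
proof -
  let ?T = "{- (pi * \<sigma> / 2)..pi * \<sigma> / 2}" and ?S = "{- (pi * \<alpha>)..pi * \<alpha>}"
  have fin: "emeasure (lborel \<Otimes>\<^sub>M lborel) ?B < \<infinity>"
    using \<alpha> \<sigma> by (subst lborel.emeasure_pair_measure_Times) (auto simp: ennreal_mult_less_top emeasure_lborel_Icc_eq)
  have "(CLINT w | lborel \<Otimes>\<^sub>M lborel. indicator ?B w *\<^sub>R (CLINT z | R. iexp (?K z w)))
      = (CLINT z | R. CLINT w | lborel \<Otimes>\<^sub>M lborel. indicator ?B w *\<^sub>R iexp (?K z w))"
  proof (intro pmf_fubini[symmetric])
    show "sigma_finite_measure (lborel \<Otimes>\<^sub>M lborel :: (real \<times> real) measure)"
      unfolding lborel_prod by (rule lborel.sigma_finite_measure_axioms)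
  qed (use fin in auto)
  also have "\<dots> = (CLINT z | R. of_real (2 * pi * \<alpha> * (pi * \<sigma>) * indicator {(b, n)} z))"
  proof (intro integral_cong_AE AE_pmfI)
    fix z assume z: "z \<in> set_pmf R"
    define x y where "x = fst z" and "y = snd z"
    define A where "A = (real x - real b - a * (real y - real n)) / \<sigma>"
    define B where "B = (real y - real n) / \<alpha>"
    have K: "?K z w = fst w * A + snd w * B" for w by (simp add: A_def B_def x_def y_def)
    have "integrable (lborel \<Otimes>\<^sub>M lborel) (\<lambda>w. indicator ?B w *\<^sub>R iexp (fst w * A + snd w * B))"
    proof (rule Bochner_Integration.integrable_bound)
      show "integrable (lborel \<Otimes>\<^sub>M lborel) (\<lambda>w. indicator ?B w :: real)"
        using fin by (subst integrable_indicator_iff) auto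
    qed (auto split: split_indicator)
    hence "(CLINT w | lborel \<Otimes>\<^sub>M lborel. indicator ?B w *\<^sub>R iexp (fst w * A + snd w * B))
       = (CLBINT t. CLBINT s. indicator ?B (t, s) *\<^sub>R iexp (t * A + s * B))"
      by (subst lborel_pair.integral_fst'[symmetric]) auto
    also have "\<dots> = (CLBINT t. CLBINT s. (indicator ?T t *\<^sub>R iexp (t * A)) * (indicator ?S s *\<^sub>R iexp (s * B)))"
      by (intro Bochner_Integration.integral_cong refl) (auto simp: exp_add distrib_left split: split_indicator)
    also have "\<dots> = (CLBINT t. indicator ?T t *\<^sub>R iexp (t * A)) * (CLBINT s. indicator ?S s *\<^sub>R iexp (s * B))"
      by (simp only: integral_mult_right_zero integral_mult_left_zero)
    also have "(CLBINT s. indicator ?S s *\<^sub>R iexp (s * B)) = (if int y - int n = 0 then of_real (2 * (pi * \<alpha>)) else 0)"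
      by (rule integral_iexp_period) (use \<alpha> in \<open>auto simp: B_def\<close>)
    also have "(CLBINT t. indicator ?T t *\<^sub>R iexp (t * A)) * \<dots> = of_real (2 * pi * \<alpha> * (pi * \<sigma>) * indicator {(b, n)} z)"
    proof (cases "y = n")
      case True
      have "even (int x - int y)" using par z by (simp add: x_def y_def)
      with b True have "even (int x - int b)" by presburger
      then obtain k where k: "int x - int b = 2 * k" by (elim evenE)
      have "real x - real b = 2 * of_int k" using k by linarith
      hence "A * (pi * \<sigma> / 2) = pi * of_int k" using \<sigma> True by (simp add: A_def field_simps)
      from integral_iexp_period[OF _ this] \<sigma>
      have "(CLBINT t. indicator ?T t *\<^sub>R iexp (t * A)) = (if k = 0 then of_real (pi * \<sigma>) else 0)" by simp
      moreover have "k = 0 \<longleftrightarrow> x = b" using k by auto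
      moreover have "z = (b, n) \<longleftrightarrow> x = b" using True by (auto simp: x_def y_def prod_eq_iff)
      ultimately show ?thesis using True by (auto simp: indicator_def)
    next
      case False
      hence "z \<noteq> (b, n)" by (auto simp: y_def)
      thus ?thesis using False by simp
    qed
    finally show "(CLINT w | lborel \<Otimes>\<^sub>M lborel. indicator ?B w *\<^sub>R iexp (?K z w)) = of_real (2 * pi * \<alpha> * (pi * \<sigma>) * indicator {(b, n)} z)"
      unfolding K .
  qed auto
  also have "\<dots> = of_real (2 * pi * \<alpha> * (pi * \<sigma>) * pmf R (b, n))"
    by (subst integral_complex_of_real) (simp add: pmf.rep_eq)
  finally show ?thesis ..
qed

section \<open>The multinomial law inside a Poisson vector\<close>

definition count_vectors :: "nat \<Rightarrow> nat \<Rightarrow> (nat \<Rightarrow> nat) set" where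
  "count_vectors n N = {\<eta>. (\<forall>m. m \<notin> {1..N} \<longrightarrow> \<eta> m = 0) \<and> (\<Sum>m=1..N. \<eta> m) = n}"

lemma finite_count_vectors: "finite (count_vectors n N)"
proof (rule finite_subset)
  show "count_vectors n N \<subseteq> {f. \<forall>x. (x \<in> {1..N} \<longrightarrow> f x \<in> {..n}) \<and> (x \<notin> {1..N} \<longrightarrow> f x = 0)}"
  proof
    fix \<eta> assume "\<eta> \<in> count_vectors n N"
    moreover from this have "\<eta> m \<le> n" if "m \<in> {1..N}" for m
      using member_le_sum[of m "{1..N}" \<eta>] that by (auto simp: count_vectors_def)
    ultimately show "\<eta> \<in> {f. \<forall>x. (x \<in> {1..N} \<longrightarrow> f x \<in> {..n}) \<and> (x \<notin> {1..N} \<longrightarrow> f x = 0)}"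
      by (auto simp: count_vectors_def)
  qed
  show "finite {f. \<forall>x. (x \<in> {1..N} \<longrightarrow> f x \<in> {..n}) \<and> (x \<notin> {1..N} \<longrightarrow> f x = (0::nat))}"
    by (rule finite_set_of_finite_funs) auto
qed

definition occupancy_pmf :: "nat \<Rightarrow> nat \<Rightarrow> (nat \<Rightarrow> real) \<Rightarrow> (nat \<times> nat) pmf" where
  "occupancy_pmf n N p = map_pmf (\<lambda>\<xi>. ((\<Sum>m=1..N. (\<xi> m)\<^sup>2), (\<Sum>m=1..N. \<xi> m))) (poisson_vec n N p)"

text \<open>On a count vector the Poisson weights multiply to its multinomial weight times the
  Poisson weight of n, since the powers of n and the exponentials depend only on the totals.\<close>

lemma multinomial_as_conditioned_poisson:
  assumes n: "n \<ge> 1" and p: "\<And>m. m \<in> {1..N} \<Longrightarrow> p m > 0" "(\<Sum>m=1..N. p m) = 1"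
  shows "measure_pmf.prob (multinomial_pmf n N p) {\<eta>. (\<Sum>m=1..N. (\<eta> m)\<^sup>2) = b} * pmf (poisson_pmf (real n)) n
    = pmf (occupancy_pmf n N p) (b, n)"
proof -
  let ?V = "{\<eta> \<in> count_vectors n N. (\<Sum>m=1..N. (\<eta> m)\<^sup>2) = b}"
  have fin: "finite ?V" using finite_count_vectors by simp
  have pe: "pmf (poisson_vec n N p) \<eta> = pmf (multinomial_pmf n N p) \<eta> * pmf (poisson_pmf (real n)) n" if "\<eta> \<in> ?V" for \<eta>
  proof -
    have \<eta>: "\<And>m. m \<notin> {1..N} \<Longrightarrow> \<eta> m = 0" "(\<Sum>m=1..N. \<eta> m) = n" using that by (auto simp: count_vectors_def)
    have "pmf (poisson_vec n N p) \<eta> = (\<Prod>m=1..N. pmf (poisson_pmf (lam_cell n p m)) (\<eta> m))"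
      unfolding poisson_vec_def using \<eta>(1) by (subst pmf_Pi) auto
    also have "\<dots> = (\<Prod>m=1..N. real n ^ \<eta> m * p m ^ \<eta> m / fact (\<eta> m) * exp (- (real n * p m)))"
      using n p by (intro prod.cong refl) (simp add: lam_cell_def power_mult_distrib)
    also have "\<dots> = (\<Prod>m=1..N. real n ^ \<eta> m) * (\<Prod>m=1..N. p m ^ \<eta> m) / (\<Prod>m=1..N. fact (\<eta> m)) * (\<Prod>m=1..N. exp (- (real n * p m)))"
      by (simp add: prod.distrib prod_dividef)
    also have "(\<Prod>m=1..N. real n ^ \<eta> m) = real n ^ n" by (simp only: power_sum[symmetric] \<eta>(2))
    also have "(\<Prod>m=1..N. exp (- (real n * p m))) = exp (- real n)"
      by (simp add: exp_sum[symmetric] sum_negf sum_distrib_left[symmetric] p(2) del: One_nat_def)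
    finally show ?thesis using n pmf_multinomial[OF p \<eta>] by simp
  qed
  \<comment> \<open>The multinomial law is carried by the finite set of count vectors, so the
    probability is a finite sum.\<close>
  have "measure_pmf.prob (multinomial_pmf n N p) {\<eta>. (\<Sum>m=1..N. (\<eta> m)\<^sup>2) = b} = measure_pmf.prob (multinomial_pmf n N p) ?V"
  proof (rule measure_pmf.finite_measure_eq_AE[OF AE_pmfI])
    fix \<eta> assume "\<eta> \<in> set_pmf (multinomial_pmf n N p)"
    then obtain xs where xs: "length xs = n" "set xs \<subseteq> set_pmf (cell_pmf N p)" "\<eta> = count_list xs"
      by (auto simp: multinomial_pmf_def set_replicate_pmf lists_eq_set)
    have "set xs \<subseteq> {1..N}" using xs(2) pmf_cell[OF p] by (auto simp: set_pmf_eq split: if_splits)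
    hence "\<eta> \<in> count_vectors n N"
      using sum_count_set[of xs "{1..N}"] xs by (auto simp: count_vectors_def count_list_0_iff subset_iff)
    thus "(\<eta> \<in> {\<eta>. (\<Sum>m=1..N. (\<eta> m)\<^sup>2) = b}) = (\<eta> \<in> ?V)" by auto
  qed auto
  also have "\<dots> = (\<Sum>\<eta>\<in>?V. pmf (multinomial_pmf n N p) \<eta>)" by (rule measure_measure_pmf_finite[OF fin])
  finally have "measure_pmf.prob (multinomial_pmf n N p) {\<eta>. (\<Sum>m=1..N. (\<eta> m)\<^sup>2) = b} * pmf (poisson_pmf (real n)) n
      = (\<Sum>\<eta>\<in>?V. pmf (poisson_vec n N p) \<eta>)"
    using pe by (simp add: sum_distrib_right)
  also have "\<dots> = measure_pmf.prob (poisson_vec n N p) ?V" by (rule measure_measure_pmf_finite[OF fin, symmetric])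
  also have "\<dots> = pmf (occupancy_pmf n N p) (b, n)"
    unfolding occupancy_pmf_def pmf_map
  proof (rule measure_pmf.finite_measure_eq_AE[OF AE_pmfI])
    fix \<xi> assume "\<xi> \<in> set_pmf (poisson_vec n N p)"
    hence "\<forall>m. m \<notin> {1..N} \<longrightarrow> \<xi> m = 0" using set_Pi_pmf_subset[of "{1..N}" 0] by (auto simp: poisson_vec_def)
    thus "(\<xi> \<in> ?V) = (\<xi> \<in> (\<lambda>\<xi>. ((\<Sum>m=1..N. (\<xi> m)\<^sup>2), (\<Sum>m=1..N. \<xi> m))) -` {(b, n)})" by (auto simp: count_vectors_def)
  qed auto
  finally show ?thesis .
qed

text \<open>Half the coefficient of \<xi> - r that is left in \<open>g_stat\<close> once
  \<open>charlier2\<close> is split off. As n P_2 is the mean of the cell means under the weights p,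
  this is a centred quantity.\<close>

definition cell_dev :: "nat \<Rightarrow> nat \<Rightarrow> (nat \<Rightarrow> real) \<Rightarrow> nat \<Rightarrow> real" where
  "cell_dev n N p m = lam_cell n p m - real n * power_sum N p 2"

definition joint_cf :: "nat \<Rightarrow> nat \<Rightarrow> (nat \<Rightarrow> real) \<Rightarrow> real \<Rightarrow> real \<Rightarrow> complex" where
  "joint_cf n N p \<theta> \<tau> = (\<Prod>m=1..N. cell_cf (lam_cell n p m) \<theta> (\<tau> + 2 * \<theta> * cell_dev n N p m))"

text \<open>The exponent is additive over the cells, and in each cell it is a combination of
  \<open>charlier2\<close> and \<xi> - r; the constants add up to \<open>Lambda\<close>.\<close>

lemma occupancy_cf:
  assumes p: "(\<Sum>m=1..N. p m) = 1"
  shows "(CLINT z | occupancy_pmf n N p. iexp (\<theta> * (real (fst z) - real b - (2 * real n * power_sum N p 2 + 1) * (real (snd z) - real n)) + \<tau> * (real (snd z) - real n)))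
    = iexp (- (\<theta> * (real b - Lambda n N p))) * joint_cf n N p \<theta> \<tau>"
proof -
  let ?l = "lam_cell n p" and ?P = "power_sum N p 2"
  let ?f = "\<lambda>m k. \<theta> * charlier2 (?l m) k + (\<tau> + 2 * \<theta> * cell_dev n N p m) * (real k - ?l m)"
  have s1: "(\<Sum>m=1..N. ?l m) = real n" using p by (simp add: lam_cell_def sum_distrib_left[symmetric] del: One_nat_def)
  have s2: "(\<Sum>m=1..N. (?l m)\<^sup>2) = (real n)\<^sup>2 * ?P" by (simp add: lam_cell_def power_sum_def power_mult_distrib sum_distrib_left)
  have id: "\<theta> * (real (\<Sum>m=1..N. (\<xi> m)\<^sup>2) - real b - (2 * real n * ?P + 1) * (real (\<Sum>m=1..N. \<xi> m) - real n)) + \<tau> * (real (\<Sum>m=1..N. \<xi> m) - real n)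
     = - (\<theta> * (real b - Lambda n N p)) + (\<Sum>m=1..N. ?f m (\<xi> m))" for \<xi> :: "nat \<Rightarrow> nat"
  proof -
    define X S where "X = (\<Sum>m=1..N. (real (\<xi> m))\<^sup>2)" and "S = (\<Sum>m=1..N. real (\<xi> m))"
    have "?f m k = \<theta> * (real k)\<^sup>2 - \<theta> * (?l m)\<^sup>2 + (\<tau> - \<theta> - 2 * \<theta> * real n * ?P) * real k - (\<tau> - 2 * \<theta> * real n * ?P) * ?l m" for m k
      unfolding charlier2_def cell_dev_def by (simp add: power2_eq_square algebra_simps)
    hence "(\<Sum>m=1..N. ?f m (\<xi> m)) = \<theta> * X - \<theta> * ((real n)\<^sup>2 * ?P) + (\<tau> - \<theta> - 2 * \<theta> * real n * ?P) * S - (\<tau> - 2 * \<theta> * real n * ?P) * real n"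
      by (simp add: sum.distrib sum_subtractf sum_distrib_left[symmetric] X_def S_def s1 s2 del: One_nat_def)
    moreover have "real (\<Sum>m=1..N. (\<xi> m)\<^sup>2) = X" "real (\<Sum>m=1..N. \<xi> m) = S" by (simp_all add: X_def S_def)
    ultimately show ?thesis by (simp add: Lambda_def power2_eq_square algebra_simps)
  qed
  have "(CLINT z | occupancy_pmf n N p. iexp (\<theta> * (real (fst z) - real b - (2 * real n * ?P + 1) * (real (snd z) - real n)) + \<tau> * (real (snd z) - real n)))
     = (CLINT \<xi> | poisson_vec n N p. iexp (- (\<theta> * (real b - Lambda n N p)) + (\<Sum>m=1..N. ?f m (\<xi> m))))"
    unfolding occupancy_pmf_def integral_map_pmf fst_conv snd_conv id ..
  also have "\<dots> = (CLINT \<xi> | poisson_vec n N p. iexp (- (\<theta> * (real b - Lambda n N p))) * iexp (\<Sum>m=1..N. ?f m (\<xi> m)))"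
    by (simp only: of_real_add distrib_left exp_add)
  also have "\<dots> = iexp (- (\<theta> * (real b - Lambda n N p))) * (CLINT \<xi> | poisson_vec n N p. iexp (\<Sum>m=1..N. ?f m (\<xi> m)))"
    by (rule integral_mult_right_zero)
  also have "(CLINT \<xi> | poisson_vec n N p. iexp (\<Sum>m=1..N. ?f m (\<xi> m))) = joint_cf n N p \<theta> \<tau>"
    unfolding poisson_vec_def joint_cf_def cell_cf_def by (rule char_Pi_pmf_sum) simp
  finally show ?thesis .
qed

lemma sqrt_2_pi_mult: "sqrt (2 * pi) * sqrt (2 * pi * x) = 2 * pi * sqrt x"
proof -
  have "sqrt (2 * pi) * sqrt (2 * pi * x) = (sqrt (2 * pi) * sqrt (2 * pi)) * sqrt x"
    unfolding real_sqrt_mult[of "2 * pi" x] by (rule mult.assoc[symmetric])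
  also have "sqrt (2 * pi) * sqrt (2 * pi) = 2 * pi" by (rule real_sqrt_mult_self[THEN trans]) simp
  finally show ?thesis .
qed

text \<open>The probability that the Poisson total equals n, relative to its Gaussian approximation
  1 / sqrt(2 \<pi> n).\<close>

definition stirling_ratio :: "nat \<Rightarrow> real" where
  "stirling_ratio n = sqrt (2 * pi * real n) * pmf (poisson_pmf (real n)) n"

definition inversion_box :: "nat \<Rightarrow> nat \<Rightarrow> (nat \<Rightarrow> real) \<Rightarrow> (real \<times> real) set" where
  "inversion_box n N p = {- (pi * sigma_N n N p / 2)..pi * sigma_N n N p / 2} \<times> {- (pi * sqrt n)..pi * sqrt n}"

text \<open>The factor 2 \<pi> sqrt(2 \<pi>) is the one by which the plane integral of the Gaussian
  integrand exceeds the normal density at u.\<close>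

lemma multinomial_inversion:
  assumes n: "n \<ge> 1" and p: "\<And>m. m \<in> {1..N} \<Longrightarrow> p m > 0" "(\<Sum>m=1..N. p m) = 1"
    and \<sigma>: "sigma_N n N p > 0" and b: "b = n + 2 * k"
  shows "of_real (2 * pi * sqrt (2 * pi) * stirling_ratio n * (sigma_N n N p / 2 *
      measure_pmf.prob (multinomial_pmf n N p) {\<eta>. (\<Sum>m=1..N. (\<eta> m)\<^sup>2) = b}))
    = (CLINT w | lborel \<Otimes>\<^sub>M lborel. indicator (inversion_box n N p) w *\<^sub>R
        (iexp (- (fst w * ((real b - Lambda n N p) / sigma_N n N p))) * joint_cf n N p (fst w / sigma_N n N p) (snd w / sqrt n)))"
proof -
  have par: "even (int x - int y)" if "(x, y) \<in> set_pmf (occupancy_pmf n N p)" for x y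
  proof -
    from that have "(x, y) \<in> (\<lambda>\<xi>. ((\<Sum>m=1..N. (\<xi> m)\<^sup>2), (\<Sum>m=1..N. \<xi> m))) ` set_pmf (poisson_vec n N p)"
      unfolding occupancy_pmf_def set_map_pmf .
    then obtain \<xi> where "(x, y) = ((\<Sum>m=1..N. (\<xi> m)\<^sup>2), (\<Sum>m=1..N. \<xi> m))" by (elim imageE)
    hence \<xi>: "x = (\<Sum>m=1..N. (\<xi> m)\<^sup>2)" "y = (\<Sum>m=1..N. \<xi> m)" by simp_all
    have "int x - int y = (\<Sum>m=1..N. int (\<xi> m) * (int (\<xi> m) - 1))"
      unfolding \<xi> by (simp add: sum_subtractf power2_eq_square algebra_simps)
    also have "even \<dots>" by (intro dvd_sum) auto
    finally show ?thesis .
  qed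
  note sq = sqrt_2_pi_mult[of "real n"]
  have mc: "measure_pmf.prob (multinomial_pmf n N p) {\<eta>. (\<Sum>m=1..N. (\<eta> m)\<^sup>2) = b} * pmf (poisson_pmf (real n)) n
      = pmf (occupancy_pmf n N p) (b, n)"
    by (rule multinomial_as_conditioned_poisson) (use n p in auto)
  have "2 * pi * sqrt (2 * pi) * stirling_ratio n * (sigma_N n N p / 2 *
      measure_pmf.prob (multinomial_pmf n N p) {\<eta>. (\<Sum>m=1..N. (\<eta> m)\<^sup>2) = b})
    = pi * sigma_N n N p * (sqrt (2 * pi) * sqrt (2 * pi * real n)) * (measure_pmf.prob (multinomial_pmf n N p) {\<eta>. (\<Sum>m=1..N. (\<eta> m)\<^sup>2) = b} * pmf (poisson_pmf (real n)) n)"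
    by (simp add: stirling_ratio_def)
  also have "\<dots> = 2 * pi * sqrt n * (pi * sigma_N n N p) * pmf (occupancy_pmf n N p) (b, n)"
    unfolding sq mc by (simp only: mult_ac)
  finally have "of_real (2 * pi * sqrt (2 * pi) * stirling_ratio n * (sigma_N n N p / 2 *
      measure_pmf.prob (multinomial_pmf n N p) {\<eta>. (\<Sum>m=1..N. (\<eta> m)\<^sup>2) = b}))
     = complex_of_real (2 * pi * sqrt n * (pi * sigma_N n N p) * pmf (occupancy_pmf n N p) (b, n))" by (rule arg_cong)
  also have "\<dots> = (CLINT w | lborel \<Otimes>\<^sub>M lborel. indicator (inversion_box n N p) w *\<^sub>R
      (CLINT z | occupancy_pmf n N p. iexp (fst w / sigma_N n N p * (real (fst z) - real b - (2 * real n * power_sum N p 2 + 1) * (real (snd z) - real n)) + snd w / sqrt n * (real (snd z) - real n))))"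
    unfolding inversion_box_def
    by (rule pmf_inversion_2) (use n \<sigma> par b in auto)
  finally show ?thesis unfolding occupancy_cf[OF p(2)] by (simp only: times_divide_eq_left times_divide_eq_right)
qed

lemma joint_cf_0:
  assumes n: "n \<ge> 1" and p: "\<And>m. m \<in> {1..N} \<Longrightarrow> p m > 0" "(\<Sum>m=1..N. p m) = 1"
  shows "joint_cf n N p 0 \<tau> = (CLINT k | poisson_pmf (real n). iexp (\<tau> * (real k - real n)))"
proof -
  have "joint_cf n N p 0 \<tau> = (\<Prod>m=1..N. centered_poisson_cf (lam_cell n p m) \<tau>)"
    unfolding joint_cf_def
  proof (intro prod.cong refl)
    fix m assume "m \<in> {1..N}"
    hence "lam_cell n p m > 0" using n p by (simp add: lam_cell_def)
    from centered_poisson_cf[OF this, of \<tau>]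
    show "cell_cf (lam_cell n p m) 0 (\<tau> + 2 * 0 * cell_dev n N p m) = centered_poisson_cf (lam_cell n p m) \<tau>"
      by (simp add: cell_cf_def has_bochner_integral_iff)
  qed
  also have "\<dots> = exp (\<Sum>m=1..N. of_real (lam_cell n p m) * (iexp \<tau> - 1 - \<i> * of_real \<tau>))"
    by (simp add: centered_poisson_cf_def exp_sum)
  also have "(\<Sum>m=1..N. of_real (lam_cell n p m) * (iexp \<tau> - 1 - \<i> * of_real \<tau>)) = of_real (\<Sum>m=1..N. lam_cell n p m) * (iexp \<tau> - 1 - \<i> * of_real \<tau>)"
    by (simp add: sum_distrib_right)
  also have "(\<Sum>m=1..N. lam_cell n p m) = real n" using p by (simp add: lam_cell_def sum_distrib_left[symmetric] del: One_nat_def)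
  also have "exp (of_real (real n) * (iexp \<tau> - 1 - \<i> * of_real \<tau>)) = (CLINT k | poisson_pmf (real n). iexp (\<tau> * (real k - real n)))"
    using centered_poisson_cf[of "real n" \<tau>] n by (simp add: centered_poisson_cf_def has_bochner_integral_iff)
  finally show ?thesis .
qed

text \<open>The denominator is an inversion integral of the same \<open>joint_cf\<close>, taken on
  the line \<theta> = 0, so that the pointwise estimates for the numerator serve for it as
  well.\<close>

lemma stirling_ratio_inversion:
  assumes n: "n \<ge> 1" and p: "\<And>m. m \<in> {1..N} \<Longrightarrow> p m > 0" "(\<Sum>m=1..N. p m) = 1"
  shows "of_real (sqrt (2 * pi) * stirling_ratio n) = (CLBINT s. indicator {- (pi * sqrt n)..pi * sqrt n} s *\<^sub>R joint_cf n N p 0 (s / sqrt n))"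
proof -
  have "sqrt (2 * pi) * stirling_ratio n = 2 * pi * sqrt n * pmf (poisson_pmf (real n)) n"
    unfolding stirling_ratio_def mult.assoc[symmetric] sqrt_2_pi_mult[unfolded mult.assoc[symmetric]] ..
  hence "of_real (sqrt (2 * pi) * stirling_ratio n) = complex_of_real (2 * pi * sqrt n * pmf (poisson_pmf (real n)) n)" by (rule arg_cong)
  also have "\<dots> = (CLBINT s. indicator {- (pi * sqrt n)..pi * sqrt n} s *\<^sub>R (CLINT k | poisson_pmf (real n). iexp (s * ((real k - real n) / sqrt n))))"
    by (rule pmf_inversion_1) (use n in auto)
  also have "\<dots> = (CLBINT s. indicator {- (pi * sqrt n)..pi * sqrt n} s *\<^sub>R joint_cf n N p 0 (s / sqrt n))"
  proof -
    have "joint_cf n N p 0 \<tau> = (CLINT k | poisson_pmf (real n). iexp (\<tau> * (real k - real n)))" for \<tau>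
      by (rule joint_cf_0) (use n p in auto)
    thus ?thesis by (simp only: times_divide_eq_left times_divide_eq_right)
  qed
  finally show ?thesis .
qed

section \<open>Uniqueness of the Fourier--Stieltjes transform\<close>

lemma interval_measure_shift: "interval_measure (\<lambda>x. F x - c) = interval_measure F"
  unfolding interval_measure_def by simp

lemma mono_bounded_limits:
  fixes A :: "real \<Rightarrow> real"
  assumes "mono A" "bounded (range A)"
  obtains l L where "(A \<longlongrightarrow> l) at_bot" "(A \<longlongrightarrow> L) at_top" "l \<le> L"
proof -
  have bd: "bdd_below (range A)" "bdd_above (range A)"
    using assms(2) bounded_imp_bdd_below bounded_imp_bdd_above by auto
  define l L where "l = Inf (range A)" and "L = Sup (range A)"
  have le: "l \<le> A x" "A x \<le> L" for x
    using bd by (auto simp: l_def L_def intro!: cInf_lower cSup_upper)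
  have "(A \<longlongrightarrow> l) at_bot"
  proof (rule order_tendstoI)
    show "\<forall>\<^sub>F x in at_bot. a < A x" if "a < l" for a
      using le(1) that by (intro always_eventually allI) (meson less_le_trans)
    show "\<forall>\<^sub>F x in at_bot. A x < a" if a: "l < a" for a
    proof -
      obtain y where "A y < a" using cInf_lessD[of "range A" a] a by (auto simp: l_def)
      moreover have "A x \<le> A y" if "x \<le> y" for x using assms(1) that by (rule monoD)
      ultimately show ?thesis unfolding eventually_at_bot_linorder by (meson le_less_trans)
    qed
  qed
  moreover have "(A \<longlongrightarrow> L) at_top"
  proof (rule order_tendstoI)
    show "\<forall>\<^sub>F x in at_top. A x < a" if "L < a" for a
      using le(2) that by (intro always_eventually allI) (meson le_less_trans)
    show "\<forall>\<^sub>F x in at_top. a < A x" if a: "a < L" for a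
    proof -
      obtain y where "a < A y" using less_cSupD[of "range A" a] a by (auto simp: L_def)
      moreover have "A y \<le> A x" if "y \<le> x" for x using assms(1) that by (rule monoD)
      ultimately show ?thesis unfolding eventually_at_top_linorder by (meson less_le_trans)
    qed
  qed
  moreover have "l \<le> L" using le[of 0] by linarith
  ultimately show ?thesis by (rule that)
qed

text \<open>The kernel of Levy's inversion formula. At t = 0 division by zero gives 0, which alters
  the integrals only on a null set.\<close>

definition levy_kernel :: "real \<Rightarrow> real \<Rightarrow> real \<Rightarrow> complex" where
  "levy_kernel a b t = (iexp (- (t * a)) - iexp (- (t * b))) / (\<i> * t)"

lemma norm_levy_kernel_le:
  assumes "a \<le> b"
  shows "norm (levy_kernel a b t) \<le> b - a"
proof (cases "t = 0")
  case False
  have "levy_kernel a b t = (iexp (t * (- a)) - iexp (t * (- b))) / (\<i> * t)" by (simp add: levy_kernel_def)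
  thus ?thesis using Levy_Inversion_aux2[of "- b" "- a" t] False assms by simp
qed (use assms in \<open>simp add: levy_kernel_def\<close>)

lemma levy_kernel_measurable [measurable]: "levy_kernel a b \<in> borel_measurable borel"
  unfolding levy_kernel_def by measurable

text \<open>Levy's inversion for probability laws, transferred by scaling with the total mass m. If
  m = 0, the transform vanishes and A is constant.\<close>

lemma interval_measure_inversion:
  fixes A :: "real \<Rightarrow> real"
  assumes A: "mono A" "bounded (range A)" "\<And>u. continuous (at_right u) A"
  defines "M \<equiv> interval_measure A"
  defines "\<phi> \<equiv> \<lambda>t. CLINT u | M. iexp (t * u)"
  shows "countable {x. measure M {x} > 0}"
    and "complex_interval_lebesgue_integrable lborel (ereal (- c)) (ereal c) (\<lambda>t. levy_kernel a b t * \<phi> t)"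
    and "a \<le> b \<Longrightarrow> measure M {a} = 0 \<Longrightarrow> measure M {b} = 0 \<Longrightarrow>
      (\<lambda>T::nat. 1 / (2 * pi) * (CLBINT t=- real T..real T. levy_kernel a b t * \<phi> t)) \<longlonglongrightarrow> of_real (A b - A a)"
proof -
  obtain l L where l: "(A \<longlongrightarrow> l) at_bot" and L: "(A \<longlongrightarrow> L) at_top" and lL: "l \<le> L"
    using mono_bounded_limits[OF A(1,2)] .
  define A' where "A' = (\<lambda>x. A x - l)"
  define m where "m = L - l"
  have M: "M = interval_measure A'" by (simp add: M_def A'_def interval_measure_shift)
  have mono': "A' x \<le> A' y" if "x \<le> y" for x y using monoD[OF A(1) that] by (simp add: A'_def)
  have rc': "continuous (at_right u) A'" for u unfolding A'_def by (intro continuous_intros A)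
  have l': "(A' \<longlongrightarrow> 0) at_bot" unfolding A'_def using tendsto_diff[OF l tendsto_const[of l]] by simp
  have L': "(A' \<longlongrightarrow> m) at_top" unfolding A'_def m_def by (intro tendsto_intros L)
  have m: "0 \<le> m" using lL by (simp add: m_def)
  interpret M: finite_borel_measure M
    unfolding M by (rule finite_borel_measure_interval_measure[OF mono' rc' l' L' m])
  have total: "emeasure M UNIV = m" unfolding M by (rule interval_measure_UNIV[OF mono' rc' l' L' m])
  have cdf: "cdf M = A'" unfolding M by (rule cdf_interval_measure[OF mono' rc' l'])
  have setsM: "sets M = sets borel" by (simp add: M_def)
  show "countable {x. measure M {x} > 0}" by (rule M.countable_atoms)
  have "(\<forall>t. norm (\<phi> t) \<le> m) \<and> \<phi> \<in> borel_measurable borel \<and>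
     (a \<le> b \<longrightarrow> measure M {a} = 0 \<longrightarrow> measure M {b} = 0 \<longrightarrow>
      (\<lambda>T::nat. 1 / (2 * pi) * (CLBINT t=- real T..real T. levy_kernel a b t * \<phi> t)) \<longlonglongrightarrow> of_real (A b - A a))"
  proof (cases "m = 0")
    case True
    have "AE x in M. False"
      using total True by (intro AE_I[where N = UNIV]) (auto simp: setsM)
    hence \<phi>0: "\<phi> t = 0" for t unfolding \<phi>_def by (intro integral_eq_zero_AE) auto
    have "A b = A a" if "a \<le> b"
    proof -
      have "emeasure M {a<..b} \<le> emeasure M UNIV" by (intro emeasure_mono) (auto simp: setsM)
      hence "ennreal (cdf M b - cdf M a) = 0" using M.emeasure_Ioc[OF that] total True by simp
      thus ?thesis using mono'[OF that] by (simp add: cdf A'_def)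
    qed
    moreover have "\<phi> = (\<lambda>_. 0)" using \<phi>0 by auto
    ultimately show ?thesis using True by auto
  next
    case False
    hence m0: "m > 0" using m by simp
    define N where "N = density M (\<lambda>_. ennreal (1 / m))"
    have setsN: "sets N = sets borel" by (simp add: N_def setsM)
    have "prob_space N"
    proof
      have "emeasure N (space N) = ennreal (1 / m) * emeasure M UNIV"
        unfolding N_def by (subst emeasure_density_const) (auto simp: setsM sets_eq_imp_space_eq[OF setsM])
      thus "emeasure N (space N) = 1" using m0 by (simp add: total ennreal_mult[symmetric])
    qed
    then interpret N: real_distribution N
      by (intro real_distribution.intro real_distribution_axioms.intro) (auto simp: setsN)
    have char: "\<phi> t = of_real m * char N t" for t
    proof -
      have "char N t = (CLINT u | M. (1 / m) *\<^sub>R iexp (t * u))"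
        unfolding char_def N_def using m0 by (intro integral_density) (auto simp: M_def)
      also have "\<dots> = (1 / m) *\<^sub>R \<phi> t" unfolding \<phi>_def by simp
      finally show ?thesis using m0 by (simp add: scaleR_conv_of_real)
    qed
    have meas: "measure N X = measure M X / m" if "X \<in> sets borel" for X
      unfolding N_def using that m0 by (subst measure_density_const) (auto simp: setsM)
    have "(\<lambda>T::nat. 1 / (2 * pi) * (CLBINT t=- real T..real T. levy_kernel a b t * \<phi> t)) \<longlonglongrightarrow> of_real (A b - A a)"
      if "a \<le> b" "measure M {a} = 0" "measure M {b} = 0"
    proof -
      have "(\<lambda>T::nat. 1 / (2 * pi) * (CLBINT t=- real T..real T. levy_kernel a b t * char N t)) \<longlonglongrightarrow> measure N {a<..b}"
        using N.Levy_Inversion[of a b] that unfolding levy_kernel_def by (simp add: meas)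
      hence "(\<lambda>T::nat. of_real m * (1 / (2 * pi) * (CLBINT t=- real T..real T. levy_kernel a b t * char N t)))
          \<longlonglongrightarrow> of_real m * complex_of_real (measure N {a<..b})"
        by (rule tendsto_mult_left)
      moreover have "of_real m * complex_of_real (measure N {a<..b}) = complex_of_real (A b - A a)"
      proof -
        have "measure M {a<..b} = A b - A a"
          using M.emeasure_Ioc[OF that(1)] mono'[OF that(1)] unfolding cdf measure_def by (simp add: A'_def)
        thus ?thesis using m0 by (simp add: meas)
      qed
      moreover have "of_real m * (1 / (2 * pi) * (CLBINT t=- real T..real T. levy_kernel a b t * char N t))
          = 1 / (2 * pi) * (CLBINT t=- real T..real T. levy_kernel a b t * \<phi> t)" for T :: nat
      proof -
        have "(\<lambda>t. levy_kernel a b t * \<phi> t) = (\<lambda>t. of_real m * (levy_kernel a b t * char N t))"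
          by (simp add: char fun_eq_iff)
        thus ?thesis by simp
      qed
      ultimately show ?thesis by simp
    qed
    moreover have "norm (\<phi> t) \<le> m" for t
      using N.cmod_char_le_1[of t] m0 by (simp add: char norm_mult mult_left_le)
    moreover have "\<phi> \<in> borel_measurable borel" unfolding char[abs_def] by measurable
    ultimately show ?thesis by auto
  qed
  hence nb: "norm (\<phi> t) \<le> m" and meas [measurable]: "\<phi> \<in> borel_measurable borel"
    and lim: "a \<le> b \<Longrightarrow> measure M {a} = 0 \<Longrightarrow> measure M {b} = 0 \<Longrightarrow>
      (\<lambda>T::nat. 1 / (2 * pi) * (CLBINT t=- real T..real T. levy_kernel a b t * \<phi> t)) \<longlonglongrightarrow> of_real (A b - A a)"
    for t by auto
  show "a \<le> b \<Longrightarrow> measure M {a} = 0 \<Longrightarrow> measure M {b} = 0 \<Longrightarrow>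
      (\<lambda>T::nat. 1 / (2 * pi) * (CLBINT t=- real T..real T. levy_kernel a b t * \<phi> t)) \<longlonglongrightarrow> of_real (A b - A a)"
    by (rule lim)
  have nk: "norm (levy_kernel a b t) \<le> \<bar>b - a\<bar>" for t
  proof (cases "a \<le> b")
    case False
    have "levy_kernel a b t = - levy_kernel b a t" by (simp only: levy_kernel_def minus_divide_left minus_diff_eq)
    thus ?thesis using norm_levy_kernel_le[of b a t] False by simp
  qed (use norm_levy_kernel_le[of a b t] in auto)
  have "norm (levy_kernel a b t * \<phi> t) \<le> \<bar>b - a\<bar> * m" for t
    by (rule norm_mult_le[OF nk nb])
  thus "complex_interval_lebesgue_integrable lborel (ereal (- c)) (ereal c) (\<lambda>t. levy_kernel a b t * \<phi> t)"
    unfolding interval_lebesgue_integrable_def set_integrable_def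
    by (auto intro!: integrableI_bounded_set_indicator[where B = "\<bar>b - a\<bar> * m"])
qed

text \<open>Inversion determines the increments between points that are atoms of none of the four
  measures involved. Letting the left point tend to -\<infinity> through such points gives the
  values themselves, and right-continuity fills in the countably many exceptions.\<close>

lemma fourier_stieltjes_transform_unique:
  assumes F: "has_fourier_stieltjes_transform F \<phi>" "(F \<longlongrightarrow> 0) at_bot"
    and G: "has_fourier_stieltjes_transform G \<phi>" "(G \<longlongrightarrow> 0) at_bot"
  shows "F = G"
proof -
  obtain A B where A: "mono A" "bounded (range A)" "\<And>u. continuous (at_right u) A"
    and B: "mono B" "bounded (range B)" "\<And>u. continuous (at_right u) B"
    and FAB: "\<And>u. F u = A u - B u"
    and \<phi>1: "\<And>t. \<phi> t = (CLINT u | interval_measure A. iexp (t * u)) - (CLINT u | interval_measure B. iexp (t * u))"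
    using F(1) unfolding has_fourier_stieltjes_transform_def by blast
  obtain A' B' where A': "mono A'" "bounded (range A')" "\<And>u. continuous (at_right u) A'"
    and B': "mono B'" "bounded (range B')" "\<And>u. continuous (at_right u) B'"
    and GAB: "\<And>u. G u = A' u - B' u"
    and \<phi>2: "\<And>t. \<phi> t = (CLINT u | interval_measure A'. iexp (t * u)) - (CLINT u | interval_measure B'. iexp (t * u))"
    using G(1) unfolding has_fourier_stieltjes_transform_def by blast
  let ?ch = "\<lambda>A t. CLINT u | interval_measure A. iexp (t * u)"
  define Z where "Z = (\<Union>X\<in>{A, B, A', B'}. {x. measure (interval_measure X) {x} > 0})"
  have Z: "countable Z"
    unfolding Z_def using interval_measure_inversion(1)[OF A] interval_measure_inversion(1)[OF B]
      interval_measure_inversion(1)[OF A'] interval_measure_inversion(1)[OF B'] by auto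
  have nZ: "measure (interval_measure X) {x} = 0" if "x \<notin> Z" "X \<in> {A, B, A', B'}" for X x
    using that measure_nonneg[of "interval_measure X" "{x}"] by (fastforce simp: Z_def)
  have eq: "F b - F a = G b - G a" if ab: "a \<le> b" "a \<notin> Z" "b \<notin> Z" for a b
  proof -
    have lim: "(\<lambda>T::nat. 1 / (2 * pi) * (CLBINT t=- real T..real T. levy_kernel a b t * \<phi> t)) \<longlonglongrightarrow> of_real ((X b - X a) - (Y b - Y a))"
      if X: "mono X" "bounded (range X)" "\<And>u. continuous (at_right u) X" and XZ: "X \<in> {A, B, A', B'}"
        and Y: "mono Y" "bounded (range Y)" "\<And>u. continuous (at_right u) Y" and YZ: "Y \<in> {A, B, A', B'}"
        and \<phi>: "\<And>t. \<phi> t = ?ch X t - ?ch Y t" for X Y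
    proof -
      note x = interval_measure_inversion(3)[OF X ab(1) nZ[OF ab(2) XZ] nZ[OF ab(3) XZ]]
      note y = interval_measure_inversion(3)[OF Y ab(1) nZ[OF ab(2) YZ] nZ[OF ab(3) YZ]]
      have "(CLBINT t=- real T..real T. levy_kernel a b t * \<phi> t) =
         (CLBINT t=- real T..real T. levy_kernel a b t * ?ch X t) - (CLBINT t=- real T..real T. levy_kernel a b t * ?ch Y t)" for T :: nat
        unfolding \<phi> right_diff_distrib
        using interval_measure_inversion(2)[OF X, of "real T" a b] interval_measure_inversion(2)[OF Y, of "real T" a b]
        by (intro interval_lebesgue_integral_diff) auto
      thus ?thesis using tendsto_diff[OF x y] by (simp add: right_diff_distrib)
    qed
    have "complex_of_real ((A b - A a) - (B b - B a)) = of_real ((A' b - A' a) - (B' b - B' a))"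
      by (rule LIMSEQ_unique[OF lim[OF A _ B _ \<phi>1] lim[OF A' _ B' _ \<phi>2]]) auto
    thus ?thesis unfolding FAB GAB of_real_eq_iff by linarith
  qed
  define D where "D = (\<lambda>x. F x - G x)"
  have D0: "(D \<longlongrightarrow> 0) at_bot" unfolding D_def using tendsto_diff[OF F(2) G(2)] by simp
  have Dr: "continuous (at_right x) D" for x
    unfolding D_def FAB GAB by (intro continuous_intros A B A' B')
  have DZ: "D x = 0" if x: "x \<notin> Z" for x
  proof (rule ccontr)
    assume "D x \<noteq> 0"
    hence "\<forall>\<^sub>F a in at_bot. dist (D a) 0 < \<bar>D x\<bar>" by (intro tendstoD[OF D0]) auto
    then obtain c where c: "\<And>a. a \<le> c \<Longrightarrow> \<bar>D a\<bar> < \<bar>D x\<bar>" by (auto simp: eventually_at_bot_linorder)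
    have "min c x - 1 < min c x" by linarith
    then obtain a where "a \<in> {min c x - 1<..<min c x}" "a \<notin> Z"
      using real_interval_avoid_countable_set Z by blast
    hence "a \<le> c" "a \<le> x" "a \<notin> Z" by auto
    moreover from this eq[of a x] x have "D a = D x" by (simp add: D_def)
    ultimately show False using c[of a] by simp
  qed
  have "D x = 0" for x
  proof (rule ccontr)
    assume nz: "D x \<noteq> 0"
    have "(D \<longlongrightarrow> D x) (at_right x)" using Dr by (simp add: continuous_within)
    hence "\<forall>\<^sub>F y in at_right x. dist (D y) (D x) < \<bar>D x\<bar>" using nz by (intro tendstoD) auto
    then obtain b where b: "b > x" "\<And>y. x < y \<Longrightarrow> y < b \<Longrightarrow> \<bar>D y - D x\<bar> < \<bar>D x\<bar>"
      unfolding eventually_at_right_field by (auto simp: dist_real_def)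
    obtain y where "y \<in> {x<..<b}" "y \<notin> Z"
      using real_interval_avoid_countable_set[of x b Z] Z b by auto
    thus False using b(2)[of y] DZ[of y] by auto
  qed
  thus ?thesis by (auto simp: D_def)
qed

section \<open>Hermite densities\<close>

text \<open>This class is closed under reflection and differentiation, so one decay statement at
  +\<infinity> supplies both boundary terms for integration by parts.\<close>

definition gauss_phase :: "real \<Rightarrow> complex poly \<Rightarrow> real \<Rightarrow> complex" where
  "gauss_phase c p t = iexp (c * t) * (poly p (of_real t) * of_real (exp (- t\<^sup>2 / 2)))"

lemma integrable_power_gauss: "integrable lborel (\<lambda>t::real. t ^ k * exp (- t\<^sup>2 / 2))"
proof -
  have "integrable lborel (\<lambda>t. sqrt (2 * pi) * (std_normal_density t * t ^ k))"
    by (intro integrable_mult_right integrable_std_normal_moment)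
  thus ?thesis by (simp add: std_normal_density_def mult_ac)
qed

lemma gauss_phase_measurable [measurable]: "gauss_phase c p \<in> borel_measurable borel"
  unfolding gauss_phase_def poly_altdef by measurable

lemma norm_gauss_phase_le:
  "norm (gauss_phase c p t) \<le> (\<Sum>i\<le>degree p. norm (coeff p i) * \<bar>t ^ i * exp (- t\<^sup>2 / 2)\<bar>)"
proof -
  have "gauss_phase c p t = iexp (c * t) * (\<Sum>i\<le>degree p. coeff p i * of_real (t ^ i * exp (- t\<^sup>2 / 2)))"
    unfolding gauss_phase_def poly_altdef by (simp only: sum_distrib_right mult.assoc of_real_mult of_real_power)
  hence "norm (gauss_phase c p t) = norm (\<Sum>i\<le>degree p. coeff p i * of_real (t ^ i * exp (- t\<^sup>2 / 2)))"
    by (simp add: norm_mult del: of_real_mult of_real_power)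
  also have "\<dots> \<le> (\<Sum>i\<le>degree p. norm (coeff p i * of_real (t ^ i * exp (- t\<^sup>2 / 2))))"
    by (rule norm_sum)
  finally show ?thesis by (simp add: norm_mult del: of_real_mult of_real_power)
qed

lemma integrable_gauss_phase: "complex_integrable lborel (gauss_phase c p)"
proof (rule Bochner_Integration.integrable_bound)
  show "integrable lborel (\<lambda>t. \<Sum>i\<le>degree p. norm (coeff p i) * \<bar>t ^ i * exp (- t\<^sup>2 / 2)\<bar>)"
    by (intro Bochner_Integration.integrable_sum integrable_mult_right integrable_abs integrable_power_gauss)
  have "norm (gauss_phase c p t) \<le> (\<Sum>i\<le>degree p. norm (coeff p i) * \<bar>t ^ i * exp (- t\<^sup>2 / 2)\<bar>)" for t
    by (rule norm_gauss_phase_le)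
  thus "AE t in lborel. norm (gauss_phase c p t) \<le> norm (\<Sum>i\<le>degree p. norm (coeff p i) * \<bar>t ^ i * exp (- t\<^sup>2 / 2)\<bar>)"
    unfolding real_norm_def by (intro AE_I2 order_trans[OF _ abs_ge_self])
qed measurable

lemma power_gauss_tendsto_0: "((\<lambda>t::real. t ^ k * exp (- t\<^sup>2 / 2)) \<longlongrightarrow> 0) at_top"
proof (rule Lim_null_comparison)
  have "norm (t ^ k * exp (- t\<^sup>2 / 2)) \<le> exp (1 / 2) * (t ^ k / exp t)" if "t \<ge> 0" for t :: real
  proof -
    have "0 \<le> (t - 1)\<^sup>2" by simp
    hence "- t\<^sup>2 / 2 \<le> 1 / 2 - t" by (simp add: power2_diff)
    hence "exp (- t\<^sup>2 / 2) \<le> exp (1 / 2) / exp t" by (simp add: exp_diff[symmetric])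
    hence "t ^ k * exp (- t\<^sup>2 / 2) \<le> t ^ k * (exp (1 / 2) / exp t)" using that by (intro mult_left_mono) auto
    thus ?thesis using that by (simp add: mult_ac)
  qed
  thus "\<forall>\<^sub>F t in at_top. norm (t ^ k * exp (- t\<^sup>2 / 2)) \<le> exp (1 / 2) * (t ^ k / exp t)"
    by (intro eventually_mono[OF eventually_ge_at_top[of 0]])
  show "((\<lambda>t::real. exp (1 / 2) * (t ^ k / exp t)) \<longlongrightarrow> 0) at_top"
    by (intro tendsto_mult_right_zero tendsto_power_div_exp_0)
qed

lemma gauss_phase_tendsto_0: "(gauss_phase c p \<longlongrightarrow> 0) at_top"
proof -
  have "((\<lambda>t. \<Sum>i\<le>degree p. norm (coeff p i) * \<bar>t ^ i * exp (- t\<^sup>2 / 2)\<bar>) \<longlongrightarrow> (\<Sum>i\<le>degree p. norm (coeff p i) * \<bar>0\<bar>)) at_top"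
    by (intro tendsto_intros power_gauss_tendsto_0)
  moreover have "norm (gauss_phase c p t) \<le> (\<Sum>i\<le>degree p. norm (coeff p i) * \<bar>t ^ i * exp (- t\<^sup>2 / 2)\<bar>)" for t
    by (rule norm_gauss_phase_le)
  ultimately show ?thesis by (intro Lim_null_comparison[of "gauss_phase c p"]) auto
qed

lemma gauss_phase_reflect: "gauss_phase c p (- t) = gauss_phase (- c) (pcompose p [:0, -1:]) t"
  by (simp add: gauss_phase_def poly_pcompose)

lemma gauss_phase_deriv:
  "(gauss_phase c p has_vector_derivative
     gauss_phase c (smult (\<i> * of_real c) p + pderiv p - pCons 0 p) t) (at t)"
proof -
  define h where "h = (\<lambda>z. exp (\<i> * of_real c * z) * (poly p z * exp (- (z ^ 2) / 2)))"
  have "(h has_field_derivative (exp (\<i> * of_real c * z) *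
     (poly (smult (\<i> * of_real c) p + pderiv p - pCons 0 p) z * exp (- (z ^ 2) / 2)))) (at z)" for z
    unfolding h_def
    by (rule derivative_eq_intros refl | simp)+ (simp add: algebra_simps)
  from has_vector_derivative_real_field[OF this[of "of_real t"], of UNIV]
  have "((\<lambda>x. h (of_real x)) has_vector_derivative (exp (\<i> * of_real c * of_real t) *
     (poly (smult (\<i> * of_real c) p + pderiv p - pCons 0 p) (of_real t) * exp (- (of_real t ^ 2) / 2)))) (at t)" by simp
  moreover have "h (of_real x) = gauss_phase c p x" for x
    by (simp add: h_def gauss_phase_def exp_of_real[symmetric] mult.assoc)
  moreover have "exp (\<i> * of_real c * of_real t) *
     (poly (smult (\<i> * of_real c) p + pderiv p - pCons 0 p) (of_real t) * exp (- (of_real t ^ 2) / 2))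
     = gauss_phase c (smult (\<i> * of_real c) p + pderiv p - pCons 0 p) t"
    by (simp only: gauss_phase_def exp_of_real[symmetric]) (simp add: mult.assoc)
  ultimately show ?thesis by simp
qed

definition gauss_int :: "real \<Rightarrow> complex poly \<Rightarrow> complex" where
  "gauss_int c p = (CLBINT t. gauss_phase c p t)"

lemma gauss_int_add: "gauss_int c (p + q) = gauss_int c p + gauss_int c q"
proof -
  have eq: "gauss_phase c (p + q) = (\<lambda>t. gauss_phase c p t + gauss_phase c q t)"
    by (rule ext) (simp add: gauss_phase_def algebra_simps)
  show ?thesis unfolding gauss_int_def eq
    by (rule Bochner_Integration.integral_add) (rule integrable_gauss_phase)+
qed

lemma gauss_int_smult: "gauss_int c (smult a p) = a * gauss_int c p"
proof -
  have eq: "gauss_phase c (smult a p) = (\<lambda>t. a * gauss_phase c p t)"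
    by (rule ext) (simp only: gauss_phase_def poly_smult mult.assoc mult.left_commute[of _ a])
  show ?thesis unfolding gauss_int_def eq by (rule integral_mult_right_zero)
qed

lemma gauss_int_diff: "gauss_int c (p - q) = gauss_int c p - gauss_int c q"
  using gauss_int_add[of c "p - q" q] by simp

text \<open>The three terms together are the integral over the line of the derivative of
  \<open>gauss_phase c p\<close>, which vanishes at both ends.\<close>

lemma gauss_int_by_parts:
  "\<i> * of_real c * gauss_int c p + gauss_int c (pderiv p) - gauss_int c (pCons 0 p) = 0"
proof -
  define q where "q = smult (\<i> * of_real c) p + pderiv p - pCons 0 p"
  have "(LBINT t=-\<infinity>..\<infinity>. gauss_phase c q t) = 0 - 0"
  proof (rule interval_integral_FTC_integrable)
    show "(gauss_phase c p has_vector_derivative gauss_phase c q t) (at t)" for t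
      unfolding q_def by (rule gauss_phase_deriv)
    show "isCont (gauss_phase c q) t" for t
      using gauss_phase_deriv[of c q t] has_vector_derivative_continuous by blast
    show "set_integrable lborel (einterval (- \<infinity>) \<infinity>) (gauss_phase c q)"
      using integrable_gauss_phase by (simp add: set_integrable_def einterval_def)
    show "((gauss_phase c p \<circ> real_of_ereal) \<longlongrightarrow> 0) (at_left \<infinity>)"
      using gauss_phase_tendsto_0 by (simp add: ereal_tendsto_simps1)
    have "((\<lambda>t. gauss_phase c p (- t)) \<longlongrightarrow> 0) at_top"
      unfolding gauss_phase_reflect by (rule gauss_phase_tendsto_0)
    hence "(gauss_phase c p \<longlongrightarrow> 0) at_bot" by (simp add: filterlim_at_bot_mirror)
    thus "((gauss_phase c p \<circ> real_of_ereal) \<longlongrightarrow> 0) (at_right (- \<infinity>))"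
      by (simp add: ereal_tendsto_simps1)
  qed simp
  hence "gauss_int c q = 0"
    by (simp add: gauss_int_def interval_lebesgue_integral_def set_lebesgue_integral_def einterval_def)
  thus ?thesis by (simp add: q_def gauss_int_add gauss_int_diff gauss_int_smult)
qed

lemma gauss_int_1: "gauss_int c 1 = of_real (sqrt (2 * pi) * exp (- c\<^sup>2 / 2))"
proof -
  have "of_real (exp (- c\<^sup>2 / 2)) = (CLBINT x. std_normal_density x *\<^sub>R iexp (c * x))"
    using fun_cong[OF char_std_normal_distribution, of c] unfolding char_def
    by (subst (asm) integral_density) auto
  also have "\<dots> = (CLBINT x. of_real (1 / sqrt (2 * pi)) * gauss_phase c 1 x)"
    by (intro Bochner_Integration.integral_cong refl)
      (simp add: std_normal_density_def gauss_phase_def scaleR_conv_of_real mult_ac)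
  also have "\<dots> = of_real (1 / sqrt (2 * pi)) * gauss_int c 1"
    unfolding gauss_int_def by (rule integral_mult_right_zero)
  finally show ?thesis by (simp add: field_simps)
qed

text \<open>The probabilists' Hermite polynomials; the recursion mirrors integration by parts
  against exp(-t^2 / 2).\<close>

fun hermite :: "nat \<Rightarrow> 'a::idom poly" where
  "hermite 0 = 1"
| "hermite (Suc k) = pCons 0 (hermite k) - pderiv (hermite k)"

lemma pderiv_hermite: "pderiv (hermite (Suc k) :: 'a::idom poly) = smult (of_nat (Suc k)) (hermite k)"
proof (induction k)
  case (Suc k)
  have "pderiv (hermite (Suc (Suc k)) :: 'a poly) = hermite (Suc k) + pCons 0 (pderiv (hermite (Suc k))) - pderiv (pderiv (hermite (Suc k)))"
    by (simp only: hermite.simps(2)[of "Suc k"] pderiv_diff pderiv_pCons)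
  also have "\<dots> = hermite (Suc k) + smult (of_nat (Suc k)) (pCons 0 (hermite k) - pderiv (hermite k))"
    unfolding Suc by (simp add: pderiv_smult smult_diff_right del: of_nat_Suc hermite.simps)
  also have "\<dots> = smult (of_nat (Suc (Suc k))) (hermite (Suc k))"
    by (simp only: hermite.simps(2)[symmetric] of_nat_Suc[of "Suc k"] smult_add_left) simp
  finally show ?case .
qed (simp add: pderiv_pCons)

lemma poly_hermite_Suc_Suc:
  "poly (hermite (Suc (Suc k))) u = u * poly (hermite (Suc k)) u - of_nat (Suc k) * poly (hermite k) (u::'a::idom)"
  unfolding hermite.simps(2)[of "Suc k"] pderiv_hermite by simp

lemma poly_hermite_of_real: "poly (hermite k) (complex_of_real u) = of_real (poly (hermite k) u)"
proof (induction k rule: induct_nat_012)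
  case (ge2 k)
  thus ?case unfolding poly_hermite_Suc_Suc by simp
qed (simp_all add: pderiv_pCons)

lemma gauss_int_hermite: "gauss_int t (hermite k) = (\<i> * of_real t) ^ k * of_real (sqrt (2 * pi) * exp (- t\<^sup>2 / 2))"
proof (induction k)
  case (Suc k)
  have "gauss_int t (hermite (Suc k)) = \<i> * of_real t * gauss_int t (hermite k)"
    using gauss_int_by_parts[of t "hermite k"] by (simp add: gauss_int_diff algebra_simps)
  thus ?case unfolding Suc by (simp add: mult_ac)
qed (simp add: gauss_int_1)

text \<open>By integration by parts the left side obeys the three-term recurrence of the Hermite
  polynomials, with the same two initial values.\<close>

lemma gauss_int_monom:
  "\<i> ^ k * gauss_int (- u) (monom 1 k) = of_real (poly (hermite k) u * sqrt (2 * pi) * exp (- u\<^sup>2 / 2))"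
proof (induction k rule: induct_nat_012)
  case 0
  show ?case using gauss_int_1[of "- u"] by simp
next
  case 1
  have "gauss_int (- u) (pCons 0 1) = - \<i> * of_real u * gauss_int (- u) 1"
    using gauss_int_by_parts[of "- u" 1] by (simp add: gauss_int_def gauss_phase_def)
  moreover have "monom 1 (Suc 0) = pCons 0 (1 :: complex poly)" by (simp add: monom_Suc)
  ultimately show ?case using gauss_int_1[of "- u"] by (simp add: pderiv_pCons mult.assoc)
next
  case (ge2 k)
  have "gauss_int (- u) (monom 1 (Suc (Suc k))) = - \<i> * of_real u * gauss_int (- u) (monom 1 (Suc k))
      + of_nat (Suc k) * gauss_int (- u) (monom 1 k)"
  proof -
    have pd: "pderiv (monom 1 (Suc k)) = smult (of_nat (Suc k)) (monom (1::complex) k)"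
      by (simp add: pderiv_monom smult_monom)
    have pc: "pCons 0 (monom 1 (Suc k)) = monom (1::complex) (Suc (Suc k))"
      by (simp only: monom_Suc)
    have "\<i> * of_real (- u) * gauss_int (- u) (monom 1 (Suc k)) + of_nat (Suc k) * gauss_int (- u) (monom 1 k)
        - gauss_int (- u) (monom 1 (Suc (Suc k))) = 0"
      using gauss_int_by_parts[of "- u" "monom 1 (Suc k)"] unfolding pd pc gauss_int_smult .
    hence "gauss_int (- u) (monom 1 (Suc (Suc k))) = \<i> * of_real (- u) * gauss_int (- u) (monom 1 (Suc k))
        + of_nat (Suc k) * gauss_int (- u) (monom 1 k)" by (simp only: right_minus_eq)
    thus ?thesis by (simp only: of_real_minus mult_minus_left mult_minus_right)
  qed
  hence "\<i> ^ Suc (Suc k) * gauss_int (- u) (monom 1 (Suc (Suc k))) =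
     of_real u * (\<i> ^ Suc k * gauss_int (- u) (monom 1 (Suc k))) - of_nat (Suc k) * (\<i> ^ k * gauss_int (- u) (monom 1 k))"
    by (simp add: right_diff_distrib distrib_left mult_ac del: of_nat_Suc)
  thus ?case unfolding ge2 poly_hermite_Suc_Suc by (simp add: algebra_simps)
qed

text \<open>Real coefficients in powers of i t encode the Hermitian symmetry that makes the inverse
  transform a real function. Exponents in the list may repeat, so a further term is simply
  prepended.\<close>

definition real_poly_it :: "(real \<times> nat) list \<Rightarrow> real \<Rightarrow> complex" where
  "real_poly_it L t = (\<Sum>(a, j)\<leftarrow>L. of_real a * (\<i> * of_real t) ^ j)"

definition hermite_density :: "(real \<times> nat) list \<Rightarrow> real \<Rightarrow> real" where
  "hermite_density L u = (\<Sum>(a, j)\<leftarrow>L. a * poly (hermite j) u) * std_normal_density u"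

lemma gauss_int_sum_list: "gauss_int c (\<Sum>x\<leftarrow>L. f x) = (\<Sum>x\<leftarrow>L. gauss_int c (f x))"
  by (induction L) (simp_all add: gauss_int_add, simp add: gauss_int_def gauss_phase_def)

lemma hermite_density_gauss_phase:
  "iexp (t * u) * of_real (hermite_density L u)
    = of_real (1 / sqrt (2 * pi)) * gauss_phase t (\<Sum>(a, j)\<leftarrow>L. smult (of_real a) (hermite j)) u"
proof -
  have "of_real (\<Sum>(a, j)\<leftarrow>L. a * poly (hermite j) u) = poly (\<Sum>(a, j)\<leftarrow>L. smult (of_real a) (hermite j)) (complex_of_real u)"
    by (induction L) (auto simp: poly_hermite_of_real)
  thus ?thesis
    by (simp add: hermite_density_def gauss_phase_def std_normal_density_def del: of_real_sum)
qed

lemma integral_iexp_hermite_density: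
  "(CLBINT u. iexp (t * u) * of_real (hermite_density L u)) = real_poly_it L t * of_real (exp (- t\<^sup>2 / 2))"
proof -
  have "(CLBINT u. iexp (t * u) * of_real (hermite_density L u))
     = of_real (1 / sqrt (2 * pi)) * gauss_int t (\<Sum>(a, j)\<leftarrow>L. smult (of_real a) (hermite j))"
    unfolding hermite_density_gauss_phase gauss_int_def by (rule integral_mult_right_zero)
  also have "gauss_int t (\<Sum>(a, j)\<leftarrow>L. smult (of_real a) (hermite j))
     = (\<Sum>(a, j)\<leftarrow>L. of_real a * ((\<i> * of_real t) ^ j * of_real (sqrt (2 * pi) * exp (- t\<^sup>2 / 2))))"
    unfolding gauss_int_sum_list by (intro arg_cong[where f = sum_list] map_cong) (auto simp: gauss_int_smult gauss_int_hermite)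
  also have "\<dots> = real_poly_it L t * of_real (sqrt (2 * pi) * exp (- t\<^sup>2 / 2))"
    unfolding real_poly_it_def by (induction L) (auto simp: algebra_simps)
  finally show ?thesis by simp
qed

text \<open>The forward transform above identifies \<open>WW5\<close>; this inverse one evaluates
  the integral that approximates the probability.\<close>

lemma hermite_density_inversion:
  "of_real (hermite_density L u) = of_real (1 / (2 * pi)) *
     (CLBINT t. iexp (- (t * u)) * (real_poly_it L t * of_real (exp (- t\<^sup>2 / 2))))"
proof -
  have "iexp (- (t * u)) * (real_poly_it L t * of_real (exp (- t\<^sup>2 / 2)))
     = gauss_phase (- u) (\<Sum>(a, j)\<leftarrow>L. smult (of_real a * \<i> ^ j) (monom 1 j)) t" for t
  proof -
    have "poly (\<Sum>(a, j)\<leftarrow>L. smult (of_real a * \<i> ^ j) (monom 1 j)) (of_real t) = real_poly_it L t"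
      unfolding real_poly_it_def by (induction L) (auto simp: poly_monom power_mult_distrib)
    thus ?thesis by (simp add: gauss_phase_def mult_ac)
  qed
  hence "(CLBINT t. iexp (- (t * u)) * (real_poly_it L t * of_real (exp (- t\<^sup>2 / 2))))
     = gauss_int (- u) (\<Sum>(a, j)\<leftarrow>L. smult (of_real a * \<i> ^ j) (monom 1 j))"
    by (simp add: gauss_int_def)
  also have "\<dots> = (\<Sum>(a, j)\<leftarrow>L. of_real a * of_real (poly (hermite j) u * sqrt (2 * pi) * exp (- u\<^sup>2 / 2)))"
    unfolding gauss_int_sum_list
    by (intro arg_cong[where f = sum_list] map_cong) (auto simp only: gauss_int_smult gauss_int_monom mult.assoc split: prod.splits)
  also have "\<dots> = of_real (hermite_density L u * (2 * pi))"
  proof -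
    have "sqrt (2 * pi) * exp (- u\<^sup>2 / 2) = std_normal_density u * (2 * pi)"
      using real_sqrt_mult_self[of "2 * pi"] by (simp add: std_normal_density_def field_simps)
    hence "(\<Sum>(a, j)\<leftarrow>L. complex_of_real a * of_real (poly (hermite j) u * sqrt (2 * pi) * exp (- u\<^sup>2 / 2)))
        = (\<Sum>(a, j)\<leftarrow>L. complex_of_real (a * poly (hermite j) u * (std_normal_density u * (2 * pi))))"
      by (intro arg_cong[where f = sum_list] map_cong) (auto simp: mult.assoc simp del: of_real_mult simp flip: of_real_mult)
    also have "\<dots> = of_real (hermite_density L u * (2 * pi))"
      unfolding hermite_density_def by (induction L) (auto simp: algebra_simps)
    finally show ?thesis .
  qed
  finally show ?thesis by simp
qed

lemma hermite_density_continuous: "continuous_on UNIV (hermite_density L)"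
proof -
  have "continuous_on UNIV (\<lambda>u. \<Sum>(a, j)\<leftarrow>L. a * poly (hermite j) (u::real))"
    by (induction L) (auto intro!: continuous_intros)
  thus ?thesis unfolding hermite_density_def[abs_def] std_normal_density_def[abs_def] by (intro continuous_intros) auto
qed

lemma integrable_hermite_density: "integrable lborel (hermite_density L)"
proof -
  have "complex_integrable lborel (\<lambda>u. iexp (0 * u) * of_real (hermite_density L u))"
    unfolding hermite_density_gauss_phase by (intro integrable_mult_right integrable_gauss_phase)
  thus ?thesis by (simp add: complex_of_real_integrable_eq)
qed

text \<open>The positive and negative parts of f are densities of two finite measures, whose
  distribution functions form the required Jordan decomposition. Continuity of f gives the
  derivative.\<close>

lemma fourier_stieltjes_of_density:
  fixes f :: "real \<Rightarrow> real"
  assumes cont: "continuous_on UNIV f" and int: "integrable lborel f"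
  defines "F \<equiv> \<lambda>u. \<integral>x. indicator {..u} x * f x \<partial>lborel"
  shows "has_fourier_stieltjes_transform F (\<lambda>t. CLBINT u. iexp (t * u) * of_real (f u))"
    and "(F \<longlongrightarrow> 0) at_bot" and "(F has_real_derivative f u) (at u)"
proof -
  have [measurable]: "f \<in> borel_measurable borel" using cont by (rule borel_measurable_continuous_onI)
  define fp fm where "fp = (\<lambda>x. max 0 (f x))" and "fm = (\<lambda>x. max 0 (- f x))"
  have f: "f x = fp x - fm x" for x by (auto simp: fp_def fm_def)
  have intp: "integrable lborel fp" "integrable lborel fm"
    unfolding fp_def fm_def using int by (auto intro!: integrable_max)
  have key: "finite_borel_measure (density lborel g) \<and> cdf (density lborel g) u = (\<integral>x. indicator {..u} x * g x \<partial>lborel)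
      \<and> interval_measure (cdf (density lborel g)) = density lborel g"
    if g: "integrable lborel g" "\<And>x. g x \<ge> 0" for g :: "real \<Rightarrow> real" and u
  proof -
    have [measurable]: "g \<in> borel_measurable borel" using g(1) by auto
    let ?M = "density lborel g"
    have "emeasure ?M UNIV = ennreal (\<integral>x. g x \<partial>lborel)"
      using g by (simp add: emeasure_density nn_integral_eq_integral)
    hence "finite_measure ?M" by (intro finite_measureI) auto
    hence fb: "finite_borel_measure ?M"
      by (intro finite_borel_measure.intro finite_borel_measure_axioms.intro) auto
    interpret finite_borel_measure ?M by (rule fb)
    have "emeasure ?M {..u} = ennreal (\<integral>x. indicator {..u} x * g x \<partial>lborel)"
    proof -
      have "emeasure ?M {..u} = (\<integral>\<^sup>+x. ennreal (indicator {..u} x * g x) \<partial>lborel)"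
        by (subst emeasure_density) (auto intro!: nn_integral_cong split: split_indicator)
      also have "\<dots> = ennreal (\<integral>x. indicator {..u} x * g x \<partial>lborel)"
        using g by (intro nn_integral_eq_integral integrable_real_mult_indicator) (auto simp: mult.commute intro!: integrable_real_mult_indicator)
      finally show ?thesis .
    qed
    hence "cdf ?M u = (\<integral>x. indicator {..u} x * g x \<partial>lborel)"
      using g by (simp add: cdf_def measure_def)
    moreover have "interval_measure (cdf ?M) = ?M"
    proof (rule cdf_unique')
      show "finite_borel_measure (interval_measure (cdf ?M))"
        by (rule finite_borel_measure_interval_measure[OF cdf_nondecreasing cdf_is_right_cont cdf_lim_at_bot cdf_lim_at_top]) auto
      show "finite_borel_measure ?M" by (rule fb)
      show "cdf (interval_measure (cdf ?M)) = cdf ?M"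
        by (rule cdf_interval_measure[OF cdf_nondecreasing cdf_is_right_cont cdf_lim_at_bot])
    qed
    ultimately show ?thesis using fb by simp
  qed
  note kp = key[OF intp(1)] and km = key[OF intp(2)]
  have p0: "fp x \<ge> 0" "fm x \<ge> 0" for x by (auto simp: fp_def fm_def)
  let ?P = "density lborel fp" and ?N = "density lborel fm"
  interpret P: finite_borel_measure ?P using kp p0 by auto
  interpret N: finite_borel_measure ?N using km p0 by auto
  have FAB: "F u = cdf ?P u - cdf ?N u" for u
  proof -
    have "integrable lborel (\<lambda>x. indicator {..u} x * fp x)" "integrable lborel (\<lambda>x. indicator {..u} x * fm x)"
      using intp integrable_real_mult_indicator[of "{..u}" lborel] by (auto simp: mult.commute)
    thus ?thesis using kp p0 km unfolding F_def f by (simp add: right_diff_distrib)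
  qed
  have bd: "bounded (range (cdf M))" if "finite_borel_measure M" for M
    using finite_borel_measure.cdf_bounded[OF that] finite_borel_measure.cdf_nonneg[OF that]
    by (intro boundedI[of _ "measure M (space M)"]) auto
  have "has_fourier_stieltjes_transform F (\<lambda>t. CLBINT u. iexp (t * u) * of_real (f u))"
    unfolding has_fourier_stieltjes_transform_def
  proof (rule exI[of _ "cdf ?P"], rule exI[of _ "cdf ?N"], intro conjI allI)
    show "mono (cdf ?P)" "mono (cdf ?N)" by (auto intro!: monoI P.cdf_nondecreasing N.cdf_nondecreasing)
    show "bounded (range (cdf ?P))" "bounded (range (cdf ?N))" by (auto intro!: bd P.finite_borel_measure_axioms N.finite_borel_measure_axioms kp[THEN conjunct1] km[THEN conjunct1] p0)
    show "continuous (at_right u) (cdf ?P)" for u by (rule P.cdf_is_right_cont)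
    show "continuous (at_right u) (cdf ?N)" for u by (rule N.cdf_is_right_cont)
    show "F u = cdf ?P u - cdf ?N u" for u by (rule FAB)
    fix t
    have ii: "complex_integrable lborel (\<lambda>u. iexp (t * u) * of_real (g u))" if "integrable lborel g" for g
    proof (rule Bochner_Integration.integrable_bound[OF that])
      have [measurable]: "g \<in> borel_measurable borel" using that by auto
      show "(\<lambda>u. iexp (t * u) * of_real (g u)) \<in> borel_measurable lborel" by measurable
    qed (auto simp: norm_mult)
    have dens: "(CLINT u | density lborel g. iexp (t * u)) = (CLBINT u. iexp (t * u) * of_real (g u))"
      if "integrable lborel g" "\<And>x. g x \<ge> 0" for g :: "real \<Rightarrow> real"
      using that by (subst integral_density) (auto simp: scaleR_conv_of_real mult.commute)
    show "(CLBINT u. iexp (t * u) * of_real (f u)) = (CLINT u | interval_measure (cdf ?P). iexp (t * u)) - (CLINT u | interval_measure (cdf ?N). iexp (t * u))"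
      unfolding kp[OF p0(1), THEN conjunct2, THEN conjunct2] km[OF p0(2), THEN conjunct2, THEN conjunct2]
        dens[OF intp(1) p0(1)] dens[OF intp(2) p0(2)]
      by (subst Bochner_Integration.integral_diff[symmetric], rule ii, rule intp, rule ii, rule intp)
        (simp add: f right_diff_distrib)
  qed
  thus "has_fourier_stieltjes_transform F (\<lambda>t. CLBINT u. iexp (t * u) * of_real (f u))" .
  show "(F \<longlongrightarrow> 0) at_bot"
    using tendsto_diff[OF P.cdf_lim_at_bot N.cdf_lim_at_bot] unfolding FAB by simp
  show "(F has_real_derivative f u) (at u)"
  proof -
    \<comment> \<open>The fundamental theorem is applied on a bounded interval starting at u - 1;
      the rest of F is a constant there.\<close>
    have Feq: "F x = F (u - 1) + (LBINT y=u-1..x. f y)" if "x \<in> {u-1<..<u+1}" for x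
    proof -
      have i1: "integrable lborel (\<lambda>y. indicator S y * f y)" if "S \<in> sets borel" for S
        using integrable_real_mult_indicator[OF _ int, of S] that by (simp add: mult.commute)
      have "F x = (\<integral>y. indicator {..u-1} y * f y + indicator {u-1<..x} y * f y \<partial>lborel)"
        unfolding F_def using that by (intro Bochner_Integration.integral_cong refl) (auto split: split_indicator)
      also have "\<dots> = F (u - 1) + (\<integral>y. indicator {u-1<..x} y * f y \<partial>lborel)"
        unfolding F_def by (intro Bochner_Integration.integral_add i1) auto
      also have "(\<integral>y. indicator {u-1<..x} y * f y \<partial>lborel) = (LBINT y:{u-1<..x}. f y)"
        by (simp add: set_lebesgue_integral_def)
      also have "\<dots> = (LBINT y=u-1..x. f y)"
        using that by (subst interval_integral_Ioc) auto
      finally show ?thesis .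
    qed
    have "((\<lambda>x. LBINT y=u-1..x. f y) has_vector_derivative f u) (at u within {u-1..u+1})"
      by (intro interval_integral_FTC2 continuous_on_subset[OF cont]) auto
    hence "((\<lambda>x. LBINT y=u-1..x. f y) has_vector_derivative f u) (at u)"
      by (simp add: at_within_Icc_at)
    hence "((\<lambda>x. F (u - 1) + (LBINT y=u-1..x. f y)) has_vector_derivative f u) (at u)"
      by (auto intro!: derivative_eq_intros)
    hence "((\<lambda>x. F (u - 1) + (LBINT y=u-1..x. f y)) has_real_derivative f u) (at u)"
      by (simp add: has_real_derivative_iff_has_vector_derivative)
    thus ?thesis
      by (rule DERIV_cong_ev[THEN iffD1, OF refl _ refl, rotated])
        (auto intro!: eventually_nhds_in_open[of "{u-1<..<u+1}", THEN eventually_mono] simp: Feq)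
  qed
qed

section \<open>Comparable cell probabilities\<close>

text \<open>The range extends beyond \<pi> because the cell frequency \<tau> + 2 \<theta> \<delta>
  may leave [-\<pi>, \<pi>] slightly, and it stays below 2 \<pi>. With y = x / 2, the cubic Taylor
  bound gives |sin y| \<ge> (29 / 150) |y|.\<close>

lemma one_minus_cos_ge:
  fixes x :: real
  assumes "\<bar>x\<bar> \<le> 22 / 5"
  shows "x\<^sup>2 / 60 \<le> 1 - cos x"
proof -
  define y where "y = x / 2"
  have "norm (Im (iexp y - (\<Sum>k\<le>2. (\<i> * y) ^ k / fact k))) \<le> \<bar>y\<bar> ^ Suc 2 / fact (Suc 2)"
    unfolding real_norm_def by (rule order_trans[OF abs_Im_le_cmod iexp_approx1])
  moreover have "Im (iexp y - (\<Sum>k\<le>2. (\<i> * y) ^ k / fact k)) = sin y - y"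
    by (simp add: eval_nat_numeral Im_exp Im_divide_numeral)
  ultimately have s: "\<bar>sin y - y\<bar> \<le> \<bar>y\<bar> ^ 3 / 6" by (simp add: fact_numeral numeral_3_eq_3 numeral_2_eq_2)
  have y2: "y\<^sup>2 \<le> (11 / 5)\<^sup>2" using assms by (simp add: y_def abs_le_square_iff[symmetric])
  have "\<bar>y\<bar> ^ 3 = \<bar>y\<bar> * y\<^sup>2" by (simp add: power3_eq_cube power2_eq_square abs_mult_self_eq mult.assoc)
  also have "\<dots> \<le> \<bar>y\<bar> * (11 / 5)\<^sup>2" by (intro mult_left_mono y2) auto
  finally have "\<bar>y\<bar> ^ 3 / 6 \<le> \<bar>y\<bar> * (121 / 150)" by (simp add: power2_eq_square)
  hence "\<bar>y\<bar> * (29 / 150) \<le> \<bar>sin y\<bar>" using s by linarith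
  hence "(\<bar>y\<bar> * (29 / 150))\<^sup>2 \<le> \<bar>sin y\<bar>\<^sup>2" by (intro power_mono) auto
  hence "y\<^sup>2 * (841 / 22500) \<le> (sin y)\<^sup>2" by (simp add: power_mult_distrib power2_eq_square)
  moreover have "y\<^sup>2 * (1 / 30) \<le> y\<^sup>2 * (841 / 22500)" by (intro mult_left_mono) auto
  moreover have "1 - cos x = 2 * (sin y)\<^sup>2" using cos_double_sin[of y] by (simp add: y_def)
  moreover have "x\<^sup>2 = 4 * y\<^sup>2" by (simp add: y_def power2_eq_square)
  ultimately show ?thesis by linarith
qed

text \<open>A perturbation of the pure Poisson case \<theta> = 0. The first absolute moment of
  \<open>charlier2\<close> is at most 3 r / 2, by the arithmetic-geometric mean inequality with
  weight r; it is linear in r also for small r.\<close>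

lemma cell_cf_near_linear:
  assumes r: "r > 0"
  shows "norm (cell_cf r \<theta> \<omega>) \<le> exp (- r * (1 - cos \<omega>)) + 3 / 2 * r * \<bar>\<theta>\<bar>"
proof -
  let ?P = "measure_pmf (poisson_pmf r)"
  have X: "has_bochner_integral ?P (\<lambda>k. iexp (\<theta> * charlier2 r k + \<omega> * (real k - r))) (cell_cf r \<theta> \<omega>)"
    unfolding cell_cf_def by (intro has_bochner_integral_integrable integrable_iexp_pmf)
  note D = has_bochner_integral_diff[OF X centered_poisson_cf[OF r, of \<omega>]]
  have B: "has_bochner_integral ?P (\<lambda>k. \<bar>\<theta>\<bar> / 2 * (charlier2 r k ^ 2 * (1 / r) + r * 1)) (\<bar>\<theta>\<bar> / 2 * ((2 * r\<^sup>2) * (1 / r) + r * 1))"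
    by (intro has_bochner_integral_mult_right has_bochner_integral_add has_bochner_integral_mult_left
        charlier2_even_moments r) (simp add: has_bochner_integral_iff)
  have g: "norm (iexp (\<theta> * charlier2 r k + \<omega> * (real k - r)) - iexp (\<omega> * (real k - r)))
      \<le> \<bar>\<theta>\<bar> / 2 * (charlier2 r k ^ 2 * (1 / r) + r * 1)" for k
  proof -
    have "iexp (\<theta> * charlier2 r k + \<omega> * (real k - r)) - iexp (\<omega> * (real k - r)) = iexp (\<omega> * (real k - r)) * (iexp (\<theta> * charlier2 r k) - 1)"
      by (simp add: exp_add distrib_left right_diff_distrib)
    hence "norm (iexp (\<theta> * charlier2 r k + \<omega> * (real k - r)) - iexp (\<omega> * (real k - r))) \<le> \<bar>\<theta> * charlier2 r k\<bar>"
      using iexp_approx1[of "\<theta> * charlier2 r k" 0] by (simp add: norm_mult)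
    also have "\<dots> = \<bar>\<theta>\<bar> * \<bar>charlier2 r k\<bar>" by (rule abs_mult)
    also have "\<bar>charlier2 r k\<bar> \<le> (charlier2 r k ^ 2 * (1 / r) + r * 1) / 2"
    proof -
      have "0 \<le> (\<bar>charlier2 r k\<bar> - r)\<^sup>2" by simp
      hence "2 * r * \<bar>charlier2 r k\<bar> \<le> charlier2 r k ^ 2 + r\<^sup>2" by (simp add: power2_diff algebra_simps)
      thus ?thesis using r by (simp add: field_simps power2_eq_square)
    qed
    finally show ?thesis by (simp add: mult_left_mono)
  qed
  have "norm (cell_cf r \<theta> \<omega> - centered_poisson_cf r \<omega>) \<le> 3 / 2 * r * \<bar>\<theta>\<bar>"
    using norm_has_bochner_integral_le[OF D B g] r by (simp add: field_simps power2_eq_square)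
  moreover have "norm (centered_poisson_cf r \<omega>) = exp (- r * (1 - cos \<omega>))"
    by (simp add: centered_poisson_cf_def Re_exp algebra_simps)
  ultimately show ?thesis
    using norm_triangle_ineq2[of "cell_cf r \<theta> \<omega>" "centered_poisson_cf r \<omega>"] by linarith
qed

text \<open>Chosen once and for all, so that the constants of the locale below are terms in c1 and
  c2 only.\<close>

definition cell_const :: real where
  "cell_const = (SOME C. C > 0 \<and> (\<forall>r>0. \<forall>\<theta> \<omega>. max 1 r * \<bar>\<theta>\<bar> \<le> 1 \<longrightarrow> \<bar>\<omega>\<bar> \<le> 1 \<longrightarrow> r * \<omega>\<^sup>2 \<le> 1 \<longrightarrow>
     norm (cell_cf r \<theta> \<omega> - exp (cell_exponent r \<theta> \<omega>))
       \<le> C * (cell_var r \<theta> \<omega> * (max 1 r * \<bar>\<theta>\<bar> + \<bar>\<omega>\<bar>) ^ 3)))"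

lemma cell_const:
  "cell_const > 0"
  "\<lbrakk>r > 0; max 1 r * \<bar>\<theta>\<bar> \<le> 1; \<bar>\<omega>\<bar> \<le> 1; r * \<omega>\<^sup>2 \<le> 1\<rbrakk> \<Longrightarrow>
     norm (cell_cf r \<theta> \<omega> - exp (cell_exponent r \<theta> \<omega>))
       \<le> cell_const * (cell_var r \<theta> \<omega> * (max 1 r * \<bar>\<theta>\<bar> + \<bar>\<omega>\<bar>) ^ 3)"
  using someI_ex[OF cell_cf_expansion] unfolding cell_const_def by blast+

lemma power_le_exp: "0 \<le> (y::real) \<Longrightarrow> y ^ k \<le> fact k * exp y"
proof -
  assume y: "0 \<le> y"
  have "y ^ k /\<^sub>R fact k \<le> (\<Sum>i. y ^ i /\<^sub>R fact i)"
    using y by (intro order_trans[OF _ sum_le_suminf[OF summable_exp_generic, of "{k}"]]) auto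
  thus ?thesis by (simp add: exp_def field_simps)
qed

text \<open>Polynomial factors in the error bounds are absorbed at the price of an eighth of t^2 +
  s^2 in the Gaussian exponent.\<close>

lemma poly_le_gauss:
  fixes t s :: real
  shows "(1 + \<bar>t\<bar> + \<bar>s\<bar>) ^ k \<le> 2 * fact k * 8 ^ k * exp ((t\<^sup>2 + s\<^sup>2) / 8)"
proof -
  define w where "w = t\<^sup>2 + s\<^sup>2"
  have "0 \<le> (\<bar>t\<bar> - 1)\<^sup>2" "0 \<le> (\<bar>s\<bar> - 1)\<^sup>2" by auto
  hence "2 * \<bar>t\<bar> \<le> t\<^sup>2 + 1" "2 * \<bar>s\<bar> \<le> s\<^sup>2 + 1" by (simp_all add: power2_diff)
  hence "1 + \<bar>t\<bar> + \<bar>s\<bar> \<le> 2 + w"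
    using zero_le_power2[of t] zero_le_power2[of s] unfolding w_def by linarith
  hence "(1 + \<bar>t\<bar> + \<bar>s\<bar>) ^ k \<le> (2 + w) ^ k" by (intro power_mono) auto
  also have "\<dots> = 8 ^ k * ((2 + w) / 8) ^ k" by (simp add: power_divide)
  also have "\<dots> \<le> 8 ^ k * (fact k * exp ((2 + w) / 8))"
    by (intro mult_left_mono power_le_exp) (auto simp: w_def)
  also have "exp ((2 + w) / 8) = exp (1 / 4) * exp (w / 8)" by (simp add: exp_add[symmetric] add_divide_distrib)
  also have "8 ^ k * (fact k * (exp (1 / 4) * exp (w / 8))) \<le> 8 ^ k * (fact k * (2 * exp (w / 8)))"
    using exp_bound_half[of "1 / 4 :: real"] by (intro mult_left_mono mult_right_mono) auto
  finally show ?thesis by (simp add: w_def mult_ac)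
qed

text \<open>One index n with its N and p. A constant built from c1 and c2 alone keeps only these as
  arguments outside the locale, which certifies its independence of n, N and p.\<close>

locale cells =
  fixes c1 c2 :: real and n N :: nat and p :: "nat \<Rightarrow> real"
  assumes c1: "c1 > 0" and n: "n \<ge> 1" and p_pos: "\<And>m. m \<in> {1..N} \<Longrightarrow> p m > 0" and p_sum: "(\<Sum>m=1..N. p m) = 1"
    and p_ge: "\<And>m. m \<in> {1..N} \<Longrightarrow> c1 \<le> real N * p m" and p_le: "\<And>m. m \<in> {1..N} \<Longrightarrow> real N * p m \<le> c2"
begin

abbreviation "l \<equiv> lam n N"
abbreviation "r \<equiv> lam_cell n p"
abbreviation "\<delta> \<equiv> cell_dev n N p"
abbreviation "\<sigma> \<equiv> sigma_N n N p"
text \<open>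
  \<open>K\<close> is the effective number of cells: the Edgeworth terms are of order \<open>1 / sqrt K\<close> and \<open>1 / K\<close>.
  Outside a neighbourhood of the origin the joint characteristic function is at most \<open>exp (- c * \<kappa>)\<close>.
\<close>

definition "M = max 1 l"
definition "mt = min 1 l"
definition "K = real N * mt\<^sup>2"
definition "\<kappa> = K / M\<^sup>2"
text \<open>Thresholds for \<tau> and \<theta> in units of M^(-1/2) and M^(-3/2). The small value of
  c2 e2 keeps r \<omega>^2 small near the origin; the 1500 makes the loss 3 r |\<theta>| / 2 of
  \<open>cell_cf_near_linear\<close> at most a quarter of the Poisson gain in
  \<open>joint_cf_zone2\<close>.\<close>

definition "e2 = 1 / (1000 * c2)"
definition "e1 = c1 * e2\<^sup>2 / (1500 * c2)"

lemma N: "N \<ge> 1" using p_sum by (cases N) auto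

text \<open>The numbers N p m have mean 1 over the cells, so both bounds may be averaged.\<close>

lemma c12: "c1 \<le> 1" "1 \<le> c2"
proof -
  have "(\<Sum>m=1..N. c1) \<le> (\<Sum>m=1..N. real N * p m)" by (intro sum_mono p_ge)
  hence "real N * c1 \<le> real N * 1" by (simp only: sum_distrib_left[symmetric] p_sum) simp
  thus "c1 \<le> 1" using N by simp
  have "(\<Sum>m=1..N. real N * p m) \<le> (\<Sum>m=1..N. c2)" by (intro sum_mono p_le)
  hence "real N * 1 \<le> real N * c2" by (simp only: sum_distrib_left[symmetric] p_sum) simp
  thus "1 \<le> c2" using N by simp
qed

lemma l: "l > 0" and nl: "real n = real N * l" using n N by (auto simp: lam_def)

lemma M: "M \<ge> 1" "l \<le> M" and mt: "0 < mt" "mt \<le> 1" "l = mt * M" and K: "K > 0" and \<kappa>: "\<kappa> > 0"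
proof -
  show "M \<ge> 1" "l \<le> M" "mt \<le> 1" by (auto simp: M_def mt_def)
  show "0 < mt" "l = mt * M" using l by (auto simp: mt_def M_def min_def max_def)
  thus "K > 0" using N by (simp add: K_def)
  thus "\<kappa> > 0" by (simp add: \<kappa>_def M_def)
qed

lemma K_le: "K \<le> real N" "K \<le> real n"
proof -
  have "mt\<^sup>2 \<le> 1" using mt by (intro power_le_one) auto
  moreover have "mt\<^sup>2 \<le> mt" using mt by (simp add: power2_eq_square mult_left_le)
  moreover have "mt \<le> l" by (simp add: mt_def)
  ultimately show "K \<le> real N" "K \<le> real n" unfolding K_def nl by (auto intro!: mult_left_le mult_left_mono)
qed

lemma r: assumes "m \<in> {1..N}" shows "r m > 0" "c1 * l \<le> r m" "r m \<le> c2 * l"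
proof -
  have eq: "r m = (real N * p m) * l" using N by (simp add: lam_cell_def lam_def)
  show "c1 * l \<le> r m" "r m \<le> c2 * l" unfolding eq using p_ge[OF assms] p_le[OF assms] l by (auto intro!: mult_right_mono)
  show "r m > 0" using p_pos[OF assms] n by (simp add: lam_cell_def)
qed

lemma sum_r: "(\<Sum>m=1..N. r m) = real n"
  using p_sum by (simp add: lam_cell_def sum_distrib_left[symmetric] del: One_nat_def)

lemma power_sum_2: "0 \<le> real n * power_sum N p 2" "real n * power_sum N p 2 \<le> c2 * l"
proof -
  show "0 \<le> real n * power_sum N p 2" by (simp add: power_sum_def sum_nonneg)
  have "real N * power_sum N p 2 = (\<Sum>m=1..N. (real N * p m) * p m)"
    by (simp add: power_sum_def sum_distrib_left power2_eq_square mult.assoc)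
  also have "\<dots> \<le> (\<Sum>m=1..N. c2 * p m)" using p_le p_pos by (intro sum_mono mult_right_mono) (auto intro: less_imp_le)
  also have "\<dots> = c2" by (simp only: sum_distrib_left[symmetric] p_sum mult_1_right)
  finally have "l * (real N * power_sum N p 2) \<le> l * c2" using l by (intro mult_left_mono) auto
  thus "real n * power_sum N p 2 \<le> c2 * l" by (simp add: nl mult_ac)
qed

lemma \<delta>: "m \<in> {1..N} \<Longrightarrow> \<bar>\<delta> m\<bar> \<le> c2 * l"
  using power_sum_2 r[of m] by (auto simp: cell_dev_def abs_le_iff)

lemma \<delta>_le: "m \<in> {1..N} \<Longrightarrow> \<bar>\<delta> m\<bar> \<le> c2 * M"
  using \<delta>[of m] M c12 mult_left_mono[of l M c2] by linarith

lemma sum_r_powers: "(\<Sum>m=1..N. (r m)\<^sup>2) = (real n)\<^sup>2 * power_sum N p 2" "(\<Sum>m=1..N. (r m) ^ 3) = (real n) ^ 3 * power_sum N p 3"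
  by (simp_all add: lam_cell_def power_sum_def power_mult_distrib sum_distrib_left)

text \<open>n P_2 is the mean of the r m under the weights r m / n, so the deviations cancel.
  Probabilistically, the statistic and the total are uncorrelated.\<close>

lemma sum_r_\<delta>: "(\<Sum>m=1..N. r m * \<delta> m) = 0"
proof -
  have "(\<Sum>m=1..N. r m * \<delta> m) = (\<Sum>m=1..N. (r m)\<^sup>2) - real n * power_sum N p 2 * (\<Sum>m=1..N. r m)"
    by (simp add: cell_dev_def sum_subtractf right_diff_distrib power2_eq_square sum_distrib_left mult_ac del: One_nat_def)
  thus ?thesis unfolding sum_r sum_r_powers by (simp add: power2_eq_square)
qed

text \<open>The orthogonal decomposition of \<open>g_stat\<close> in each cell: 2 r^2 from
  \<open>charlier2\<close> and 4 r \<delta>^2 from the linear part.\<close>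

lemma \<sigma>_sq: "\<sigma>\<^sup>2 = (\<Sum>m=1..N. 2 * (r m)\<^sup>2 + 4 * r m * (\<delta> m)\<^sup>2)"
proof -
  define b where "b = real n * power_sum N p 2"
  have ss: "sigma_sq n N p = 2 * real n ^ 2 * power_sum N p 2 + 4 * real n ^ 3 * (power_sum N p 3 - (power_sum N p 2)\<^sup>2)"
    by (rule sigma_sq_eq) (use n p_pos p_sum in auto)
  have "(\<Sum>m=1..N. 2 * (r m)\<^sup>2 + 4 * r m * (\<delta> m)\<^sup>2) = (\<Sum>m=1..N. 2 * (r m)\<^sup>2 + 4 * (r m) ^ 3 - 8 * b * (r m)\<^sup>2 + 4 * b\<^sup>2 * r m)"
    by (intro sum.cong refl) (simp add: cell_dev_def b_def power2_eq_square power3_eq_cube algebra_simps)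
  also have "\<dots> = 2 * (\<Sum>m=1..N. (r m)\<^sup>2) + 4 * (\<Sum>m=1..N. (r m) ^ 3) - 8 * b * (\<Sum>m=1..N. (r m)\<^sup>2) + 4 * b\<^sup>2 * (\<Sum>m=1..N. r m)"
    by (simp add: sum.distrib sum_subtractf sum_distrib_left del: One_nat_def)
  also have "\<dots> = sigma_sq n N p"
    unfolding sum_r sum_r_powers ss b_def by (simp add: power2_eq_square power3_eq_cube algebra_simps)
  finally have eq: "(\<Sum>m=1..N. 2 * (r m)\<^sup>2 + 4 * r m * (\<delta> m)\<^sup>2) = sigma_sq n N p" .
  moreover have "0 \<le> (\<Sum>m=1..N. 2 * (r m)\<^sup>2 + 4 * r m * (\<delta> m)\<^sup>2)"
  proof (rule sum_nonneg)
    show "0 \<le> 2 * (r m)\<^sup>2 + 4 * r m * (\<delta> m)\<^sup>2" if "m \<in> {1..N}" for m using r(1)[OF that] by simp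
  qed
  ultimately show ?thesis by (simp add: sigma_N_def del: One_nat_def)
qed

text \<open>The contribution of \<open>charlier2\<close> alone is used, since the linear part
  vanishes when all cells are equal.\<close>

lemma \<sigma>_ge: "c1 * (sqrt N * l) \<le> \<sigma>" and \<sigma>_pos: "\<sigma> > 0"
proof -
  have "(c1 * l)\<^sup>2 \<le> (r m)\<^sup>2" if "m \<in> {1..N}" for m using r[OF that] c1 l by (intro power_mono) auto
  hence "(\<Sum>m=1..N. (c1 * l)\<^sup>2) \<le> (\<Sum>m=1..N. 2 * (r m)\<^sup>2 + 4 * r m * (\<delta> m)\<^sup>2)"
  proof (intro sum_mono)
    fix m assume m: "m \<in> {1..N}" and h: "\<And>m. m \<in> {1..N} \<Longrightarrow> (c1 * l)\<^sup>2 \<le> (r m)\<^sup>2"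
    have "0 \<le> 4 * r m * (\<delta> m)\<^sup>2" using r(1)[OF m] by simp
    thus "(c1 * l)\<^sup>2 \<le> 2 * (r m)\<^sup>2 + 4 * r m * (\<delta> m)\<^sup>2" using h[OF m] zero_le_power2[of "r m"] by linarith
  qed
  hence "(c1 * (sqrt N * l))\<^sup>2 \<le> \<sigma>\<^sup>2" unfolding \<sigma>_sq by (simp add: power_mult_distrib mult_ac)
  moreover have "\<sigma> \<ge> 0" by (auto simp: sigma_N_def sigma_sq_def intro!: sum_nonneg)
  ultimately show 1: "c1 * (sqrt N * l) \<le> \<sigma>" by (rule power2_le_imp_le)
  have "0 < c1 * (sqrt N * l)" using c1 l N by simp
  with 1 show "\<sigma> > 0" by linarith
qed

text \<open>The factor sqrt M allows for deviations \<delta> of order \<lambda>, for which the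
  linear part contributes \<lambda>^3 per cell.\<close>

lemma \<sigma>_le: "\<sigma> \<le> 3 * c2\<^sup>2 * (sqrt N * l * sqrt M)"
proof -
  have "2 * (r m)\<^sup>2 + 4 * r m * (\<delta> m)\<^sup>2 \<le> 6 * c2 ^ 3 * (l\<^sup>2 * M)" if m: "m \<in> {1..N}" for m
  proof -
    have a: "(r m)\<^sup>2 \<le> (c2 * l)\<^sup>2" using r[OF m] by (intro power_mono) auto
    have b: "(\<delta> m)\<^sup>2 \<le> (c2 * l)\<^sup>2" using \<delta>[OF m] by (metis abs_ge_zero power2_abs power_mono)
    have "r m * (\<delta> m)\<^sup>2 \<le> (c2 * l) * (c2 * l)\<^sup>2" using b r[OF m] by (intro mult_mono) auto
    also have "\<dots> = c2 ^ 3 * (l\<^sup>2 * l)" by (simp add: power2_eq_square power3_eq_cube)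
    also have "\<dots> \<le> c2 ^ 3 * (l\<^sup>2 * M)" using c12 M by (intro mult_left_mono) auto
    finally have B: "r m * (\<delta> m)\<^sup>2 \<le> c2 ^ 3 * (l\<^sup>2 * M)" .
    have "c2\<^sup>2 * (l\<^sup>2 * 1) \<le> c2 ^ 3 * (l\<^sup>2 * M)" using c12 M by (intro mult_mono power_increasing mult_left_mono) auto
    hence "(r m)\<^sup>2 \<le> c2 ^ 3 * (l\<^sup>2 * M)" using a by (simp add: power_mult_distrib)
    with B show ?thesis by linarith
  qed
  hence "\<sigma>\<^sup>2 \<le> (\<Sum>m=1..N. 6 * c2 ^ 3 * (l\<^sup>2 * M))" unfolding \<sigma>_sq by (intro sum_mono)
  also have "\<dots> = 6 * c2 ^ 3 * (real N * l\<^sup>2 * M)" by simp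
  also have "\<dots> \<le> 9 * c2 ^ 4 * (real N * l\<^sup>2 * M)" using c12 M by (intro mult_right_mono mult_mono power_increasing) auto
  also have "\<dots> = (3 * c2\<^sup>2 * (sqrt N * l * sqrt M))\<^sup>2" using M by (simp add: power_mult_distrib flip: power_mult)
  finally show ?thesis using c12 l M by (intro power2_le_imp_le[of \<sigma>]) auto
qed

abbreviation "om \<theta> \<tau> m \<equiv> \<tau> + 2 * \<theta> * \<delta> m"

text \<open>The cross terms cancel by \<open>sum_r_\<delta>\<close>, so the scalings by \<sigma> and
  sqrt n turn the quadratic form into exactly t^2 + s^2.\<close>

lemma sum_cell_var: "(\<Sum>m=1..N. cell_var (r m) (t / \<sigma>) (om (t / \<sigma>) (s / sqrt n) m)) = t\<^sup>2 + s\<^sup>2"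
proof -
  define \<theta> \<tau> where "\<theta> = t / \<sigma>" and "\<tau> = s / sqrt n"
  have "(\<Sum>m=1..N. cell_var (r m) \<theta> (om \<theta> \<tau> m)) = (\<Sum>m=1..N. \<theta>\<^sup>2 * (2 * (r m)\<^sup>2 + 4 * r m * (\<delta> m)\<^sup>2) + \<tau>\<^sup>2 * r m + 4 * \<theta> * \<tau> * (r m * \<delta> m))"
    by (intro sum.cong refl) (simp add: cell_var_def power2_eq_square algebra_simps)
  also have "\<dots> = \<theta>\<^sup>2 * \<sigma>\<^sup>2 + \<tau>\<^sup>2 * real n + 4 * \<theta> * \<tau> * 0"
    unfolding \<sigma>_sq sum_r[symmetric] sum_r_\<delta>[symmetric] by (simp only: sum.distrib sum_distrib_left[symmetric])
  also have "\<dots> = t\<^sup>2 + s\<^sup>2" using \<sigma>_pos n by (simp add: \<theta>_def \<tau>_def power_divide)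
  finally show ?thesis by (simp add: \<theta>_def \<tau>_def)
qed

definition "D = 3 * c2 / c1"

lemma D: "D \<ge> 1" using c1 c12 by (simp add: D_def field_simps)

text \<open>This is where K comes from: \<sigma> is at least c1 sqrt N \<lambda> and M / \<lambda> =
  1 / \<open>mt\<close>, so M |t / \<sigma>| is of order |t| / sqrt K. The 3 in D counts one for
  max(1, r) and two for the factor in 2 \<theta> \<delta>.\<close>

lemma cell_size:
  assumes m: "m \<in> {1..N}"
  shows "max 1 (r m) * \<bar>t / \<sigma>\<bar> + \<bar>om (t / \<sigma>) (s / sqrt n) m\<bar> \<le> D * ((\<bar>t\<bar> + \<bar>s\<bar>) / sqrt K)"
proof -
  have sK: "sqrt K = sqrt N * mt" using mt by (simp add: K_def real_sqrt_mult)
  have sK0: "sqrt K > 0" using K by simp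
  have "M * \<bar>t / \<sigma>\<bar> \<le> (1 / c1) * (\<bar>t\<bar> / sqrt K)"
  proof -
    have "\<bar>t / \<sigma>\<bar> \<le> \<bar>t\<bar> / (c1 * (sqrt N * l))"
      using \<sigma>_ge \<sigma>_pos c1 l N by (simp add: abs_divide divide_left_mono)
    hence "M * \<bar>t / \<sigma>\<bar> \<le> M * (\<bar>t\<bar> / (c1 * (sqrt N * l)))" using M by (intro mult_left_mono) auto
    also have "\<dots> = (1 / c1) * (\<bar>t\<bar> / sqrt K)" using M mt by (simp add: sK mt(3))
    finally show ?thesis .
  qed
  hence T: "M * \<bar>t / \<sigma>\<bar> \<le> \<bar>t\<bar> / sqrt K / c1" by (simp add: mult.commute)
  have h: "max 1 (r m) * \<bar>t / \<sigma>\<bar> \<le> c2 * (M * \<bar>t / \<sigma>\<bar>)"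
  proof -
    have "max 1 (r m) \<le> c2 * M"
    proof (rule max.boundedI)
      show "1 \<le> c2 * M" using c12 M mult_mono[of 1 c2 1 M] by simp
      have "c2 * l \<le> c2 * M" using c12 M by (intro mult_left_mono) auto
      thus "r m \<le> c2 * M" using r[OF m] by linarith
    qed
    thus ?thesis by (simp only: mult.assoc[symmetric] mult_right_mono abs_ge_zero)
  qed
  have "\<bar>2 * (t / \<sigma>) * \<delta> m\<bar> = 2 * \<bar>t / \<sigma>\<bar> * \<bar>\<delta> m\<bar>" by (simp add: abs_mult)
  also have "\<dots> \<le> 2 * \<bar>t / \<sigma>\<bar> * (c2 * M)"
    using \<delta>_le[OF m] M by (intro mult_left_mono) auto
  finally have w1: "\<bar>2 * (t / \<sigma>) * \<delta> m\<bar> \<le> 2 * (c2 * (M * \<bar>t / \<sigma>\<bar>))" by (simp add: mult_ac)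
  have w2: "\<bar>s / sqrt n\<bar> \<le> \<bar>s\<bar> / sqrt K"
    using K_le K n by (simp add: abs_divide divide_left_mono)
  have "c2 * (M * \<bar>t / \<sigma>\<bar>) \<le> c2 * (\<bar>t\<bar> / sqrt K / c1)" using T c12 by (intro mult_left_mono) auto
  hence "max 1 (r m) * \<bar>t / \<sigma>\<bar> + \<bar>om (t / \<sigma>) (s / sqrt n) m\<bar> \<le> 3 * (c2 * (\<bar>t\<bar> / sqrt K / c1)) + \<bar>s\<bar> / sqrt K"
    using h w1 w2 abs_triangle_ineq[of "s / sqrt n" "2 * (t / \<sigma>) * \<delta> m"] by linarith
  also have "\<dots> = D * (\<bar>t\<bar> / sqrt K) + 1 * (\<bar>s\<bar> / sqrt K)" by (simp add: D_def mult.commute)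
  also have "\<dots> \<le> D * (\<bar>t\<bar> / sqrt K) + D * (\<bar>s\<bar> / sqrt K)" using D sK0 by (intro add_mono mult_right_mono) auto
  finally show ?thesis by (simp add: add_divide_distrib distrib_left)
qed

lemma e: "0 < e2" "e2 \<le> 1 / 1000" "0 < e1" "e1 \<le> e2 / 1000" "c2 * e2 = 1 / 1000" "c2 * e1 = c1 * e2\<^sup>2 / 1500" "c2 * e1 \<le> e2 / 1000"
proof -
  show 1: "0 < e2" "c2 * e2 = 1 / 1000" using c12 by (auto simp: e2_def)
  show 2: "e2 \<le> 1 / 1000" using c12 by (simp add: e2_def field_simps)
  show 3: "0 < e1" using 1 c1 c12 by (simp add: e1_def)
  show 4: "c2 * e1 = c1 * e2\<^sup>2 / 1500" using c12 by (simp add: e1_def)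
  have "c1 * e2\<^sup>2 \<le> 1 * (e2 * 1)" unfolding power2_eq_square using c1 c12 1 2 by (intro mult_mono) auto
  thus 5: "c2 * e1 \<le> e2 / 1000" unfolding 4 using 1 by linarith
  have "1 * e1 \<le> c2 * e1" using c12 3 by (intro mult_right_mono) auto
  thus "e1 \<le> e2 / 1000" using 5 by linarith
qed

text \<open>Below the \<theta>-threshold the shift 2 \<theta> \<delta> is small on the scale 1 /
  sqrt M, the scale on which r \<omega>^2 remains bounded.\<close>

lemma om_bounds:
  assumes m: "m \<in> {1..N}" and \<theta>: "\<bar>\<theta>\<bar> * (M * sqrt M) \<le> e1"
  shows "sqrt M * \<bar>2 * \<theta> * \<delta> m\<bar> \<le> 2 * (c2 * e1)" "max 1 (r m) * \<bar>\<theta>\<bar> \<le> c2 * e1"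
proof -
  have sM: "sqrt M \<ge> 1" using M by simp
  have "sqrt M * \<bar>2 * \<theta> * \<delta> m\<bar> = 2 * (\<bar>\<theta>\<bar> * sqrt M) * \<bar>\<delta> m\<bar>" by (simp add: abs_mult)
  also have "\<dots> \<le> 2 * (\<bar>\<theta>\<bar> * sqrt M) * (c2 * M)"
    using \<delta>_le[OF m] M by (intro mult_left_mono) auto
  also have "\<dots> = 2 * (c2 * (\<bar>\<theta>\<bar> * (M * sqrt M)))" by simp
  also have "\<dots> \<le> 2 * (c2 * e1)" using \<theta> c12 by (intro mult_left_mono) auto
  finally show "sqrt M * \<bar>2 * \<theta> * \<delta> m\<bar> \<le> 2 * (c2 * e1)" .
  have "max 1 (r m) \<le> c2 * M"
  proof (rule max.boundedI)
    show "1 \<le> c2 * M" using c12 M mult_mono[of 1 c2 1 M] by simp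
    have "c2 * l \<le> c2 * M" using c12 M by (intro mult_left_mono) auto
    thus "r m \<le> c2 * M" using r[OF m] by linarith
  qed
  hence "max 1 (r m) * \<bar>\<theta>\<bar> \<le> c2 * M * \<bar>\<theta>\<bar>" by (intro mult_right_mono) auto
  also have "\<dots> \<le> c2 * M * (\<bar>\<theta>\<bar> * sqrt M)" using c12 M sM mult_left_mono[of 1 "sqrt M" "\<bar>\<theta>\<bar>"] by (intro mult_left_mono) auto
  also have "\<dots> = c2 * (\<bar>\<theta>\<bar> * (M * sqrt M))" by simp
  also have "\<dots> \<le> c2 * e1" using \<theta> c12 by (intro mult_left_mono) auto
  finally show "max 1 (r m) * \<bar>\<theta>\<bar> \<le> c2 * e1" .
qed

text \<open>For small \<theta> each cell is close to its Poisson factor exp(-r (1 - cos \<omega>)),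
  whose gain x / 2 is twice the loss x / 4 allowed for \<theta>.\<close>

lemma joint_cf_zone2:
  assumes \<theta>: "\<bar>\<theta>\<bar> * (M * sqrt M) \<le> e1" and \<tau>: "e2 \<le> \<bar>\<tau>\<bar> * sqrt M" "\<bar>\<tau>\<bar> \<le> pi"
  shows "norm (joint_cf n N p \<theta> \<tau>) \<le> exp (- (c1 * e2\<^sup>2 / 960) * \<kappa>)"
proof -
  have sM: "sqrt M \<ge> 1" using M by simp
  \<comment> \<open>A lower bound for r (1 - cos \<omega>), obtained from r \<ge> c1
    \<open>mt\<close> M, M \<omega>^2 \<ge> e2^2 / 4 and 1 - cos \<omega> \<ge> \<omega>^2 /
    60.\<close>
  define x where "x = c1 * e2\<^sup>2 * mt / 240"
  have x: "0 \<le> x" "x \<le> 1"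
  proof -
    show "0 \<le> x" using c1 mt by (simp add: x_def)
    have "c1 * e2\<^sup>2 * mt \<le> 1 * 1 * 1" using c1 c12 e mt by (intro mult_mono power_le_one) auto
    thus "x \<le> 1" by (simp add: x_def)
  qed
  have "norm (cell_cf (r m) \<theta> (om \<theta> \<tau> m)) \<le> exp (- x / 4)" if m: "m \<in> {1..N}" for m
  proof -
    note b = om_bounds[OF m \<theta>]
    have d: "\<bar>2 * \<theta> * \<delta> m\<bar> \<le> 2 * (c2 * e1)" using b(1) sM mult_right_mono[of 1 "sqrt M" "\<bar>2 * \<theta> * \<delta> m\<bar>"] by simp
    have om4: "\<bar>om \<theta> \<tau> m\<bar> \<le> 22 / 5" using d \<tau>(2) pi_less_4 e abs_triangle_ineq[of \<tau> "2 * \<theta> * \<delta> m"] by linarith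
    have "e2 / 2 \<le> sqrt M * \<bar>om \<theta> \<tau> m\<bar>"
    proof -
      have "sqrt M * \<bar>\<tau>\<bar> \<le> sqrt M * (\<bar>om \<theta> \<tau> m\<bar> + \<bar>2 * \<theta> * \<delta> m\<bar>)" using M by (intro mult_left_mono) auto
      thus ?thesis using b(1) \<tau>(1) e by (simp add: distrib_left mult.commute)
    qed
    hence "(e2 / 2)\<^sup>2 \<le> (sqrt M * \<bar>om \<theta> \<tau> m\<bar>)\<^sup>2" using e by (intro power_mono) auto
    hence o2: "e2\<^sup>2 / 4 \<le> M * (om \<theta> \<tau> m)\<^sup>2" using M by (simp add: power_mult_distrib power_divide)
    have "x \<le> r m * (1 - cos (om \<theta> \<tau> m))"
    proof -
      have "x = c1 * mt * (e2\<^sup>2 / 4) / 60" by (simp add: x_def)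
      also have "\<dots> \<le> c1 * mt * (M * (om \<theta> \<tau> m)\<^sup>2) / 60" using o2 c1 mt by (intro divide_right_mono mult_left_mono) auto
      also have "\<dots> = c1 * l * ((om \<theta> \<tau> m)\<^sup>2 / 60)" by (simp add: mt(3))
      also have "\<dots> \<le> r m * (1 - cos (om \<theta> \<tau> m))"
        using r[OF m] one_minus_cos_ge[OF om4] by (intro mult_mono) auto
      finally show ?thesis .
    qed
    hence "exp (- r m * (1 - cos (om \<theta> \<tau> m))) \<le> exp (- x)" by simp
    also have "\<dots> \<le> 1 - x / 2" using one_minus_exp_ge[OF x(1)] x by (simp add: min_def split: if_splits)
    finally have E: "exp (- r m * (1 - cos (om \<theta> \<tau> m))) \<le> 1 - x / 2" .
    have "3 / 2 * r m * \<bar>\<theta>\<bar> \<le> x / 4"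
    proof -
      have "3 / 2 * r m * \<bar>\<theta>\<bar> \<le> 3 / 2 * (c2 * l) * \<bar>\<theta>\<bar>" using r[OF m] by (intro mult_right_mono mult_left_mono) auto
      also have "\<dots> = 3 / 2 * mt * c2 * (\<bar>\<theta>\<bar> * (M * 1))" by (simp add: mt(3))
      also have "\<dots> \<le> 3 / 2 * mt * c2 * (\<bar>\<theta>\<bar> * (M * sqrt M))" using mt c12 M sM by (intro mult_left_mono) auto
      also have "\<dots> \<le> 3 / 2 * mt * c2 * e1" using \<theta> mt c12 by (intro mult_left_mono) auto
      also have "\<dots> = 3 / 2 * mt * (c1 * e2\<^sup>2 / 1500)" using e(6) by simp
      also have "\<dots> \<le> x / 4" using c1 mt by (simp add: x_def field_simps)
      finally show ?thesis .
    qed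
    with E have "norm (cell_cf (r m) \<theta> (om \<theta> \<tau> m)) \<le> 1 - x / 4"
      using cell_cf_near_linear[OF r(1)[OF m], of \<theta> "om \<theta> \<tau> m"] by linarith
    thus ?thesis using exp_ge_add_one_self[of "- x / 4"] by linarith
  qed
  hence "norm (joint_cf n N p \<theta> \<tau>) \<le> (\<Prod>m=1..N. exp (- x / 4))"
    unfolding joint_cf_def prod_norm[symmetric] by (intro prod_mono) auto
  also have "\<dots> = exp (- (c1 * e2\<^sup>2 / 960) * (real N * mt))"
    by (simp add: exp_of_nat_mult[symmetric] x_def mult_ac)
  also have "\<dots> \<le> exp (- (c1 * e2\<^sup>2 / 960) * \<kappa>)"
  proof -
    have "\<kappa> \<le> K / 1" unfolding \<kappa>_def using M K by (intro divide_left_mono) auto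
    also have "\<dots> \<le> real N * mt" using mt by (simp add: K_def power2_eq_square mult_left_mono mult_left_le)
    finally have "(c1 * e2\<^sup>2 / 960) * \<kappa> \<le> (c1 * e2\<^sup>2 / 960) * (real N * mt)" using c1 by (intro mult_left_mono) auto
    thus ?thesis by simp
  qed
  finally show ?thesis .
qed

text \<open>Here the quadratic-phase bound applies, uniformly in \<tau>. It degenerates where cos (2
  \<theta>) = 1; apart from the origin the first such point is |\<theta>| = \<pi>, which the
  restriction to half a period excludes.\<close>

lemma joint_cf_zone3:
  assumes \<theta>: "e1 \<le> \<bar>\<theta>\<bar> * (M * sqrt M)" "\<bar>\<theta>\<bar> \<le> pi / 2"
  shows "norm (joint_cf n N p \<theta> \<tau>) \<le> exp (- (c1\<^sup>2 * e1\<^sup>2 / 240) * \<kappa>)"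
proof -
  \<comment> \<open>Half the product of the lower bounds c1 \<open>mt\<close> / 2 and b / 2 for the
    two factors in \<open>poisson_quadratic_phase_bound\<close>; its quotient of \<open>mt\<close>
    and M is the source of \<kappa>.\<close>
  define y where "y = c1\<^sup>2 * e1\<^sup>2 * mt\<^sup>2 / (120 * M\<^sup>2)"
  have "norm (cell_cf (r m) \<theta> (om \<theta> \<tau> m)) \<le> exp (- y / 2)" if m: "m \<in> {1..N}" for m
  proof -
    have a: "c1 * mt / 2 \<le> 1 - exp (- r m)"
    proof -
      have "c1 * mt \<le> min 1 (r m)"
      proof (rule min.boundedI)
        show "c1 * mt \<le> 1" using mult_mono[of c1 1 mt 1] c1 c12 mt by simp
        have "c1 * mt \<le> c1 * l" using c1 by (intro mult_left_mono) (auto simp: mt_def)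
        thus "c1 * mt \<le> r m" using r[OF m] by linarith
      qed
      thus ?thesis using one_minus_exp_ge[of "r m"] r(1)[OF m] by linarith
    qed
    define b where "b = c1 * e1\<^sup>2 * mt / (15 * M\<^sup>2)"
    have b1: "b \<le> 1"
    proof -
      have "c1 * e1\<^sup>2 * mt \<le> 1 * 1 * 1" using c1 c12 e mt by (intro mult_mono power_le_one) auto
      moreover have "1 \<le> M\<^sup>2" using M by simp
      ultimately have "c1 * e1\<^sup>2 * mt \<le> 15 * M\<^sup>2" by linarith
      thus ?thesis using M by (simp add: b_def divide_le_eq)
    qed
    have "b \<le> r m * (1 - cos (2 * \<theta>))"
    proof -
      have "e1\<^sup>2 \<le> (\<bar>\<theta>\<bar> * (M * sqrt M))\<^sup>2" using \<theta> e by (intro power_mono) auto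
      also have "\<dots> = \<theta>\<^sup>2 * (M\<^sup>2 * M)" using M by (simp add: power_mult_distrib)
      finally have "c1 * mt * (e1\<^sup>2 / (15 * M\<^sup>2)) \<le> c1 * mt * (\<theta>\<^sup>2 * (M\<^sup>2 * M) / (15 * M\<^sup>2))"
        using c1 mt by (intro mult_left_mono divide_right_mono) auto
      hence "b \<le> c1 * l * ((2 * \<theta>)\<^sup>2 / 60)" using M by (simp add: b_def mt(3) power_mult_distrib mult_ac)
      also have "\<dots> \<le> r m * (1 - cos (2 * \<theta>))"
        using r[OF m] \<theta>(2) pi_less_4 by (intro mult_mono one_minus_cos_ge) auto
      finally show ?thesis .
    qed
    moreover have "0 \<le> r m * (1 - cos (2 * \<theta>))" using r(1)[OF m] by simp
    ultimately have b2: "b / 2 \<le> 1 - exp (- r m * (1 - cos (2 * \<theta>)))"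
      using one_minus_exp_ge[of "r m * (1 - cos (2 * \<theta>))"] b1 by (simp add: min_def split: if_splits)
    have "y = (c1 * mt / 2) * (b / 2) / 2" using M by (simp add: y_def b_def power2_eq_square)
    also have "\<dots> \<le> (1 - exp (- r m)) * (1 - exp (- r m * (1 - cos (2 * \<theta>)))) / 2"
      using a b2 c1 mt r(1)[OF m] by (intro divide_right_mono mult_mono) (auto simp: b_def)
    finally have "norm (cell_cf (r m) \<theta> (om \<theta> \<tau> m)) ^ 2 \<le> 1 - y"
      unfolding cell_cf_as_quadratic_phase
      using poisson_quadratic_phase_bound[OF r(1)[OF m], of \<theta> "om \<theta> \<tau> m - \<theta> * (2 * r m + 1)"] by linarith
    also have "\<dots> \<le> exp (- y)" using exp_ge_add_one_self[of "- y"] by simp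
    also have "\<dots> = exp (- y / 2) ^ 2" by (simp add: exp_double[symmetric])
    finally show ?thesis by (rule power2_le_imp_le) simp
  qed
  hence "norm (joint_cf n N p \<theta> \<tau>) \<le> (\<Prod>m=1..N. exp (- y / 2))"
    unfolding joint_cf_def prod_norm[symmetric] by (intro prod_mono) auto
  also have "\<dots> = exp (- (c1\<^sup>2 * e1\<^sup>2 / 240) * \<kappa>)"
    by (simp add: exp_of_nat_mult[symmetric] y_def \<kappa>_def K_def mult_ac)
  finally show ?thesis .
qed

end

section \<open>Expansion of the joint characteristic function\<close>

text \<open>Applied with x of order K^(-1/2) and y of order 1 / K: everything up to order 1 / K is
  kept, and for K \<ge> 1 the remainder is of order K^(-3/2).\<close>

lemma exp_two_scale_expansion:
  fixes x y :: real
  shows "norm (exp (- \<i> * of_real x) * of_real (exp y) - (1 - \<i> * of_real x + of_real y - of_real (x\<^sup>2) / 2))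
    \<le> \<bar>x\<bar> ^ 3 / 6 + \<bar>y\<bar> * \<bar>x\<bar> + y\<^sup>2 * exp \<bar>y\<bar>"
proof -
  define E where "E = iexp (- x)"
  have E: "exp (- \<i> * of_real x) = E" by (simp add: E_def)
  have 1: "norm (E - (1 - \<i> * of_real x - of_real (x\<^sup>2) / 2)) \<le> \<bar>x\<bar> ^ 3 / 6"
    using iexp_approx1[of "- x" 2] by (simp add: E_def eval_nat_numeral fact_numeral algebra_simps)
  have 2: "norm (of_real y * (E - 1)) \<le> \<bar>y\<bar> * \<bar>x\<bar>"
    using iexp_approx1[of "- x" 0] by (simp add: E_def norm_mult mult_left_mono)
  have 3: "norm (E * of_real (exp y - 1 - y)) \<le> y\<^sup>2 * exp \<bar>y\<bar>"
  proof -
    have "norm (complex_of_real (exp y - 1 - y)) = norm (exp (complex_of_real y) - (\<Sum>k\<le>1. of_real y ^ k / fact k))"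
      by (simp add: exp_of_real algebra_simps)
    also have "\<dots> \<le> exp \<bar>Re (of_real y)\<bar> * norm (complex_of_real y) ^ Suc 1 / fact 1" by (rule Taylor_exp)
    finally have "\<bar>exp y - 1 - y\<bar> \<le> y\<^sup>2 * exp \<bar>y\<bar>"
      unfolding norm_of_real by (simp add: power2_eq_square mult_ac)
    thus ?thesis by (simp add: norm_mult E_def del: of_real_diff)
  qed
  have "E * of_real (exp y) - (1 - \<i> * of_real x + of_real y - of_real (x\<^sup>2) / 2)
     = (E - (1 - \<i> * of_real x - of_real (x\<^sup>2) / 2)) + of_real y * (E - 1) + E * of_real (exp y - 1 - y)"
    by (simp add: algebra_simps)
  also have "norm \<dots> \<le> \<bar>x\<bar> ^ 3 / 6 + \<bar>y\<bar> * \<bar>x\<bar> + y\<^sup>2 * exp \<bar>y\<bar>"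
    by (intro order_trans[OF norm_triangle_ineq] add_mono 1 2 3)
  finally show ?thesis unfolding E .
qed

lemma cell_cf_measurable:
  assumes [measurable]: "f \<in> borel_measurable L" "g \<in> borel_measurable L"
  shows "(\<lambda>w. cell_cf r (f w) (g w)) \<in> borel_measurable L"
proof -
  have [measurable]: "charlier2 r \<in> borel_measurable (measure_pmf (poisson_pmf r))"
    "(\<lambda>k. real k - r) \<in> borel_measurable (measure_pmf (poisson_pmf r))" by auto
  have "(\<lambda>(w, k). iexp (f w * charlier2 r k + g w * (real k - r))) \<in> borel_measurable (L \<Otimes>\<^sub>M measure_pmf (poisson_pmf r))"
    by measurable
  thus ?thesis unfolding cell_cf_def by (rule measure_pmf.borel_measurable_lebesgue_integral)
qed

lemma norm_cell_cf_le_1: "norm (cell_cf r \<theta> \<omega>) \<le> 1"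
proof -
  have "norm (cell_cf r \<theta> \<omega>) \<le> (\<integral>k. norm (iexp (\<theta> * charlier2 r k + \<omega> * (real k - r))) \<partial>poisson_pmf r)"
    unfolding cell_cf_def by (rule integral_norm_bound)
  thus ?thesis by simp
qed

lemma le_mult_exp_minus: "x * exp w \<le> y \<Longrightarrow> x \<le> y * exp (- w)" for x y w :: real
  by (simp add: exp_minus field_simps)

lemma zone1_rearrange: "3 * c * z\<^sup>2 * (d * (z / q)) ^ 3 = 3 * c * d ^ 3 * (z ^ 5 / q ^ 3)" for c z d q :: real
  by (simp add: power_mult_distrib power_divide flip: power_add)

context cells
begin

lemma joint_cf_measurable:
  assumes "f \<in> borel_measurable L" "g \<in> borel_measurable L"
  shows "(\<lambda>w. joint_cf n N p (f w) (g w)) \<in> borel_measurable L"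
  unfolding joint_cf_def using assms by (intro borel_measurable_prod cell_cf_measurable) auto

lemma norm_joint_cf_le_1: "norm (joint_cf n N p \<theta> \<tau>) \<le> 1"
  unfolding joint_cf_def prod_norm[symmetric] by (intro prod_le_1) (auto simp: norm_cell_cf_le_1)

definition "k3 t s = (\<Sum>m=1..N. cell_cumulant3 (r m) (t / \<sigma>) (om (t / \<sigma>) (s / sqrt n) m))"
definition "k4 t s = (\<Sum>m=1..N. cell_cumulant4 (r m) (t / \<sigma>) (om (t / \<sigma>) (s / sqrt n) m))"

text \<open>The Gaussian times exp(-i k3 / 6 + k4 / 24) expanded to order 1 / K, where
  \<open>k3\<close> counts as K^(-1/2) and \<open>k4\<close> as 1 / K.\<close>

definition "edge t s = of_real (exp (- (t\<^sup>2 + s\<^sup>2) / 2)) *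
   (1 - \<i> * of_real (k3 t s / 6) + of_real (k4 t s / 24) - of_real ((k3 t s / 6)\<^sup>2) / 2)"

abbreviation "zz (t::real) s \<equiv> \<bar>t\<bar> + \<bar>s\<bar>"

lemma sq_le_zz: "t\<^sup>2 + s\<^sup>2 \<le> (zz t s)\<^sup>2"
proof -
  have "(zz t s)\<^sup>2 = t\<^sup>2 + s\<^sup>2 + 2 * (\<bar>t\<bar> * \<bar>s\<bar>)" by (simp add: power2_sum)
  thus ?thesis using mult_nonneg_nonneg[of "\<bar>t\<bar>" "\<bar>s\<bar>"] by linarith
qed

lemma var_nonneg: "m \<in> {1..N} \<Longrightarrow> 0 \<le> cell_var (r m) \<theta> \<omega>"
  using r(1)[of m] by (simp add: cell_var_def)

text \<open>In a cell the cumulant is at most its variance times its size. The size bound is common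
  to all cells and the variances sum to t^2 + s^2, so the number of cells does not enter.\<close>

lemma k3_bound: "\<bar>k3 t s\<bar> \<le> 100 * D * (zz t s ^ 3 / sqrt K)"
proof -
  let ?v = "\<lambda>m. cell_var (r m) (t / \<sigma>) (om (t / \<sigma>) (s / sqrt n) m)"
  have "\<bar>k3 t s\<bar> \<le> (\<Sum>m=1..N. 100 * (?v m * (D * (zz t s / sqrt K))))"
    unfolding k3_def
  proof (intro sum_abs[THEN order_trans] sum_mono)
    fix m assume m: "m \<in> {1..N}"
    show "\<bar>cell_cumulant3 (r m) (t / \<sigma>) (om (t / \<sigma>) (s / sqrt n) m)\<bar> \<le> 100 * (?v m * (D * (zz t s / sqrt K)))"
      by (intro order_trans[OF cell_cumulant_bounds(1)[OF r(1)[OF m]]] mult_left_mono cell_size m var_nonneg) auto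
  qed
  also have "\<dots> = 100 * (t\<^sup>2 + s\<^sup>2) * (D * (zz t s / sqrt K))"
    unfolding sum_cell_var[symmetric] by (simp add: sum_distrib_left sum_distrib_right mult_ac del: One_nat_def)
  also have "\<dots> \<le> 100 * (zz t s)\<^sup>2 * (D * (zz t s / sqrt K))"
    using sq_le_zz[of t s] D K by (intro mult_right_mono mult_left_mono) auto
  finally show ?thesis by (simp add: power2_eq_square power3_eq_cube mult_ac)
qed

lemma k4_bound: "\<bar>k4 t s\<bar> \<le> 1000 * D\<^sup>2 * (zz t s ^ 4 / K)"
proof -
  let ?v = "\<lambda>m. cell_var (r m) (t / \<sigma>) (om (t / \<sigma>) (s / sqrt n) m)"
  have "\<bar>k4 t s\<bar> \<le> (\<Sum>m=1..N. 1000 * (?v m * (D * (zz t s / sqrt K))\<^sup>2))"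
    unfolding k4_def
  proof (intro sum_abs[THEN order_trans] sum_mono)
    fix m assume m: "m \<in> {1..N}"
    show "\<bar>cell_cumulant4 (r m) (t / \<sigma>) (om (t / \<sigma>) (s / sqrt n) m)\<bar> \<le> 1000 * (?v m * (D * (zz t s / sqrt K))\<^sup>2)"
      by (intro order_trans[OF cell_cumulant_bounds(2)[OF r(1)[OF m]]] mult_left_mono power_mono cell_size m var_nonneg) auto
  qed
  also have "\<dots> = 1000 * (t\<^sup>2 + s\<^sup>2) * (D * (zz t s / sqrt K))\<^sup>2"
    unfolding sum_cell_var[symmetric] by (simp add: sum_distrib_left sum_distrib_right mult_ac del: One_nat_def)
  also have "\<dots> \<le> 1000 * (zz t s)\<^sup>2 * (D * (zz t s / sqrt K))\<^sup>2"
    using sq_le_zz[of t s] by (intro mult_right_mono mult_left_mono) auto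
  also have "(D * (zz t s / sqrt K))\<^sup>2 = D\<^sup>2 * ((zz t s)\<^sup>2 / K)" using K by (simp add: power_mult_distrib power_divide)
  finally show ?thesis by (simp add: power2_eq_square power4_eq_xxxx mult_ac)
qed

text \<open>Near the origin all cells meet the smallness conditions of the expansion and decay
  estimates at once.\<close>

lemma zone1_cell:
  assumes m: "m \<in> {1..N}" and \<theta>: "\<bar>\<theta>\<bar> * (M * sqrt M) \<le> e1" and \<tau>: "\<bar>\<tau>\<bar> * sqrt M \<le> e2"
  shows "max 1 (r m) * \<bar>\<theta>\<bar> + \<bar>om \<theta> \<tau> m\<bar> \<le> 1 / 100" "r m * (om \<theta> \<tau> m)\<^sup>2 \<le> 1 / 100"
    "cell_var (r m) \<theta> (om \<theta> \<tau> m) \<le> 1"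
proof -
  note b = om_bounds[OF m \<theta>]
  have sM: "sqrt M \<ge> 1" using M by simp
  have "sqrt M * \<bar>om \<theta> \<tau> m\<bar> \<le> sqrt M * (\<bar>\<tau>\<bar> + \<bar>2 * \<theta> * \<delta> m\<bar>)" using M by (intro mult_left_mono) auto
  also have "\<dots> \<le> e2 + 2 * (c2 * e1)" using b(1) \<tau> by (simp add: distrib_left mult.commute)
  also have "\<dots> \<le> 2 * e2" using e by linarith
  finally have sw: "sqrt M * \<bar>om \<theta> \<tau> m\<bar> \<le> 2 * e2" .
  have "1 * \<bar>om \<theta> \<tau> m\<bar> \<le> sqrt M * \<bar>om \<theta> \<tau> m\<bar>" using sM by (intro mult_right_mono) auto
  hence o: "\<bar>om \<theta> \<tau> m\<bar> \<le> 2 * e2" using sw unfolding mult_1 by (rule order_trans)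
  have "c2 * e1 + 2 * e2 \<le> 1 / 100" using e by linarith
  with add_mono[OF b(2) o] show 1: "max 1 (r m) * \<bar>\<theta>\<bar> + \<bar>om \<theta> \<tau> m\<bar> \<le> 1 / 100" by (rule order_trans)
  have "(sqrt M * \<bar>om \<theta> \<tau> m\<bar>)\<^sup>2 \<le> (2 * e2)\<^sup>2" using sw M by (intro power_mono) auto
  hence Mo: "M * (om \<theta> \<tau> m)\<^sup>2 \<le> 4 * e2\<^sup>2" using M by (simp add: power_mult_distrib)
  have "r m * (om \<theta> \<tau> m)\<^sup>2 \<le> (c2 * M) * (om \<theta> \<tau> m)\<^sup>2"
    by (rule mult_right_mono[OF order_trans[OF r(3)[OF m] mult_left_mono[OF M(2)]]]) (use c12 in auto)
  also have "\<dots> \<le> c2 * (4 * e2\<^sup>2)" using Mo c12 by (simp add: mult.assoc mult_left_mono)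
  also have "\<dots> = 4 * (c2 * e2) * e2" by (simp add: power2_eq_square)
  also have "\<dots> \<le> 1 / 100" unfolding e(5) using e(2) by simp
  finally show 2: "r m * (om \<theta> \<tau> m)\<^sup>2 \<le> 1 / 100" .
  have "r m * \<bar>\<theta>\<bar> \<le> max 1 (r m) * \<bar>\<theta>\<bar>" by (intro mult_right_mono) auto
  hence "r m * \<bar>\<theta>\<bar> \<le> 1 / 100" using 1 by linarith
  hence "(r m * \<bar>\<theta>\<bar>)\<^sup>2 \<le> (1 / 100)\<^sup>2" using r(1)[OF m] by (intro power_mono) auto
  thus "cell_var (r m) \<theta> (om \<theta> \<tau> m) \<le> 1" using 2 by (simp add: cell_var_def power_mult_distrib power_divide)
qed

text \<open>The degree 9 is that of the cube of the cubic form \<open>k3\<close>, the highest power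
  in the remainder.\<close>

definition "C1 = (3 * cell_const * D ^ 3 + 5000 * D ^ 4) * (2 * fact 9 * 8 ^ 9)"

lemma C1: "C1 > 0" using cell_const(1) D by (auto simp: C1_def intro!: mult_pos_pos add_pos_pos)

text \<open>Each factor is multiplied by exp(v / 4). Then all factors of both products have modulus
  at most 1, so the products differ by at most the sum of the differences of the factors; the
  multipliers return as exp(-(t^2 + s^2) / 4).\<close>

lemma zone1_product:
  fixes t s :: real
  defines "\<theta> \<equiv> t / \<sigma>" and "\<tau> \<equiv> s / sqrt n"
  assumes \<theta>: "\<bar>\<theta>\<bar> * (M * sqrt M) \<le> e1" and \<tau>: "\<bar>\<tau>\<bar> * sqrt M \<le> e2"
  shows "norm (joint_cf n N p \<theta> \<tau> - exp (\<Sum>m=1..N. cell_exponent (r m) \<theta> (om \<theta> \<tau> m)))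
    \<le> 3 * cell_const * D ^ 3 * (zz t s ^ 5 / (K * sqrt K)) * exp (- (t\<^sup>2 + s\<^sup>2) / 4)"
proof -
  let ?v = "\<lambda>m. cell_var (r m) \<theta> (om \<theta> \<tau> m)"
  let ?x = "\<lambda>m. cell_cf (r m) \<theta> (om \<theta> \<tau> m)" and ?a = "\<lambda>m. exp (cell_exponent (r m) \<theta> (om \<theta> \<tau> m))"
  have sv: "(\<Sum>m=1..N. ?v m) = t\<^sup>2 + s\<^sup>2" unfolding \<theta>_def \<tau>_def by (rule sum_cell_var)
  have le: "norm (?x m * of_real (exp (?v m / 4))) \<le> 1" "norm (?a m * of_real (exp (?v m / 4))) \<le> 1" if m: "m \<in> {1..N}" for m
  proof -
    note z = zone1_cell[OF m \<theta> \<tau>]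
    have "norm (?x m) * exp (?v m / 4) \<le> exp (- ?v m / 4) * exp (?v m / 4)"
      by (intro mult_right_mono cell_cf_decay r m z) auto
    thus "norm (?x m * of_real (exp (?v m / 4))) \<le> 1" by (simp add: norm_mult exp_add[symmetric])
    have "norm (?a m) * exp (?v m / 4) \<le> exp (- ?v m / 4) * exp (?v m / 4)"
      by (intro mult_right_mono norm_cell_exponent_le r m z) auto
    thus "norm (?a m * of_real (exp (?v m / 4))) \<le> 1" by (simp add: norm_mult exp_add[symmetric])
  qed
  have pe: "(\<Prod>m=1..N. complex_of_real (exp (?v m / 4))) = of_real (exp ((t\<^sup>2 + s\<^sup>2) / 4))"
    by (simp only: of_real_prod[symmetric] exp_sum[symmetric, OF finite_atLeastAtMost] sum_divide_distrib[symmetric] sv)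
  have "norm (joint_cf n N p \<theta> \<tau> - exp (\<Sum>m=1..N. cell_exponent (r m) \<theta> (om \<theta> \<tau> m))) * exp ((t\<^sup>2 + s\<^sup>2) / 4)
    = norm ((\<Prod>m=1..N. ?x m * of_real (exp (?v m / 4))) - (\<Prod>m=1..N. ?a m * of_real (exp (?v m / 4))))"
    unfolding prod.distrib pe left_diff_distrib[symmetric] norm_mult joint_cf_def exp_sum[OF finite_atLeastAtMost] by simp
  also have "\<dots> \<le> (\<Sum>m=1..N. norm (?x m * of_real (exp (?v m / 4)) - ?a m * of_real (exp (?v m / 4))))"
    by (rule norm_prod_diff) (use le in auto)
  also have "\<dots> \<le> (\<Sum>m=1..N. cell_const * (?v m * (D * (zz t s / sqrt K)) ^ 3) * 3)"
  proof (rule sum_mono)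
    fix m assume m: "m \<in> {1..N}"
    note z = zone1_cell[OF m \<theta> \<tau>]
    have h0: "0 \<le> max 1 (r m) * \<bar>\<theta>\<bar>" by simp
    have "norm (?x m - ?a m) \<le> cell_const * (?v m * (max 1 (r m) * \<bar>\<theta>\<bar> + \<bar>om \<theta> \<tau> m\<bar>) ^ 3)"
      using z h0 by (intro cell_const(2) r m) linarith+
    also have "\<dots> \<le> cell_const * (?v m * (D * (zz t s / sqrt K)) ^ 3)"
      using cell_const(1) var_nonneg[OF m] unfolding \<theta>_def \<tau>_def
      by (intro mult_left_mono power_mono cell_size m) auto
    finally have "norm (?x m - ?a m) * exp (?v m / 4) \<le> cell_const * (?v m * (D * (zz t s / sqrt K)) ^ 3) * 3"
    proof (rule mult_mono)
      have "exp (?v m / 4) \<le> exp 1" using z(3) by simp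
      thus "exp (?v m / 4) \<le> 3" using exp_le by linarith
      show "0 \<le> cell_const * (?v m * (D * (zz t s / sqrt K)) ^ 3)"
        using cell_const(1) var_nonneg[OF m] D K by (intro mult_nonneg_nonneg zero_le_power) auto
    qed auto
    thus "norm (?x m * of_real (exp (?v m / 4)) - ?a m * of_real (exp (?v m / 4))) \<le> cell_const * (?v m * (D * (zz t s / sqrt K)) ^ 3) * 3"
      unfolding left_diff_distrib[symmetric] norm_mult by simp
  qed
  also have "\<dots> = 3 * cell_const * (t\<^sup>2 + s\<^sup>2) * (D * (zz t s / sqrt K)) ^ 3"
    unfolding sv[symmetric] by (simp add: sum_distrib_left sum_distrib_right mult_ac del: One_nat_def)
  also have "\<dots> \<le> 3 * cell_const * (zz t s)\<^sup>2 * (D * (zz t s / sqrt K)) ^ 3"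
    using sq_le_zz[of t s] cell_const(1) D K by (intro mult_right_mono mult_left_mono) auto
  also have "\<dots> = 3 * cell_const * D ^ 3 * (zz t s ^ 5 / (K * sqrt K))"
    using K by (subst zone1_rearrange) (simp add: power3_eq_cube)
  finally show ?thesis unfolding minus_divide_left[symmetric] by (rule le_mult_exp_minus)
qed

lemma zone1_exponent:
  fixes t s :: real
  defines "\<theta> \<equiv> t / \<sigma>" and "\<tau> \<equiv> s / sqrt n"
  assumes \<theta>: "\<bar>\<theta>\<bar> * (M * sqrt M) \<le> e1" and \<tau>: "\<bar>\<tau>\<bar> * sqrt M \<le> e2" and K1: "K \<ge> 1"
  shows "norm (exp (\<Sum>m=1..N. cell_exponent (r m) \<theta> (om \<theta> \<tau> m)) - edge t s)
    \<le> 5000 * D ^ 4 * ((1 + zz t s) ^ 9 / (K * sqrt K)) * exp (- (t\<^sup>2 + s\<^sup>2) / 4)"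
proof -
  let ?v = "\<lambda>m. cell_var (r m) \<theta> (om \<theta> \<tau> m)"
  define w where "w = t\<^sup>2 + s\<^sup>2"
  have sv: "(\<Sum>m=1..N. ?v m) = w" unfolding \<theta>_def \<tau>_def w_def by (rule sum_cell_var)
  define x y where "x = k3 t s / 6" and "y = k4 t s / 24"
  define Z where "Z = 1 + zz t s"
  have Z: "Z \<ge> 1" "zz t s \<le> Z" by (auto simp: Z_def)
  have w0: "w \<ge> 0" by (simp add: w_def)
  have ex: "exp (\<Sum>m=1..N. cell_exponent (r m) \<theta> (om \<theta> \<tau> m)) = of_real (exp (- w / 2)) * (exp (- \<i> * of_real x) * of_real (exp y))"
  proof -
    have "(\<Sum>m=1..N. cell_exponent (r m) \<theta> (om \<theta> \<tau> m)) = of_real (- w / 2) + - \<i> * of_real x + of_real y"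
      unfolding cell_exponent_def sv[symmetric] x_def y_def k3_def k4_def \<theta>_def \<tau>_def
      by (simp add: sum.distrib sum_subtractf sum_negf sum_divide_distrib sum_distrib_left del: One_nat_def)
    thus ?thesis by (simp only: exp_add exp_of_real mult.assoc)
  qed
  have "\<bar>k4 t s\<bar> \<le> (\<Sum>m=1..N. ?v m / 10)"
    unfolding k4_def \<theta>_def[symmetric] \<tau>_def[symmetric]
  proof (intro sum_abs[THEN order_trans] sum_mono)
    fix m assume m: "m \<in> {1..N}"
    note z = zone1_cell[OF m \<theta> \<tau>]
    have "\<bar>cell_cumulant4 (r m) \<theta> (om \<theta> \<tau> m)\<bar> \<le> 1000 * (?v m * (max 1 (r m) * \<bar>\<theta>\<bar> + \<bar>om \<theta> \<tau> m\<bar>)\<^sup>2)"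
      by (rule cell_cumulant_bounds(2)[OF r(1)[OF m]])
    also have "\<dots> \<le> 1000 * (?v m * (1 / 100)\<^sup>2)"
      using z(1) var_nonneg[OF m] by (intro mult_left_mono power_mono) auto
    finally show "\<bar>cell_cumulant4 (r m) \<theta> (om \<theta> \<tau> m)\<bar> \<le> ?v m / 10" by (simp add: power2_eq_square)
  qed
  also have "\<dots> = w / 10" by (simp only: sum_divide_distrib[symmetric] sv)
  \<comment> \<open>The fourth-cumulant term uses up at most w / 4 of the Gaussian exponent w /
    2.\<close>
  finally have yw: "\<bar>y\<bar> \<le> w / 4" using w0 by (simp add: y_def)
  have xb: "\<bar>x\<bar> \<le> 17 * D * (Z ^ 3 / sqrt K)"
  proof -
    have "100 * D * (zz t s ^ 3 / sqrt K) \<le> 102 * D * (Z ^ 3 / sqrt K)"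
      using Z D K by (intro mult_mono divide_right_mono power_mono) auto
    thus ?thesis using k3_bound[of t s] by (simp add: x_def)
  qed
  have yb: "\<bar>y\<bar> \<le> 42 * D\<^sup>2 * (Z ^ 4 / K)"
  proof -
    have "1000 * D\<^sup>2 * (zz t s ^ 4 / K) \<le> 1008 * D\<^sup>2 * (Z ^ 4 / K)"
      using Z D K by (intro mult_mono divide_right_mono power_mono) auto
    thus ?thesis using k4_bound[of t s] by (simp add: y_def)
  qed
  \<comment> \<open>A common majorant of the three remainder terms: D and Z are at least 1, and K
    \<ge> 1 reduces the K^(-2) of the squared fourth cumulant to K^(-3/2).\<close>
  define B where "B = D ^ 4 * (Z ^ 9 / (K * sqrt K))"
  have B: "B \<ge> 0" using D Z K by (auto simp: B_def)
  have b1: "\<bar>x\<bar> ^ 3 / 6 \<le> 900 * B"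
  proof -
    have "\<bar>x\<bar> ^ 3 \<le> (17 * D * (Z ^ 3 / sqrt K)) ^ 3" by (intro power_mono xb) auto
    also have "\<dots> = 4913 * (D ^ 3 * (Z ^ 9 / (K * sqrt K)))"
      using K by (simp add: power_mult_distrib power_divide eval_nat_numeral mult_ac)
    also have "\<dots> \<le> 4913 * B" unfolding B_def using D Z K by (intro mult_left_mono mult_right_mono power_increasing) auto
    finally show ?thesis using B by simp
  qed
  have b2: "\<bar>y\<bar> * \<bar>x\<bar> \<le> 714 * B"
  proof -
    have "\<bar>y\<bar> * \<bar>x\<bar> \<le> (42 * D\<^sup>2 * (Z ^ 4 / K)) * (17 * D * (Z ^ 3 / sqrt K))" using D Z K by (intro mult_mono yb xb) auto
    also have "\<dots> = 714 * (D ^ 3 * (Z ^ 7 / (K * sqrt K)))" by (simp add: eval_nat_numeral)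
    also have "\<dots> \<le> 714 * B" unfolding B_def using D Z K
      by (intro mult_left_mono mult_mono power_increasing divide_right_mono) auto
    finally show ?thesis .
  qed
  have b3: "y\<^sup>2 \<le> 1764 * B"
  proof -
    have "y\<^sup>2 = \<bar>y\<bar>\<^sup>2" by simp
    also have "\<dots> \<le> (42 * D\<^sup>2 * (Z ^ 4 / K))\<^sup>2" by (intro power_mono yb) auto
    also have "\<dots> = 1764 * (D ^ 4 * (Z ^ 8 / (K * K)))" by (simp add: eval_nat_numeral)
    also have "\<dots> \<le> 1764 * B"
    proof -
      have "sqrt K \<le> K" using K1 by (simp add: real_le_lsqrt power2_eq_square mult_left_mono[of 1 K K, simplified])
      hence "K * sqrt K \<le> K * K" using K by (intro mult_left_mono) auto
      hence "Z ^ 8 / (K * K) \<le> Z ^ 9 / (K * sqrt K)"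
        using Z K by (intro frac_le power_increasing) auto
      thus ?thesis unfolding B_def using D by (intro mult_left_mono) auto
    qed
    finally show ?thesis .
  qed
  have e1: "1 \<le> exp (w / 4)" using w0 by simp
  have "exp (\<Sum>m=1..N. cell_exponent (r m) \<theta> (om \<theta> \<tau> m)) - edge t s
     = of_real (exp (- w / 2)) * (exp (- \<i> * of_real x) * of_real (exp y) - (1 - \<i> * of_real x + of_real y - of_real (x\<^sup>2) / 2))"
    unfolding ex edge_def x_def[symmetric] y_def[symmetric] w_def[symmetric] by (simp only: right_diff_distrib)
  hence "norm (exp (\<Sum>m=1..N. cell_exponent (r m) \<theta> (om \<theta> \<tau> m)) - edge t s) = exp (- w / 2) *
     norm (exp (- \<i> * of_real x) * of_real (exp y) - (1 - \<i> * of_real x + of_real y - of_real (x\<^sup>2) / 2))"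
    by (simp only: norm_mult norm_of_real) simp
  also have "\<dots> \<le> exp (- w / 2) * (\<bar>x\<bar> ^ 3 / 6 + \<bar>y\<bar> * \<bar>x\<bar> + y\<^sup>2 * exp \<bar>y\<bar>)"
    by (intro mult_left_mono exp_two_scale_expansion) auto
  also have "\<dots> \<le> exp (- w / 2) * (900 * B * exp (w / 4) + 714 * B * exp (w / 4) + 1764 * B * exp (w / 4))"
  proof -
    have p1: "\<bar>x\<bar> ^ 3 / 6 \<le> 900 * B * exp (w / 4)" using b1 B e1 mult_left_mono[OF e1, of "900 * B"] by simp
    have p2: "\<bar>y\<bar> * \<bar>x\<bar> \<le> 714 * B * exp (w / 4)" using b2 B e1 mult_left_mono[OF e1, of "714 * B"] by simp
    have p3: "y\<^sup>2 * exp \<bar>y\<bar> \<le> 1764 * B * exp (w / 4)"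
      by (rule mult_mono[OF b3]) (use yw B in auto)
    show ?thesis by (intro mult_left_mono add_mono p1 p2 p3) auto
  qed
  also have "\<dots> = 3378 * B * exp (- w / 4)" by (simp add: exp_add[symmetric] algebra_simps)
  also have "\<dots> \<le> 5000 * B * exp (- w / 4)" using B by (intro mult_right_mono) auto
  finally show ?thesis by (simp only: B_def Z_def w_def mult.assoc)
qed

lemma zone1:
  fixes t s :: real
  assumes \<theta>: "\<bar>t / \<sigma>\<bar> * (M * sqrt M) \<le> e1" and \<tau>: "\<bar>s / sqrt n\<bar> * sqrt M \<le> e2" and K1: "K \<ge> 1"
  shows "norm (joint_cf n N p (t / \<sigma>) (s / sqrt n) - edge t s) \<le> C1 * (1 / (K * sqrt K)) * exp (- (t\<^sup>2 + s\<^sup>2) / 8)"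
proof -
  define w where "w = t\<^sup>2 + s\<^sup>2"
  let ?Z = "1 + zz t s"
  have "norm (joint_cf n N p (t / \<sigma>) (s / sqrt n) - edge t s) \<le>
     3 * cell_const * D ^ 3 * (zz t s ^ 5 / (K * sqrt K)) * exp (- w / 4) + 5000 * D ^ 4 * (?Z ^ 9 / (K * sqrt K)) * exp (- w / 4)"
    unfolding w_def by (rule norm_diff_triangle_le[OF zone1_product[OF \<theta> \<tau>] zone1_exponent[OF \<theta> \<tau> K1]])
  also have "\<dots> \<le> 3 * cell_const * D ^ 3 * (?Z ^ 9 / (K * sqrt K)) * exp (- w / 4) + 5000 * D ^ 4 * (?Z ^ 9 / (K * sqrt K)) * exp (- w / 4)"
  proof (intro add_right_mono mult_right_mono mult_left_mono divide_right_mono)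
    have "zz t s ^ 5 \<le> ?Z ^ 5" by (intro power_mono) auto
    also have "\<dots> \<le> ?Z ^ 9" by (intro power_increasing) auto
    finally show "zz t s ^ 5 \<le> ?Z ^ 9" .
  qed (use D K cell_const(1) in auto)
  also have "\<dots> = (3 * cell_const * D ^ 3 + 5000 * D ^ 4) * (1 / (K * sqrt K)) * (?Z ^ 9 * exp (- w / 4))"
    by (simp add: algebra_simps)
  also have "\<dots> \<le> (3 * cell_const * D ^ 3 + 5000 * D ^ 4) * (1 / (K * sqrt K)) * ((2 * fact 9 * 8 ^ 9 * exp (w / 8)) * exp (- w / 4))"
    unfolding w_def using poly_le_gauss[of t s 9] cell_const(1) D K
    by (intro mult_left_mono mult_right_mono) (auto simp: add.assoc)
  also have "\<dots> = C1 * (1 / (K * sqrt K)) * exp (- w / 8)"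
    by (simp add: C1_def exp_add[symmetric] mult.assoc)
  finally show ?thesis by (simp add: w_def)
qed

definition "C2 = 300 * D\<^sup>2 * (2 * fact 6 * 8 ^ 6)"

lemma C2: "C2 > 0" using D by (auto simp: C2_def)

text \<open>The third-cumulant term is of order K^(-1/2) but purely imaginary, so the real part is
  closer to the Gaussian by a factor K^(-1/2). The second estimate serves the denominator, which is
  real.\<close>

lemma edge_minus_gauss:
  "norm (edge t s - of_real (exp (- (t\<^sup>2 + s\<^sup>2) / 2))) \<le> C2 * (1 / sqrt K + 1 / K) * exp (- (t\<^sup>2 + s\<^sup>2) / 4)"
  and Re_edge_minus_gauss:
  "\<bar>Re (edge t s) - exp (- (t\<^sup>2 + s\<^sup>2) / 2)\<bar> \<le> C2 * (1 / K) * exp (- (t\<^sup>2 + s\<^sup>2) / 4)"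
proof -
  define w where "w = t\<^sup>2 + s\<^sup>2"
  define x y where "x = k3 t s / 6" and "y = k4 t s / 24"
  define Z where "Z = 1 + zz t s"
  have Z: "Z \<ge> 1" "zz t s \<le> Z" by (auto simp: Z_def)
  define a b where "a = 1 / sqrt K" and "b = 1 / K"
  have ab: "a \<ge> 0" "b \<ge> 0" using K by (auto simp: a_def b_def)
  have DZ: "D * Z ^ 3 \<le> D\<^sup>2 * Z ^ 6" "D\<^sup>2 * Z ^ 4 \<le> D\<^sup>2 * Z ^ 6"
  proof -
    have "D ^ 1 \<le> D ^ 2" using D by (intro power_increasing) auto
    moreover have z: "Z ^ 3 \<le> Z ^ 6" "Z ^ 4 \<le> Z ^ 6" using power_increasing[OF _ Z(1), of 3 6] power_increasing[OF _ Z(1), of 4 6] by simp_all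
    ultimately show "D * Z ^ 3 \<le> D\<^sup>2 * Z ^ 6" "D\<^sup>2 * Z ^ 4 \<le> D\<^sup>2 * Z ^ 6"
      using Z by (auto intro!: mult_mono mult_left_mono)
  qed
  have xb: "\<bar>x\<bar> \<le> 17 * (D * Z ^ 3) * a"
  proof -
    have "100 * D * (zz t s ^ 3 / sqrt K) \<le> 102 * D * (Z ^ 3 / sqrt K)"
      using Z D K by (intro mult_mono divide_right_mono power_mono) auto
    thus ?thesis using k3_bound[of t s] by (simp add: x_def a_def)
  qed
  have yb: "\<bar>y\<bar> \<le> 42 * (D\<^sup>2 * Z ^ 4) * b"
  proof -
    have "1000 * D\<^sup>2 * (zz t s ^ 4 / K) \<le> 1008 * D\<^sup>2 * (Z ^ 4 / K)"
      using Z D K by (intro mult_mono divide_right_mono power_mono) auto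
    thus ?thesis using k4_bound[of t s] by (simp add: y_def b_def)
  qed
  have x1: "\<bar>x\<bar> \<le> 17 * (D\<^sup>2 * Z ^ 6) * a"
    by (rule order_trans[OF xb mult_right_mono[OF mult_left_mono[OF DZ(1)]]]) (use ab in auto)
  have y1: "\<bar>y\<bar> \<le> 42 * (D\<^sup>2 * Z ^ 6) * b"
    by (rule order_trans[OF yb mult_right_mono[OF mult_left_mono[OF DZ(2)]]]) (use ab in auto)
  have "\<bar>x\<bar>\<^sup>2 \<le> (17 * (D * Z ^ 3) * a)\<^sup>2" by (intro power_mono xb) auto
  also have "\<dots> = 289 * (D\<^sup>2 * Z ^ 6) * b" using K by (simp add: power_mult_distrib power_divide a_def b_def flip: power_mult)
  finally have "x\<^sup>2 \<le> 289 * ((D\<^sup>2 * Z ^ 6) * b)" by simp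
  moreover have "0 \<le> (D\<^sup>2 * Z ^ 6) * b" using ab by simp
  ultimately have x2: "x\<^sup>2 / 2 \<le> 145 * (D\<^sup>2 * Z ^ 6) * b" by linarith
  have G: "exp (- w / 2) * (300 * (D\<^sup>2 * Z ^ 6) * c) \<le> C2 * c * exp (- w / 4)" if "c \<ge> 0" for c
  proof -
    have "exp (- w / 2) * (300 * (D\<^sup>2 * Z ^ 6) * c) = 300 * D\<^sup>2 * c * (Z ^ 6 * exp (- w / 2))" by simp
    also have "\<dots> \<le> 300 * D\<^sup>2 * c * ((2 * fact 6 * 8 ^ 6 * exp (w / 8)) * exp (- w / 2))"
      unfolding w_def Z_def using poly_le_gauss[of t s 6] that by (intro mult_left_mono mult_right_mono) (auto simp: add.assoc)
    also have "\<dots> = C2 * c * exp (- (3 * w / 8))"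
      by (simp add: C2_def exp_add[symmetric])
    also have "\<dots> \<le> C2 * c * exp (- w / 4)"
    proof (rule mult_left_mono)
      have "0 \<le> w" by (simp add: w_def)
      thus "exp (- (3 * w / 8)) \<le> exp (- w / 4)" by simp
    qed (use C2 that in auto)
    finally show ?thesis .
  qed
  have ab2: "17 * (D\<^sup>2 * Z ^ 6) * a \<le> 300 * (D\<^sup>2 * Z ^ 6) * a" "187 * (D\<^sup>2 * Z ^ 6) * b \<le> 300 * (D\<^sup>2 * Z ^ 6) * b"
    using ab Z D by (auto intro!: mult_right_mono)
  have eq: "edge t s - of_real (exp (- w / 2)) = of_real (exp (- w / 2)) * (- (\<i> * of_real x) + of_real y - of_real (x\<^sup>2) / 2)"
    unfolding edge_def x_def y_def w_def by (simp add: algebra_simps)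
  hence "norm (edge t s - of_real (exp (- w / 2))) \<le> exp (- w / 2) * (\<bar>x\<bar> + \<bar>y\<bar> + x\<^sup>2 / 2)"
    using norm_triangle_ineq4[of "- (\<i> * of_real x) + of_real y" "of_real (x\<^sup>2) / 2 :: complex"] norm_triangle_ineq[of "- (\<i> * of_real x)" "of_real y :: complex"]
    by (simp add: norm_mult norm_divide norm_power)
  also have "\<dots> \<le> exp (- w / 2) * (300 * (D\<^sup>2 * Z ^ 6) * (a + b))"
    using ab2 x1 y1 x2 by (intro mult_left_mono) (auto simp: distrib_left)
  also have "\<dots> \<le> C2 * (a + b) * exp (- w / 4)" using ab by (intro G) auto
  finally show "norm (edge t s - of_real (exp (- (t\<^sup>2 + s\<^sup>2) / 2))) \<le> C2 * (1 / sqrt K + 1 / K) * exp (- (t\<^sup>2 + s\<^sup>2) / 4)"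
    by (simp only: w_def a_def b_def)
  have "Re (edge t s) - exp (- w / 2) = Re (of_real (exp (- w / 2)) * (- (\<i> * of_real x) + of_real y - of_real (x\<^sup>2) / 2))"
    unfolding eq[symmetric] by simp
  also have "\<dots> = exp (- w / 2) * (y - x\<^sup>2 / 2)" by (simp flip: of_real_power)
  finally have "\<bar>Re (edge t s) - exp (- w / 2)\<bar> = exp (- w / 2) * \<bar>y - x\<^sup>2 / 2\<bar>" by (simp add: abs_mult)
  also have "\<dots> \<le> exp (- w / 2) * (300 * (D\<^sup>2 * Z ^ 6) * b)"
  proof (rule mult_left_mono)
    have "\<bar>y - x\<^sup>2 / 2\<bar> \<le> \<bar>y\<bar> + x\<^sup>2 / 2" by (rule order_trans[OF abs_triangle_ineq4]) simp
    thus "\<bar>y - x\<^sup>2 / 2\<bar> \<le> 300 * (D\<^sup>2 * Z ^ 6) * b" using ab2 y1 x2 by linarith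
  qed simp
  also have "\<dots> \<le> C2 * b * exp (- w / 4)" using ab by (intro G)
  finally show "\<bar>Re (edge t s) - exp (- (t\<^sup>2 + s\<^sup>2) / 2)\<bar> \<le> C2 * (1 / K) * exp (- (t\<^sup>2 + s\<^sup>2) / 4)"
    by (simp only: w_def a_def b_def)
qed

lemma edge_bound: "norm (edge t s) \<le> (1 + C2 * (1 / sqrt K + 1 / K)) * exp (- (t\<^sup>2 + s\<^sup>2) / 4)"
proof -
  have "norm (edge t s) \<le> norm (edge t s - of_real (exp (- (t\<^sup>2 + s\<^sup>2) / 2))) + norm (complex_of_real (exp (- (t\<^sup>2 + s\<^sup>2) / 2)))"
    using norm_triangle_sub by (simp only: add.commute)
  also have "norm (complex_of_real (exp (- (t\<^sup>2 + s\<^sup>2) / 2))) \<le> exp (- (t\<^sup>2 + s\<^sup>2) / 4)"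
    by simp
  finally show ?thesis using edge_minus_gauss[of t s] by (simp add: distrib_right)
qed

text \<open>The decay rate, which becomes the c of the theorem. It is below the rates found in both
  outer zones, and 8 q0 is below c1^2 e1^2 as \<open>outside_zone1\<close> requires.\<close>

definition "q0 = c1\<^sup>2 * e1\<^sup>2 / 960"

lemma q0: "q0 > 0" using c1 e by (simp add: q0_def)

text \<open>Away from the origin the Gaussian integrand is itself exponentially small. The factor 8
  allows exp(-w / 4) to be split into exp(-q0 \<kappa>) and an integrable exp(-w / 8), where w = t^2
  + s^2.\<close>

lemma outside_zone1:
  assumes "\<not> (\<bar>t / \<sigma>\<bar> * (M * sqrt M) \<le> e1 \<and> \<bar>s / sqrt n\<bar> * sqrt M \<le> e2)"
  shows "8 * q0 * \<kappa> \<le> t\<^sup>2 + s\<^sup>2"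
proof -
  have MK: "\<kappa> \<le> K / M" "\<kappa> \<le> K"
    unfolding \<kappa>_def using M K by (auto intro!: divide_left_mono simp: power2_eq_square divide_le_eq mult_le_cancel_left1)
      (auto simp: mult_ac intro: order_trans[OF _ mult_mono[of 1 M 1 M]])
  have q: "8 * q0 \<le> c1\<^sup>2 * e1\<^sup>2" "c1\<^sup>2 * e1\<^sup>2 \<le> e2\<^sup>2"
  proof -
    show "8 * q0 \<le> c1\<^sup>2 * e1\<^sup>2" by (simp add: q0_def)
    have "c1\<^sup>2 * e1\<^sup>2 \<le> 1 * e2\<^sup>2" using c1 c12 e by (intro mult_mono power_mono power_le_one) auto
    thus "c1\<^sup>2 * e1\<^sup>2 \<le> e2\<^sup>2" by simp
  qed
  consider "e1 < \<bar>t / \<sigma>\<bar> * (M * sqrt M)" | "e2 < \<bar>s / sqrt n\<bar> * sqrt M" using assms by linarith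
  thus ?thesis
  proof cases
    case 1
    have "e1\<^sup>2 \<le> (\<bar>t / \<sigma>\<bar> * (M * sqrt M))\<^sup>2" using 1 e by (intro power_mono) auto
    also have "\<dots> = t\<^sup>2 * (M ^ 3 / \<sigma>\<^sup>2)" using M by (simp add: power_mult_distrib power_divide power3_eq_cube power2_eq_square[of M])
    finally have "e1\<^sup>2 * (\<sigma>\<^sup>2 / M ^ 3) \<le> t\<^sup>2" using M \<sigma>_pos by (simp add: field_simps)
    moreover have "c1\<^sup>2 * (K / M) \<le> \<sigma>\<^sup>2 / M ^ 3"
    proof -
      have "(c1 * (sqrt N * l))\<^sup>2 \<le> \<sigma>\<^sup>2" using \<sigma>_ge c1 l by (intro power_mono) auto
      hence "(c1 * (sqrt N * l))\<^sup>2 / M ^ 3 \<le> \<sigma>\<^sup>2 / M ^ 3" using M by (intro divide_right_mono) auto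
      moreover have "(c1 * (sqrt N * l))\<^sup>2 / M ^ 3 = c1\<^sup>2 * (K / M)"
        using M by (simp add: mt(3) K_def power_mult_distrib eval_nat_numeral)
      ultimately show ?thesis by simp
    qed
    hence "e1\<^sup>2 * (c1\<^sup>2 * (K / M)) \<le> e1\<^sup>2 * (\<sigma>\<^sup>2 / M ^ 3)" by (intro mult_left_mono) auto
    moreover have "8 * q0 * \<kappa> \<le> c1\<^sup>2 * e1\<^sup>2 * (K / M)" by (rule mult_mono[OF q(1) MK(1)]) (use \<kappa> in auto)
    ultimately have "8 * q0 * \<kappa> \<le> t\<^sup>2" by (simp add: mult_ac)
    thus ?thesis using zero_le_power2[of s] by linarith
  next
    case 2
    have "e2\<^sup>2 \<le> (\<bar>s / sqrt n\<bar> * sqrt M)\<^sup>2" using 2 e by (intro power_mono) auto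
    also have "\<dots> = s\<^sup>2 * (M / real n)" using M by (simp add: power_mult_distrib power_divide)
    finally have "e2\<^sup>2 * (real n / M) \<le> s\<^sup>2" using M n by (simp add: field_simps)
    moreover have "K \<le> real n / M"
    proof -
      have "real n / M = real N * mt" using M by (simp add: nl mt(3))
      moreover have "K \<le> real N * mt" using mt by (simp add: K_def power2_eq_square mult_left_mono mult_left_le)
      ultimately show ?thesis by simp
    qed
    hence "e2\<^sup>2 * \<kappa> \<le> e2\<^sup>2 * (real n / M)" using MK by (intro mult_left_mono) auto
    moreover have "8 * q0 * \<kappa> \<le> e2\<^sup>2 * \<kappa>" using q \<kappa> by (intro mult_right_mono) auto
    ultimately show ?thesis using zero_le_power2[of t] by linarith
  qed
qed

definition "C3 = C1 + (1 + 2 * C2)"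

lemma C3: "C3 > 0" using C1 C2 by (simp add: C3_def)

text \<open>The term with the indicator does not decay in t and s: away from the origin
  \<open>joint_cf\<close> is only bounded uniformly, and integration will cost the area of the
  box.\<close>

lemma pointwise_error:
  assumes K1: "K \<ge> 1"
  shows "norm (indicator (inversion_box n N p) (t, s) *\<^sub>R joint_cf n N p (t / \<sigma>) (s / sqrt n) - edge t s)
    \<le> C3 * (1 / (K * sqrt K) + exp (- q0 * \<kappa>)) * exp (- (t\<^sup>2 + s\<^sup>2) / 8) + indicator (inversion_box n N p) (t, s) * exp (- q0 * \<kappa>)"
    (is "norm (?I *\<^sub>R ?H - _) \<le> ?R + _")
proof -
  define w where "w = t\<^sup>2 + s\<^sup>2"
  have I: "?I = (if \<bar>t / \<sigma>\<bar> \<le> pi / 2 \<and> \<bar>s / sqrt n\<bar> \<le> pi then 1 else 0 :: real)"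
    using \<sigma>_pos n by (auto simp: inversion_box_def indicator_def abs_le_iff field_simps)
  show ?thesis
  proof (cases "\<bar>t / \<sigma>\<bar> * (M * sqrt M) \<le> e1 \<and> \<bar>s / sqrt n\<bar> * sqrt M \<le> e2")
    case True
    have sM: "sqrt M \<ge> 1" "M * sqrt M \<ge> 1" using M mult_mono[of 1 M 1 "sqrt M"] by auto
    have "\<bar>t / \<sigma>\<bar> * 1 \<le> \<bar>t / \<sigma>\<bar> * (M * sqrt M)" "\<bar>s / sqrt n\<bar> * 1 \<le> \<bar>s / sqrt n\<bar> * sqrt M"
      by (rule mult_left_mono[OF sM(2) abs_ge_zero], rule mult_left_mono[OF sM(1) abs_ge_zero])
    \<comment> \<open>The zone around the origin lies inside the box, so the indicator equals 1
      wherever the expansion is used.\<close>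
    hence "\<bar>t / \<sigma>\<bar> \<le> pi / 2 \<and> \<bar>s / sqrt n\<bar> \<le> pi" using True e pi_gt3 by linarith
    hence I1: "?I = 1" unfolding I by simp
    have "norm (?H - edge t s) \<le> C1 * (1 / (K * sqrt K)) * exp (- w / 8)"
      unfolding w_def using True K1 by (intro zone1) auto
    also have "\<dots> \<le> C3 * (1 / (K * sqrt K) + exp (- q0 * \<kappa>)) * exp (- w / 8)"
      using C1 C2 K by (intro mult_right_mono mult_mono) (auto simp: C3_def)
    finally show ?thesis unfolding I1 w_def scaleR_one mult_1 by (intro add_increasing2[OF exp_ge_zero])
  next
    case False
    note w8 = outside_zone1[OF False, folded w_def]
    have H: "norm (?I *\<^sub>R ?H) \<le> ?I * exp (- q0 * \<kappa>)"
    proof (cases "\<bar>t / \<sigma>\<bar> \<le> pi / 2 \<and> \<bar>s / sqrt n\<bar> \<le> pi")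
      case box: True
      have "norm ?H \<le> exp (- q0 * \<kappa>)"
      proof (cases "\<bar>t / \<sigma>\<bar> * (M * sqrt M) \<le> e1")
        case True
        hence "norm ?H \<le> exp (- (c1 * e2\<^sup>2 / 960) * \<kappa>)" using False box by (intro joint_cf_zone2) auto
        also have "\<dots> \<le> exp (- q0 * \<kappa>)"
        proof -
          have "c1\<^sup>2 * e1\<^sup>2 \<le> c1 * e2\<^sup>2"
            using c1 c12 e by (intro mult_mono power_mono) (auto simp: power2_eq_square)
          hence "q0 * \<kappa> \<le> (c1 * e2\<^sup>2 / 960) * \<kappa>" unfolding q0_def using \<kappa> by (intro mult_right_mono) auto
          thus ?thesis by simp
        qed
        finally show ?thesis .
      next
        case False
        hence "norm ?H \<le> exp (- (c1\<^sup>2 * e1\<^sup>2 / 240) * \<kappa>)" using box by (intro joint_cf_zone3) auto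
        also have "\<dots> \<le> exp (- q0 * \<kappa>)"
        proof -
          have "q0 * \<kappa> \<le> (c1\<^sup>2 * e1\<^sup>2 / 240) * \<kappa>" unfolding q0_def using \<kappa> c1 by (intro mult_right_mono) auto
          thus ?thesis by simp
        qed
        finally show ?thesis .
      qed
      thus ?thesis unfolding I using box by simp
    qed (simp only: I if_not_P, simp)
    have "norm (edge t s) \<le> (1 + C2 * (1 / sqrt K + 1 / K)) * exp (- w / 4)" unfolding w_def by (rule edge_bound)
    also have "\<dots> \<le> (1 + C2 * 2) * (exp (- q0 * \<kappa>) * exp (- w / 8))"
    proof (intro mult_mono)
      have "1 / sqrt K \<le> 1" "1 / K \<le> 1" using K1 by auto
      hence "1 / sqrt K + 1 / K \<le> 2" by linarith
      thus "1 + C2 * (1 / sqrt K + 1 / K) \<le> 1 + C2 * 2" using C2 by (intro add_left_mono mult_left_mono) auto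
      show "exp (- w / 4) \<le> exp (- q0 * \<kappa>) * exp (- w / 8)" using w8 by (simp add: exp_add[symmetric])
    qed (use C2 in auto)
    also have "\<dots> \<le> C3 * (1 / (K * sqrt K) + exp (- q0 * \<kappa>)) * exp (- w / 8)"
      unfolding mult.assoc[symmetric] using C1 C2 K by (intro mult_right_mono mult_mono) (auto simp: C3_def)
    finally show ?thesis using H norm_triangle_ineq4[of "?I *\<^sub>R ?H" "edge t s"] unfolding w_def by linarith
  qed
qed

end

section \<open>The Edgeworth polynomial\<close>

definition bipoly_it :: "(real \<times> nat \<times> nat) list \<Rightarrow> real \<Rightarrow> real \<Rightarrow> complex" where
  "bipoly_it L t s = (\<Sum>(a, j, k)\<leftarrow>L. of_real a * (\<i> * of_real t) ^ j * (\<i> * of_real s) ^ k)"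

text \<open>Only the existence of real coefficients matters; the closure rules below yield it for
  the Edgeworth correction without computing them.\<close>

definition is_bipoly_it :: "(real \<Rightarrow> real \<Rightarrow> complex) \<Rightarrow> bool" where
  "is_bipoly_it P \<longleftrightarrow> (\<exists>L. P = bipoly_it L)"

lemma is_bipoly_it_const: "is_bipoly_it (\<lambda>t s. of_real c)"
  unfolding is_bipoly_it_def by (intro exI[of _ "[(c, 0, 0)]"]) (simp add: bipoly_it_def fun_eq_iff)

lemma is_bipoly_it_fst: "is_bipoly_it (\<lambda>t s. \<i> * of_real t)"
  unfolding is_bipoly_it_def by (intro exI[of _ "[(1, 1, 0)]"]) (simp add: bipoly_it_def fun_eq_iff)

lemma is_bipoly_it_snd: "is_bipoly_it (\<lambda>t s. \<i> * of_real s)"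
  unfolding is_bipoly_it_def by (intro exI[of _ "[(1, 0, 1)]"]) (simp add: bipoly_it_def fun_eq_iff)

lemma is_bipoly_it_add:
  assumes "is_bipoly_it P" "is_bipoly_it Q" shows "is_bipoly_it (\<lambda>t s. P t s + Q t s)"
proof -
  obtain L L' where "P = bipoly_it L" "Q = bipoly_it L'" using assms by (auto simp: is_bipoly_it_def)
  hence "(\<lambda>t s. P t s + Q t s) = bipoly_it (L @ L')" by (simp add: bipoly_it_def fun_eq_iff)
  thus ?thesis by (auto simp: is_bipoly_it_def)
qed

lemma is_bipoly_it_mult:
  assumes "is_bipoly_it P" "is_bipoly_it Q" shows "is_bipoly_it (\<lambda>t s. P t s * Q t s)"
proof -
  obtain L L' where L: "P = bipoly_it L" "Q = bipoly_it L'" using assms by (auto simp: is_bipoly_it_def)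
  have "is_bipoly_it (\<lambda>t s. bipoly_it L t s * bipoly_it L' t s)"
  proof (induction L)
    case Nil
    show ?case using is_bipoly_it_const[of 0] by (simp add: bipoly_it_def)
  next
    case (Cons x L)
    obtain a j k where x: "x = (a, j, k)" by (cases x)
    have "is_bipoly_it (\<lambda>t s. of_real a * (\<i> * of_real t) ^ j * (\<i> * of_real s) ^ k * bipoly_it L' t s)"
      unfolding is_bipoly_it_def
    proof (intro exI ext)
      show "of_real a * (\<i> * of_real t) ^ j * (\<i> * of_real s) ^ k * bipoly_it L' t s
          = bipoly_it (map (\<lambda>(b, j', k'). (a * b, j + j', k + k')) L') t s" for t s
        by (induction L') (auto simp: bipoly_it_def power_add algebra_simps)
    qed
    from is_bipoly_it_add[OF this Cons.IH] show ?case
      by (simp add: bipoly_it_def x distrib_right)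
  qed
  thus ?thesis by (simp add: L)
qed

lemma is_bipoly_it_cmult: "is_bipoly_it P \<Longrightarrow> is_bipoly_it (\<lambda>t s. of_real c * P t s)"
  by (rule is_bipoly_it_mult[OF is_bipoly_it_const])

lemma is_bipoly_it_power: "is_bipoly_it P \<Longrightarrow> is_bipoly_it (\<lambda>t s. P t s ^ k)"
proof (induction k)
  case 0
  show ?case using is_bipoly_it_const[of 1] by simp
next
  case (Suc k)
  show ?case unfolding power_Suc by (intro is_bipoly_it_mult Suc)
qed

lemma is_bipoly_it_sum: "(\<And>m. m \<in> A \<Longrightarrow> is_bipoly_it (P m)) \<Longrightarrow> is_bipoly_it (\<lambda>t s. \<Sum>m\<in>A. P m t s)"
proof (induction A rule: infinite_finite_induct)
  case (insert x A)
  have "is_bipoly_it (\<lambda>t s. P x t s + (\<Sum>m\<in>A. P m t s))" by (intro is_bipoly_it_add insert) auto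
  thus ?case using insert by simp
qed (use is_bipoly_it_const[of 0] in simp_all)

lemma bipoly_it_gauss_phase:
  "bipoly_it L t s * of_real (exp (- s\<^sup>2 / 2))
    = gauss_phase 0 (\<Sum>(a, j, k)\<leftarrow>L. smult (of_real a * (\<i> * of_real t) ^ j * \<i> ^ k) (monom 1 k)) s"
proof -
  have "bipoly_it L t s = poly (\<Sum>(a, j, k)\<leftarrow>L. smult (of_real a * (\<i> * of_real t) ^ j * \<i> ^ k) (monom 1 k)) (of_real s)"
    by (induction L) (auto simp: bipoly_it_def poly_monom power_mult_distrib algebra_simps)
  thus ?thesis by (simp add: gauss_phase_def)
qed

lemma integrable_bipoly_it:
  assumes "is_bipoly_it P" shows "complex_integrable lborel (\<lambda>s. P t s * of_real (exp (- s\<^sup>2 / 2)))"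
proof -
  obtain L where "P = bipoly_it L" using assms by (auto simp: is_bipoly_it_def)
  thus ?thesis by (simp only: bipoly_it_gauss_phase integrable_gauss_phase)
qed

text \<open>The \<open>k\<close>-th moment of the standard normal law times \<open>\<i> ^ k\<close> is the value of the
  \<open>k\<close>-th Hermite polynomial at \<open>0\<close>.\<close>

definition hermite_mean :: "(real \<times> nat \<times> nat) list \<Rightarrow> (real \<times> nat) list" where
  "hermite_mean L = map (\<lambda>(a, j, k). (a * poly (hermite k) 0, j)) L"

lemma gauss_avg_bipoly_it: "gauss_avg (bipoly_it L) t = real_poly_it (hermite_mean L) t"
proof -
  have m: "\<i> ^ k * gauss_int 0 (monom 1 k) = of_real (poly (hermite k) 0 * sqrt (2 * pi))" for k
    using gauss_int_monom[of k 0] by simp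
  have "gauss_avg (bipoly_it L) t = of_real (1 / sqrt (2 * pi)) *
     gauss_int 0 (\<Sum>(a, j, k)\<leftarrow>L. smult (of_real a * (\<i> * of_real t) ^ j * \<i> ^ k) (monom 1 k))"
    unfolding gauss_avg_def bipoly_it_gauss_phase gauss_int_def ..
  also have "gauss_int 0 (\<Sum>(a, j, k)\<leftarrow>L. smult (of_real a * (\<i> * of_real t) ^ j * \<i> ^ k) (monom 1 k))
     = (\<Sum>(a, j, k)\<leftarrow>L. of_real a * (\<i> * of_real t) ^ j * (\<i> ^ k * gauss_int 0 (monom 1 k)))"
    unfolding gauss_int_sum_list by (simp add: case_prod_unfold gauss_int_smult mult.assoc)
  also have "\<dots> = of_real (sqrt (2 * pi)) * real_poly_it (hermite_mean L) t"
    unfolding m by (induction L) (auto simp: hermite_mean_def real_poly_it_def algebra_simps)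
  finally show ?thesis by simp
qed

lemma gauss_avg_add:
  assumes "is_bipoly_it P" "is_bipoly_it Q"
  shows "gauss_avg (\<lambda>t s. P t s + Q t s) t = gauss_avg P t + gauss_avg Q t"
  unfolding gauss_avg_def distrib_right
  by (simp only: Bochner_Integration.integral_add[OF integrable_bipoly_it[OF assms(1)] integrable_bipoly_it[OF assms(2)]] distrib_left)

lemma gauss_avg_cmult: "gauss_avg (\<lambda>t s. c * P t s) t = c * gauss_avg P t"
  unfolding gauss_avg_def mult.assoc by (subst integral_mult_right_zero) simp

lemma gauss_avg_1: "gauss_avg (\<lambda>t s. 1) t = 1"
  using gauss_avg_bipoly_it[of "[(1, 0, 0)]" t] by (simp add: hermite_mean_def real_poly_it_def bipoly_it_def[abs_def])

text \<open>The cumulants are homogeneous of degrees 3 and 4, so the powers of i can be moved into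
  the variables and the coefficients stay real.\<close>

lemma cell_cumulants_it:
  "\<i> ^ 3 * complex_of_real (cell_cumulant3 r \<theta> \<omega>) = of_real (8 * r ^ 3 + 4 * r\<^sup>2) * (\<i> * of_real \<theta>) ^ 3
     + of_real (12 * r\<^sup>2) * ((\<i> * of_real \<theta>) ^ 2 * (\<i> * of_real \<omega>))
     + of_real (6 * r\<^sup>2) * ((\<i> * of_real \<theta>) * (\<i> * of_real \<omega>) ^ 2) + of_real r * (\<i> * of_real \<omega>) ^ 3"
  "complex_of_real (cell_cumulant4 r \<theta> \<omega>) = of_real (48 * r ^ 4 + 144 * r ^ 3 + 8 * r\<^sup>2) * (\<i> * of_real \<theta>) ^ 4
     + of_real (192 * r ^ 3 + 32 * r\<^sup>2) * ((\<i> * of_real \<theta>) ^ 3 * (\<i> * of_real \<omega>))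
     + of_real (48 * r ^ 3 + 48 * r\<^sup>2) * ((\<i> * of_real \<theta>) ^ 2 * (\<i> * of_real \<omega>) ^ 2)
     + of_real (24 * r\<^sup>2) * ((\<i> * of_real \<theta>) * (\<i> * of_real \<omega>) ^ 3) + of_real r * (\<i> * of_real \<omega>) ^ 4"
proof -
  have i: "\<i> ^ 3 = - \<i>" "\<i> ^ 4 = 1" by (simp_all add: eval_nat_numeral)
  show "\<i> ^ 3 * complex_of_real (cell_cumulant3 r \<theta> \<omega>) = of_real (8 * r ^ 3 + 4 * r\<^sup>2) * (\<i> * of_real \<theta>) ^ 3
     + of_real (12 * r\<^sup>2) * ((\<i> * of_real \<theta>) ^ 2 * (\<i> * of_real \<omega>))
     + of_real (6 * r\<^sup>2) * ((\<i> * of_real \<theta>) * (\<i> * of_real \<omega>) ^ 2) + of_real r * (\<i> * of_real \<omega>) ^ 3"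
    unfolding cell_cumulant3_def power_mult_distrib i by (simp add: algebra_simps)
  show "complex_of_real (cell_cumulant4 r \<theta> \<omega>) = of_real (48 * r ^ 4 + 144 * r ^ 3 + 8 * r\<^sup>2) * (\<i> * of_real \<theta>) ^ 4
     + of_real (192 * r ^ 3 + 32 * r\<^sup>2) * ((\<i> * of_real \<theta>) ^ 3 * (\<i> * of_real \<omega>))
     + of_real (48 * r ^ 3 + 48 * r\<^sup>2) * ((\<i> * of_real \<theta>) ^ 2 * (\<i> * of_real \<omega>) ^ 2)
     + of_real (24 * r\<^sup>2) * ((\<i> * of_real \<theta>) * (\<i> * of_real \<omega>) ^ 3) + of_real r * (\<i> * of_real \<omega>) ^ 4"
    unfolding cell_cumulant4_def power_mult_distrib i by (simp add: algebra_simps)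
qed

context cells
begin

definition "k3c t s = \<i> ^ 3 * complex_of_real (k3 t s)"
definition "k4c t s = complex_of_real (k4 t s)"

lemma edge_eq: "edge t s = of_real (exp (- (t\<^sup>2 + s\<^sup>2) / 2)) * (1 + k3c t s / 6 + (k4c t s / 24 + (k3c t s / 6)\<^sup>2 / 2))"
  unfolding edge_def k3c_def k4c_def by (simp add: power3_eq_cube power2_eq_square field_simps)

lemma is_bipoly_it_cumulants: "is_bipoly_it k3c" "is_bipoly_it k4c"
proof -
  let ?X = "\<lambda>t (s::real). of_real (1 / \<sigma>) * (\<i> * complex_of_real t)"
  let ?Y = "\<lambda>m t s. of_real (1 / sqrt n) * (\<i> * complex_of_real s) + of_real (2 * \<delta> m / \<sigma>) * (\<i> * complex_of_real t)"
  note I = is_bipoly_it_fst is_bipoly_it_snd is_bipoly_it_sum is_bipoly_it_add is_bipoly_it_cmult is_bipoly_it_power is_bipoly_it_mult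
  have X: "?X t s = \<i> * of_real (t / \<sigma>)" for t s by simp
  have Y: "?Y m t s = \<i> * of_real (om (t / \<sigma>) (s / sqrt n) m)" for m t s by (simp add: algebra_simps)
  have eq3: "k3c = (\<lambda>t s. \<Sum>m\<in>{1..N}. of_real (8 * r m ^ 3 + 4 * (r m)\<^sup>2) * ?X t s ^ 3 + of_real (12 * (r m)\<^sup>2) * (?X t s ^ 2 * ?Y m t s)
     + of_real (6 * (r m)\<^sup>2) * (?X t s * ?Y m t s ^ 2) + of_real (r m) * ?Y m t s ^ 3)"
    unfolding X Y k3c_def k3_def of_real_sum sum_distrib_left
    by (intro ext sum.cong refl cell_cumulants_it)
  show "is_bipoly_it k3c" unfolding eq3 by (intro I)
  have eq4: "k4c = (\<lambda>t s. \<Sum>m\<in>{1..N}. of_real (48 * r m ^ 4 + 144 * r m ^ 3 + 8 * (r m)\<^sup>2) * ?X t s ^ 4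
     + of_real (192 * r m ^ 3 + 32 * (r m)\<^sup>2) * (?X t s ^ 3 * ?Y m t s)
     + of_real (48 * r m ^ 3 + 48 * (r m)\<^sup>2) * (?X t s ^ 2 * ?Y m t s ^ 2)
     + of_real (24 * (r m)\<^sup>2) * (?X t s * ?Y m t s ^ 3) + of_real (r m) * ?Y m t s ^ 4)"
    unfolding X Y k4c_def k4_def of_real_sum
    by (intro ext sum.cong refl cell_cumulants_it)
  show "is_bipoly_it k4c" unfolding eq4 by (intro I)
qed

section \<open>Identification of the polynomials in the expansion\<close>

lemma sigma_hat: "sqrt (sigma_sq n N p / real N) = \<sigma> / sqrt N"
  by (simp add: sigma_N_def real_sqrt_divide)

text \<open>\<open>g_hat\<close> and \<open>xi_hat\<close> are normalised by \<sigma> / sqrt N and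
  by sqrt(n / N), so their combination is sqrt N times the cell variable at the frequencies t /
  \<sigma> and \<omega>.\<close>

lemma lin_moment_eq:
  assumes m: "m \<in> {1..N}"
  shows "lin_moment n N p k m t s = measure_pmf.expectation (poisson_pmf (r m))
     (\<lambda>x. (sqrt N * (t / \<sigma> * charlier2 (r m) x + om (t / \<sigma>) (s / sqrt n) m * (real x - r m))) ^ k)"
proof -
  have sN: "sqrt (real n) = sqrt N * sqrt l" by (simp add: nl real_sqrt_mult)
  have "t * g_hat n N p m (real x) + s * xi_hat n N p m (real x)
     = sqrt N * (t / \<sigma> * charlier2 (r m) x + om (t / \<sigma>) (s / sqrt n) m * (real x - r m))" for x
  proof -
    have g: "g_stat n N p m (real x) = charlier2 (r m) x + 2 * \<delta> m * (real x - r m)"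
      by (simp add: g_stat_def charlier2_def cell_dev_def power2_eq_square algebra_simps)
    have 1: "t * g_hat n N p m (real x) = sqrt N * (t / \<sigma> * g_stat n N p m (real x))"
      using N \<sigma>_pos by (simp add: g_hat_def sigma_hat)
    have 2: "s * xi_hat n N p m (real x) = sqrt N * (s / sqrt n * (real x - r m))"
      using N l by (simp add: xi_hat_def sN)
    define u v where "u = t / \<sigma>" and "v = s / sqrt n"
    show ?thesis unfolding 1 2 g u_def[symmetric] v_def[symmetric] by (simp add: algebra_simps)
  qed
  thus ?thesis unfolding lin_moment_def
    using expectation_poisson_vec[OF m, of n p "\<lambda>x. (t * g_hat n N p m (real x) + s * xi_hat n N p m (real x)) ^ k"] by simp
qed

lemma lin_moments:
  fixes t s :: real
  assumes m: "m \<in> {1..N}"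
  defines "\<theta> \<equiv> t / \<sigma>" and "\<omega> \<equiv> om (t / \<sigma>) (s / sqrt n) m"
  shows "lin_moment n N p 2 m t s = N * cell_var (r m) \<theta> \<omega>"
    "lin_moment n N p 3 m t s = N * sqrt N * cell_cumulant3 (r m) \<theta> \<omega>"
    "lin_moment n N p 4 m t s = N\<^sup>2 * (cell_cumulant4 (r m) \<theta> \<omega> + 3 * (cell_var (r m) \<theta> \<omega>)\<^sup>2)"
proof -
  note c = cell_moments[OF r(1)[OF m], of \<theta> \<omega>, THEN has_bochner_integral_integral_eq]
  have s: "sqrt (real N) ^ 3 = N * sqrt N" "sqrt (real N) ^ 4 = (real N)\<^sup>2"
    by (simp_all add: eval_nat_numeral)
  show "lin_moment n N p 2 m t s = N * cell_var (r m) \<theta> \<omega>"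
    "lin_moment n N p 3 m t s = N * sqrt N * cell_cumulant3 (r m) \<theta> \<omega>"
    "lin_moment n N p 4 m t s = N\<^sup>2 * (cell_cumulant4 (r m) \<theta> \<omega> + 3 * (cell_var (r m) \<theta> \<omega>)\<^sup>2)"
    unfolding lin_moment_eq[OF m] \<omega>_def[symmetric] unfolding \<theta>_def[symmetric] power_mult_distrib
    by (simp_all add: c s)
qed

text \<open>The factor sqrt N, like the N in \<open>P2_eq\<close>, cancels against the denominators
  in \<open>W5\<close> and leaves the corrections that occur in \<open>edge\<close>.\<close>

lemma P1_eq: "P1 n N p t s = of_real (sqrt N) * (k3c t s / 6)"
proof -
  have "(\<Sum>m=1..N. lin_moment n N p 3 m t s) = N * sqrt N * k3 t s"
    unfolding k3_def sum_distrib_left by (intro sum.cong refl lin_moments)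
  thus ?thesis using N unfolding P1_def k3c_def by (simp add: field_simps)
qed

lemma P2_eq: "P2 n N p t s = of_real (real N) * (k4c t s / 24 + (k3c t s / 6)\<^sup>2 / 2)"
proof -
  have "(\<Sum>m=1..N. lin_moment n N p 4 m t s - 3 * (lin_moment n N p 2 m t s)\<^sup>2)
     = (\<Sum>m=1..N. N\<^sup>2 * cell_cumulant4 (r m) (t / \<sigma>) (om (t / \<sigma>) (s / sqrt n) m))"
    by (intro sum.cong refl) (simp add: lin_moments power_mult_distrib algebra_simps)
  also have "\<dots> = N\<^sup>2 * k4 t s" unfolding k4_def sum_distrib_left ..
  finally have 1: "(\<Sum>m=1..N. lin_moment n N p 4 m t s - 3 * (lin_moment n N p 2 m t s)\<^sup>2) = N\<^sup>2 * k4 t s" .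
  have i: "\<i> ^ 4 = 1" by (simp add: eval_nat_numeral)
  have s: "complex_of_real (sqrt N) ^ 2 = of_nat N" by (simp flip: of_real_power)
  have "P2 n N p t s = of_nat N * of_real (k4 t s) / 24 + of_nat N * (k3c t s / 6)\<^sup>2 / 2"
    unfolding P2_def 1 P1_eq power_mult_distrib s i using N by (simp add: power2_eq_square)
  thus ?thesis by (simp add: k4c_def algebra_simps)
qed

definition "corr t s = 1 + k3c t s / 6 + (k4c t s / 24 + (k3c t s / 6)\<^sup>2 / 2)"

lemma edge_corr: "edge t s = of_real (exp (- (t\<^sup>2 + s\<^sup>2) / 2)) * corr t s"
  unfolding edge_eq corr_def ..

lemma is_bipoly_it_corr: "is_bipoly_it (\<lambda>t s. k3c t s / 6)" "is_bipoly_it (\<lambda>t s. k4c t s / 24 + (k3c t s / 6)\<^sup>2 / 2)"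
  "is_bipoly_it corr"
proof -
  note I = is_bipoly_it_add is_bipoly_it_power is_bipoly_it_cmult is_bipoly_it_cumulants
  have a: "is_bipoly_it (\<lambda>t s. of_real (1 / 6) * k3c t s)" by (intro I)
  thus 1: "is_bipoly_it (\<lambda>t s. k3c t s / 6)" by simp
  have "is_bipoly_it (\<lambda>t s. of_real (1 / 24) * k4c t s + of_real (1 / 2) * (k3c t s / 6)\<^sup>2)" by (intro I 1)
  thus 2: "is_bipoly_it (\<lambda>t s. k4c t s / 24 + (k3c t s / 6)\<^sup>2 / 2)" by simp
  have "is_bipoly_it (\<lambda>t s. of_real 1 + k3c t s / 6 + (k4c t s / 24 + (k3c t s / 6)\<^sup>2 / 2))"
    by (intro is_bipoly_it_add is_bipoly_it_const 1 2)
  thus "is_bipoly_it corr" by (simp add: corr_def[abs_def])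
qed

text \<open>On the line t = 0 the cubic form is a multiple of s^3, which has Gaussian mean
  0.\<close>

lemma k3c_avg_0: "gauss_avg k3c 0 = 0"
proof -
  define a where "a = (\<Sum>m=1..N. r m / sqrt n ^ 3)"
  have "k3c 0 s = bipoly_it [(a, 0, 3)] 0 s" for s
  proof -
    have "k3 0 s = a * s ^ 3"
      by (simp add: k3_def a_def cell_cumulant3_def sum_distrib_right power_divide)
    thus ?thesis by (simp add: k3c_def bipoly_it_def power_mult_distrib)
  qed
  hence "gauss_avg k3c 0 = gauss_avg (bipoly_it [(a, 0, 3)]) 0" by (simp add: gauss_avg_def)
  also have "\<dots> = 0" unfolding gauss_avg_bipoly_it
    by (simp add: hermite_mean_def real_poly_it_def numeral_3_eq_3 pderiv_pCons pderiv_diff)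
  finally show ?thesis .
qed

text \<open>The excess g of the average over 1 at t = 0 is removed. In the density this subtracts g
  times the normal density, the leading effect of dividing by the denominator 1 + g.\<close>

lemma W5_eq: "W5 n N p t = gauss_avg corr t - (gauss_avg corr 0 - 1)"
proof -
  define A where "A = gauss_avg (\<lambda>t s. k3c t s / 6)"
  define B where "B = gauss_avg (\<lambda>t s. k4c t s / 24 + (k3c t s / 6)\<^sup>2 / 2)"
  have G1: "gauss_avg (P1 n N p) t = of_real (sqrt N) * A t" for t
    unfolding A_def gauss_avg_cmult[symmetric] P1_eq[abs_def] ..
  have G2: "gauss_avg (P2 n N p) t = of_real (real N) * B t" for t
    unfolding B_def gauss_avg_cmult[symmetric] P2_eq[abs_def] ..
  have A0: "A 0 = 0" using gauss_avg_cmult[of "1 / 6" k3c 0] by (simp add: A_def k3c_avg_0)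
  have C: "gauss_avg corr t = 1 + A t + B t" for t
  proof -
    have "gauss_avg corr t = gauss_avg (\<lambda>t s. 1 + k3c t s / 6) t + B t"
      unfolding corr_def[abs_def] B_def
      using is_bipoly_it_add[OF is_bipoly_it_const[of 1] is_bipoly_it_corr(1)] is_bipoly_it_corr(2)
      by (intro gauss_avg_add) simp_all
    also have "gauss_avg (\<lambda>t s. 1 + k3c t s / 6) t = gauss_avg (\<lambda>t s. 1) t + A t"
      unfolding A_def using is_bipoly_it_const[of 1] is_bipoly_it_corr(1) by (intro gauss_avg_add) simp_all
    finally show ?thesis by (simp add: gauss_avg_1)
  qed
  have "complex_of_real (sqrt (real N)) \<noteq> 0" "complex_of_nat N \<noteq> 0" using N by auto
  thus ?thesis unfolding W5_def Let_def G1 G2 C A0 by (simp add: field_simps)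
qed

end

section \<open>The error integrals\<close>

lemma integrable_gauss_eighth: "integrable lborel (\<lambda>s::real. exp (- s\<^sup>2 / 8))"
proof -
  have "(\<lambda>s::real. exp (- s\<^sup>2 / 8)) = (\<lambda>s. sqrt (2 * pi * 2\<^sup>2) * normal_density 0 2 s)"
    by (simp add: normal_density_def fun_eq_iff)
  moreover have "integrable lborel \<dots>" by (intro integrable_mult_right) simp
  ultimately show ?thesis by simp
qed

lemma integrable_gauss_eighth_plane:
  "integrable (lborel \<Otimes>\<^sub>M lborel) (\<lambda>w::real \<times> real. exp (- ((fst w)\<^sup>2 + (snd w)\<^sup>2) / 8))"
proof (rule lborel_pair.Fubini_integrable)
  have eq: "exp (- (t\<^sup>2 + s\<^sup>2) / 8) = exp (- t\<^sup>2 / 8) * exp (- s\<^sup>2 / 8)" for t s :: real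
    by (simp add: exp_add[symmetric] add_divide_distrib diff_divide_distrib)
  show "integrable lborel (\<lambda>x::real. LBINT y. norm (exp (- ((fst (x, y))\<^sup>2 + (snd (x, y))\<^sup>2) / (8::real))))"
    unfolding fst_conv snd_conv eq norm_mult using integrable_gauss_eighth by simp
  show "AE x::real in lborel. integrable lborel (\<lambda>y. exp (- ((fst (x, y))\<^sup>2 + (snd (x, y))\<^sup>2) / 8))"
    unfolding fst_conv snd_conv eq using integrable_gauss_eighth by simp
qed measurable

definition gauss_line_mass :: real where
  "gauss_line_mass = (LBINT s. exp (- s\<^sup>2 / 8))"

definition gauss_plane_mass :: real where
  "gauss_plane_mass = (LINT w|(lborel \<Otimes>\<^sub>M lborel). exp (- ((fst w)\<^sup>2 + (snd w)\<^sup>2) / (8::real)))"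

lemma gauss_mass_nonneg: "0 \<le> gauss_line_mass" "0 \<le> gauss_plane_mass"
  unfolding gauss_line_mass_def gauss_plane_mass_def by (auto intro!: Bochner_Integration.integral_nonneg)

lemma has_gauss_line_mass: "has_bochner_integral lborel (\<lambda>s::real. c * exp (- s\<^sup>2 / 8)) (c * gauss_line_mass)"
  unfolding gauss_line_mass_def
  by (intro has_bochner_integral_mult_right has_bochner_integral_integrable integrable_gauss_eighth)

lemma has_gauss_plane_mass:
  "has_bochner_integral (lborel \<Otimes>\<^sub>M lborel) (\<lambda>w::real \<times> real. c * exp (- ((fst w)\<^sup>2 + (snd w)\<^sup>2) / 8)) (c * gauss_plane_mass)"
  unfolding gauss_plane_mass_def
  by (intro has_bochner_integral_mult_right has_bochner_integral_integrable integrable_gauss_eighth_plane)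

text \<open>By induction n! e^n \<le> e sqrt n n^n, as (1 + 1/n)^(n + 1/2) \<ge> e, and sqrt(2
  \<pi>) exceeds e / 2. Dividing by the denominator requires such a bound away from 0 for all
  n.\<close>

lemma stirling_ratio_ge:
  assumes "n \<ge> 1"
  shows "1 / 2 \<le> stirling_ratio n"
proof -
  have step: "exp 1 * (sqrt (real n) * real n ^ n) \<le> sqrt (real (Suc n)) * real (Suc n) ^ n" if n: "n \<ge> 1" for n
  proof -
    define x where "x = real (Suc n) / real n"
    have x: "x > 1" using n by (simp add: x_def)
    have "(x - 1) / (x + 1) = 1 / (2 * real n + 1)" using n by (simp add: x_def field_simps)
    \<comment> \<open>The first term of the series of ln x in powers of (x - 1) / (x + 1).\<close>
    hence "2 / (2 * real n + 1) \<le> ln x"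
      using ln_approx_bounds[of x 1] x by (simp add: Let_def)
    hence "1 \<le> (real n + 1 / 2) * ln x" using n by (simp add: field_simps)
    hence "exp 1 \<le> exp ((real n + 1 / 2) * ln x)" by (simp only: exp_le_cancel_iff)
    also have "(real n + 1 / 2) * ln x = real n * ln x + ln (sqrt x)" using x by (simp add: ln_sqrt distrib_right)
    also have "exp (real n * ln x + ln (sqrt x)) = x ^ n * sqrt x" using x by (simp add: exp_add exp_of_nat_mult)
    finally have "exp 1 * (sqrt (real n) * real n ^ n) \<le> (x ^ n * sqrt x) * (sqrt (real n) * real n ^ n)"
      by (rule mult_right_mono) simp
    also have "\<dots> = sqrt (x * real n) * (x * real n) ^ n" by (simp add: real_sqrt_mult power_mult_distrib)
    also have "x * real n = real (Suc n)" using n by (simp add: x_def)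
    finally show ?thesis .
  qed
  have key: "fact n * exp (real n) \<le> exp 1 * (sqrt (real n) * real n ^ n)"
    using assms
  proof (induction n rule: nat_induct_at_least)
    case (Suc n)
    have "fact (Suc n) * exp (real (Suc n)) = (real (Suc n) * exp 1) * (fact n * exp (real n))"
      by (simp add: exp_add[symmetric] algebra_simps)
    also have "\<dots> \<le> (real (Suc n) * exp 1) * (exp 1 * (sqrt (real n) * real n ^ n))"
      by (intro mult_left_mono Suc.IH) auto
    also have "\<dots> \<le> (real (Suc n) * exp 1) * (sqrt (real (Suc n)) * real (Suc n) ^ n)"
      by (intro mult_left_mono step Suc.hyps) auto
    finally show ?case by (simp add: mult_ac)
  qed simp
  have "2 \<le> sqrt (2 * pi)" using pi_gt3 by (intro real_le_rsqrt) (simp add: power2_eq_square)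
  moreover have "exp 1 \<le> (3::real)" by (rule exp_le)
  ultimately have "exp 1 / 2 \<le> sqrt (2 * pi)" by linarith
  hence "(1 / 2) * (fact n * exp (real n)) \<le> sqrt (2 * pi) * (sqrt (real n) * real n ^ n)"
    using key mult_right_mono[of "exp 1 / 2" "sqrt (2 * pi)" "sqrt (real n) * real n ^ n"] by simp
  moreover have "stirling_ratio n = sqrt (2 * pi) * (sqrt (real n) * real n ^ n) / (fact n * exp (real n))"
    using assms by (simp add: stirling_ratio_def real_sqrt_mult exp_minus field_simps)
  ultimately show ?thesis by (simp add: le_divide_eq)
qed

text \<open>The primitive of the Hermite density has the required transform, and uniqueness then
  evaluates the definite description.\<close>

lemma deriv_WW5:
  assumes "\<And>t. W5 n N p t = real_poly_it L t"
  shows "deriv (WW5 n N p) u = hermite_density L u"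
proof -
  define F where "F u = (\<integral>x. indicator {..u} x * hermite_density L x \<partial>lborel)" for u
  note F = fourier_stieltjes_of_density[OF hermite_density_continuous integrable_hermite_density, of L, folded F_def]
  have t: "has_fourier_stieltjes_transform F (\<lambda>t. W5 n N p t * of_real (exp (- t\<^sup>2 / 2)))"
    using F(1) unfolding integral_iexp_hermite_density assms .
  have "WW5 n N p = F" unfolding WW5_def
    by (rule the_equality) (use t F(2) fourier_stieltjes_transform_unique in blast)+
  thus ?thesis using DERIV_imp_deriv[OF F(3)] by simp
qed

lemma gauss_avg_line:
  "(CLBINT s. of_real (exp (- (t\<^sup>2 + s\<^sup>2) / 2)) * P t s) = of_real (exp (- t\<^sup>2 / 2) * sqrt (2 * pi)) * gauss_avg P t"
proof -
  have "of_real (exp (- (t\<^sup>2 + s\<^sup>2) / 2)) * P t s = of_real (exp (- t\<^sup>2 / 2)) * (P t s * of_real (exp (- s\<^sup>2 / 2)))" for s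
  proof -
    have "exp (- (t\<^sup>2 + s\<^sup>2) / 2) = exp (- t\<^sup>2 / 2) * exp (- s\<^sup>2 / 2)"
      by (simp add: exp_add[symmetric] add_divide_distrib diff_divide_distrib)
    thus ?thesis by simp
  qed
  hence "(CLBINT s. of_real (exp (- (t\<^sup>2 + s\<^sup>2) / 2)) * P t s)
     = (CLBINT s. of_real (exp (- t\<^sup>2 / 2)) * (P t s * of_real (exp (- s\<^sup>2 / 2))))" by (simp only:)
  also have "\<dots> = of_real (exp (- t\<^sup>2 / 2)) * (CLBINT s. P t s * of_real (exp (- s\<^sup>2 / 2)))"
    by (rule integral_mult_right_zero)
  finally show ?thesis unfolding gauss_avg_def mult.assoc[symmetric] of_real_mult[symmetric] by simp
qed

text \<open>Integrating out s produces the Gaussian average, and Fourier inversion in t the density;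
  they contribute the factors sqrt(2 \<pi>) and 2 \<pi>.\<close>

lemma plane_integral_bipoly_it:
  fixes u :: real
  assumes "complex_integrable (lborel \<Otimes>\<^sub>M lborel)
    (\<lambda>w. iexp (- (fst w * u)) * (of_real (exp (- ((fst w)\<^sup>2 + (snd w)\<^sup>2) / 2)) * bipoly_it L (fst w) (snd w)))"
  shows "(CLINT w | lborel \<Otimes>\<^sub>M lborel. iexp (- (fst w * u)) * (of_real (exp (- ((fst w)\<^sup>2 + (snd w)\<^sup>2) / 2)) * bipoly_it L (fst w) (snd w)))
    = of_real (2 * pi * sqrt (2 * pi) * hermite_density (hermite_mean L) u)"
proof -
  have "(CLINT w | lborel \<Otimes>\<^sub>M lborel. iexp (- (fst w * u)) * (of_real (exp (- ((fst w)\<^sup>2 + (snd w)\<^sup>2) / 2)) * bipoly_it L (fst w) (snd w)))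
    = (CLBINT t. CLBINT s. iexp (- (t * u)) * (of_real (exp (- (t\<^sup>2 + s\<^sup>2) / 2)) * bipoly_it L t s))"
    using lborel_pair.integral_fst'[OF assms] by simp
  also have "\<dots> = (CLBINT t. of_real (sqrt (2 * pi)) * (iexp (- (t * u)) * (real_poly_it (hermite_mean L) t * of_real (exp (- t\<^sup>2 / 2)))))"
    by (subst integral_mult_right_zero, subst gauss_avg_line) (simp add: gauss_avg_bipoly_it mult_ac)
  also have "\<dots> = of_real (sqrt (2 * pi)) * (CLBINT t. iexp (- (t * u)) * (real_poly_it (hermite_mean L) t * of_real (exp (- t\<^sup>2 / 2))))"
    by (rule integral_mult_right_zero)
  also have "\<dots> = of_real (2 * pi * sqrt (2 * pi) * hermite_density (hermite_mean L) u)"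
    using hermite_density_inversion[of "hermite_mean L" u] by (simp add: field_simps)
  finally show ?thesis .
qed

lemma exp_quarter_le_eighth: "exp (- (t\<^sup>2 + s\<^sup>2) / 4) \<le> exp (- (t\<^sup>2 + s\<^sup>2) / 8)" for t s :: real
proof -
  have "0 \<le> t\<^sup>2 + s\<^sup>2" by simp
  thus ?thesis by simp
qed

lemma exp_le_eighth:
  fixes t s :: real
  shows "c \<ge> 1 / 8 \<Longrightarrow> exp (- (c * (t\<^sup>2 + s\<^sup>2))) \<le> exp (- (t\<^sup>2 + s\<^sup>2) / 8)"
  using mult_right_mono[of "1 / 8" c "t\<^sup>2 + s\<^sup>2"] by simp

context cells
begin

lemma edge_measurable:
  assumes [measurable]: "f \<in> borel_measurable L" "g \<in> borel_measurable L"
  shows "(\<lambda>w. edge (f w) (g w)) \<in> borel_measurable L"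
  unfolding edge_def k3_def k4_def cell_cumulant3_def cell_cumulant4_def by measurable

lemma edge_le_eighth: "norm (edge t s) \<le> (1 + C2 * (1 / sqrt K + 1 / K)) * exp (- (t\<^sup>2 + s\<^sup>2) / 8)"
  by (rule order_trans[OF edge_bound mult_left_mono[OF exp_quarter_le_eighth]]) (use C2 K in auto)

lemma integrable_edge_plane:
  "complex_integrable (lborel \<Otimes>\<^sub>M lborel) (\<lambda>w. iexp (- (fst w * u)) * edge (fst w) (snd w))"
proof (rule Bochner_Integration.integrable_bound)
  show "integrable (lborel \<Otimes>\<^sub>M lborel) (\<lambda>w::real \<times> real. (1 + C2 * (1 / sqrt K + 1 / K)) * exp (- ((fst w)\<^sup>2 + (snd w)\<^sup>2) / 8))"
    using has_gauss_plane_mass by (rule integrable.intros)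
  show "AE w in lborel \<Otimes>\<^sub>M lborel. norm (iexp (- (fst w * u)) * edge (fst w) (snd w))
      \<le> norm ((1 + C2 * (1 / sqrt K + 1 / K)) * exp (- ((fst w)\<^sup>2 + (snd w)\<^sup>2) / 8))"
  proof (rule AE_I2)
    fix w :: "real \<times> real"
    show "norm (iexp (- (fst w * u)) * edge (fst w) (snd w)) \<le> norm ((1 + C2 * (1 / sqrt K + 1 / K)) * exp (- ((fst w)\<^sup>2 + (snd w)\<^sup>2) / 8))"
      using edge_le_eighth[of "fst w" "snd w"] by (auto simp: norm_mult intro: order_trans[OF _ abs_ge_self])
  qed
  have [measurable]: "(\<lambda>w. edge (fst w) (snd w)) \<in> borel_measurable (lborel \<Otimes>\<^sub>M lborel)" by (intro edge_measurable) auto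
  show "(\<lambda>w. iexp (- (fst w * u)) * edge (fst w) (snd w)) \<in> borel_measurable (lborel \<Otimes>\<^sub>M lborel)" by measurable
qed

lemma integrable_edge_line: "complex_integrable lborel (\<lambda>s. edge t s)"
proof (rule Bochner_Integration.integrable_bound)
  show "integrable lborel (\<lambda>s::real. (1 + C2 * (1 / sqrt K + 1 / K)) * exp (- s\<^sup>2 / 8))"
    using has_gauss_line_mass by (rule integrable.intros)
  have "norm (edge t s) \<le> (1 + C2 * (1 / sqrt K + 1 / K)) * exp (- s\<^sup>2 / 8)" for s
    by (rule order_trans[OF edge_le_eighth mult_left_mono]) (use C2 K in auto)
  thus "AE s in lborel. norm (edge t s) \<le> norm ((1 + C2 * (1 / sqrt K + 1 / K)) * exp (- s\<^sup>2 / 8))"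
    by (auto intro: order_trans[OF _ abs_ge_self])
  show "(\<lambda>s. edge t s) \<in> borel_measurable lborel" by (intro edge_measurable) auto
qed

lemma has_inversion_box:
  "has_bochner_integral (lborel \<Otimes>\<^sub>M lborel) (indicator (inversion_box n N p) :: _ \<Rightarrow> real) (pi * \<sigma> * (2 * pi * sqrt n))"
proof -
  have "emeasure (lborel \<Otimes>\<^sub>M lborel) (inversion_box n N p) = ennreal (pi * \<sigma>) * ennreal (2 * pi * sqrt n)"
    unfolding inversion_box_def using \<sigma>_pos by (subst lborel.emeasure_pair_measure_Times) (auto simp: mult_ac)
  also have "\<dots> = ennreal (pi * \<sigma> * (2 * pi * sqrt n))" using \<sigma>_pos by (subst ennreal_mult) auto
  finally have e: "emeasure (lborel \<Otimes>\<^sub>M lborel) (inversion_box n N p) = ennreal (pi * \<sigma> * (2 * pi * sqrt n))" .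
  have "inversion_box n N p \<in> sets (lborel \<Otimes>\<^sub>M lborel)" unfolding inversion_box_def by (intro pair_measureI) auto
  moreover from e have "measure (lborel \<Otimes>\<^sub>M lborel) (inversion_box n N p) = pi * \<sigma> * (2 * pi * sqrt n)"
    using \<sigma>_pos by (simp add: measure_def)
  ultimately show ?thesis using has_bochner_integral_real_indicator[of "inversion_box n N p" "lborel \<Otimes>\<^sub>M lborel"] e by simp
qed

lemma integrable_joint_cf_plane:
  "complex_integrable (lborel \<Otimes>\<^sub>M lborel) (\<lambda>w. indicator (inversion_box n N p) w *\<^sub>R
     (iexp (- (fst w * u)) * joint_cf n N p (fst w / \<sigma>) (snd w / sqrt n)))"
proof (rule Bochner_Integration.integrable_bound)
  show "integrable (lborel \<Otimes>\<^sub>M lborel) (indicator (inversion_box n N p) :: _ \<Rightarrow> real)"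
    using has_inversion_box by (rule integrable.intros)
  show "AE w in lborel \<Otimes>\<^sub>M lborel. norm (indicator (inversion_box n N p) w *\<^sub>R
     (iexp (- (fst w * u)) * joint_cf n N p (fst w / \<sigma>) (snd w / sqrt n))) \<le> norm (indicator (inversion_box n N p) w :: real)"
    by (rule AE_I2) (simp add: norm_mult norm_joint_cf_le_1 mult_left_le)
  have [measurable]: "inversion_box n N p \<in> sets (lborel \<Otimes>\<^sub>M lborel)" unfolding inversion_box_def by (intro pair_measureI) auto
  have [measurable]: "(\<lambda>w. joint_cf n N p (fst w / \<sigma>) (snd w / sqrt n)) \<in> borel_measurable (lborel \<Otimes>\<^sub>M lborel)"
    by (intro joint_cf_measurable) auto
  show "(\<lambda>w. indicator (inversion_box n N p) w *\<^sub>R (iexp (- (fst w * u)) * joint_cf n N p (fst w / \<sigma>) (snd w / sqrt n)))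
     \<in> borel_measurable (lborel \<Otimes>\<^sub>M lborel)" by measurable
qed

abbreviation "err \<equiv> 1 / (K * sqrt K) + exp (- q0 * \<kappa>)"

lemma plane_error:
  assumes "K \<ge> 1"
  shows "norm ((CLINT w | lborel \<Otimes>\<^sub>M lborel. indicator (inversion_box n N p) w *\<^sub>R
       (iexp (- (fst w * u)) * joint_cf n N p (fst w / \<sigma>) (snd w / sqrt n)))
     - (CLINT w | lborel \<Otimes>\<^sub>M lborel. iexp (- (fst w * u)) * edge (fst w) (snd w)))
     \<le> C3 * err * gauss_plane_mass + pi * \<sigma> * (2 * pi * sqrt n) * exp (- q0 * \<kappa>)"
proof (rule norm_has_bochner_integral_le[OF has_bochner_integral_diff[OF
      has_bochner_integral_integrable[OF integrable_joint_cf_plane] has_bochner_integral_integrable[OF integrable_edge_plane]]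
      has_bochner_integral_add[OF has_gauss_plane_mass has_bochner_integral_mult_left[OF has_inversion_box]]])
  fix w :: "real \<times> real"
  obtain t s where w: "w = (t, s)" by (cases w)
  have "norm (indicator (inversion_box n N p) w *\<^sub>R (iexp (- (fst w * u)) * joint_cf n N p (fst w / \<sigma>) (snd w / sqrt n))
      - iexp (- (fst w * u)) * edge (fst w) (snd w))
     = norm (iexp (- (t * u)) * (indicator (inversion_box n N p) (t, s) *\<^sub>R joint_cf n N p (t / \<sigma>) (s / sqrt n) - edge t s))"
    by (simp add: w right_diff_distrib)
  also have "\<dots> = norm (indicator (inversion_box n N p) (t, s) *\<^sub>R joint_cf n N p (t / \<sigma>) (s / sqrt n) - edge t s)"
    unfolding norm_mult by simp
  finally show "norm (indicator (inversion_box n N p) w *\<^sub>R (iexp (- (fst w * u)) * joint_cf n N p (fst w / \<sigma>) (snd w / sqrt n))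
      - iexp (- (fst w * u)) * edge (fst w) (snd w))
    \<le> C3 * err * exp (- ((fst w)\<^sup>2 + (snd w)\<^sup>2) / 8) + indicator (inversion_box n N p) w * exp (- q0 * \<kappa>)"
    using pointwise_error[OF assms, of t s] by (simp add: w)
qed

text \<open>The section of the box at t = 0 is the interval of the one-dimensional inversion, so
  \<open>pointwise_error\<close> at t = 0 can be integrated directly.\<close>

lemma line_error:
  assumes "K \<ge> 1"
  shows "norm (of_real (sqrt (2 * pi) * stirling_ratio n) - (CLBINT s. edge 0 s))
     \<le> C3 * err * gauss_line_mass + 2 * pi * sqrt n * exp (- q0 * \<kappa>)"
proof -
  let ?A = "{- (pi * sqrt n)..pi * sqrt n}"
  have A: "has_bochner_integral lborel (indicator ?A :: _ \<Rightarrow> real) (2 * pi * sqrt n)"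
    using has_bochner_integral_real_indicator[of ?A lborel] by (simp add: mult.assoc)
  have J: "complex_integrable lborel (\<lambda>s. indicator ?A s *\<^sub>R joint_cf n N p 0 (s / sqrt n))"
  proof (rule Bochner_Integration.integrable_bound)
    show "integrable lborel (indicator ?A :: _ \<Rightarrow> real)" using A by (rule integrable.intros)
    show "AE s in lborel. norm (indicator ?A s *\<^sub>R joint_cf n N p 0 (s / sqrt n)) \<le> norm (indicator ?A s :: real)"
      by (rule AE_I2) (simp add: norm_joint_cf_le_1 mult_left_le)
    have [measurable]: "(\<lambda>s. joint_cf n N p 0 (s / sqrt n)) \<in> borel_measurable lborel"
      by (intro joint_cf_measurable) auto
    show "(\<lambda>s. indicator ?A s *\<^sub>R joint_cf n N p 0 (s / sqrt n)) \<in> borel_measurable lborel" by measurable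
  qed
  have q: "of_real (sqrt (2 * pi) * stirling_ratio n) = (CLBINT s. indicator ?A s *\<^sub>R joint_cf n N p 0 (s / sqrt n))"
    by (rule stirling_ratio_inversion) (use n p_pos p_sum in auto)
  show ?thesis unfolding q
  proof (rule norm_has_bochner_integral_le[OF has_bochner_integral_diff[OF
      has_bochner_integral_integrable[OF J] has_bochner_integral_integrable[OF integrable_edge_line]]
      has_bochner_integral_add[OF has_gauss_line_mass has_bochner_integral_mult_left[OF A]]])
    fix s :: real
    have "indicator (inversion_box n N p) (0, s) = (indicator ?A s :: real)"
      using \<sigma>_pos by (auto simp: inversion_box_def indicator_def)
    thus "norm (indicator ?A s *\<^sub>R joint_cf n N p 0 (s / sqrt n) - edge 0 s)
      \<le> C3 * err * exp (- s\<^sup>2 / 8) + indicator ?A s * exp (- q0 * \<kappa>)"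
      using pointwise_error[OF assms, of 0 s] by simp
  qed
qed

end

section \<open>The local limit theorem\<close>

lemma powr_three_halves: "x > 0 \<Longrightarrow> x powr (3 / 2) = x * sqrt x" for x :: real
  using powr_add[of x 1 "1 / 2"] by (simp add: powr_half_sqrt)

lemma std_normal_density_le_1: "0 \<le> std_normal_density u" "std_normal_density u \<le> 1"
proof -
  show "0 \<le> std_normal_density u" by (simp add: std_normal_density_def)
  have "1 \<le> sqrt (2 * pi)" using pi_gt3 by (intro real_le_rsqrt) simp
  hence "1 / sqrt (2 * pi) * exp (- u\<^sup>2 / 2) \<le> 1 * 1" by (intro mult_mono) auto
  thus "std_normal_density u \<le> 1" by (simp add: std_normal_density_def)
qed

lemma le_mult_big: "\<bar>c * x\<bar> \<le> b \<Longrightarrow> 1 \<le> c \<Longrightarrow> \<bar>x\<bar> \<le> b" for b c x :: real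
  using mult_right_mono[of 1 c "\<bar>x\<bar>"] by (simp add: abs_mult)

lemma trivial_estimate:
  fixes x e y :: real
  shows "\<lbrakk>\<bar>x\<bar> \<le> a; \<bar>e - y\<bar> \<le> b; \<bar>h\<bar> \<le> c; 0 \<le> y; y \<le> 1; a + 1 \<le> d\<rbrakk> \<Longrightarrow> \<bar>x - (e - h)\<bar> \<le> d + b + c"
  by linarith

lemma two_pi_bounds: "1 \<le> sqrt (2 * pi)" "1 \<le> 2 * pi * sqrt (2 * pi)"
proof -
  show 1: "1 \<le> sqrt (2 * pi)" using pi_gt3 by (intro real_le_rsqrt) simp
  show "1 \<le> 2 * pi * sqrt (2 * pi)" using mult_mono[OF _ 1, of 1 "2 * pi"] pi_gt3 by simp
qed

lemma real_poly_it_0: "real_poly_it L 0 = of_real (\<Sum>(a, j)\<leftarrow>L. a * 0 ^ j)"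
  by (induction L) (auto simp: real_poly_it_def)

context cells
begin

text \<open>L lists the coefficients of the averaged correction; the prepended entry -g of degree 0
  subtracts g times the normal density.\<close>

lemma obtain_density:
  obtains L g where "\<And>t. W5 n N p t = real_poly_it ((- g, 0) # L) t"
    "gauss_avg corr 0 = of_real (1 + g)"
    "\<And>u. (CLINT w | lborel \<Otimes>\<^sub>M lborel. iexp (- (fst w * u)) * edge (fst w) (snd w)) = of_real (2 * pi * sqrt (2 * pi) * hermite_density L u)"
proof -
  obtain L0 where L0: "corr = bipoly_it L0" using is_bipoly_it_corr(3) by (auto simp: is_bipoly_it_def)
  define L where "L = hermite_mean L0"
  define g where "g = (\<Sum>(a, j)\<leftarrow>L. a * 0 ^ j) - 1"
  have avg: "gauss_avg corr t = real_poly_it L t" for t unfolding L0 L_def by (rule gauss_avg_bipoly_it)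
  have g: "gauss_avg corr 0 = of_real (1 + g)" unfolding avg real_poly_it_0 by (simp add: g_def)
  show ?thesis
  proof (rule that)
    show "W5 n N p t = real_poly_it ((- g, 0) # L) t" for t
      unfolding W5_eq g by (simp add: avg real_poly_it_def)
    show "(CLINT w | lborel \<Otimes>\<^sub>M lborel. iexp (- (fst w * u)) * edge (fst w) (snd w)) = of_real (2 * pi * sqrt (2 * pi) * hermite_density L u)" for u
      using plane_integral_bipoly_it[of u L0] integrable_edge_plane[of u] by (simp add: edge_corr L0 L_def)
  qed (rule g)
qed

lemma density_near_normal:
  assumes "\<And>u. (CLINT w | lborel \<Otimes>\<^sub>M lborel. iexp (- (fst w * u)) * edge (fst w) (snd w)) = of_real (2 * pi * sqrt (2 * pi) * hermite_density L u)"
  shows "\<bar>hermite_density L u - std_normal_density u\<bar> \<le> C2 * (1 / sqrt K + 1 / K) * gauss_plane_mass"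
proof (rule le_mult_big[OF _ two_pi_bounds(2)])
  let ?G = "\<lambda>w::real \<times> real. complex_of_real (exp (- ((fst w)\<^sup>2 + (snd w)\<^sup>2) / 2))"
  have int: "complex_integrable (lborel \<Otimes>\<^sub>M lborel) (\<lambda>w. iexp (- (fst w * u)) * ?G w)"
  proof (rule Bochner_Integration.integrable_bound[OF integrable_gauss_eighth_plane _ AE_I2])
    fix w :: "real \<times> real"
    show "norm (iexp (- (fst w * u)) * ?G w) \<le> norm (exp (- ((fst w)\<^sup>2 + (snd w)\<^sup>2) / 8))"
      using exp_le_eighth[of "1 / 2" "fst w" "snd w"] by (simp add: norm_mult)
  qed measurable
  have G: "(CLINT w | lborel \<Otimes>\<^sub>M lborel. iexp (- (fst w * u)) * ?G w) = of_real (2 * pi * sqrt (2 * pi) * std_normal_density u)"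
    using plane_integral_bipoly_it[of u "[(1, 0, 0)]"] int by (simp add: bipoly_it_def hermite_mean_def hermite_density_def)
  have "norm (complex_of_real (2 * pi * sqrt (2 * pi) * hermite_density L u) - of_real (2 * pi * sqrt (2 * pi) * std_normal_density u))
    \<le> C2 * (1 / sqrt K + 1 / K) * gauss_plane_mass"
    unfolding assms[symmetric] G[symmetric]
  proof (rule norm_has_bochner_integral_le[OF has_bochner_integral_diff[OF
      has_bochner_integral_integrable[OF integrable_edge_plane] has_bochner_integral_integrable[OF int]] has_gauss_plane_mass])
    fix w :: "real \<times> real"
    have "norm (iexp (- (fst w * u)) * edge (fst w) (snd w) - iexp (- (fst w * u)) * ?G w) = norm (edge (fst w) (snd w) - ?G w)"
      by (simp only: right_diff_distrib[symmetric] norm_mult) simp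
    also have "\<dots> \<le> C2 * (1 / sqrt K + 1 / K) * exp (- ((fst w)\<^sup>2 + (snd w)\<^sup>2) / 8)"
      by (rule order_trans[OF edge_minus_gauss mult_left_mono[OF exp_quarter_le_eighth]]) (use C2 K in auto)
    finally show "norm (iexp (- (fst w * u)) * edge (fst w) (snd w) - iexp (- (fst w * u)) * ?G w)
       \<le> C2 * (1 / sqrt K + 1 / K) * exp (- ((fst w)\<^sup>2 + (snd w)\<^sup>2) / 8)" .
  qed
  thus "\<bar>2 * pi * sqrt (2 * pi) * (hermite_density L u - std_normal_density u)\<bar> \<le> C2 * (1 / sqrt K + 1 / K) * gauss_plane_mass"
    by (simp only: of_real_diff[symmetric] norm_of_real right_diff_distrib)
qed

lemma integral_edge_line:
  assumes "gauss_avg corr 0 = of_real (1 + g)"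
  shows "(CLBINT s. edge 0 s) = of_real (sqrt (2 * pi) * (1 + g))"
  using gauss_avg_line[of 0 corr] assms by (simp add: edge_corr)

text \<open>The integral is real, so only the real part of the integrand counts, and this deviates
  from the Gaussian by order 1 / K instead of K^(-1/2).\<close>

lemma normalisation_bound:
  assumes "gauss_avg corr 0 = of_real (1 + g)"
  shows "\<bar>g\<bar> \<le> C2 * (1 / K) * gauss_line_mass"
proof (rule le_mult_big[OF _ two_pi_bounds(1)])
  have int: "complex_integrable lborel (\<lambda>s. complex_of_real (exp (- s\<^sup>2 / 2)))"
    using integrable_gauss_phase[of 0 1] by (simp add: gauss_phase_def[abs_def])
  have G: "(CLBINT s. complex_of_real (exp (- s\<^sup>2 / 2))) = of_real (sqrt (2 * pi))"
    using gauss_avg_line[of 0 "\<lambda>t s. 1"] by (simp add: gauss_avg_1)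
  have "has_bochner_integral lborel (\<lambda>s. edge 0 s - of_real (exp (- s\<^sup>2 / 2)))
     ((CLBINT s. edge 0 s) - (CLBINT s. complex_of_real (exp (- s\<^sup>2 / 2))))"
    by (intro has_bochner_integral_diff has_bochner_integral_integrable integrable_edge_line int)
  hence "has_bochner_integral lborel (\<lambda>s. edge 0 s - of_real (exp (- s\<^sup>2 / 2))) (of_real (sqrt (2 * pi) * g))"
    unfolding G integral_edge_line[OF assms] by (simp add: distrib_left)
  from has_bochner_integral_bounded_linear[OF bounded_linear_Re this]
  have R: "has_bochner_integral lborel (\<lambda>s. Re (edge 0 s - of_real (exp (- s\<^sup>2 / 2)))) (sqrt (2 * pi) * g)"
    by (simp only: Re_complex_of_real)
  have "norm (sqrt (2 * pi) * g) \<le> C2 * (1 / K) * gauss_line_mass"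
  proof (rule norm_has_bochner_integral_le[OF R has_gauss_line_mass])
    fix s :: real
    have "\<bar>Re (edge 0 s) - exp (- (0\<^sup>2 + s\<^sup>2) / 2)\<bar> \<le> C2 * (1 / K) * exp (- (0\<^sup>2 + s\<^sup>2) / 8)"
      by (rule order_trans[OF Re_edge_minus_gauss mult_left_mono[OF exp_quarter_le_eighth]]) (use C2 K in auto)
    thus "norm (Re (edge 0 s - of_real (exp (- s\<^sup>2 / 2)))) \<le> C2 * (1 / K) * exp (- s\<^sup>2 / 8)" by simp
  qed
  thus "\<bar>sqrt (2 * pi) * g\<bar> \<le> C2 * (1 / K) * gauss_line_mass" by simp
qed

text \<open>The expansion error plus the exponentially small part weighted by the size of the
  integration domain; the product of the two brackets covers both the area of the box and the length
  of the line.\<close>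

definition "tot = 1 / (K * sqrt K) + (1 + sqrt n) * (1 + \<sigma>) * exp (- q0 * \<kappa>)"

lemma tot_ge: "1 / (K * sqrt K) \<le> tot" "err \<le> tot" "\<sigma> * sqrt n * exp (- q0 * \<kappa>) \<le> tot" "sqrt n * exp (- q0 * \<kappa>) \<le> tot" "0 < tot"
proof -
  have "1 + \<sigma> * sqrt n + sqrt n \<le> (1 + sqrt n) * (1 + \<sigma>)" using \<sigma>_pos by (simp add: algebra_simps)
  hence A: "(1 + \<sigma> * sqrt n + sqrt n) * exp (- q0 * \<kappa>) \<le> (1 + sqrt n) * (1 + \<sigma>) * exp (- q0 * \<kappa>)"
    by (rule mult_right_mono) simp
  have B: "0 < 1 / (K * sqrt K)" "0 < exp (- q0 * \<kappa>)" "0 \<le> \<sigma> * sqrt n * exp (- q0 * \<kappa>)" "0 \<le> sqrt n * exp (- q0 * \<kappa>)"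
    using K \<sigma>_pos by auto
  note A = A[unfolded distrib_right mult_1]
  show "1 / (K * sqrt K) \<le> tot" "err \<le> tot" "\<sigma> * sqrt n * exp (- q0 * \<kappa>) \<le> tot" "sqrt n * exp (- q0 * \<kappa>) \<le> tot" "0 < tot"
    using A B unfolding tot_def distrib_right mult_1 by linarith+
qed

definition "A1 = C3 * gauss_plane_mass + 2 * pi\<^sup>2"
definition "A2 = C3 * gauss_line_mass + 2 * pi"
definition "A3 = C2 * gauss_line_mass"
definition "A4 = 2 * C2 * gauss_plane_mass"

lemma A_nonneg: "0 \<le> A1" "0 \<le> A2" "0 \<le> A3" "0 \<le> A4"
  using C2 C3 gauss_mass_nonneg by (auto simp: A1_def A2_def A3_def A4_def)

definition "C5 = 2 * A1 + 2 * A4 * (A2 + A3) + 2 * (A2 * (1 + A3) + A3\<^sup>2)"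

lemma C5: "0 \<le> C5" using A_nonneg by (simp add: C5_def)

text \<open>Let X be the scaled probability, q the denominator, e the Hermite density and \<phi> the
  normal one. Inversion gives q X = e up to the error. Since q is 1 + g up to the error, g is of
  order 1 / K and e - \<phi> of order K^(-1/2), the quotient e / q is e - g \<phi> up to order
  K^(-3/2). The factors 2 in \<open>C5\<close> bound 1 / q.\<close>

lemma local_limit_large:
  assumes K1: "K \<ge> 1"
  shows "\<bar>\<sigma> / 2 * measure_pmf.prob (multinomial_pmf n N p) {\<eta>. (\<Sum>m=1..N. (\<eta> m)\<^sup>2) = n + 2 * k}
     - deriv (WW5 n N p) ((real (n + 2 * k) - Lambda n N p) / \<sigma>)\<bar> \<le> C5 * tot"
proof -
  define u where "u = (real (n + 2 * k) - Lambda n N p) / \<sigma>"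
  define X where "X = \<sigma> / 2 * measure_pmf.prob (multinomial_pmf n N p) {\<eta>. (\<Sum>m=1..N. (\<eta> m)\<^sup>2) = n + 2 * k}"
  define q where "q = stirling_ratio n"
  define \<phi> where "\<phi> = std_normal_density u"
  obtain L g where L: "\<And>t. W5 n N p t = real_poly_it ((- g, 0) # L) t"
    "gauss_avg corr 0 = of_real (1 + g)"
    "\<And>u. (CLINT w | lborel \<Otimes>\<^sub>M lborel. iexp (- (fst w * u)) * edge (fst w) (snd w)) = of_real (2 * pi * sqrt (2 * pi) * hermite_density L u)"
    by (rule obtain_density) blast
  define e where "e = hermite_density L u"
  have f: "deriv (WW5 n N p) u = e - g * \<phi>"
    unfolding deriv_WW5[OF L(1)] by (simp add: hermite_density_def e_def \<phi>_def algebra_simps)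
  have q: "1 / 2 \<le> q" unfolding q_def using n by (rule stirling_ratio_ge)
  have qX: "\<bar>q * X - e\<bar> \<le> A1 * tot"
  proof -
    have "of_real (2 * pi * sqrt (2 * pi) * q * X) = (CLINT w | lborel \<Otimes>\<^sub>M lborel. indicator (inversion_box n N p) w *\<^sub>R
       (iexp (- (fst w * u)) * joint_cf n N p (fst w / \<sigma>) (snd w / sqrt n)))"
      unfolding q_def X_def u_def by (rule multinomial_inversion) (use n p_pos p_sum \<sigma>_pos in auto)
    with plane_error[OF K1, of u] L(3)[of u, folded e_def]
    have "norm (complex_of_real (2 * pi * sqrt (2 * pi) * q * X) - of_real (2 * pi * sqrt (2 * pi) * e))
      \<le> C3 * err * gauss_plane_mass + pi * \<sigma> * (2 * pi * sqrt n) * exp (- q0 * \<kappa>)" by simp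
    hence "\<bar>2 * pi * sqrt (2 * pi) * (q * X - e)\<bar> \<le> C3 * err * gauss_plane_mass + pi * \<sigma> * (2 * pi * sqrt n) * exp (- q0 * \<kappa>)"
      by (simp only: of_real_diff[symmetric] norm_of_real right_diff_distrib mult.assoc)
    hence "\<bar>q * X - e\<bar> \<le> C3 * err * gauss_plane_mass + pi * \<sigma> * (2 * pi * sqrt n) * exp (- q0 * \<kappa>)"
      by (rule le_mult_big[OF _ two_pi_bounds(2)])
    also have "\<dots> = (C3 * gauss_plane_mass) * err + (2 * pi\<^sup>2) * (\<sigma> * sqrt n * exp (- q0 * \<kappa>))"
      by (simp only: power2_eq_square mult_ac)
    also have "\<dots> \<le> (C3 * gauss_plane_mass) * tot + (2 * pi\<^sup>2) * tot"
      by (rule add_mono[OF mult_left_mono[OF tot_ge(2)] mult_left_mono[OF tot_ge(3)]]) (use C3 gauss_mass_nonneg in auto)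
    finally show ?thesis by (simp add: A1_def distrib_right)
  qed
  have rho: "\<bar>q - 1 - g\<bar> \<le> A2 * tot"
  proof -
    have "norm (complex_of_real (sqrt (2 * pi) * q) - of_real (sqrt (2 * pi) * (1 + g)))
      \<le> C3 * err * gauss_line_mass + 2 * pi * sqrt n * exp (- q0 * \<kappa>)"
      using line_error[OF K1] unfolding integral_edge_line[OF L(2)] q_def .
    hence "\<bar>sqrt (2 * pi) * (q - (1 + g))\<bar> \<le> C3 * err * gauss_line_mass + 2 * pi * sqrt n * exp (- q0 * \<kappa>)"
      by (simp only: of_real_diff[symmetric] norm_of_real right_diff_distrib)
    hence "\<bar>q - (1 + g)\<bar> \<le> C3 * err * gauss_line_mass + 2 * pi * sqrt n * exp (- q0 * \<kappa>)"
      by (rule le_mult_big[OF _ two_pi_bounds(1)])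
    also have "\<dots> = (C3 * gauss_line_mass) * err + (2 * pi) * (sqrt n * exp (- q0 * \<kappa>))"
      by (simp only: mult_ac)
    also have "\<dots> \<le> (C3 * gauss_line_mass) * tot + (2 * pi) * tot"
      by (rule add_mono[OF mult_left_mono[OF tot_ge(2)] mult_left_mono[OF tot_ge(4)]]) (use C3 gauss_mass_nonneg in auto)
    finally show ?thesis by (simp add: A2_def distrib_right)
  qed
  have g: "\<bar>g\<bar> \<le> A3 * (1 / K)" using normalisation_bound[OF L(2)] by (simp add: A3_def)
  have sK: "1 \<le> sqrt K" "sqrt K \<le> K" using K1 by (auto intro!: real_le_lsqrt simp: power2_eq_square mult_le_cancel_left1)
  have K1': "1 / K \<le> 1" "1 / K \<le> 1 / sqrt K" using K1 sK by (auto simp: frac_le)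
  have g1: "\<bar>g\<bar> \<le> A3" using g mult_left_mono[OF K1'(1) A_nonneg(3)] by simp
  have ephi: "\<bar>e - \<phi>\<bar> \<le> A4 * (1 / sqrt K)"
  proof -
    have "\<bar>e - \<phi>\<bar> \<le> (C2 * gauss_plane_mass) * (1 / sqrt K + 1 / K)"
      using density_near_normal[OF L(3), of u] by (simp add: e_def \<phi>_def mult_ac)
    also have "\<dots> \<le> (C2 * gauss_plane_mass) * (2 * (1 / sqrt K))"
      by (rule mult_left_mono) (use K1' C2 gauss_mass_nonneg in auto)
    finally show ?thesis by (simp add: A4_def mult_ac)
  qed
  have s1: "1 / sqrt K \<le> 1" using sK by simp
  have t2: "\<bar>(e - \<phi>) * (1 - q)\<bar> \<le> A4 * (A2 + A3) * tot"
  proof -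
    have "\<bar>1 - q\<bar> \<le> A2 * tot + A3 * (1 / K)" using rho g by linarith
    hence "\<bar>(e - \<phi>) * (1 - q)\<bar> \<le> (A4 * (1 / sqrt K)) * (A2 * tot + A3 * (1 / K))"
      unfolding abs_mult by (rule mult_mono[OF ephi]) (use A_nonneg K in auto)
    also have "\<dots> = A4 * (A2 * ((1 / sqrt K) * tot) + A3 * (1 / (K * sqrt K)))"
      by (simp add: distrib_left add_divide_distrib mult_ac)
    also have "\<dots> \<le> A4 * (A2 * tot + A3 * tot)"
      by (rule mult_left_mono[OF add_mono[OF mult_left_mono mult_left_mono[OF tot_ge(1)]] A_nonneg(4)])
        (use A_nonneg mult_right_mono[OF s1, of tot] tot_ge(5) in auto)
    finally show ?thesis by (simp add: algebra_simps)
  qed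
  have t3: "\<bar>\<phi> * (1 - q + g * q)\<bar> \<le> (A2 * (1 + A3) + A3\<^sup>2) * tot"
  proof -
    have "1 - q + g * q = g\<^sup>2 - (q - 1 - g) * (1 - g)" by (simp add: power2_eq_square algebra_simps)
    hence "\<bar>1 - q + g * q\<bar> \<le> g\<^sup>2 + \<bar>q - 1 - g\<bar> * \<bar>1 - g\<bar>"
      using abs_triangle_ineq4[of "g\<^sup>2" "(q - 1 - g) * (1 - g)"] by (simp add: abs_mult)
    also have "\<dots> \<le> A3\<^sup>2 * tot + (A2 * tot) * (1 + A3)"
    proof (rule add_mono)
      have "\<bar>g\<bar>\<^sup>2 \<le> (A3 * (1 / K))\<^sup>2" by (intro power_mono g) auto
      also have "\<dots> = A3\<^sup>2 * (1 / K * (1 / K))" by (simp only: power2_eq_square mult_ac)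
      also have "\<dots> \<le> A3\<^sup>2 * (1 / K * (1 / sqrt K))" using K1' K by (intro mult_left_mono) auto
      also have "\<dots> = A3\<^sup>2 * (1 / (K * sqrt K))" by simp
      also have "\<dots> \<le> A3\<^sup>2 * tot" by (intro mult_left_mono tot_ge) auto
      finally show "g\<^sup>2 \<le> A3\<^sup>2 * tot" by simp
      have "\<bar>1 - g\<bar> \<le> 1 + A3" using g1 by linarith
      thus "\<bar>q - 1 - g\<bar> * \<bar>1 - g\<bar> \<le> (A2 * tot) * (1 + A3)"
        by (rule mult_mono[OF rho]) (use A_nonneg tot_ge(5) in auto)
    qed
    finally have "\<bar>1 - q + g * q\<bar> \<le> (A2 * (1 + A3) + A3\<^sup>2) * tot" by (simp add: algebra_simps)
    hence "\<bar>\<phi>\<bar> * \<bar>1 - q + g * q\<bar> \<le> 1 * ((A2 * (1 + A3) + A3\<^sup>2) * tot)"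
      by (rule mult_mono[rotated]) (use std_normal_density_le_1[of u] in \<open>auto simp: \<phi>_def\<close>)
    thus ?thesis by (simp add: abs_mult)
  qed
  \<comment> \<open>The factor \<open>1 - q + g * q\<close> is quadratically small in \<open>g\<close>, since \<open>q\<close> is close to \<open>1 + g\<close>.\<close>
  define Y where "Y = (q * X - e) + (e - \<phi>) * (1 - q) + \<phi> * (1 - q + g * q)"
  have "Y = q * (X - (e - g * \<phi>))" by (simp add: Y_def algebra_simps)
  hence "q * \<bar>X - (e - g * \<phi>)\<bar> = \<bar>Y\<bar>" using q by (simp add: abs_mult)
  hence "1 / 2 * \<bar>X - (e - g * \<phi>)\<bar> \<le> \<bar>Y\<bar>" using mult_right_mono[OF q, of "\<bar>X - (e - g * \<phi>)\<bar>"] by simp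
  also have "\<dots> \<le> A1 * tot + A4 * (A2 + A3) * tot + (A2 * (1 + A3) + A3\<^sup>2) * tot"
    unfolding Y_def by (rule order_trans[OF abs_triangle_ineq add_mono[OF order_trans[OF abs_triangle_ineq add_mono[OF qX t2]] t3]])
  finally have "\<bar>X - (e - g * \<phi>)\<bar> \<le> C5 * tot" by (simp add: C5_def algebra_simps)
  thus ?thesis unfolding f[symmetric] X_def u_def .
qed

definition "C7 = 3 * c2\<^sup>2 + 1 + 2 * C2 * gauss_plane_mass + C2 * gauss_line_mass"

lemma C7: "0 \<le> C7" using C2 gauss_mass_nonneg by (simp add: C7_def)

text \<open>For K < 1 no expansion is involved: \<lambda> is below 1, \<sigma> is at most a constant
  times sqrt K, and every term is at most a constant times K^(-3/2).\<close>

lemma local_limit_small: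
  assumes K1: "K < 1"
  shows "\<bar>\<sigma> / 2 * measure_pmf.prob (multinomial_pmf n N p) {\<eta>. (\<Sum>m=1..N. (\<eta> m)\<^sup>2) = b}
     - deriv (WW5 n N p) u\<bar> \<le> C7 * (1 / (K * sqrt K))"
proof -
  obtain L g where L: "\<And>t. W5 n N p t = real_poly_it ((- g, 0) # L) t"
    "gauss_avg corr 0 = of_real (1 + g)"
    "\<And>u. (CLINT w | lborel \<Otimes>\<^sub>M lborel. iexp (- (fst w * u)) * edge (fst w) (snd w)) = of_real (2 * pi * sqrt (2 * pi) * hermite_density L u)"
    by (rule obtain_density) blast
  define \<phi> where "\<phi> = std_normal_density u"
  define e where "e = hermite_density L u"
  define R where "R = 1 / (K * sqrt K)"
  have f: "deriv (WW5 n N p) u = e - g * \<phi>"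
    unfolding deriv_WW5[OF L(1)] by (simp add: hermite_density_def e_def \<phi>_def algebra_simps)
  have sK: "0 < sqrt K" "sqrt K \<le> 1" using K K1 by auto
  have R: "1 \<le> R" "1 / K \<le> R" "1 / sqrt K \<le> R"
    using mult_mono[of K 1 "sqrt K" 1] mult_left_le[of "sqrt K" K] mult_right_mono[of K 1 "sqrt K"] sK K K1
    by (auto simp: R_def divide_left_mono)
  have l1: "l < 1"
  proof (rule ccontr)
    assume "\<not> l < 1"
    hence "K = real N" by (simp add: K_def mt_def)
    thus False using K1 N by simp
  qed
  have sq: "sqrt K = sqrt N * l" using l l1 by (simp add: K_def mt_def real_sqrt_mult)
  have "\<sigma> \<le> 3 * c2\<^sup>2 * sqrt K" using \<sigma>_le l1 by (simp add: sq M_def)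
  also have "\<dots> \<le> 3 * c2\<^sup>2 * 1" using sK by (intro mult_left_mono) auto
  finally have \<sigma>1: "\<sigma> / 2 * 1 \<le> 3 * c2\<^sup>2" using \<sigma>_pos by simp
  have "\<sigma> / 2 * measure_pmf.prob (multinomial_pmf n N p) {\<eta>. (\<Sum>m=1..N. (\<eta> m)\<^sup>2) = b} \<le> \<sigma> / 2 * 1"
    using \<sigma>_pos by (intro mult_left_mono) auto
  from order_trans[OF this \<sigma>1] have X: "\<bar>\<sigma> / 2 * measure_pmf.prob (multinomial_pmf n N p) {\<eta>. (\<Sum>m=1..N. (\<eta> m)\<^sup>2) = b}\<bar> \<le> 3 * c2\<^sup>2"
    by (subst abs_of_nonneg) (use \<sigma>_pos in auto)
  have e: "\<bar>e - \<phi>\<bar> \<le> 2 * C2 * gauss_plane_mass * R"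
  proof -
    have "\<bar>e - \<phi>\<bar> \<le> C2 * gauss_plane_mass * (1 / sqrt K + 1 / K)"
      using density_near_normal[OF L(3), of u] by (simp add: e_def \<phi>_def mult_ac)
    also have "\<dots> \<le> C2 * gauss_plane_mass * (R + R)"
      by (rule mult_left_mono[OF add_mono[OF R(3,2)]]) (use C2 gauss_mass_nonneg in auto)
    finally show ?thesis by simp
  qed
  have g: "\<bar>g\<bar> \<le> C2 * gauss_line_mass * R"
  proof -
    have "\<bar>g\<bar> \<le> C2 * gauss_line_mass * (1 / K)" using normalisation_bound[OF L(2)] by simp
    also have "\<dots> \<le> C2 * gauss_line_mass * R" by (rule mult_left_mono[OF R(2)]) (use C2 gauss_mass_nonneg in auto)
    finally show ?thesis .
  qed
  have p1: "0 \<le> \<phi>" "\<phi> \<le> 1" unfolding \<phi>_def by (rule std_normal_density_le_1)+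
  have "\<bar>g * \<phi>\<bar> \<le> \<bar>g\<bar>" using p1 by (simp add: abs_mult mult_left_le)
  moreover have "3 * c2\<^sup>2 + 1 \<le> (3 * c2\<^sup>2 + 1) * R" using mult_left_mono[OF R(1), of "3 * c2\<^sup>2 + 1"] by simp
  ultimately have "\<bar>\<sigma> / 2 * measure_pmf.prob (multinomial_pmf n N p) {\<eta>. (\<Sum>m=1..N. (\<eta> m)\<^sup>2) = b} - (e - g * \<phi>)\<bar>
     \<le> (3 * c2\<^sup>2 + 1) * R + 2 * C2 * gauss_plane_mass * R + C2 * gauss_line_mass * R"
    by (intro trivial_estimate[OF X e order_trans[OF _ g] p1])
  thus ?thesis unfolding f by (simp add: C7_def R_def algebra_simps)
qed

section \<open>The error in terms of n, N and \<lambda>\<close>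

definition "bound = 1 / real N powr (3 / 2) + 1 / (real n * l powr (3 / 2))
   + real n * l * exp (- (q0 * real N / (l * max 1 l)))"

lemma bound_terms_nonneg: "0 \<le> 1 / real N powr (3 / 2)" "0 \<le> 1 / (real n * l powr (3 / 2))"
  "0 \<le> real n * l * exp (- (q0 * real N / (l * max 1 l)))"
  using l by auto

text \<open>The second term of the bound exceeds K^(-3/2) by the factor sqrt n; this slack pays for
  the sqrt n contained in \<open>tot\<close>.\<close>

lemma sparse_regime:
  assumes "l \<le> 1"
  shows "K = real n * l" "1 / (real n * l powr (3 / 2)) = sqrt n * (1 / (K * sqrt K))" "1 / (K * sqrt K) \<le> bound"
proof -
  show K1: "K = real n * l" using assms by (simp add: K_def mt_def nl power2_eq_square)
  have "K * sqrt K = sqrt n * (real n * (l * sqrt l))" by (simp add: K1 real_sqrt_mult)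
  thus R: "1 / (real n * l powr (3 / 2)) = sqrt n * (1 / (K * sqrt K))"
    using n l by (simp add: powr_three_halves)
  have "1 * (1 / (K * sqrt K)) \<le> sqrt n * (1 / (K * sqrt K))" using n K by (intro mult_right_mono) auto
  thus "1 / (K * sqrt K) \<le> bound" using R bound_terms_nonneg unfolding bound_def by linarith
qed

definition "C6 = 1 + 2 * (1 + 3 * c2\<^sup>2) + 4 * (1 + 3 * c2\<^sup>2) / q0\<^sup>2"

lemma C6: "0 \<le> C6" by (simp add: C6_def)

text \<open>For \<lambda> > 1, \<kappa> is N / \<lambda>^2 and sqrt n \<sigma> is of order n
  \<lambda>, which gives the third term of the bound. For \<lambda> \<le> 1, \<kappa> is K and the
  exponential is replaced by a negative power of K, which the second term absorbs.\<close>

lemma tot_le_bound: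
  assumes K1: "K \<ge> 1"
  shows "tot \<le> C6 * bound"
proof (cases "l \<le> 1")
  case True
  note S = sparse_regime[OF True]
  define R where "R = 1 / (real n * l powr (3 / 2))"
  have R: "R = sqrt n * (1 / (K * sqrt K))" unfolding R_def by (rule S(2))
  have Rb: "0 \<le> R" "R \<le> bound" using bound_terms_nonneg by (simp_all add: R_def bound_def)
  have kK: "\<kappa> = K" using True by (simp add: \<kappa>_def M_def)
  have sn: "1 \<le> sqrt n" "1 \<le> sqrt K" using n K1 by auto
  have sq: "sqrt K = sqrt N * l" using l True by (simp add: K_def mt_def real_sqrt_mult)
  have "\<sigma> \<le> 3 * c2\<^sup>2 * sqrt K" using \<sigma>_le True by (simp add: sq M_def)
  hence "1 + \<sigma> \<le> (1 + 3 * c2\<^sup>2) * sqrt K" unfolding distrib_right mult_1 using sn by linarith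
  moreover have "1 + sqrt n \<le> 2 * sqrt n" using sn by simp
  ultimately have "(1 + sqrt n) * (1 + \<sigma>) \<le> (2 * sqrt n) * ((1 + 3 * c2\<^sup>2) * sqrt K)"
    using \<sigma>_pos by (intro mult_mono) auto
  hence "(1 + sqrt n) * (1 + \<sigma>) * exp (- q0 * K) \<le> (2 * sqrt n) * ((1 + 3 * c2\<^sup>2) * sqrt K) * (2 / (q0 * K)\<^sup>2)"
  proof (rule mult_mono)
    \<comment> \<open>The exponent 2 is chosen so that the prefactor sqrt n sqrt K turns into sqrt n
      K^(-3/2), which is exactly the second term.\<close>
    have "(q0 * K)\<^sup>2 \<le> 2 * exp (q0 * K)" using power_le_exp[of "q0 * K" 2] q0 K by (simp add: fact_numeral)
    thus "exp (- q0 * K) \<le> 2 / (q0 * K)\<^sup>2" using q0 K by (simp add: exp_minus field_simps)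
  qed (use \<sigma>_pos K in auto)
  also have "\<dots> = 4 * (1 + 3 * c2\<^sup>2) / q0\<^sup>2 * (sqrt n * (sqrt K / K\<^sup>2))" by (simp add: power_mult_distrib field_simps)
  also have "sqrt K / K\<^sup>2 = 1 / (K * sqrt K)" using K by (simp add: field_simps power2_eq_square)
  finally have "(1 + sqrt n) * (1 + \<sigma>) * exp (- q0 * K) \<le> 4 * (1 + 3 * c2\<^sup>2) / q0\<^sup>2 * bound"
    unfolding R[symmetric] by (rule order_trans[OF _ mult_left_mono[OF Rb(2)]]) simp
  moreover have "0 \<le> (2 * (1 + 3 * c2\<^sup>2)) * bound" using Rb by (intro mult_nonneg_nonneg) auto
  ultimately show ?thesis using S(3) unfolding tot_def kK C6_def distrib_right mult_1 by linarith
next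
  case False
  hence kN: "K = real N" "\<kappa> = real N / l\<^sup>2" "M = l" "max 1 l = l" by (auto simp: K_def mt_def \<kappa>_def M_def)
  define V where "V = real n * l * exp (- (q0 * real N / (l * max 1 l)))"
  have V: "V = real n * l * exp (- q0 * \<kappa>)" by (simp add: V_def kN power2_eq_square)
  have Vb: "0 \<le> V" "1 / (K * sqrt K) \<le> bound" "V \<le> bound" "0 \<le> bound"
    using bound_terms_nonneg N by (simp_all add: V_def bound_def kN(1) powr_three_halves)
  have sn: "1 \<le> sqrt n" using n by simp
  have "\<sigma> \<le> 3 * c2\<^sup>2 * (sqrt n * l)" using \<sigma>_le by (simp add: kN(3) nl real_sqrt_mult mult_ac)
  moreover have "1 * 1 \<le> sqrt n * l" using sn False by (intro mult_mono) auto
  ultimately have "1 + \<sigma> \<le> (1 + 3 * c2\<^sup>2) * (sqrt n * l)" by (simp add: distrib_right)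
  moreover have "1 + sqrt n \<le> 2 * sqrt n" using sn by simp
  ultimately have "(1 + sqrt n) * (1 + \<sigma>) \<le> (2 * sqrt n) * ((1 + 3 * c2\<^sup>2) * (sqrt n * l))"
    using \<sigma>_pos by (intro mult_mono) auto
  also have "\<dots> = 2 * (1 + 3 * c2\<^sup>2) * ((sqrt n * sqrt n) * l)" by (simp only: mult_ac)
  also have "sqrt n * sqrt n = real n" by simp
  finally have "(1 + sqrt n) * (1 + \<sigma>) * exp (- q0 * \<kappa>) \<le> 2 * (1 + 3 * c2\<^sup>2) * (real n * l) * exp (- q0 * \<kappa>)"
    by (rule mult_right_mono) simp
  also have "\<dots> = 2 * (1 + 3 * c2\<^sup>2) * V" by (simp add: V mult_ac)
  also have "\<dots> \<le> 2 * (1 + 3 * c2\<^sup>2) * bound" using Vb by (intro mult_left_mono) auto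
  finally have "(1 + sqrt n) * (1 + \<sigma>) * exp (- q0 * \<kappa>) \<le> 2 * (1 + 3 * c2\<^sup>2) * bound" .
  moreover have "0 \<le> 4 * (1 + 3 * c2\<^sup>2) / q0\<^sup>2 * bound" using Vb by (intro mult_nonneg_nonneg) auto
  ultimately show ?thesis using Vb(2) unfolding tot_def C6_def distrib_right mult_1 by linarith
qed

text \<open>The summand 1 makes the constant strictly positive.\<close>

definition "C8 = C5 * C6 + C7 + 1"

lemma local_limit:
  "\<bar>\<sigma> / 2 * measure_pmf.prob (multinomial_pmf n N p) {\<eta>. (\<Sum>m=1..N. (\<eta> m)\<^sup>2) = n + 2 * k}
     - deriv (WW5 n N p) ((real (n + 2 * k) - Lambda n N p) / \<sigma>)\<bar> \<le> C8 * bound" (is "?E \<le> _")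
proof -
  have b0: "0 \<le> bound" using bound_terms_nonneg by (simp add: bound_def)
  show ?thesis
  proof (cases "K \<ge> 1")
    case True
    have "?E \<le> C5 * (C6 * bound)"
      by (rule order_trans[OF local_limit_large[OF True] mult_left_mono[OF tot_le_bound[OF True] C5]])
    also have "\<dots> \<le> C8 * bound"
      unfolding mult.assoc[symmetric] C8_def using b0 C7 by (intro mult_right_mono) auto
    finally show ?thesis .
  next
    case False
    hence K1: "K < 1" by simp
    have "l \<le> 1"
    proof (rule ccontr)
      assume "\<not> l \<le> 1"
      hence "K = real N" by (simp add: K_def mt_def)
      thus False using K1 N by simp
    qed
    have "?E \<le> C7 * bound"
      by (rule order_trans[OF local_limit_small[OF K1] mult_left_mono[OF sparse_regime(3)[OF \<open>l \<le> 1\<close>] C7]])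
    also have "\<dots> \<le> C8 * bound"
      unfolding C8_def using b0 C5 C6 by (intro mult_right_mono) auto
    finally show ?thesis .
  qed
qed

end

theorem corollary4p1:
  fixes c1 c2 :: real
  assumes "c1 > 0" and "c2 > 0"
  shows "\<exists>c>0. \<exists>C>0. \<forall>(N :: nat \<Rightarrow> nat) (p :: nat \<Rightarrow> nat \<Rightarrow> real).
    filterlim N at_top sequentially \<longrightarrow>
    (\<forall>n\<ge>1. (\<forall>m\<in>{1..N n}. p n m > 0) \<and> (\<Sum>m=1..N n. p n m) = 1) \<longrightarrow>
    (\<lambda>n. Max (p n ` {1..N n})) \<longlonglongrightarrow> 0 \<longrightarrow>
    (\<forall>n\<ge>1. \<forall>m\<in>{1..N n}. c1 \<le> real (N n) * p n m \<and> real (N n) * p n m \<le> c2) \<longrightarrow>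
    (\<forall>n\<ge>1. \<forall>b\<in>{n + 2 * k | k. k \<le> (n * (n - 1)) div 2}.
      \<bar>sigma_N n (N n) (p n) / 2 *
          measure_pmf.prob (multinomial_pmf n (N n) (p n)) {\<eta>. (\<Sum>m=1..N n. (\<eta> m)\<^sup>2) = b}
        - deriv (WW5 n (N n) (p n)) ((real b - Lambda n (N n) (p n)) / sigma_N n (N n) (p n))\<bar>
      \<le> C * (1 / real (N n) powr (3 / 2)
            + 1 / (real n * lam n (N n) powr (3 / 2))
            + real n * lam n (N n) *
                exp (- (c * real (N n) / (lam n (N n) * max 1 (lam n (N n)))))))"
proof -
  \<comment> \<open>\<open>cells.q0\<close> and \<open>cells.C8\<close> take c1 and c2 as their only
    arguments, so the witnesses are fixed before n, N and p. Their positivity is proved inside the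
    locale; the default 1 keeps the witnesses positive even when no admissible cells exist.\<close>
  define c where "c = (if cells.q0 c1 c2 > 0 then cells.q0 c1 c2 else 1)"
  define C where "C = (if cells.C8 c1 c2 > 0 then cells.C8 c1 c2 else 1)"
  show ?thesis
  proof (rule exI[of _ c], rule conjI, simp add: c_def, rule exI[of _ C], rule conjI, simp add: C_def, intro allI impI ballI)
    fix N :: "nat \<Rightarrow> nat" and p :: "nat \<Rightarrow> nat \<Rightarrow> real" and n b :: nat
    assume p: "\<forall>n\<ge>1. (\<forall>m\<in>{1..N n}. p n m > 0) \<and> (\<Sum>m=1..N n. p n m) = 1"
      and np: "\<forall>n\<ge>1. \<forall>m\<in>{1..N n}. c1 \<le> real (N n) * p n m \<and> real (N n) * p n m \<le> c2"
      and n: "1 \<le> n" and b: "b \<in> {n + 2 * k | k. k \<le> (n * (n - 1)) div 2}"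
    interpret cells c1 c2 n "N n" "p n"
      by unfold_locales (use assms p np n in auto)
    obtain k where k: "b = n + 2 * k" using b by blast
    have "C8 > 0" using C7 mult_nonneg_nonneg[OF C5 C6] by (simp add: C8_def)
    hence "C = C8" "c = q0" using q0 by (simp_all add: C_def c_def)
    thus "\<bar>sigma_N n (N n) (p n) / 2 *
          measure_pmf.prob (multinomial_pmf n (N n) (p n)) {\<eta>. (\<Sum>m=1..N n. (\<eta> m)\<^sup>2) = b}
        - deriv (WW5 n (N n) (p n)) ((real b - Lambda n (N n) (p n)) / sigma_N n (N n) (p n))\<bar>
      \<le> C * (1 / real (N n) powr (3 / 2)
            + 1 / (real n * lam n (N n) powr (3 / 2))
            + real n * lam n (N n) *
                exp (- (c * real (N n) / (lam n (N n) * max 1 (lam n (N n))))))"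
      using local_limit[of k] unfolding bound_def k by simp
  qed
qed

end
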